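(* For every positive integer $n$ there exists a smooth affine complex variety which is $\mathbb{A}^n$-fibered over $\mathbb{A}^1$ (hence rational and of negative logarithmic Kodaira dimension), which is simply connected and for which the Generalized Jacobian Conjecture fails.
   Context: A fibration of an algebraic variety is a faithfully flat (hence surjective) morphism whose general fibers are irreducible, reduced and have positive dimension. A variety is $\mathbb{A}^n$-fibered over $\mathbb{A}^1$ if it admits a fibration over $\mathbb{A}^1$ whose general fibers are isomorphic to $\mathbb{A}^n$. A smooth complex variety satisfies the Generalized Jacobian Conjecture if all étale endomorphisms of that variety are proper; the conjecture fails for it if it admits a non-proper étale endomorphism. *)

theory Defs
  imports
    "HOL-Analysis.Analysis"
    "HOL-Library.Function_Algebras"
    "HOL-Library.Poly_Mapping"
    "HOL-Algebra.QuotRing"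
    "HOL-Algebra.Module"
    "Jordan_Normal_Form.Determinant"
begin

section \<open>Closed subsets of affine space\<close>

text \<open>
  Since the dimension of the ambient space varies, all affine spaces live in the single type
  \<^typ>\<open>nat \<Rightarrow> complex\<close>: \<open>aff m\<close> consists of the points whose coordinates of index at least \<open>m\<close>
  vanish. The complex numbers are infinite, so polynomials are identified with polynomial
  functions. The product topology of \<^typ>\<open>nat \<Rightarrow> complex\<close> induces the Euclidean topology
  on \<open>aff m\<close>.
\<close>

type_synonym pt = "nat \<Rightarrow> complex"

definition aff :: "nat \<Rightarrow> pt set" where
  "aff m = {x. \<forall>i\<ge>m. x i = 0}"

inductive_set polyfun :: "(pt \<Rightarrow> complex) set" where
  const: "(\<lambda>_. c) \<in> polyfun"
| coord: "(\<lambda>x. x i) \<in> polyfun"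
| add: "a \<in> polyfun \<Longrightarrow> b \<in> polyfun \<Longrightarrow> (\<lambda>x. a x + b x) \<in> polyfun"
| mult: "a \<in> polyfun \<Longrightarrow> b \<in> polyfun \<Longrightarrow> (\<lambda>x. a x * b x) \<in> polyfun"

definition zariski_closed :: "pt set \<Rightarrow> bool" where
  "zariski_closed S \<longleftrightarrow> (\<exists>H\<subseteq>polyfun. S = {x. \<forall>h\<in>H. h x = 0})"

definition zariski_open_in :: "pt set \<Rightarrow> pt set \<Rightarrow> bool" where
  "zariski_open_in X U \<longleftrightarrow> U \<subseteq> X \<and> zariski_closed (X - U)"

definition zariski_irreducible :: "pt set \<Rightarrow> bool" where
  "zariski_irreducible S \<longleftrightarrow> S \<noteq> {} \<and>
     (\<forall>C D. zariski_closed C \<and> zariski_closed D \<and> S \<subseteq> C \<union> D \<longrightarrow> S \<subseteq> C \<or> S \<subseteq> D)"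

text \<open>
  Krull dimension of a closed subset of some \<open>aff m\<close>; there the lengths of chains are bounded
  by \<open>m\<close>, so the supremum is a maximum (and the dimension of the empty set is \<open>0\<close>).
\<close>

definition zariski_dim :: "pt set \<Rightarrow> nat" where
  "zariski_dim S = Sup {k. \<exists>Z :: nat \<Rightarrow> pt set.
     (\<forall>i\<le>k. zariski_closed (Z i) \<and> zariski_irreducible (Z i) \<and> Z i \<subseteq> S) \<and>
     (\<forall>i<k. Z i \<subset> Z (Suc i))}"

definition affine_variety :: "pt set \<Rightarrow> bool" where
  "affine_variety X \<longleftrightarrow> (\<exists>m. X \<subseteq> aff m) \<and> zariski_closed X \<and> zariski_irreducible X"

definition morphism :: "pt set \<Rightarrow> pt set \<Rightarrow> (pt \<Rightarrow> pt) \<Rightarrow> bool" where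
  "morphism X Y f \<longleftrightarrow> (\<forall>x\<in>X. f x \<in> Y) \<and> (\<forall>i. \<exists>h\<in>polyfun. \<forall>x\<in>X. f x i = h x)"

section \<open>Tangent spaces and smoothness\<close>

definition scl :: "complex \<Rightarrow> pt \<Rightarrow> pt" where
  "scl c v = (\<lambda>i. c * v i)"

global_interpretation pt: vector_space scl
  by unfold_locales (auto simp: scl_def fun_eq_iff algebra_simps)

definition dir_deriv :: "(pt \<Rightarrow> complex) \<Rightarrow> pt \<Rightarrow> pt \<Rightarrow> complex" where
  "dir_deriv h x v = deriv (\<lambda>t. h (\<lambda>i. x i + t * v i)) 0"

text \<open>
  If \<open>X \<subseteq> aff m\<close>, the coordinates of index at least \<open>m\<close> vanish on \<open>X\<close>, so that tangent vectors
  automatically lie in \<open>aff m\<close>.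
\<close>

definition tangent_space :: "pt set \<Rightarrow> pt \<Rightarrow> pt set" where
  "tangent_space X x = {v. \<forall>h\<in>polyfun. (\<forall>y\<in>X. h y = 0) \<longrightarrow> dir_deriv h x v = 0}"

definition smooth_variety :: "pt set \<Rightarrow> bool" where
  "smooth_variety X \<longleftrightarrow> (\<forall>x\<in>X. pt.dim (tangent_space X x) = zariski_dim X)"

section \<open>Coordinate rings and scheme-theoretic fibres\<close>

definition coord_ring :: "pt set \<Rightarrow> (pt \<Rightarrow> complex) ring" where
  "coord_ring X = \<lparr>
     carrier = (\<lambda>h. restrict h X) ` polyfun,
     mult = (\<lambda>a b. restrict (\<lambda>x. a x * b x) X),
     one = restrict (\<lambda>_. 1) X,
     zero = restrict (\<lambda>_. 0) X,
     add = (\<lambda>a b. restrict (\<lambda>x. a x + b x) X)\<rparr>"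

definition pullback :: "pt set \<Rightarrow> (pt \<Rightarrow> pt) \<Rightarrow> (pt \<Rightarrow> complex) \<Rightarrow> (pt \<Rightarrow> complex)" where
  "pullback X f h = restrict (\<lambda>x. h (f x)) X"

text \<open>
  The ideal \<open>\<mm>\<^sub>y \<O>(X)\<close> for \<open>f : X \<rightarrow> Y\<close>; the scheme-theoretic fibre over \<open>y\<close> is the spectrum of the
  (possibly non-reduced) ring \<open>\<O>(X) / \<mm>\<^sub>y \<O>(X)\<close>.
\<close>

definition fibre_ideal :: "pt set \<Rightarrow> pt set \<Rightarrow> (pt \<Rightarrow> pt) \<Rightarrow> pt \<Rightarrow> (pt \<Rightarrow> complex) set" where
  "fibre_ideal X Y f y =
     genideal (coord_ring X) (pullback X f ` {h \<in> carrier (coord_ring Y). h y = 0})"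

definition fibre_ring :: "pt set \<Rightarrow> pt set \<Rightarrow> (pt \<Rightarrow> pt) \<Rightarrow> pt \<Rightarrow> (pt \<Rightarrow> complex) set ring" where
  "fibre_ring X Y f y = coord_ring X Quot fibre_ideal X Y f y"

definition fibre :: "pt set \<Rightarrow> (pt \<Rightarrow> pt) \<Rightarrow> pt \<Rightarrow> pt set" where
  "fibre X f y = {x\<in>X. f x = y}"

definition reduced_ring :: "('a, 'b) ring_scheme \<Rightarrow> bool" where
  "reduced_ring R \<longleftrightarrow> (\<forall>a\<in>carrier R. \<forall>k::nat. a [^]\<^bsub>R\<^esub> k = \<zero>\<^bsub>R\<^esub> \<longrightarrow> a = \<zero>\<^bsub>R\<^esub>)"

text \<open>Isomorphism of \<open>\<complex>\<close>-schemes, i.e. an isomorphism of rings that respects the constants.\<close>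

definition fibre_iso_affine_space ::
  "nat \<Rightarrow> pt set \<Rightarrow> pt set \<Rightarrow> (pt \<Rightarrow> pt) \<Rightarrow> pt \<Rightarrow> bool" where
  "fibre_iso_affine_space n X Y f y \<longleftrightarrow>
     (\<exists>\<phi>\<in>ring_iso (fibre_ring X Y f y) (coord_ring (aff n)).
        \<forall>c. \<phi> (fibre_ideal X Y f y +>\<^bsub>coord_ring X\<^esub> restrict (\<lambda>_. c) X) = restrict (\<lambda>_. c) (aff n))"

section \<open>Flatness\<close>

text \<open>
  \<open>N \<otimes>\<^sub>R M\<close> is the free abelian group on \<open>N \<times> M\<close> modulo the following subgroup.
\<close>

inductive_set tensor_relations ::
  "('a, 'r) ring_scheme \<Rightarrow> ('a, 'n, 'x) module_scheme \<Rightarrow> ('a, 'm, 'y) module_scheme \<Rightarrow>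
   ('n \<times> 'm \<Rightarrow>\<^sub>0 int) set"
  for R N M where
  zero: "0 \<in> tensor_relations R N M"
| diff: "s \<in> tensor_relations R N M \<Longrightarrow> t \<in> tensor_relations R N M \<Longrightarrow>
    s - t \<in> tensor_relations R N M"
| add_left: "n \<in> carrier N \<Longrightarrow> n' \<in> carrier N \<Longrightarrow> m \<in> carrier M \<Longrightarrow>
    Poly_Mapping.single (n \<oplus>\<^bsub>N\<^esub> n', m) 1 - Poly_Mapping.single (n, m) 1
      - Poly_Mapping.single (n', m) 1 \<in> tensor_relations R N M"
| add_right: "n \<in> carrier N \<Longrightarrow> m \<in> carrier M \<Longrightarrow> m' \<in> carrier M \<Longrightarrow>
    Poly_Mapping.single (n, m \<oplus>\<^bsub>M\<^esub> m') 1 - Poly_Mapping.single (n, m) 1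
      - Poly_Mapping.single (n, m') 1 \<in> tensor_relations R N M"
| balanced: "r \<in> carrier R \<Longrightarrow> n \<in> carrier N \<Longrightarrow> m \<in> carrier M \<Longrightarrow>
    Poly_Mapping.single (r \<odot>\<^bsub>N\<^esub> n, m) 1 - Poly_Mapping.single (n, r \<odot>\<^bsub>M\<^esub> m) 1
      \<in> tensor_relations R N M"

text \<open>
  \<open>M\<close> is flat if \<open>N' \<otimes>\<^sub>R M \<rightarrow> N \<otimes>\<^sub>R M\<close> is injective for every submodule \<open>N'\<close> of every \<open>R\<close>-module
  \<open>N\<close>. HOL cannot quantify over the type of \<open>N\<close>; letting \<open>N\<close> range over the modules on the element
  type of \<open>R\<close> loses nothing, as flatness may be tested on \<open>N = R\<close> and its ideals \<open>N'\<close>.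
\<close>

definition flat_module :: "('a, 'r) ring_scheme \<Rightarrow> ('a, 'm, 'y) module_scheme \<Rightarrow> bool" where
  "flat_module R M \<longleftrightarrow> module R M \<and>
     (\<forall>(N :: ('a, 'a) module) N'. module R N \<and> submodule N' R N \<longrightarrow>
        (\<forall>t. Poly_Mapping.keys t \<subseteq> N' \<times> carrier M \<and> t \<in> tensor_relations R N M \<longrightarrow>
             t \<in> tensor_relations R (N\<lparr>carrier := N'\<rparr>) M))"

definition coord_module ::
  "pt set \<Rightarrow> (pt \<Rightarrow> pt) \<Rightarrow> (pt \<Rightarrow> complex, pt \<Rightarrow> complex) module" where
  "coord_module X f = ring.extend (coord_ring X)
     \<lparr>smult = (\<lambda>r a. pullback X f r \<otimes>\<^bsub>coord_ring X\<^esub> a)\<rparr>"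

definition flat_morphism :: "pt set \<Rightarrow> pt set \<Rightarrow> (pt \<Rightarrow> pt) \<Rightarrow> bool" where
  "flat_morphism X Y f \<longleftrightarrow> morphism X Y f \<and> flat_module (coord_ring Y) (coord_module X f)"

definition faithfully_flat :: "pt set \<Rightarrow> pt set \<Rightarrow> (pt \<Rightarrow> pt) \<Rightarrow> bool" where
  "faithfully_flat X Y f \<longleftrightarrow> flat_morphism X Y f \<and> f ` X = Y"

section \<open>Fibrations\<close>

definition general_point :: "pt set \<Rightarrow> (pt \<Rightarrow> bool) \<Rightarrow> bool" where
  "general_point Y Q \<longleftrightarrow> (\<exists>U. zariski_open_in Y U \<and> U \<noteq> {} \<and> (\<forall>y\<in>U. Q y))"

definition fibration :: "pt set \<Rightarrow> pt set \<Rightarrow> (pt \<Rightarrow> pt) \<Rightarrow> bool" where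
  "fibration X Y f \<longleftrightarrow> faithfully_flat X Y f \<and>
     general_point Y (\<lambda>y. zariski_irreducible (fibre X f y) \<and>
       reduced_ring (fibre_ring X Y f y) \<and> zariski_dim (fibre X f y) > 0)"

definition affine_space_fibered :: "nat \<Rightarrow> pt set \<Rightarrow> pt set \<Rightarrow> bool" where
  "affine_space_fibered n X Y \<longleftrightarrow>
     (\<exists>f. fibration X Y f \<and> general_point Y (fibre_iso_affine_space n X Y f))"

section \<open>Etale and proper morphisms, the Generalized Jacobian Conjecture\<close>

text \<open>
  \<open>f\<close> is unramified at \<open>x\<close> if \<open>\<mm>\<^bsub>f(x)\<^esub> \<O>\<^sub>x = \<mm>\<^sub>x\<close>, where \<open>\<O>\<^sub>x\<close> is the localization of \<open>\<O>(X)\<close> at \<open>x\<close>;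
  the residue fields at closed points are all \<open>\<complex>\<close>.
\<close>

definition unramified :: "pt set \<Rightarrow> pt set \<Rightarrow> (pt \<Rightarrow> pt) \<Rightarrow> bool" where
  "unramified X Y f \<longleftrightarrow>
     (\<forall>x\<in>X. \<forall>h\<in>carrier (coord_ring X). h x = 0 \<longrightarrow>
        (\<exists>s\<in>carrier (coord_ring X). s x \<noteq> 0 \<and> s \<otimes>\<^bsub>coord_ring X\<^esub> h \<in> fibre_ideal X Y f (f x)))"

definition etale :: "pt set \<Rightarrow> pt set \<Rightarrow> (pt \<Rightarrow> pt) \<Rightarrow> bool" where
  "etale X Y f \<longleftrightarrow> flat_morphism X Y f \<and> unramified X Y f"

text \<open>Interleaving coordinates realizes the product of two affine spaces.\<close>

definition pair_pt :: "pt \<Rightarrow> pt \<Rightarrow> pt" where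
  "pair_pt x z = (\<lambda>i. if even i then x (i div 2) else z (i div 2))"

definition fibre_product :: "pt set \<Rightarrow> (pt \<Rightarrow> pt) \<Rightarrow> pt set \<Rightarrow> (pt \<Rightarrow> pt) \<Rightarrow> pt set" where
  "fibre_product X f Z g = {pair_pt x z | x z. x \<in> X \<and> z \<in> Z \<and> f x = g z}"

text \<open>
  Morphisms of affine varieties are separated and of finite type, so properness means universal
  closedness, which may be tested on base changes along \<open>Z \<rightarrow> Y\<close> with \<open>Z\<close> closed in an affine space.
\<close>

definition proper_morphism :: "pt set \<Rightarrow> pt set \<Rightarrow> (pt \<Rightarrow> pt) \<Rightarrow> bool" where
  "proper_morphism X Y f \<longleftrightarrow> morphism X Y f \<and>
     (\<forall>m Z g C. Z \<subseteq> aff m \<and> zariski_closed Z \<and> morphism Z Y g \<and>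
        C \<subseteq> fibre_product X f Z g \<and> zariski_closed C \<longrightarrow>
        zariski_closed {z\<in>Z. \<exists>x\<in>X. pair_pt x z \<in> C})"

definition generalized_jacobian_conjecture :: "pt set \<Rightarrow> bool" where
  "generalized_jacobian_conjecture X \<longleftrightarrow> (\<forall>f. etale X X f \<longrightarrow> proper_morphism X X f)"

section \<open>Rationality\<close>

definition regular_on :: "pt set \<Rightarrow> (pt \<Rightarrow> complex) \<Rightarrow> bool" where
  "regular_on U \<phi> \<longleftrightarrow>
     (\<forall>x\<in>U. \<exists>a\<in>polyfun. \<exists>b\<in>polyfun. b x \<noteq> 0 \<and> (\<forall>y\<in>U. b y \<noteq> 0 \<longrightarrow> \<phi> y = a y / b y))"

text \<open>Birational to some affine space.\<close>

definition rational_variety :: "pt set \<Rightarrow> bool" where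
  "rational_variety X \<longleftrightarrow>
     (\<exists>d U V f g. zariski_open_in X U \<and> U \<noteq> {} \<and> zariski_open_in (aff d) V \<and> V \<noteq> {} \<and>
        (\<forall>i. regular_on U (\<lambda>x. f x i)) \<and> (\<forall>i. regular_on V (\<lambda>y. g y i)) \<and>
        (\<forall>x\<in>U. f x \<in> V \<and> g (f x) = x) \<and> (\<forall>y\<in>V. g y \<in> U \<and> f (g y) = y))"

section \<open>Logarithmic Kodaira dimension\<close>

text \<open>
  A projective variety is given by its affine cone; its points are the nonzero points of the cone
  up to scaling.
\<close>

definition homogeneous :: "nat \<Rightarrow> (pt \<Rightarrow> complex) \<Rightarrow> bool" where
  "homogeneous e h \<longleftrightarrow> h \<in> polyfun \<and> (\<forall>c x. h (scl c x) = c ^ e * h x)"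

definition projective_cone :: "pt set \<Rightarrow> bool" where
  "projective_cone P \<longleftrightarrow> affine_variety P \<and> (\<forall>c. \<forall>x\<in>P. scl c x \<in> P) \<and> P \<noteq> {\<lambda>_. 0}"

definition near :: "pt set \<Rightarrow> pt \<Rightarrow> (pt \<Rightarrow> bool) \<Rightarrow> bool" where
  "near P p Q \<longleftrightarrow> (\<exists>e s. homogeneous e s \<and> s p \<noteq> 0 \<and>
     (\<forall>q\<in>P. q \<noteq> (\<lambda>_. 0) \<and> s q \<noteq> 0 \<longrightarrow> Q q))"

text \<open>
  Representatives of the elements of the local ring at \<open>p\<close>; they are equal in the local ring of \<open>P\<close>
  if they agree \<open>near P p\<close>.
\<close>

definition regular_at :: "pt \<Rightarrow> (pt \<Rightarrow> complex) set" where
  "regular_at p = {\<lambda>q. a q / b q | a b. \<exists>e. homogeneous e a \<and> homogeneous e b \<and> b p \<noteq> 0}"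

text \<open>
  The functions \<open>z 0, \<dots>, z (d - 1)\<close> generate the maximal ideal of the local ring at \<open>p\<close>. If \<open>d\<close>
  is the dimension of the projective variety, this says that it is smooth at \<open>p\<close> and that the
  \<open>z l\<close> are local parameters.
\<close>

definition local_parameters :: "pt set \<Rightarrow> pt \<Rightarrow> nat \<Rightarrow> (nat \<Rightarrow> pt \<Rightarrow> complex) \<Rightarrow> bool" where
  "local_parameters P p d z \<longleftrightarrow>
     (\<forall>l<d. z l \<in> regular_at p \<and> z l p = 0) \<and>
     (\<forall>h\<in>regular_at p. h p = 0 \<longrightarrow>
        (\<exists>c. (\<forall>l<d. c l \<in> regular_at p) \<and> near P p (\<lambda>q. h q = (\<Sum>l<d. c l q * z l q))))"

text \<open>
  Near \<open>p\<close> the set \<open>D\<close> is the simple normal crossing divisor \<open>z 0 \<cdots> z (k - 1) = 0\<close> (empty if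
  \<open>k = 0\<close>).
\<close>

definition snc_coordinates ::
  "pt set \<Rightarrow> pt set \<Rightarrow> pt \<Rightarrow> nat \<Rightarrow> nat \<Rightarrow> (nat \<Rightarrow> pt \<Rightarrow> complex) \<Rightarrow> bool" where
  "snc_coordinates P D p d k z \<longleftrightarrow> local_parameters P p d z \<and> k \<le> d \<and>
     near P p (\<lambda>q. q \<in> D \<longleftrightarrow> (\<exists>l<k. z l q = 0))"

definition boundary :: "pt set \<Rightarrow> pt set \<Rightarrow> (pt \<Rightarrow> pt) \<Rightarrow> pt set" where
  "boundary X P j = P - {scl c (j x) | c x. c \<noteq> 0 \<and> x \<in> X}"

text \<open>
  An open embedding of \<open>X\<close> into the projective variety with cone \<open>P\<close>: \<open>j x\<close> is an arbitrary choice of homogeneous coordinates of the image of \<open>x\<close>; locally the image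
  is given by polynomial homogeneous coordinates \<open>a\<close>, and the last two conditions say that the image is
  open and that the inverse is regular (in particular, that the map is injective).
\<close>

definition open_embedding :: "pt set \<Rightarrow> pt set \<Rightarrow> (pt \<Rightarrow> pt) \<Rightarrow> bool" where
  "open_embedding X P j \<longleftrightarrow>
     (\<forall>x\<in>X. j x \<in> P \<and> j x \<noteq> (\<lambda>_. 0)) \<and>
     (\<forall>x\<in>X. \<exists>a. (\<forall>i. (\<lambda>y. a y i) \<in> polyfun) \<and> a x \<noteq> (\<lambda>_. 0) \<and>
        (\<forall>y\<in>X. a y \<noteq> (\<lambda>_. 0) \<longrightarrow> (\<exists>c. c \<noteq> 0 \<and> a y = scl c (j y)))) \<and>
     zariski_closed (boundary X P j) \<and>
     (\<forall>x\<in>X. \<forall>i. \<exists>\<phi>\<in>regular_at (j x). near P (j x) (\<lambda>q. \<forall>y\<in>X. j y = q \<longrightarrow> y i = \<phi> q))"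

definition snc_completion :: "pt set \<Rightarrow> pt set \<Rightarrow> (pt \<Rightarrow> pt) \<Rightarrow> bool" where
  "snc_completion X P j \<longleftrightarrow> projective_cone P \<and> open_embedding X P j \<and>
     (\<forall>p\<in>P. p \<noteq> (\<lambda>_. 0) \<longrightarrow>
        (\<exists>k z. snc_coordinates P (boundary X P j) p (zariski_dim X) k z))"

text \<open>
  The differential at \<open>x\<close> of a function that is regular on a neighbourhood of \<open>x\<close> in \<open>X\<close>, evaluated
  at a tangent vector \<open>v\<close>.
\<close>

definition differential :: "pt set \<Rightarrow> (pt \<Rightarrow> complex) \<Rightarrow> pt \<Rightarrow> pt \<Rightarrow> complex" where
  "differential X \<phi> x v = (THE w. \<exists>a\<in>polyfun. \<exists>b\<in>polyfun. b x \<noteq> 0 \<and>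
     (\<forall>y\<in>X. b y \<noteq> 0 \<longrightarrow> \<phi> y = a y / b y) \<and>
     w = (dir_deriv a x v * b x - a x * dir_deriv b x v) / (b x)\<^sup>2)"

text \<open>
  A section of \<open>(\<Omega>\<^sup>d)\<^sup>\<otimes>\<^sup>m\<close> over \<open>X\<close>, \<open>d = dim X\<close>, is represented by its values \<open>\<omega> x v\<close> on \<open>d\<close>-tuples
  \<open>v 0, \<dots>, v (d - 1)\<close> of tangent vectors at \<open>x\<close>, with
  \<open>(dz\<^sub>0 \<and> \<dots> \<and> dz\<^bsub>d-1\<^esub>)\<^sup>\<otimes>\<^sup>m\<close> corresponding to \<open>v \<mapsto> det (dz\<^sub>l (v\<^sub>i))\<^sup>m\<close>. Elements of
  \<open>H\<^sup>0(P, m(K + D))\<close> are those which near each point of \<open>P\<close> are of the form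
  \<open>g (dz\<^sub>0/z\<^sub>0 \<and> \<dots> \<and> dz\<^bsub>k-1\<^esub>/z\<^bsub>k-1\<^esub> \<and> dz\<^sub>k \<and> \<dots> \<and> dz\<^bsub>d-1\<^esub>)\<^sup>\<otimes>\<^sup>m\<close> with \<open>g\<close> regular, where the boundary
  \<open>D\<close> is \<open>z\<^sub>0 \<cdots> z\<^bsub>k-1\<^esub> = 0\<close>.
\<close>

definition log_pluricanonical ::
  "pt set \<Rightarrow> pt set \<Rightarrow> (pt \<Rightarrow> pt) \<Rightarrow> nat \<Rightarrow> (pt \<Rightarrow> (nat \<Rightarrow> pt) \<Rightarrow> complex) \<Rightarrow> bool" where
  "log_pluricanonical X P j m \<omega> \<longleftrightarrow>
     (\<forall>p\<in>P. p \<noteq> (\<lambda>_. 0) \<longrightarrow>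
        (\<exists>k z. snc_coordinates P (boundary X P j) p (zariski_dim X) k z \<and>
          (\<exists>g\<in>regular_at p. near P p (\<lambda>q. \<forall>x\<in>X. j x = q \<longrightarrow>
             (\<forall>v. (\<forall>i<zariski_dim X. v i \<in> tangent_space X x) \<longrightarrow>
                \<omega> x v = g q *
                  (Determinant.det (Matrix.mat (zariski_dim X) (zariski_dim X)
                     (\<lambda>(i, l). differential X (\<lambda>y. z l (j y)) x (v i)))
                   / (\<Prod>l<k. z l q)) ^ m)))))"

text \<open>
  All log plurigenera vanish, i.e. the logarithmic Kodaira dimension is \<open>-\<infinity>\<close>. By Hironaka a smooth
  variety has a completion as above, and the log plurigenera do not depend on its choice.
\<close>

definition negative_log_kodaira_dimension :: "pt set \<Rightarrow> bool" where
  "negative_log_kodaira_dimension X \<longleftrightarrow>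
     (\<forall>P j. snc_completion X P j \<longrightarrow>
        (\<forall>m\<ge>1. \<forall>\<omega>. log_pluricanonical X P j m \<omega> \<longrightarrow>
           (\<forall>x\<in>X. \<forall>v. (\<forall>i<zariski_dim X. v i \<in> tangent_space X x) \<longrightarrow> \<omega> x v = 0)))"

end

theory Submission
  imports Defs "HOL-Complex_Analysis.Complex_Analysis" "HOL-Algebra.Free_Abelian_Groups"
begin

text \<open>
  The variety is the product of the Danielewski surface \<open>x\<^sup>2 z = y\<^sup>2 - 1\<close> with an affine space of
  dimension \<open>n - 1\<close>; the coordinates \<open>x\<close>, \<open>z\<close>, \<open>y\<close> of a point \<open>P\<close> are \<open>P 0\<close>, \<open>P 1\<close>, \<open>P 2\<close>, and the
  remaining ones are free. It is smooth, as the differential of the equation vanishes nowhere, and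
  irreducible of dimension \<open>n + 1\<close>. The geometry comes from two facts. Where \<open>x \<noteq> 0\<close> the
  coordinate \<open>z\<close> is determined by the others; and the complement of each of the two sheets
  \<open>y = 1\<close>, \<open>y = -1\<close> over \<open>x = 0\<close> is an affine space, with coordinates \<open>x\<close>, the free
  ones, and \<open>u = z / (y + \<epsilon>) = (y - \<epsilon>) / x\<^sup>2\<close>, where \<open>\<epsilon>\<close> is the remaining value of \<open>y\<close>.

  The projection to \<open>x\<close> is onto, and over \<open>c \<noteq> 0\<close> its fibre is an affine space. It is
  flat, because the coordinate ring is free over \<open>\<complex>[x]\<close>, with basis the monomials in the other
  coordinates of degree at most one in \<open>y\<close> (\<open>flat_projection\<close>). As \<open>z\<close> is determined by the other coordinates where
  \<open>x \<noteq> 0\<close>, the variety is rational.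

  The complements of the sheets are open, cover the variety, and meet in the path connected
  set \<open>x \<noteq> 0\<close>. So the simplest case of van Kampen's theorem applies (\<open>simply_connected_Un\<close>).

  The equation is a Pell equation \<open>y\<^sup>2 - z x\<^sup>2 = 1\<close> with parameter \<open>z\<close>. If
  \<open>z = u\<^sup>2\<close>, its solutions are given by the units \<open>s = y + u x\<close>, and \<open>s \<mapsto> s\<^sup>3\<close> sends \<open>(x, y)\<close> to
  \<open>(x (4 y\<^sup>2 - 1), 4 y\<^sup>3 - 3 y)\<close>, a formula with Chebyshev polynomials which makes sense for every \<open>z\<close>. The
  morphism has degree \<open>3\<close> over the points with \<open>z \<noteq> 0\<close>. For \<open>z = 0\<close> the equation says \<open>y = \<plusminus>1\<close>, and
  the morphism is \<open>x \<mapsto> 3 x\<close> on each sheet: two of the three preimages have gone to infinity.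
  So the morphism is not proper (\<open>not_proper_endo\<close>). It is unramified (\<open>unramified_endo\<close>). It is also
  flat: after multiplication by a power of \<open>z\<close> (of \<open>4 y\<^sup>2 - 1\<close>) every function is a combination of
  \<open>1, x, y\<close> (of \<open>1, y, y\<^sup>2\<close>) with unique coefficients in the image of the coordinate ring, and
  \<open>z\<close> and \<open>4 y\<^sup>2 - 1\<close> generate the unit ideal (\<open>flat_endo\<close>).

  The additive group acts on the variety by
  \<open>y \<mapsto> y + t x\<^sup>2\<close>, \<open>z \<mapsto> z + 2 t y + t\<^sup>2 x\<^sup>2\<close>. Let a logarithmic pluricanonical form be given, and evaluate it
  along an orbit on transported tangent vectors. The result is an entire function of \<open>t\<close>
  (\<open>log_form_along_flow_entire\<close>). For a general orbit its limit at infinity is computed in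
  logarithmic coordinates near the limit point of the orbit in the completion. The logarithmic
  derivatives of the coordinates have limits, and the limit of the logarithmic derivative along the
  orbit itself is zero. Hence the matrix of logarithmic derivatives becomes singular in the limit,
  and the entire function tends to zero. By Liouville's theorem it is zero
  (\<open>log_form_vanishes_generically\<close>). A form that vanishes at the general point vanishes.
\<close>

section \<open>Polynomial functions\<close>

lemma polyfun_uminus: "a \<in> polyfun \<Longrightarrow> (\<lambda>x. - a x) \<in> polyfun"
  using polyfun.mult[OF polyfun.const[of "-1"]] by force

lemma polyfun_diff: "a \<in> polyfun \<Longrightarrow> b \<in> polyfun \<Longrightarrow> (\<lambda>x. a x - b x) \<in> polyfun"
  using polyfun.add[OF _ polyfun_uminus] by fastforce

lemma polyfun_power: "a \<in> polyfun \<Longrightarrow> (\<lambda>x. a x ^ k) \<in> polyfun"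
  by (induction k) (auto intro: polyfun.intros)

lemma polyfun_sum: "(\<And>i. i \<in> I \<Longrightarrow> a i \<in> polyfun) \<Longrightarrow> (\<lambda>x. \<Sum>i\<in>I. a i x) \<in> polyfun"
  by (induction I rule: infinite_finite_induct) (auto intro: polyfun.intros)

lemma polyfun_prod: "(\<And>i. i \<in> I \<Longrightarrow> a i \<in> polyfun) \<Longrightarrow> (\<lambda>x. \<Prod>i\<in>I. a i x) \<in> polyfun"
  by (induction I rule: infinite_finite_induct) (auto intro: polyfun.intros)

lemma polyfun_poly: "a \<in> polyfun \<Longrightarrow> (\<lambda>x. poly p (a x)) \<in> polyfun"
  by (induction p) (auto intro: polyfun.intros)

lemmas polyfun_intros =
  polyfun.intros polyfun_uminus polyfun_diff polyfun_power polyfun_sum polyfun_prod polyfun_poly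

lemma polyfun_compose:
  assumes "h \<in> polyfun" "\<And>i. (\<lambda>x. \<phi> x i) \<in> polyfun"
  shows "(\<lambda>x. h (\<phi> x)) \<in> polyfun"
  using assms by (induction h) (auto intro: polyfun.intros)

lemma continuous_polyfun: "h \<in> polyfun \<Longrightarrow> continuous_on S h"
proof (induction h rule: polyfun.induct)
  case (coord i)
  show ?case by (rule continuous_on_subset[OF continuous_on_product_coordinates]) simp
qed (auto intro!: continuous_intros)

text \<open>
  This reduces questions about polynomial functions on a variety to polynomials in one variable, whenever
  the variety contains enough polynomial curves.
\<close>

lemma polyfun_along_curve:
  assumes "h \<in> polyfun"
  shows "\<exists>q. \<forall>t. h (\<lambda>i. poly (c i) t) = poly q t"
  using assms
proof (induction h rule: polyfun.induct)
  case (const k)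
  show ?case by (rule exI[of _ "[:k:]"]) simp
next
  case (coord i)
  show ?case by (rule exI[of _ "c i"]) simp
next
  case (add a b)
  then obtain p q where "\<forall>t. a (\<lambda>i. poly (c i) t) = poly p t" "\<forall>t. b (\<lambda>i. poly (c i) t) = poly q t"
    by blast
  then show ?case by (intro exI[of _ "p + q"]) simp
next
  case (mult a b)
  then obtain p q where "\<forall>t. a (\<lambda>i. poly (c i) t) = poly p t" "\<forall>t. b (\<lambda>i. poly (c i) t) = poly q t"
    by blast
  then show ?case by (intro exI[of _ "p * q"]) simp
qed

section \<open>Directional derivatives\<close>

lemma has_dir_deriv:
  assumes "h \<in> polyfun"
  shows "((\<lambda>t. h (\<lambda>i. x i + t * v i)) has_field_derivative dir_deriv h x v) (at 0)"
proof -
  have "(\<lambda>t. h (\<lambda>i. x i + t * v i)) field_differentiable at 0"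
    using assms
    by (induction h rule: polyfun.induct) (auto intro!: derivative_intros)
  then show ?thesis
    unfolding dir_deriv_def by (simp add: field_differentiable_derivI)
qed

lemma dir_deriv_unique:
  "((\<lambda>t. h (\<lambda>i. x i + t * v i)) has_field_derivative D) (at 0) \<Longrightarrow> dir_deriv h x v = D"
  unfolding dir_deriv_def by (rule DERIV_imp_deriv)

lemma dir_deriv_const [simp]: "dir_deriv (\<lambda>_. c) x v = 0"
  by (rule dir_deriv_unique) simp

lemma dir_deriv_coord [simp]: "dir_deriv (\<lambda>x. x i) x v = v i"
  by (rule dir_deriv_unique) (auto intro!: derivative_eq_intros)

lemma dir_deriv_add:
  "a \<in> polyfun \<Longrightarrow> b \<in> polyfun \<Longrightarrow>
   dir_deriv (\<lambda>x. a x + b x) x v = dir_deriv a x v + dir_deriv b x v"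
  by (rule dir_deriv_unique) (auto intro!: derivative_eq_intros has_dir_deriv)

lemma dir_deriv_mult:
  assumes "a \<in> polyfun" "b \<in> polyfun"
  shows "dir_deriv (\<lambda>x. a x * b x) x v = dir_deriv a x v * b x + a x * dir_deriv b x v"
  by (rule dir_deriv_unique)
     (auto intro!: derivative_eq_intros has_dir_deriv assms simp: algebra_simps)

lemma dir_deriv_diff:
  "a \<in> polyfun \<Longrightarrow> b \<in> polyfun \<Longrightarrow>
   dir_deriv (\<lambda>x. a x - b x) x v = dir_deriv a x v - dir_deriv b x v"
  by (rule dir_deriv_unique) (auto intro!: derivative_eq_intros has_dir_deriv)

lemma dir_deriv_sum:
  "(\<And>i. i \<in> I \<Longrightarrow> a i \<in> polyfun) \<Longrightarrow>
   dir_deriv (\<lambda>x. \<Sum>i\<in>I. a i x) x v = (\<Sum>i\<in>I. dir_deriv (a i) x v)"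
  by (induction I rule: infinite_finite_induct) (simp_all add: dir_deriv_add polyfun_sum)

text \<open>The chain rule, for a polynomial map and for a differentiable curve.\<close>

lemma dir_deriv_compose:
  assumes "h \<in> polyfun" "\<And>i. (\<lambda>x. \<phi> x i) \<in> polyfun"
  shows "dir_deriv (\<lambda>x. h (\<phi> x)) x v = dir_deriv h (\<phi> x) (\<lambda>i. dir_deriv (\<lambda>x. \<phi> x i) x v)"
  using assms
  by (induction h rule: polyfun.induct)
     (auto simp: dir_deriv_add dir_deriv_mult polyfun_compose)

lemma polyfun_curve_derivative:
  assumes "h \<in> polyfun" "\<And>i. ((\<lambda>t. c t i) has_field_derivative d i) (at t)"
  shows "((\<lambda>t. h (c t)) has_field_derivative dir_deriv h (c t) d) (at t)"
  using assms
  by (induction h rule: polyfun.induct)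
     (auto simp: dir_deriv_add dir_deriv_mult intro: DERIV_add DERIV_cong[OF DERIV_mult])

lemma dir_deriv_linear:
  assumes "h \<in> polyfun"
  shows "dir_deriv h x (\<lambda>i. c * v i + d * w i) = c * dir_deriv h x v + d * dir_deriv h x w"
  using assms
  by (induction h rule: polyfun.induct) (auto simp: dir_deriv_add dir_deriv_mult algebra_simps)

lemma dir_deriv_scale: "h \<in> polyfun \<Longrightarrow> dir_deriv h x (\<lambda>i. c * v i) = c * dir_deriv h x v"
  using dir_deriv_linear[of h x c v 0 v] by simp

lemma dir_deriv_lincomb:
  assumes "h \<in> polyfun"
  shows "dir_deriv h x (\<lambda>i. \<Sum>j\<in>J. c j * v j i) = (\<Sum>j\<in>J. c j * dir_deriv h x (v j))"
proof -
  have z: "dir_deriv h x (\<lambda>i. 0) = 0"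
    by (rule dir_deriv_unique) simp
  show ?thesis
  proof (induction J rule: infinite_finite_induct)
  case (insert j J)
  have "(\<lambda>i. \<Sum>j\<in>insert j J. c j * v j i) = (\<lambda>i. c j * v j i + 1 * (\<Sum>j\<in>J. c j * v j i))"
    using insert by simp
  then have "dir_deriv h x (\<lambda>i. \<Sum>j\<in>insert j J. c j * v j i) =
      c j * dir_deriv h x (v j) + 1 * dir_deriv h x (\<lambda>i. \<Sum>j\<in>J. c j * v j i)"
    by (simp only: dir_deriv_linear[OF assms])
  also have "\<dots> = (\<Sum>j\<in>insert j J. c j * dir_deriv h x (v j))"
    by (simp only: insert.IH sum.insert[OF insert.hyps] mult_1)
  finally show ?case .
next
  case empty
  show ?case using z by (simp only: sum.empty)
next
  case (infinite J)
  show ?case using z by (simp only: sum.infinite[OF infinite])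
  qed
qed

section \<open>Closed and irreducible sets\<close>

lemma zariski_closedI: "H \<subseteq> polyfun \<Longrightarrow> S = {x. \<forall>h\<in>H. h x = 0} \<Longrightarrow> zariski_closed S"
  unfolding zariski_closed_def by blast

lemma zariski_closed_zero_set: "h \<in> polyfun \<Longrightarrow> zariski_closed {x. h x = 0}"
  by (rule zariski_closedI[of "{h}"]) auto

lemma zariski_closed_Inter:
  assumes "\<And>i. i \<in> I \<Longrightarrow> zariski_closed (S i)"
  shows "zariski_closed (\<Inter>i\<in>I. S i)"
proof -
  have "\<forall>i\<in>I. \<exists>H. H \<subseteq> polyfun \<and> S i = {x. \<forall>h\<in>H. h x = 0}"
    using assms unfolding zariski_closed_def by blast
  from bchoice[OF this] obtain H
    where H: "\<forall>i\<in>I. H i \<subseteq> polyfun \<and> S i = {x. \<forall>h\<in>H i. h x = 0}" ..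
  have "(\<Inter>i\<in>I. S i) = {x. \<forall>h\<in>(\<Union>i\<in>I. H i). h x = 0}" using H by blast
  moreover have "(\<Union>i\<in>I. H i) \<subseteq> polyfun" using H by blast
  ultimately show ?thesis by (intro zariski_closedI)
qed

lemma zariski_closed_Int: "zariski_closed S \<Longrightarrow> zariski_closed T \<Longrightarrow> zariski_closed (S \<inter> T)"
  using zariski_closed_Inter[of "{S, T}" "\<lambda>x. x"] by auto

lemma zariski_closed_aff: "zariski_closed (aff m)"
  by (rule zariski_closedI[of "(\<lambda>i x. x i) ` {m..}"]) (auto simp: aff_def intro: polyfun.intros)

lemma zariski_closed_separate:
  assumes "zariski_closed S" "x \<notin> S"
  shows "\<exists>h. h \<in> polyfun \<and> (\<forall>y\<in>S. h y = 0) \<and> h x \<noteq> 0"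
proof -
  obtain H where H: "H \<subseteq> polyfun" "S = {x. \<forall>h\<in>H. h x = 0}"
    using assms(1) unfolding zariski_closed_def by auto
  then obtain h where "h \<in> H" "h x \<noteq> 0" using assms(2) by auto
  then show ?thesis using H by (intro exI[of _ h]) auto
qed

text \<open>Irreducibility says that the ring of polynomial functions on the set has no zero divisors.\<close>

definition function_domain :: "pt set \<Rightarrow> bool" where
  "function_domain S \<longleftrightarrow> S \<noteq> {} \<and> (\<forall>a\<in>polyfun. \<forall>b\<in>polyfun.
     (\<forall>x\<in>S. a x * b x = 0) \<longrightarrow> (\<forall>x\<in>S. a x = 0) \<or> (\<forall>x\<in>S. b x = 0))"

lemma function_domain_cases:
  "function_domain S \<Longrightarrow> a \<in> polyfun \<Longrightarrow> b \<in> polyfun \<Longrightarrow> \<forall>x\<in>S. a x * b x = 0 \<Longrightarrow>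
   (\<forall>x\<in>S. a x = 0) \<or> (\<forall>x\<in>S. b x = 0)"
  unfolding function_domain_def by simp

lemma function_domainD:
  assumes "function_domain S" "a \<in> polyfun" "b \<in> polyfun" "\<And>x. x \<in> S \<Longrightarrow> a x * b x = 0"
    "y \<in> S" "a y \<noteq> 0" "x \<in> S"
  shows "b x = 0"
  using function_domain_cases[OF assms(1-3)] assms(4-) by auto

lemma function_domain_prod_nonzero:
  assumes "function_domain S" "finite I" "\<And>i. i \<in> I \<Longrightarrow> a i \<in> polyfun"
    "\<And>i. i \<in> I \<Longrightarrow> \<exists>x\<in>S. a i x \<noteq> 0"
  shows "\<exists>x\<in>S. (\<Prod>i\<in>I. a i x) \<noteq> 0"
  using assms(2-)
proof (induction I)
  case empty
  then show ?case using assms(1) unfolding function_domain_def by auto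
next
  case (insert j I)
  have p: "(\<lambda>x. \<Prod>i\<in>I. a i x) \<in> polyfun" using insert by (auto intro: polyfun_prod)
  have aj: "a j \<in> polyfun" using insert by auto
  have "\<exists>x\<in>S. a j x \<noteq> 0" "\<exists>x\<in>S. (\<Prod>i\<in>I. a i x) \<noteq> 0"
    using insert.prems insert.IH by blast+
  then have "\<exists>x\<in>S. a j x * (\<Prod>i\<in>I. a i x) \<noteq> 0"
    using function_domain_cases[OF assms(1) aj p] by blast
  then show ?case by (simp add: insert.hyps)
qed

text \<open>
  A product \<open>a b\<close> that vanishes on \<open>S\<close> gives a covering of \<open>S\<close> by the zero sets of \<open>a\<close> and \<open>b\<close>.
  Conversely, if points of \<open>S\<close> lie outside \<open>C\<close> and outside \<open>D\<close>, functions vanishing on \<open>C\<close> and on \<open>D\<close> but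
  not at these points have a product that vanishes on \<open>S\<close>.
\<close>

lemma zariski_irreducible_iff: "zariski_irreducible S \<longleftrightarrow> function_domain S"
proof
  assume S: "zariski_irreducible S"
  show "function_domain S"
    unfolding function_domain_def
  proof (intro conjI ballI impI)
    show "S \<noteq> {}" using S unfolding zariski_irreducible_def by auto
    fix a b assume ab: "a \<in> polyfun" "b \<in> polyfun" "\<forall>x\<in>S. a x * b x = 0"
    then have "S \<subseteq> {x. a x = 0} \<union> {x. b x = 0}" by auto
    moreover have "zariski_closed {x. a x = 0}" "zariski_closed {x. b x = 0}"
      using zariski_closed_zero_set ab by auto
    ultimately have "S \<subseteq> {x. a x = 0} \<or> S \<subseteq> {x. b x = 0}"
      using S unfolding zariski_irreducible_def by simp
    then show "(\<forall>x\<in>S. a x = 0) \<or> (\<forall>x\<in>S. b x = 0)" by auto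
  qed
next
  assume S: "function_domain S"
  show "zariski_irreducible S"
    unfolding zariski_irreducible_def
  proof (intro conjI allI impI)
    show "S \<noteq> {}" using S unfolding function_domain_def by auto
    fix C D assume CD: "zariski_closed C \<and> zariski_closed D \<and> S \<subseteq> C \<union> D"
    show "S \<subseteq> C \<or> S \<subseteq> D"
    proof (rule ccontr)
      assume "\<not> ?thesis"
      then obtain x y where xy: "x \<in> S" "x \<notin> C" "y \<in> S" "y \<notin> D" by auto
      obtain a where a: "a \<in> polyfun" "\<forall>z\<in>C. a z = 0" "a x \<noteq> 0"
        using zariski_closed_separate[of C x] CD xy by auto
      obtain b where b: "b \<in> polyfun" "\<forall>z\<in>D. b z = 0" "b y \<noteq> 0"
        using zariski_closed_separate[of D y] CD xy by auto
      have "\<forall>z\<in>S. a z * b z = 0" using a b CD by auto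
      from function_domain_cases[OF S a(1) b(1) this] show False using a b xy by auto
    qed
  qed
qed

lemma poly_zero_cofinite: "finite {t. poly p t \<noteq> (0::complex)} \<Longrightarrow> p = 0"
proof (rule ccontr)
  assume f: "finite {t. poly p t \<noteq> 0}" and "p \<noteq> 0"
  then have "finite ({t. poly p t \<noteq> 0} \<union> {t. poly p t = 0})" by (simp add: poly_roots_finite)
  moreover have "{t. poly p t \<noteq> 0} \<union> {t. poly p t = 0} = (UNIV :: complex set)" by auto
  ultimately show False using infinite_UNIV_char_0[where 'a = complex] by simp
qed

text \<open>
  On the line through a point where \<open>a\<close> does not vanish and a point where \<open>b\<close> does not vanish, both are
  nonzero polynomials in one variable.
\<close>

lemma function_domain_affine_lines:
  assumes "S \<noteq> {}" "\<And>x y t. x \<in> S \<Longrightarrow> y \<in> S \<Longrightarrow> (\<lambda>i. x i + t * (y i - x i)) \<in> S"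
  shows "function_domain S"
  unfolding function_domain_def
proof (intro conjI ballI impI)
  fix a b assume ab: "a \<in> polyfun" "b \<in> polyfun" "\<forall>x\<in>S. a x * b x = 0"
  show "(\<forall>x\<in>S. a x = 0) \<or> (\<forall>x\<in>S. b x = 0)"
  proof (rule ccontr)
    assume "\<not> ?thesis"
    then obtain x y where xy: "x \<in> S" "a x \<noteq> 0" "y \<in> S" "b y \<noteq> 0" by auto
    define c where "c = (\<lambda>i. [:x i, y i - x i:])"
    have c: "(\<lambda>i. poly (c i) t) \<in> S" for t using assms(2)[OF xy(1,3), of t] by (simp add: c_def)
    from polyfun_along_curve[OF ab(1), of c] obtain p
      where p: "\<forall>t. a (\<lambda>i. poly (c i) t) = poly p t" ..
    from polyfun_along_curve[OF ab(2), of c] obtain q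
      where q: "\<forall>t. b (\<lambda>i. poly (c i) t) = poly q t" ..
    have "poly (p * q) t = 0" for t
      using ab(3)[rule_format, OF c[of t]] p q by simp
    then have "p * q = 0" using poly_all_0_iff_0 by blast
    moreover have "poly p 0 \<noteq> 0" "poly q 1 \<noteq> 0"
      using p[rule_format, of 0] q[rule_format, of 1] xy by (auto simp: c_def)
    ultimately show False by auto
  qed
qed fact

lemma function_domain_aff: "function_domain (aff m)"
proof (rule function_domain_affine_lines)
  have "(\<lambda>_. 0) \<in> aff m" by (simp add: aff_def)
  then show "aff m \<noteq> {}" by blast
qed (auto simp: aff_def)

lemma function_domain_image:
  assumes S: "function_domain S" and \<phi>: "\<And>i. (\<lambda>x. \<phi> x i) \<in> polyfun"
  shows "function_domain (\<phi> ` S)"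
  unfolding function_domain_def
proof (intro conjI ballI impI)
  show "\<phi> ` S \<noteq> {}" using S unfolding function_domain_def by auto
  fix a b assume ab: "a \<in> polyfun" "b \<in> polyfun" "\<forall>x\<in>\<phi> ` S. a x * b x = 0"
  have "(\<lambda>x. a (\<phi> x)) \<in> polyfun" "(\<lambda>x. b (\<phi> x)) \<in> polyfun" using ab \<phi> by (auto intro: polyfun_compose)
  from function_domain_cases[OF S this] have "(\<forall>x\<in>S. a (\<phi> x) = 0) \<or> (\<forall>x\<in>S. b (\<phi> x) = 0)"
    using ab by auto
  then show "(\<forall>x\<in>\<phi> ` S. a x = 0) \<or> (\<forall>x\<in>\<phi> ` S. b x = 0)" by auto
qed

lemma function_domain_dense:
  assumes S: "function_domain S" "S \<subseteq> T"
    and dense: "\<And>h. h \<in> polyfun \<Longrightarrow> \<forall>x\<in>S. h x = 0 \<Longrightarrow> \<forall>x\<in>T. h x = 0"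
  shows "function_domain T"
  unfolding function_domain_def
proof (intro conjI ballI impI)
  show "T \<noteq> {}" using S unfolding function_domain_def by auto
  fix a b assume ab: "a \<in> polyfun" "b \<in> polyfun" "\<forall>x\<in>T. a x * b x = 0"
  then have "\<forall>x\<in>S. a x * b x = 0" using S(2) by auto
  then have "(\<forall>x\<in>S. a x = 0) \<or> (\<forall>x\<in>S. b x = 0)"
    by (rule function_domain_cases[OF S(1) ab(1,2)])
  then show "(\<forall>x\<in>T. a x = 0) \<or> (\<forall>x\<in>T. b x = 0)"
    using dense[OF ab(1)] dense[OF ab(2)] by argo
qed

section \<open>The dimension of affine space\<close>

global_interpretation fn: vector_space "\<lambda>c (f :: pt \<Rightarrow> complex) x. c * f x"
  by unfold_locales (auto simp: fun_eq_iff algebra_simps)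

definition monomial :: "nat \<Rightarrow> (nat \<Rightarrow> nat) \<Rightarrow> pt \<Rightarrow> complex" where
  "monomial m \<alpha> x = (\<Prod>i<m. x i ^ \<alpha> i)"

text \<open>
  Degrees are bounded in each variable separately, which makes the count of monomials trivial.
\<close>

definition box_monomials :: "nat \<Rightarrow> nat \<Rightarrow> (pt \<Rightarrow> complex) set" where
  "box_monomials m N = monomial m ` ({..<m} \<rightarrow>\<^sub>E {..N})"

abbreviation polys_upto :: "nat \<Rightarrow> nat \<Rightarrow> (pt \<Rightarrow> complex) set" where
  "polys_upto m N \<equiv> fn.span (box_monomials m N)"

lemma card_box_monomials: "finite (box_monomials m N)" "card (box_monomials m N) \<le> (N + 1) ^ m"
proof -
  have f: "finite ({..<m} \<rightarrow>\<^sub>E {..N})" by (auto intro: finite_PiE)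
  then show "finite (box_monomials m N)" by (simp add: box_monomials_def)
  have "card (box_monomials m N) \<le> card ({..<m} \<rightarrow>\<^sub>E {..N})"
    unfolding box_monomials_def by (rule card_image_le[OF f])
  also have "\<dots> = (N + 1) ^ m" by (simp add: card_PiE)
  finally show "card (box_monomials m N) \<le> (N + 1) ^ m" .
qed

lemma monomial_in_box:
  assumes "\<And>i. i < m \<Longrightarrow> \<alpha> i \<le> N"
  shows "monomial m \<alpha> \<in> box_monomials m N"
proof -
  have "monomial m \<alpha> = monomial m (restrict \<alpha> {..<m})"
    by (auto simp: monomial_def fun_eq_iff intro!: prod.cong)
  moreover have "restrict \<alpha> {..<m} \<in> {..<m} \<rightarrow>\<^sub>E {..N}" using assms by auto
  ultimately show ?thesis unfolding box_monomials_def by blast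
qed

lemma box_monomialsD:
  assumes "f \<in> box_monomials m N"
  shows "\<exists>\<alpha>. f = monomial m \<alpha> \<and> (\<forall>i<m. \<alpha> i \<le> N)"
proof -
  obtain \<alpha> where "f = monomial m \<alpha>" "\<alpha> \<in> {..<m} \<rightarrow>\<^sub>E {..N}"
    using assms unfolding box_monomials_def by auto
  then show ?thesis by (intro exI[of _ \<alpha>]) (auto simp: PiE_iff)
qed

lemma polys_upto_mono: "N \<le> K \<Longrightarrow> polys_upto m N \<subseteq> polys_upto m K"
proof (rule fn.span_mono, rule subsetI)
  fix f assume "N \<le> K" "f \<in> box_monomials m N"
  then show "f \<in> box_monomials m K"
    using box_monomialsD[of f m N] by (auto intro!: monomial_in_box intro: order.trans)
qed

lemma polys_upto_polyfun: "f \<in> polys_upto m N \<Longrightarrow> f \<in> polyfun"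
proof (rule fn.span_induct[of f "box_monomials m N"])
  show "fn.subspace {f. f \<in> polyfun}"
    unfolding fn.subspace_def plus_fun_def zero_fun_def
    by (auto intro: polyfun.intros)
next
  fix f assume "f \<in> box_monomials m N"
  then obtain \<alpha> where "f = monomial m \<alpha>" by (auto simp: box_monomials_def)
  then have "f = (\<lambda>x. \<Prod>i<m. x i ^ \<alpha> i)" by (simp add: monomial_def fun_eq_iff)
  then show "f \<in> polyfun" by (simp add: polyfun_prod polyfun_power polyfun.coord)
qed

lemma polys_upto_mult:
  assumes "f \<in> polys_upto m N" "g \<in> polys_upto m K"
  shows "(\<lambda>x. f x * g x) \<in> polys_upto m (N + K)"
proof -
  let ?V = "polys_upto m (N + K)"
  have add: "(\<lambda>x. a x + b x) \<in> ?V" if "a \<in> ?V" "b \<in> ?V" for a b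
    using fn.span_add[OF that] by (simp add: plus_fun_def)
  have sc: "(\<lambda>x. c * a x) \<in> ?V" if "a \<in> ?V" for a c
    using fn.span_scale[OF that] by simp
  have z: "(\<lambda>x. 0) \<in> ?V" using fn.span_zero[of "box_monomials m (N + K)"] by (simp add: zero_fun_def)
  have mon: "(\<lambda>x. f x * g x) \<in> ?V" if f: "f \<in> box_monomials m N" and g: "g \<in> box_monomials m K" for f g
  proof -
    obtain \<alpha> where \<alpha>: "f = monomial m \<alpha>" "\<forall>i<m. \<alpha> i \<le> N" using box_monomialsD[OF f] by auto
    obtain \<beta> where \<beta>: "g = monomial m \<beta>" "\<forall>i<m. \<beta> i \<le> K" using box_monomialsD[OF g] by auto
    have "(\<lambda>x. f x * g x) = monomial m (\<lambda>i. \<alpha> i + \<beta> i)"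
      by (simp add: \<alpha> \<beta> monomial_def fun_eq_iff power_add prod.distrib)
    moreover have "monomial m (\<lambda>i. \<alpha> i + \<beta> i) \<in> box_monomials m (N + K)"
      using \<alpha>(2) \<beta>(2) by (intro monomial_in_box add_mono) auto
    ultimately show ?thesis by (simp add: fn.span_base)
  qed
  have half: "(\<lambda>x. f x * g x) \<in> ?V" if f: "f \<in> box_monomials m N" and g: "g \<in> polys_upto m K" for f g
    using g
  proof (rule fn.span_induct)
    show "fn.subspace {g. (\<lambda>x. f x * g x) \<in> ?V}"
      unfolding fn.subspace_def
    proof (intro conjI ballI allI)
      show "0 \<in> {g. (\<lambda>x. f x * g x) \<in> ?V}" using z by simp
      fix a b assume "a \<in> {g. (\<lambda>x. f x * g x) \<in> ?V}" "b \<in> {g. (\<lambda>x. f x * g x) \<in> ?V}"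
      then show "a + b \<in> {g. (\<lambda>x. f x * g x) \<in> ?V}"
        using add[of "\<lambda>x. f x * a x" "\<lambda>x. f x * b x"] by (simp add: algebra_simps)
    next
      fix c a assume "a \<in> {g. (\<lambda>x. f x * g x) \<in> ?V}"
      then show "(\<lambda>x. c * a x) \<in> {g. (\<lambda>x. f x * g x) \<in> ?V}"
        using sc[of "\<lambda>x. f x * a x" c] by (simp add: algebra_simps)
    qed
  qed (rule mon[OF f])
  show ?thesis
    using assms(1)
  proof (rule fn.span_induct)
    show "fn.subspace {f. (\<lambda>x. f x * g x) \<in> ?V}"
      unfolding fn.subspace_def
    proof (intro conjI ballI allI)
      show "0 \<in> {f. (\<lambda>x. f x * g x) \<in> ?V}" using z by simp
      fix a b assume "a \<in> {f. (\<lambda>x. f x * g x) \<in> ?V}" "b \<in> {f. (\<lambda>x. f x * g x) \<in> ?V}"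
      then show "a + b \<in> {f. (\<lambda>x. f x * g x) \<in> ?V}"
        using add[of "\<lambda>x. a x * g x" "\<lambda>x. b x * g x"] by (simp add: algebra_simps)
    next
      fix c a assume "a \<in> {f. (\<lambda>x. f x * g x) \<in> ?V}"
      then show "(\<lambda>x. c * a x) \<in> {f. (\<lambda>x. f x * g x) \<in> ?V}"
        using sc[of "\<lambda>x. a x * g x" c] by (simp add: algebra_simps)
    qed
  qed (rule half[OF _ assms(2)])
qed

lemma one_in_polys_upto: "(\<lambda>_. 1) \<in> polys_upto m N"
proof -
  have "monomial m (\<lambda>_. 0) \<in> box_monomials m N" by (rule monomial_in_box) simp
  moreover have "monomial m (\<lambda>_. 0) = (\<lambda>_. 1)" by (simp add: monomial_def fun_eq_iff)
  ultimately show ?thesis by (metis fn.span_base)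
qed

lemma polyfun_in_polys_upto:
  assumes "h \<in> polyfun"
  shows "\<exists>N. \<exists>g\<in>polys_upto m N. \<forall>x\<in>aff m. h x = g x"
  using assms
proof (induction h rule: polyfun.induct)
  case (const c)
  have "(\<lambda>x. c * 1) \<in> polys_upto m 0" by (rule fn.span_scale) (rule one_in_polys_upto)
  then show ?case by (intro exI[of _ 0] bexI[of _ "\<lambda>x. c * 1"]) auto
next
  case (coord i)
  show ?case
  proof (cases "i < m")
    case True
    have e: "monomial m (\<lambda>j. if j = i then 1 else 0) = (\<lambda>x. x i)"
    proof
      fix x :: pt
      have "(\<Prod>j<m. x j ^ (if j = i then 1 else 0)) = (\<Prod>j<m. if j = i then x j else 1)"
        by (rule prod.cong) auto
      then show "monomial m (\<lambda>j. if j = i then 1 else 0) x = x i"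
        using True by (simp add: monomial_def)
    qed
    have "monomial m (\<lambda>j. if j = i then 1 else 0) \<in> polys_upto m 1"
      by (intro fn.span_base monomial_in_box) auto
    then show ?thesis unfolding e by (intro exI[of _ 1] bexI[of _ "\<lambda>x. x i"]) auto
  next
    case False
    have "(\<lambda>_. 0) \<in> polys_upto m 0"
      using fn.span_zero[of "box_monomials m 0"] by (simp add: zero_fun_def)
    then show ?thesis using False by (intro exI[of _ 0] bexI[of _ "\<lambda>_. 0"]) (auto simp: aff_def)
  qed
next
  case (add a b)
  then obtain N f K g where fg: "f \<in> polys_upto m N" "\<forall>x\<in>aff m. a x = f x"
    "g \<in> polys_upto m K" "\<forall>x\<in>aff m. b x = g x" by blast
  have "f + g \<in> polys_upto m (max N K)"
    using fg polys_upto_mono[of N "max N K" m] polys_upto_mono[of K "max N K" m]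
    by (intro fn.span_add) auto
  then show ?case using fg by (intro exI[of _ "max N K"] bexI[of _ "f + g"]) auto
next
  case (mult a b)
  then obtain N f K g where fg: "f \<in> polys_upto m N" "\<forall>x\<in>aff m. a x = f x"
    "g \<in> polys_upto m K" "\<forall>x\<in>aff m. b x = g x" by blast
  then show ?case
    using polys_upto_mult[OF fg(1,3)]
    by (intro exI[of _ "N + K"] bexI[of _ "\<lambda>x. f x * g x"]) auto
qed

definition independent_on :: "pt set \<Rightarrow> (nat \<Rightarrow> pt \<Rightarrow> complex) \<Rightarrow> nat \<Rightarrow> bool" where
  "independent_on Z b K \<longleftrightarrow> (\<forall>c. (\<forall>x\<in>Z. (\<Sum>i<K. c i * b i x) = 0) \<longrightarrow> (\<forall>i<K. c i = 0))"

definition independent_polys :: "nat \<Rightarrow> pt set \<Rightarrow> nat \<Rightarrow> nat \<Rightarrow> bool" where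
  "independent_polys m Z N K \<longleftrightarrow> (\<exists>b. (\<forall>i<K. b i \<in> polys_upto m N) \<and> independent_on Z b K)"

lemma independent_polys_mono:
  "independent_polys m Z N K \<Longrightarrow> N \<le> N' \<Longrightarrow> independent_polys m Z N' K"
  unfolding independent_polys_def using polys_upto_mono[of N N' m] by (meson subsetD)

lemma independent_polys_bound:
  assumes "independent_polys m Z N K"
  shows "K \<le> (N + 1) ^ m"
proof -
  obtain b where b: "\<And>i. i < K \<Longrightarrow> b i \<in> polys_upto m N" and ind: "independent_on Z b K"
    using assms unfolding independent_polys_def by auto
  have inj: "inj_on b {..<K}"
  proof
    fix i j assume ij: "i \<in> {..<K}" "j \<in> {..<K}" "b i = b j"
    show "i = j"
    proof (rule ccontr)
      assume ne: "i \<noteq> j"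
      define c where "c = (\<lambda>k. (if k = i then 1 else 0) - (if k = j then 1 else 0) :: complex)"
      have "(\<Sum>k<K. c k * b k x) = 0" for x
      proof -
        have "(\<Sum>k<K. c k * b k x) = (\<Sum>k<K. (if k = i then b k x else 0) - (if k = j then b k x else 0))"
          by (rule sum.cong) (auto simp: c_def)
        also have "\<dots> = b i x - b j x" using ij by (simp add: sum_subtractf)
        finally show ?thesis using ij by simp
      qed
      then have "c i = 0" using ind ij unfolding independent_on_def by simp
      then show False using ne by (simp add: c_def)
    qed
  qed
  have sumfn: "(\<Sum>i\<in>I. f i) x = (\<Sum>i\<in>I. f i x)" for I and f :: "nat \<Rightarrow> pt \<Rightarrow> complex" and x
    by (induction I rule: infinite_finite_induct) auto
  have fin: "finite (b ` {..<K})" by simp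
  have coeff: "u f = 0" if u: "(\<Sum>f\<in>b ` {..<K}. (\<lambda>x. u f * f x)) = 0" and f: "f \<in> b ` {..<K}" for u f
  proof -
    obtain i where i: "i < K" "f = b i" using f by auto
    have "(\<Sum>i<K. (\<lambda>x. u (b i) * b i x)) = 0" using u by (simp add: sum.reindex[OF inj])
    then have "(\<Sum>i<K. u (b i) * b i x) = 0" for x
      using sumfn[of "\<lambda>i x. u (b i) * b i x" "{..<K}" x] by (simp add: zero_fun_def)
    then show "u f = 0"
      using ind[unfolded independent_on_def, rule_format, of "\<lambda>i. u (b i)" i] i by simp
  qed
  have ind': "fn.independent (b ` {..<K})"
    unfolding fn.dependent_finite[OF fin] using coeff by auto
  have sub: "b ` {..<K} \<subseteq> fn.span (box_monomials m N)" using b by auto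
  have "card (b ` {..<K}) \<le> card (box_monomials m N)"
    using fn.independent_span_bound[OF card_box_monomials(1) ind' sub] ..
  then show ?thesis using card_box_monomials[where m = m and N = N] inj by (simp add: card_image)
qed

lemma sum_lessThan_add: "(\<Sum>i<(K::nat) + L. f i) = (\<Sum>i<K. f i) + (\<Sum>i<L. f (K + i))"
  by (induction L) (auto simp: add.assoc)

text \<open>
  Multiplication by a function that vanishes on \<open>Z\<close> but not on the larger irreducible set \<open>Z'\<close> is
  injective on functions on \<open>Z'\<close>, and its image restricts to zero on \<open>Z\<close>. Hence there is room on
  \<open>Z'\<close> for both families.
\<close>

lemma independent_polys_step:
  assumes Z': "function_domain Z'" "Z \<subseteq> Z'"
    and f: "f \<in> polys_upto m e" "\<And>x. x \<in> Z \<Longrightarrow> f x = 0" "y \<in> Z'" "f y \<noteq> 0"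
    and K: "independent_polys m Z N K" "independent_polys m Z' N' L" "N' + e \<le> N"
  shows "independent_polys m Z' N (K + L)"
proof -
  obtain b where b: "\<And>i. i < K \<Longrightarrow> b i \<in> polys_upto m N" "independent_on Z b K"
    using K unfolding independent_polys_def by auto
  obtain b' where b': "\<And>i. i < L \<Longrightarrow> b' i \<in> polys_upto m N'" "independent_on Z' b' L"
    using K unfolding independent_polys_def by auto
  define B where "B = (\<lambda>i. if i < K then b i else (\<lambda>x. f x * b' (i - K) x))"
  have "B i \<in> polys_upto m N" if "i < K + L" for i
  proof (cases "i < K")
    case False
    then have "B i \<in> polys_upto m (e + N')"
      unfolding B_def using that polys_upto_mult[OF f(1) b'(1)[of "i - K"]] by simp
    then show ?thesis using polys_upto_mono[of "e + N'" N m] K(3) by (auto simp: add.commute)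
  qed (simp add: B_def b)
  moreover have "independent_on Z' B (K + L)"
    unfolding independent_on_def
  proof (intro allI impI)
    fix c i assume c: "\<forall>x\<in>Z'. (\<Sum>i<K + L. c i * B i x) = 0" and i: "i < K + L"
    have split: "(\<Sum>i<K + L. c i * B i x) = (\<Sum>i<K. c i * b i x) + f x * (\<Sum>i<L. c (K + i) * b' i x)" for x
      unfolding sum_lessThan_add by (simp add: B_def sum_distrib_left algebra_simps)
    have "(\<Sum>i<K. c i * b i x) = 0" if "x \<in> Z" for x
    proof -
      have "x \<in> Z'" using that Z'(2) by auto
      from c[rule_format, OF this] show ?thesis
        unfolding split f(2)[OF that] by (simp only: mult_zero_left add_0_right)
    qed
    then have low: "\<forall>i<K. c i = 0"
      using b(2)[unfolded independent_on_def, rule_format, of c] by simp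
    have g: "(\<lambda>x. \<Sum>i<L. c (K + i) * b' i x) \<in> polyfun"
    proof (rule polyfun_sum)
      fix i assume "i \<in> {..<L}"
      then have "b' i \<in> polyfun" using polys_upto_polyfun[OF b'(1)] by simp
      then show "(\<lambda>x. c (K + i) * b' i x) \<in> polyfun" by (rule polyfun.mult[OF polyfun.const])
    qed
    have "f x * (\<Sum>i<L. c (K + i) * b' i x) = 0" if "x \<in> Z'" for x
    proof -
      have "(\<Sum>i<K. c i * b i x) = 0" using low by (intro sum.neutral) auto
      then show ?thesis using c[rule_format, OF that] unfolding split by (simp only: add_0)
    qed
    then have "(\<Sum>i<L. c (K + i) * b' i x) = 0" if "x \<in> Z'" for x
      by (rule function_domainD[OF Z'(1) polys_upto_polyfun[OF f(1)] g _ f(3,4) that])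
    then have "\<forall>i<L. c (K + i) = 0"
      using b'(2)[unfolded independent_on_def, rule_format, of "\<lambda>i. c (K + i)"] by simp
    then show "c i = 0" using low i by (metis add_diff_inverse_nat nat_add_left_cancel_less)
  qed
  ultimately show ?thesis unfolding independent_polys_def by (intro exI[of _ B]) simp
qed

definition irreducible_chain :: "(nat \<Rightarrow> pt set) \<Rightarrow> nat \<Rightarrow> bool" where
  "irreducible_chain Z k \<longleftrightarrow>
     (\<forall>i\<le>k. zariski_closed (Z i) \<and> zariski_irreducible (Z i)) \<and> (\<forall>i<k. Z i \<subset> Z (Suc i))"

text \<open>
  By \<open>independent_polys_step\<close> the number of independent functions of bounded degree satisfies the recursion of Pascal's
  triangle along a chain. So on the \<open>j\<close>-th member it grows at least as a polynomial of degree \<open>j\<close>, as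
  the Hilbert function of a variety of dimension \<open>j\<close> does.
\<close>

lemma irreducible_chain_growth:
  assumes Z: "irreducible_chain Z k" "\<And>i. i \<le> k \<Longrightarrow> Z i \<subseteq> aff m" and "j \<le> k"
  shows "\<exists>E. \<forall>N. independent_polys m (Z j) (E * N) ((N + j) choose j)"
proof -
  have dom: "function_domain (Z i)" if "i \<le> k" for i
    using Z that unfolding irreducible_chain_def by (simp add: zariski_irreducible_iff)
  have one: "independent_polys m (Z i) N 1" if "i \<le> k" for i N
  proof -
    have "Z i \<noteq> {}" using dom[OF that] unfolding function_domain_def by simp
    then obtain x where x: "x \<in> Z i" by (meson all_not_in_conv)
    show ?thesis
      unfolding independent_polys_def independent_on_def
    proof (rule exI[of _ "\<lambda>_ _. 1"], intro conjI allI impI)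
      show "(\<lambda>_. 1) \<in> polys_upto m N" by (rule one_in_polys_upto)
      fix c :: "nat \<Rightarrow> complex" and j :: nat
      assume c: "\<forall>x\<in>Z i. (\<Sum>i<1. c i * 1) = 0" and "j < 1"
      then show "c j = 0" using c[rule_format, OF x] by simp
    qed
  qed
  show ?thesis
    using \<open>j \<le> k\<close>
  proof (induction j)
  case 0
  show ?case using one[of 0] by (intro exI[of _ 0] allI) simp
next
  case (Suc j)
  then obtain E where E: "\<And>N. independent_polys m (Z j) (E * N) ((N + j) choose j)" by auto
  have sub: "Z j \<subset> Z (Suc j)" "zariski_closed (Z j)"
    using Z Suc.prems unfolding irreducible_chain_def by auto
  then obtain y where y: "y \<in> Z (Suc j)" "y \<notin> Z j" by auto
  obtain h where h: "h \<in> polyfun" "\<forall>x\<in>Z j. h x = 0" "h y \<noteq> 0"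
    using zariski_closed_separate[OF sub(2) y(2)] by auto
  from polyfun_in_polys_upto[OF h(1), of m] obtain e f
    where f: "f \<in> polys_upto m e" "\<forall>x\<in>aff m. h x = f x" by blast
  have f0: "f x = 0" if "x \<in> Z j" for x
  proof -
    have "x \<in> aff m" using Z(2)[of j] that Suc.prems by auto
    then have "h x = f x" using f(2) by blast
    then show ?thesis using h(2)[rule_format, OF that] by simp
  qed
  have fy: "f y \<noteq> 0" using f h Z(2)[of "Suc j"] y Suc.prems by auto
  have "independent_polys m (Z (Suc j)) ((E + e) * N) ((N + Suc j) choose Suc j)" for N
  proof (induction N)
    case 0
    show ?case using one[OF Suc.prems] by simp
  next
    case (Suc N)
    have "independent_polys m (Z (Suc j)) ((E + e) * Suc N)
        (((Suc N + j) choose j) + ((N + Suc j) choose Suc j))"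
    proof (rule independent_polys_step[OF dom[OF \<open>Suc j \<le> k\<close>] _ f(1) f0 y(1) fy _ Suc])
      show "independent_polys m (Z j) ((E + e) * Suc N) ((Suc N + j) choose j)"
        by (rule independent_polys_mono[OF E]) (auto simp: algebra_simps)
    qed (use sub in \<open>auto simp: algebra_simps\<close>)
    then show ?case by (simp add: add.commute)
  qed
  then show ?case by blast
qed
qed

text \<open>
  Growth of degree \<open>m + 1\<close> is impossible, as there are only \<open>(N + 1)\<^sup>m\<close> monomials with exponents up to
  \<open>N\<close> in \<open>m\<close> variables.
\<close>

lemma irreducible_chain_bound:
  assumes Z: "irreducible_chain Z k" "\<And>i. i \<le> k \<Longrightarrow> Z i \<subseteq> aff m"
  shows "k \<le> m"
proof (rule ccontr)
  assume "\<not> k \<le> m"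
  then have le: "Suc m \<le> k" by simp
  obtain E where E: "\<And>N. independent_polys m (Z (Suc m)) (E * N) ((N + Suc m) choose Suc m)"
    using irreducible_chain_growth[OF Z le] by auto
  define k' where "k' = Suc m"
  \<comment> \<open>Chosen such that \<open>(E N + 1)\<^sup>m \<le> T (T + 1)\<^sup>m\<close> for \<open>N = k' T\<close>, whereas \<open>(T + 1)\<^sup>m\<^sup>+\<^sup>1\<close> is a lower bound for the binomial coefficient.\<close>
  define T where "T = (E * k' + 1) ^ m"
  have e: "real (k' * T + k') / real k' = real T + 1"
    by (simp add: k'_def field_simps)
  have "(real T + 1) ^ k' = (real (k' * T + k') / real k') ^ k'"
    by (simp only: e)
  also have "\<dots> \<le> real ((k' * T + k') choose k')"
    by (rule binomial_ge_n_over_k_pow_k) simp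
  also have "\<dots> \<le> real ((E * (k' * T) + 1) ^ m)"
    using independent_polys_bound[OF E[of "k' * T"]] unfolding k'_def of_nat_le_iff .
  also have "\<dots> = real (E * (k' * T) + 1) ^ m" by (rule of_nat_power)
  also have "\<dots> \<le> (real (E * k' + 1) * (real T + 1)) ^ m"
    by (rule power_mono) (simp_all add: algebra_simps)
  also have "\<dots> = real T * (real T + 1) ^ m"
    by (simp only: power_mult_distrib T_def of_nat_power)
  finally have "(real T + 1) ^ Suc m \<le> real T * (real T + 1) ^ m" by (simp only: k'_def)
  moreover have "(real T + 1) ^ m > 0" by simp
  ultimately have "real T + 1 \<le> real T" by (simp add: mult_le_cancel_right)
  then show False by simp
qed

lemma zariski_dim_chains:
  "zariski_dim S = Sup {k. \<exists>Z. irreducible_chain Z k \<and> (\<forall>i\<le>k. Z i \<subseteq> S)}"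
  unfolding zariski_dim_def irreducible_chain_def
  by (rule arg_cong[where f = Sup], rule Collect_cong, rule ex_cong1) auto

lemma zariski_dim_ge:
  assumes "irreducible_chain Z k" "\<And>i. i \<le> k \<Longrightarrow> Z i \<subseteq> S" "S \<subseteq> aff m"
  shows "k \<le> zariski_dim S"
  unfolding zariski_dim_chains
proof (rule cSup_upper)
  show "k \<in> {k. \<exists>Z. irreducible_chain Z k \<and> (\<forall>i\<le>k. Z i \<subseteq> S)}" using assms by auto
  show "bdd_above {k. \<exists>Z. irreducible_chain Z k \<and> (\<forall>i\<le>k. Z i \<subseteq> S)}"
  proof (rule bdd_aboveI[of _ m])
    fix j assume "j \<in> {k. \<exists>Z. irreducible_chain Z k \<and> (\<forall>i\<le>k. Z i \<subseteq> S)}"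
    then obtain W where W: "irreducible_chain W j" "\<forall>i\<le>j. W i \<subseteq> S" by auto
    show "j \<le> m"
      by (rule irreducible_chain_bound[OF W(1)]) (use W(2) assms(3) in auto)
  qed
qed

text \<open>
  A chain in a proper subset of the affine space can be prolonged by the affine space itself.
\<close>

lemma zariski_dim_hypersurface:
  assumes S: "S \<subset> aff (Suc m)" and Z: "irreducible_chain Z m" "\<And>i. i \<le> m \<Longrightarrow> Z i \<subseteq> S"
  shows "zariski_dim S = m"
proof -
  have bound: "k \<le> m" if W: "irreducible_chain W k" "\<forall>i\<le>k. W i \<subseteq> S" for W k
  proof -
    define W' where "W' = (\<lambda>i. if i \<le> k then W i else aff (Suc m))"
    have "irreducible_chain W' (Suc k)"
      using W S unfolding irreducible_chain_def W'_def
      by (auto simp: zariski_closed_aff zariski_irreducible_iff function_domain_aff le_Suc_eq less_Suc_eq)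
    moreover have "W' i \<subseteq> aff (Suc m)" if "i \<le> Suc k" for i
      using W(2) S that by (auto simp: W'_def)
    ultimately have "Suc k \<le> Suc m" by (rule irreducible_chain_bound)
    then show ?thesis by simp
  qed
  show ?thesis
    unfolding zariski_dim_chains
  proof (rule cSup_eq_maximum)
    show "m \<in> {k. \<exists>Z. irreducible_chain Z k \<and> (\<forall>i\<le>k. Z i \<subseteq> S)}"
      using Z by blast
    fix j assume "j \<in> {k. \<exists>Z. irreducible_chain Z k \<and> (\<forall>i\<le>k. Z i \<subseteq> S)}"
    then obtain W where W: "irreducible_chain W j" "\<forall>i\<le>j. W i \<subseteq> S" by auto
    show "j \<le> m" by (rule bound[OF W])
  qed
qed

section \<open>Unions of simply connected sets\<close>

text \<open>
  All paths with the same end points are homotopic; together with path connectedness this is simple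
  connectedness.
\<close>

definition paths_homotopic_in :: "'a::topological_space set \<Rightarrow> bool" where
  "paths_homotopic_in U \<longleftrightarrow> (\<forall>p q. path p \<and> path q \<and> path_image p \<subseteq> U \<and> path_image q \<subseteq> U \<and>
     pathstart p = pathstart q \<and> pathfinish p = pathfinish q \<longrightarrow> homotopic_paths U p q)"

text \<open>
  The preimages of \<open>U\<close> and \<open>V\<close> cover the unit interval; take a Lebesgue number of this covering.
\<close>

lemma path_subdivision:
  fixes U V :: "'a::topological_space set"
  assumes g: "path g" "path_image g \<subseteq> U \<union> V"
    and U: "openin (top_of_set (U \<union> V)) U" and V: "openin (top_of_set (U \<union> V)) V"
  shows "\<exists>N>0. \<forall>k<N. g ` {real k / real N .. real (Suc k) / real N} \<subseteq> U \<or>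
     g ` {real k / real N .. real (Suc k) / real N} \<subseteq> V"
proof -
  let ?I = "{0..1::real}"
  have cont: "continuous_on ?I g" "g \<in> ?I \<rightarrow> U \<union> V"
    using g by (auto simp: path_def path_image_def)
  obtain A where A: "open A" "?I \<inter> g -` U = ?I \<inter> A"
    using continuous_openin_preimage[OF cont U] unfolding openin_open by auto
  obtain B where B: "open B" "?I \<inter> g -` V = ?I \<inter> B"
    using continuous_openin_preimage[OF cont V] unfolding openin_open by auto
  have cover: "?I \<subseteq> \<Union>{A, B}"
  proof
    fix t assume t: "t \<in> ?I"
    then have "g t \<in> U \<union> V" using cont(2) by auto
    then have "t \<in> ?I \<inter> g -` U \<or> t \<in> ?I \<inter> g -` V" using t by auto
    then show "t \<in> \<Union>{A, B}" unfolding A B by auto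
  qed
  obtain d where d: "0 < d" "\<And>T. \<lbrakk>T \<subseteq> ?I; diameter T < d\<rbrakk> \<Longrightarrow> \<exists>C\<in>{A, B}. T \<subseteq> C"
    by (rule Lebesgue_number_lemma[OF compact_Icc _ cover]) (use A B in auto)
  obtain N :: nat where N: "N > 0" "1 / real N < d"
    using d(1) real_arch_inverse[of d] by (auto simp: inverse_eq_divide)
  show ?thesis
  proof (intro exI[of _ N] conjI allI impI)
    fix k assume k: "k < N"
    let ?T = "{real k / real N .. real (Suc k) / real N}"
    have sub: "?T \<subseteq> ?I"
    proof -
      have "real (Suc k) / real N \<le> 1" using k by (simp add: field_simps)
      then show ?thesis by auto
    qed
    have "diameter ?T = 1 / real N" using N by (simp add: diameter_closed_interval field_simps)
    then obtain C where C: "C \<in> {A, B}" "?T \<subseteq> C" using d(2)[OF sub] N by auto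
    then have "?T \<subseteq> ?I \<inter> A \<or> ?T \<subseteq> ?I \<inter> B" using sub by auto
    then have "?T \<subseteq> g -` U \<or> ?T \<subseteq> g -` V" unfolding A(2)[symmetric] B(2)[symmetric] by auto
    then show "g ` ?T \<subseteq> U \<or> g ` ?T \<subseteq> V" by auto
  qed (use N in auto)
qed

text \<open>
  The type of points is not a normed space, so that a path in it is restricted by composing it with a
  subpath of the identity of the real line.
\<close>

definition piece :: "real \<Rightarrow> real \<Rightarrow> (real \<Rightarrow> 'a::topological_space) \<Rightarrow> real \<Rightarrow> 'a" where
  "piece a b g = g \<circ> subpath a b (\<lambda>x. x)"

lemma piece_props:
  assumes g: "path g" and ab: "0 \<le> a" "a \<le> b" "b \<le> 1"
  shows "path (piece a b g)" "path_image (piece a b g) = g ` {a..b}"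
    "pathstart (piece a b g) = g a" "pathfinish (piece a b g) = g b"
proof -
  have p: "path (\<lambda>x::real. x)" by (simp add: path_def)
  have im: "path_image (subpath a b (\<lambda>x. x)) = {a..b}"
    using path_image_subpath[of a b "\<lambda>x. x"] ab by simp
  have "path (subpath a b (\<lambda>x. x))" by (rule path_subpath[OF p]) (use ab in auto)
  then show "path (piece a b g)"
    unfolding piece_def
    by (rule path_continuous_image) (use g ab im in \<open>auto simp: path_def intro: continuous_on_subset\<close>)
  show "path_image (piece a b g) = g ` {a..b}"
    unfolding piece_def path_image_compose im ..
qed (auto simp: piece_def pathstart_def pathfinish_def subpath_def)

lemma homotopic_join_pieces:
  assumes g: "path g" "path_image g \<subseteq> S" and ab: "0 \<le> a" "a \<le> b" "b \<le> 1"
  shows "homotopic_paths S (piece 0 a g +++ piece a b g) (piece 0 b g)"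
proof -
  have "homotopic_paths {0..1} (subpath 0 a (\<lambda>x::real. x) +++ subpath a b (\<lambda>x. x)) (subpath 0 b (\<lambda>x. x))"
    by (rule homotopic_join_subpaths) (use ab in \<open>auto simp: path_def path_image_def\<close>)
  then have "homotopic_paths S (g \<circ> (subpath 0 a (\<lambda>x::real. x) +++ subpath a b (\<lambda>x. x)))
      (g \<circ> subpath 0 b (\<lambda>x. x))"
    by (rule homotopic_paths_continuous_image) (use g in \<open>auto simp: path_def path_image_def\<close>)
  then show ?thesis by (simp add: piece_def path_compose_join)
qed

text \<open>
  The path is subdivided into pieces lying in \<open>U\<close> or in \<open>V\<close>. Initial segments are deformed
  successively, either into \<open>U\<close> or into \<open>V\<close> (up to a fixed path \<open>\<kappa>\<close> in \<open>U\<close> to a base point of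
  \<open>U \<inter> V\<close>); at end points in \<open>U \<inter> V\<close> one may switch, as \<open>U \<inter> V\<close> is path connected.
\<close>

lemma path_homotopic_into:
  fixes U V :: "'a::topological_space set"
  assumes U: "openin (top_of_set (U \<union> V)) U" "paths_homotopic_in U" "path_connected U"
    and V: "openin (top_of_set (U \<union> V)) V" "paths_homotopic_in V"
    and UV: "path_connected (U \<inter> V)" "U \<inter> V \<noteq> {}"
    and g: "path g" "path_image g \<subseteq> U \<union> V" "pathstart g \<in> U" "pathfinish g \<in> U"
  shows "\<exists>r. path r \<and> path_image r \<subseteq> U \<and> homotopic_paths (U \<union> V) g r"
proof -
  let ?S = "U \<union> V"
  obtain N where N: "N > 0" "\<And>k. k < N \<Longrightarrow> g ` {real k / real N .. real (Suc k) / real N} \<subseteq> U \<or>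
     g ` {real k / real N .. real (Suc k) / real N} \<subseteq> V"
    using path_subdivision[OF g(1,2) U(1) V(1)] by blast
  obtain c where c: "c \<in> U" "c \<in> V" using UV(2) by auto
  obtain \<kappa> where \<kappa>: "path \<kappa>" "path_image \<kappa> \<subseteq> U" "pathstart \<kappa> = pathstart g" "pathfinish \<kappa> = c"
    using U(3) g(3) c(1) unfolding path_connected_def by blast
  define inU where "inU h \<longleftrightarrow> (\<exists>r. path r \<and> path_image r \<subseteq> U \<and> homotopic_paths ?S h r)" for h
  define inV where "inV h \<longleftrightarrow> (\<exists>r. path r \<and> path_image r \<subseteq> V \<and> pathstart r = c \<and>
      homotopic_paths ?S h (\<kappa> +++ r))" for h
  have link: "\<exists>l. path l \<and> path_image l \<subseteq> U \<inter> V \<and> pathstart l = c \<and> pathfinish l = e" if "e \<in> U \<inter> V" for e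
    using UV(1) c that unfolding path_connected_def by blast
  have U_to_V: "inV h" if h: "inU h" "pathfinish h \<in> V" "pathstart h = pathstart g" for h
  proof -
    obtain r where r: "path r" "path_image r \<subseteq> U" "homotopic_paths ?S h r" using h(1) unfolding inU_def by blast
    have ends: "pathstart r = pathstart g" "pathfinish r = pathfinish h"
      using homotopic_paths_imp_pathstart[OF r(3)] homotopic_paths_imp_pathfinish[OF r(3)] h(3) by auto
    have "pathfinish h \<in> U \<inter> V" using ends r(2) pathfinish_in_path_image[of r] h(2) by auto
    from link[OF this] obtain l where l: "path l" "path_image l \<subseteq> U \<inter> V" "pathstart l = c"
      "pathfinish l = pathfinish h" by blast
    have "path (\<kappa> +++ l)" "path_image (\<kappa> +++ l) \<subseteq> U"
      using \<kappa> l by (auto simp: path_image_join)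
    then have "homotopic_paths U r (\<kappa> +++ l)"
      using U(2) r ends l \<kappa> unfolding paths_homotopic_in_def by simp
    then have "homotopic_paths ?S r (\<kappa> +++ l)" by (rule homotopic_paths_subset) simp
    from homotopic_paths_trans[OF r(3) this] show ?thesis
      unfolding inV_def using l by blast
  qed
  have V_to_U: "inU h" if h: "inV h" "pathfinish h \<in> U" for h
  proof -
    obtain r where r: "path r" "path_image r \<subseteq> V" "pathstart r = c" "homotopic_paths ?S h (\<kappa> +++ r)"
      using h(1) unfolding inV_def by blast
    have fin: "pathfinish r = pathfinish h"
      using homotopic_paths_imp_pathfinish[OF r(4)] by simp
    have "pathfinish h \<in> U \<inter> V" using fin r(2) pathfinish_in_path_image[of r] h(2) by auto
    from link[OF this] obtain l where l: "path l" "path_image l \<subseteq> U \<inter> V" "pathstart l = c"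
      "pathfinish l = pathfinish h" by blast
    have "homotopic_paths V r l"
      using V(2) r fin l unfolding paths_homotopic_in_def by simp
    then have "homotopic_paths ?S r l" by (rule homotopic_paths_subset) simp
    moreover have "homotopic_paths ?S \<kappa> \<kappa>" using \<kappa> by auto
    ultimately have "homotopic_paths ?S (\<kappa> +++ r) (\<kappa> +++ l)"
      using \<kappa> r by (intro homotopic_paths_join) auto
    from homotopic_paths_trans[OF r(4) this] have "homotopic_paths ?S h (\<kappa> +++ l)" .
    moreover have "path (\<kappa> +++ l)" "path_image (\<kappa> +++ l) \<subseteq> U"
      using \<kappa> l by (auto simp: path_image_join)
    ultimately show ?thesis unfolding inU_def by blast
  qed
  have main: "(g (real k / real N) \<in> U \<longrightarrow> inU (piece 0 (real k / real N) g)) \<and>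
        (g (real k / real N) \<in> V \<longrightarrow> inV (piece 0 (real k / real N) g))" if "k \<le> N" for k
    using that
  proof (induction k)
    case 0
    have p: "path (piece 0 0 g)" "path_image (piece 0 0 g) \<subseteq> U"
      using piece_props[OF g(1), of 0 0] g(3) by (auto simp: pathstart_def)
    have "homotopic_paths ?S (piece 0 0 g) (piece 0 0 g)" using p by auto
    then have "inU (piece 0 0 g)" using p unfolding inU_def by blast
    moreover have "pathfinish (piece 0 0 g) = g 0" "pathstart (piece 0 0 g) = pathstart g"
      using piece_props[OF g(1), of 0 0] by (auto simp: pathstart_def)
    ultimately show ?case using U_to_V[of "piece 0 0 g"] by simp
  next
    case (Suc k)
    define a b where "a = real k / real N" and "b = real (Suc k) / real N"
    have ab: "0 \<le> a" "a \<le> b" "b \<le> 1" using Suc.prems N(1) unfolding a_def b_def by (auto simp: field_simps)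
    let ?h = "piece 0 a g" and ?s = "piece a b g" and ?h' = "piece 0 b g"
    have join: "homotopic_paths ?S ?h' (?h +++ ?s)"
      by (rule homotopic_paths_sym, rule homotopic_join_pieces[OF g(1,2) ab])
    have a1: "a \<le> 1" and b0: "0 \<le> b" using ab by linarith+
    have s: "path ?s" "path_image ?s = g ` {a..b}" "pathstart ?s = g a" "pathfinish ?s = g b"
      by (rule piece_props[OF g(1) ab])+
    have s': "pathfinish ?h = g a" "pathfinish ?h' = g b" "pathstart ?h' = pathstart g" "path ?h"
      using piece_props[OF g(1) order_refl ab(1) a1] piece_props[OF g(1) order_refl b0 ab(3)]
      by (simp_all only: pathstart_def)
    note s = s s'
    have sS: "homotopic_paths ?S ?s ?s"
    proof -
      have "g ` {a..b} \<subseteq> g ` {0..1}" using ab by (intro image_mono) auto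
      then show ?thesis using s g(2) by (auto simp: path_image_def)
    qed
    have "k < N" using Suc.prems by simp
    from N(2)[OF this, folded a_def b_def] consider "path_image ?s \<subseteq> U" | "path_image ?s \<subseteq> V" unfolding s(2) by blast
    then have "inU ?h' \<or> inV ?h'"
    proof cases
      case 1
      then have "g a \<in> U" using pathstart_in_path_image[of ?s] s(3) by auto
      then obtain r where r: "path r" "path_image r \<subseteq> U" "homotopic_paths ?S ?h r"
        using Suc.IH Suc.prems unfolding inU_def a_def[symmetric] by auto
      have fr: "pathfinish r = g a" using homotopic_paths_imp_pathfinish[OF r(3)] s by simp
      have "homotopic_paths ?S (?h +++ ?s) (r +++ ?s)"
        by (rule homotopic_paths_join[OF r(3) sS]) (simp add: s)
      from homotopic_paths_trans[OF join this] have "homotopic_paths ?S ?h' (r +++ ?s)" .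
      moreover have "path (r +++ ?s)" "path_image (r +++ ?s) \<subseteq> U"
        using r s fr 1 by (auto simp: path_image_join)
      ultimately show ?thesis unfolding inU_def by blast
    next
      case 2
      then have "g a \<in> V" using pathstart_in_path_image[of ?s] s(3) by auto
      then obtain r where r: "path r" "path_image r \<subseteq> V" "pathstart r = c" "homotopic_paths ?S ?h (\<kappa> +++ r)"
        using Suc.IH Suc.prems unfolding inV_def a_def[symmetric] by auto
      have fr: "pathfinish r = g a" using homotopic_paths_imp_pathfinish[OF r(4)] s by simp
      have 1: "homotopic_paths ?S (?h +++ ?s) ((\<kappa> +++ r) +++ ?s)"
        by (rule homotopic_paths_join[OF r(4) sS]) (simp add: s)
      have 2: "homotopic_paths ?S (\<kappa> +++ (r +++ ?s)) ((\<kappa> +++ r) +++ ?s)"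
        by (rule homotopic_paths_assoc) (use \<kappa> r s fr 2 in auto)
      from homotopic_paths_trans[OF homotopic_paths_trans[OF join 1] homotopic_paths_sym[OF 2]]
      have "homotopic_paths ?S ?h' (\<kappa> +++ (r +++ ?s))" .
      moreover have "path (r +++ ?s)" "path_image (r +++ ?s) \<subseteq> V" "pathstart (r +++ ?s) = c"
        using r s fr \<open>path_image ?s \<subseteq> V\<close> by (auto simp: path_image_join)
      ultimately show ?thesis unfolding inV_def by blast
    qed
    then show ?case using U_to_V[of ?h'] V_to_U[of ?h'] s(6,7) unfolding b_def[symmetric] by auto
  qed
  have e: "real N / real N = 1" using N(1) by simp
  have "piece 0 1 g = g" by (simp add: piece_def subpath_def comp_def)
  then have "inU g" using main[of N] g(4) unfolding e pathfinish_def by simp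
  then show ?thesis unfolding inU_def .
qed

lemma homotopic_constant_loops:
  fixes S :: "'a::topological_space set"
  assumes "path p" "path_image p \<subseteq> S"
  shows "homotopic_loops S (\<lambda>_. pathstart p) (\<lambda>_. pathfinish p)"
  unfolding homotopic_loops
proof (intro exI[of _ "p \<circ> fst"] conjI ballI)
  have "continuous_on {0..1} p" using assms by (simp add: path_def)
  then show "continuous_on ({0..1::real} \<times> {0..1::real}) (p \<circ> fst)"
    by (intro continuous_on_compose continuous_on_fst continuous_on_id) (auto elim: continuous_on_subset)
qed (use assms in \<open>auto simp: pathstart_def pathfinish_def path_image_def\<close>)

text \<open>
  A loop is deformed into the one of \<open>U\<close> and \<open>V\<close> that contains its base point, and contracted there.
\<close>

lemma simply_connected_Un:
  fixes U V :: "'a::topological_space set"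
  assumes U: "openin (top_of_set (U \<union> V)) U" "paths_homotopic_in U" "path_connected U"
    and V: "openin (top_of_set (U \<union> V)) V" "paths_homotopic_in V" "path_connected V"
    and UV: "path_connected (U \<inter> V)" "U \<inter> V \<noteq> {}"
  shows "simply_connected (U \<union> V)"
proof -
  let ?S = "U \<union> V"
  have null: "homotopic_loops ?S p (\<lambda>_. pathstart p)"
    if p: "path p" "path_image p \<subseteq> ?S" "pathfinish p = pathstart p" for p
  proof -
    have "\<exists>W r. path r \<and> path_image r \<subseteq> W \<and> homotopic_paths ?S p r \<and> paths_homotopic_in W \<and> W \<subseteq> ?S"
    proof (cases "pathstart p \<in> U")
      case True
      then show ?thesis
        using path_homotopic_into[OF U V(1,2) UV p(1,2)] p(3) U(2) by auto
    next
      case False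
      then have i: "pathstart p \<in> V" using p(2) pathstart_in_path_image[of p] by auto
      have "\<exists>r. path r \<and> path_image r \<subseteq> V \<and> homotopic_paths (V \<union> U) p r"
        by (rule path_homotopic_into) (use U V UV p i in \<open>auto simp: Un_commute Int_commute\<close>)
      then show ?thesis using V(2) by (auto simp: Un_commute)
    qed
    then obtain W r where r: "path r" "path_image r \<subseteq> W" "homotopic_paths ?S p r"
      "paths_homotopic_in W" "W \<subseteq> ?S" by blast
    have ends: "pathstart r = pathstart p" "pathfinish r = pathstart p"
      using homotopic_paths_imp_pathstart[OF r(3)] homotopic_paths_imp_pathfinish[OF r(3)] p(3) by auto
    have c: "path (\<lambda>_::real. pathstart p)" "path_image (\<lambda>_::real. pathstart p) \<subseteq> W"
      using pathstart_in_path_image[of r] ends r(2) by (auto simp: path_def path_image_def)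
    have "homotopic_paths W r (\<lambda>_. pathstart p)"
      using r(4) r(1,2) c ends unfolding paths_homotopic_in_def
      by (auto simp: pathstart_def pathfinish_def)
    then have "homotopic_paths ?S r (\<lambda>_. pathstart p)" by (rule homotopic_paths_subset[OF _ r(5)])
    from homotopic_paths_trans[OF r(3) this] show ?thesis
      by (rule homotopic_paths_imp_homotopic_loops) (use p in \<open>auto simp: pathstart_def pathfinish_def\<close>)
  qed
  have conn: "path_connected ?S" by (rule path_connected_Un[OF U(3) V(3) UV(2)])
  show ?thesis
    unfolding simply_connected_def
  proof (intro allI impI, elim conjE)
    fix p q :: "real \<Rightarrow> 'a"
    assume p: "path p" "pathfinish p = pathstart p" "path_image p \<subseteq> ?S"
      and q: "path q" "pathfinish q = pathstart q" "path_image q \<subseteq> ?S"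
    have "pathstart p \<in> ?S" "pathstart q \<in> ?S"
      using p(3) q(3) pathstart_in_path_image[of p] pathstart_in_path_image[of q] by blast+
    then obtain r where r: "path r" "path_image r \<subseteq> ?S" "pathstart r = pathstart p" "pathfinish r = pathstart q"
      using conn[unfolded path_connected_def, rule_format, of "pathstart p" "pathstart q"] by auto
    have "homotopic_loops ?S (\<lambda>_. pathstart p) (\<lambda>_. pathstart q)"
      using homotopic_constant_loops[OF r(1,2)] r(3,4) by simp
    then show "homotopic_loops ?S p q"
      by (rule homotopic_loops_trans[OF homotopic_loops_trans[OF null[OF p(1,3,2)]]
            homotopic_loops_sym[OF null[OF q(1,3,2)]]])
  qed
qed

section \<open>Relations of the tensor product\<close>

lemma tensor_relations_uminus: "t \<in> tensor_relations R N M \<Longrightarrow> - t \<in> tensor_relations R N M"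
  using tensor_relations.diff[OF tensor_relations.zero, of t] by simp

lemma tensor_relations_plus:
  "s \<in> tensor_relations R N M \<Longrightarrow> t \<in> tensor_relations R N M \<Longrightarrow> s + t \<in> tensor_relations R N M"
  using tensor_relations.diff[OF _ tensor_relations_uminus] by fastforce

lemma tensor_relations_sum:
  "(\<And>i. i \<in> I \<Longrightarrow> f i \<in> tensor_relations R N M) \<Longrightarrow> (\<Sum>i\<in>I. f i) \<in> tensor_relations R N M"
  by (induction I rule: infinite_finite_induct)
     (auto intro: tensor_relations.zero tensor_relations_plus)

lemma tensor_relations_cancel:
  assumes "s - t \<in> tensor_relations R N M" "t \<in> tensor_relations R N M"
  shows "s \<in> tensor_relations R N M"
  using tensor_relations_plus[OF assms] by simp

lemma tensor_zero_left:
  assumes "abelian_group N" "m \<in> carrier M"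
  shows "frag_of (\<zero>\<^bsub>N\<^esub>, m) \<in> tensor_relations R N M"
proof -
  interpret N: abelian_group N by fact
  have "frag_of (\<zero>\<^bsub>N\<^esub> \<oplus>\<^bsub>N\<^esub> \<zero>\<^bsub>N\<^esub>, m) - frag_of (\<zero>\<^bsub>N\<^esub>, m) - frag_of (\<zero>\<^bsub>N\<^esub>, m) \<in> tensor_relations R N M"
    by (rule tensor_relations.add_left) (use assms in auto)
  from tensor_relations_uminus[OF this] show ?thesis by simp
qed

lemma tensor_zero_right:
  assumes "abelian_group M" "n \<in> carrier N"
  shows "frag_of (n, \<zero>\<^bsub>M\<^esub>) \<in> tensor_relations R N M"
proof -
  interpret M: abelian_group M by fact
  have "frag_of (n, \<zero>\<^bsub>M\<^esub> \<oplus>\<^bsub>M\<^esub> \<zero>\<^bsub>M\<^esub>) - frag_of (n, \<zero>\<^bsub>M\<^esub>) - frag_of (n, \<zero>\<^bsub>M\<^esub>) \<in> tensor_relations R N M"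
    by (rule tensor_relations.add_right) (use assms in auto)
  from tensor_relations_uminus[OF this] show ?thesis by simp
qed

lemma tensor_minus_left:
  assumes "abelian_group N" "a \<in> carrier N" "b \<in> carrier N" "m \<in> carrier M"
  shows "frag_of (a \<ominus>\<^bsub>N\<^esub> b, m) - (frag_of (a, m) - frag_of (b, m)) \<in> tensor_relations R N M"
proof -
  interpret N: abelian_group N by fact
  have "frag_of ((a \<ominus>\<^bsub>N\<^esub> b) \<oplus>\<^bsub>N\<^esub> b, m) - frag_of (a \<ominus>\<^bsub>N\<^esub> b, m) - frag_of (b, m) \<in> tensor_relations R N M"
    by (rule tensor_relations.add_left) (use assms in auto)
  moreover have "(a \<ominus>\<^bsub>N\<^esub> b) \<oplus>\<^bsub>N\<^esub> b = a"
    using assms by (simp add: a_minus_def N.a_assoc N.l_neg)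
  ultimately have "frag_of (a, m) - frag_of (a \<ominus>\<^bsub>N\<^esub> b, m) - frag_of (b, m) \<in> tensor_relations R N M"
    by simp
  from tensor_relations_uminus[OF this] show ?thesis by (simp add: algebra_simps)
qed

lemma tensor_finsum_right:
  assumes M: "abelian_group M" and n: "n \<in> carrier N" and "finite F" "\<And>b. b \<in> F \<Longrightarrow> f b \<in> carrier M"
  shows "frag_of (n, finsum M f F) - (\<Sum>b\<in>F. frag_of (n, f b)) \<in> tensor_relations R N M"
  using assms(3,4)
proof (induction F)
  interpret M: abelian_group M by fact
  case empty
  show ?case using tensor_zero_right[OF M n] by simp
next
  interpret M: abelian_group M by fact
  case (insert b F)
  have fF: "f \<in> F \<rightarrow> carrier M" "f b \<in> carrier M" using insert by auto
  have 1: "frag_of (n, f b \<oplus>\<^bsub>M\<^esub> finsum M f F) - frag_of (n, f b) - frag_of (n, finsum M f F)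
      \<in> tensor_relations R N M"
    by (rule tensor_relations.add_right) (use n fF in auto)
  have 2: "frag_of (n, finsum M f F) - (\<Sum>b\<in>F. frag_of (n, f b)) \<in> tensor_relations R N M"
    using insert by simp
  have "finsum M f (insert b F) = f b \<oplus>\<^bsub>M\<^esub> finsum M f F"
    by (rule M.finsum_insert) (use insert fF in auto)
  then show ?case
    using tensor_relations_plus[OF 1 2] insert.hyps by (simp add: algebra_simps)
qed

text \<open>
  On representatives this is the map \<open>id \<otimes> g\<close> of a tensor product.
\<close>

definition tensor_map :: "('m \<Rightarrow> 'm) \<Rightarrow> ('n \<times> 'm \<Rightarrow>\<^sub>0 int) \<Rightarrow> ('n \<times> 'm \<Rightarrow>\<^sub>0 int)" where
  "tensor_map g = frag_extend (\<lambda>p. frag_of (fst p, g (snd p)))"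

lemma tensor_map_of [simp]: "tensor_map g (frag_of (n, m)) = frag_of (n, g m)"
  by (simp add: tensor_map_def)

lemma tensor_map_0 [simp]: "tensor_map g 0 = 0"
  by (simp add: tensor_map_def)

lemma tensor_map_diff: "tensor_map g (a - b) = tensor_map g a - tensor_map g b"
  by (simp add: tensor_map_def frag_extend_diff)

lemma tensor_map_comp: "tensor_map g (tensor_map h t) = tensor_map (\<lambda>m. g (h m)) t"
proof -
  have "Poly_Mapping.keys t \<subseteq> UNIV" by simp
  then show ?thesis
    by (induction t rule: frag_induction) (auto simp: tensor_map_diff)
qed

lemma keys_tensor_map:
  assumes "Poly_Mapping.keys t \<subseteq> A \<times> B"
  shows "Poly_Mapping.keys (tensor_map g t) \<subseteq> A \<times> UNIV"
  using assms
proof (induction t rule: frag_induction)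
  case (diff a b)
  then show ?case unfolding tensor_map_diff using keys_diff[of "tensor_map g a" "tensor_map g b"] by blast
qed auto

definition module_endo :: "('a, 'r) ring_scheme \<Rightarrow> ('a, 'm, 'y) module_scheme \<Rightarrow> ('m \<Rightarrow> 'm) \<Rightarrow> bool" where
  "module_endo R M g \<longleftrightarrow> (\<forall>m\<in>carrier M. g m \<in> carrier M) \<and>
     (\<forall>m\<in>carrier M. \<forall>m'\<in>carrier M. g (m \<oplus>\<^bsub>M\<^esub> m') = g m \<oplus>\<^bsub>M\<^esub> g m') \<and>
     (\<forall>r\<in>carrier R. \<forall>m\<in>carrier M. g (r \<odot>\<^bsub>M\<^esub> m) = r \<odot>\<^bsub>M\<^esub> g m)"

lemma module_endo_funpow:
  assumes "module_endo R M g"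
  shows "module_endo R M (g ^^ k)"
  by (induction k) (use assms in \<open>auto simp: module_endo_def\<close>)

lemma tensor_map_relations:
  assumes g: "module_endo R M g" and t: "t \<in> tensor_relations R N M"
  shows "tensor_map g t \<in> tensor_relations R N M"
  using t
proof induction
  case (add_left n n' m)
  then show ?case using g tensor_relations.add_left[of n N n' "g m" M R]
    by (simp add: tensor_map_diff module_endo_def)
next
  case (add_right n m m')
  then show ?case using g tensor_relations.add_right[of n N "g m" M "g m'" R]
    by (simp add: tensor_map_diff module_endo_def)
next
  case (balanced r n m)
  then show ?case using g tensor_relations.balanced[of r R n N "g m" M]
    by (simp add: tensor_map_diff module_endo_def)
qed (auto simp: tensor_map_diff intro: tensor_relations.intros)

lemma tensor_map_add:
  assumes "Poly_Mapping.keys t \<subseteq> carrier N \<times> carrier M"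
    and g: "\<And>m. m \<in> carrier M \<Longrightarrow> g m \<in> carrier M" and h: "\<And>m. m \<in> carrier M \<Longrightarrow> h m \<in> carrier M"
    and sum: "\<And>m. m \<in> carrier M \<Longrightarrow> m = g m \<oplus>\<^bsub>M\<^esub> h m"
  shows "t - (tensor_map g t + tensor_map h t) \<in> tensor_relations R N M"
  using assms(1)
proof (induction t rule: frag_induction)
  case (one p)
  obtain n m where p: "p = (n, m)" "n \<in> carrier N" "m \<in> carrier M" using one by auto
  have "frag_of (n, g m \<oplus>\<^bsub>M\<^esub> h m) - frag_of (n, g m) - frag_of (n, h m) \<in> tensor_relations R N M"
    by (rule tensor_relations.add_right) (use p g h in auto)
  then show ?case using sum[OF p(3)] p by (simp add: algebra_simps)
next
  case (diff a b)
  from tensor_relations.diff[OF diff] show ?case by (simp add: tensor_map_diff algebra_simps)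
qed (auto intro: tensor_relations.zero)

section \<open>Flatness from locally defined dual bases\<close>

lemma module_abelian_group: "module R M \<Longrightarrow> abelian_group M"
  by (rule module.axioms(2))

text \<open>
  A functional \<open>c\<close> on a submodule \<open>M\<^sub>0\<close> of \<open>M\<close> evaluates elements of \<open>N \<otimes> M\<^sub>0\<close> in \<open>N\<close>.
\<close>

lemma tensor_evaluation:
  assumes N: "module R N"
    and c: "\<And>m. m \<in> M0 \<Longrightarrow> c m \<in> carrier R"
    and c_add: "\<And>m m'. m \<in> M0 \<Longrightarrow> m' \<in> M0 \<Longrightarrow> c (m \<oplus>\<^bsub>M\<^esub> m') = c m \<oplus>\<^bsub>R\<^esub> c m'"
    and c_smult: "\<And>r m. r \<in> carrier R \<Longrightarrow> m \<in> M0 \<Longrightarrow> c (r \<odot>\<^bsub>M\<^esub> m) = r \<otimes>\<^bsub>R\<^esub> c m"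
    and M0_add: "\<And>m m'. m \<in> M0 \<Longrightarrow> m' \<in> M0 \<Longrightarrow> m \<oplus>\<^bsub>M\<^esub> m' \<in> M0"
    and M0_smult: "\<And>r m. r \<in> carrier R \<Longrightarrow> m \<in> M0 \<Longrightarrow> r \<odot>\<^bsub>M\<^esub> m \<in> M0"
  shows "\<exists>h. (\<forall>n\<in>carrier N. \<forall>m\<in>M0. h (frag_of (n, m)) = c m \<odot>\<^bsub>N\<^esub> n) \<and> h 0 = \<zero>\<^bsub>N\<^esub> \<and>
     (\<forall>a b. Poly_Mapping.keys a \<subseteq> carrier N \<times> M0 \<longrightarrow> Poly_Mapping.keys b \<subseteq> carrier N \<times> M0 \<longrightarrow>
        h (a - b) = h a \<ominus>\<^bsub>N\<^esub> h b) \<and>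
     (\<forall>a. Poly_Mapping.keys a \<subseteq> carrier N \<times> M0 \<longrightarrow> h a \<in> carrier N) \<and>
     (\<forall>t \<in> tensor_relations R N (M\<lparr>carrier := M0\<rparr>).
        Poly_Mapping.keys t \<subseteq> carrier N \<times> M0 \<and> h t = \<zero>\<^bsub>N\<^esub>)"
proof -
  interpret N: module R N by fact
  let ?S = "carrier N \<times> M0"
  have G: "comm_group (add_monoid N)" by (rule N.a_comm_group)
  have "(\<lambda>p. c (snd p) \<odot>\<^bsub>N\<^esub> fst p) ` ?S \<subseteq> carrier (add_monoid N)"
    using c by auto
  from comm_group.free_Abelian_group_universal[OF G this] obtain h
    where h: "h \<in> hom (free_Abelian_group ?S) (add_monoid N)"
      and hf: "\<And>x. x \<in> ?S \<Longrightarrow> h (frag_of x) = c (snd x) \<odot>\<^bsub>N\<^esub> fst x" by metis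
  have hadd: "h (a + b) = h a \<oplus>\<^bsub>N\<^esub> h b"
    if "Poly_Mapping.keys a \<subseteq> ?S" "Poly_Mapping.keys b \<subseteq> ?S" for a b
    using h that unfolding hom_def by auto
  have hcl: "h a \<in> carrier N" if "Poly_Mapping.keys a \<subseteq> ?S" for a
    using h that unfolding hom_def by auto
  have h0: "h 0 = \<zero>\<^bsub>N\<^esub>"
  proof -
    have z: "Poly_Mapping.keys 0 \<subseteq> ?S" by simp
    have "h (0 + 0) = h 0 \<oplus>\<^bsub>N\<^esub> h 0" by (rule hadd[OF z z])
    then have "h 0 \<oplus>\<^bsub>N\<^esub> h 0 = h 0" by simp
    then show ?thesis using hcl[OF z] by (simp only: N.add.l_cancel_one)
  qed
  have hdiff: "h (a - b) = h a \<ominus>\<^bsub>N\<^esub> h b"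
    if "Poly_Mapping.keys a \<subseteq> ?S" "Poly_Mapping.keys b \<subseteq> ?S" for a b
  proof -
    have k: "Poly_Mapping.keys (a - b) \<subseteq> ?S" using that keys_diff[of a b] by blast
    have "h a = h (a - b) \<oplus>\<^bsub>N\<^esub> h b" using hadd[OF k that(2)] by simp
    then show ?thesis
      using hcl[OF k] hcl[OF that(2)] by (simp add: a_minus_def N.a_assoc N.r_neg)
  qed
  have rel: "Poly_Mapping.keys t \<subseteq> ?S \<and> h t = \<zero>\<^bsub>N\<^esub>"
    if "t \<in> tensor_relations R N (M\<lparr>carrier := M0\<rparr>)" for t
    using that
  proof induction
    case zero
    show ?case using h0 by simp
  next
    case (diff s t)
    then show ?case using keys_diff[of s t] by (auto simp: hdiff a_minus_def)
  next
    case (add_left n n' m)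
    then have m: "n \<in> carrier N" "n' \<in> carrier N" "m \<in> M0" by auto
    let ?a = "frag_of (n \<oplus>\<^bsub>N\<^esub> n', m)" and ?b = "frag_of (n, m)" and ?c = "frag_of (n', m)"
    have k: "Poly_Mapping.keys ?a \<subseteq> ?S" "Poly_Mapping.keys ?b \<subseteq> ?S" "Poly_Mapping.keys ?c \<subseteq> ?S"
      using m by auto
    have k': "Poly_Mapping.keys (?a - ?b) \<subseteq> ?S" using k keys_diff[of ?a ?b] by blast
    have k'': "Poly_Mapping.keys (?a - ?b - ?c) \<subseteq> ?S" using k k' keys_diff[of "?a - ?b" ?c] by blast
    have "h (?a - ?b - ?c) = (c m \<odot>\<^bsub>N\<^esub> (n \<oplus>\<^bsub>N\<^esub> n')) \<ominus>\<^bsub>N\<^esub> (c m \<odot>\<^bsub>N\<^esub> n) \<ominus>\<^bsub>N\<^esub> (c m \<odot>\<^bsub>N\<^esub> n')"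
      using hdiff[OF k' k(3)] hdiff[OF k(1,2)] hf m by simp
    also have "\<dots> = \<zero>\<^bsub>N\<^esub>"
    proof -
      have cl: "c m \<odot>\<^bsub>N\<^esub> n \<in> carrier N" "c m \<odot>\<^bsub>N\<^esub> n' \<in> carrier N" using m c by auto
      have "c m \<odot>\<^bsub>N\<^esub> (n \<oplus>\<^bsub>N\<^esub> n') = (c m \<odot>\<^bsub>N\<^esub> n) \<oplus>\<^bsub>N\<^esub> (c m \<odot>\<^bsub>N\<^esub> n')"
        using m c by (simp add: N.smult_r_distr)
      then show ?thesis using cl by (simp add: a_minus_def N.a_ac N.r_neg N.r_neg1 N.r_neg2)
    qed
    finally show ?case using k'' by simp
  next
    case (add_right n m m')
    then have m: "n \<in> carrier N" "m \<in> M0" "m' \<in> M0" by auto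
    let ?a = "frag_of (n, m \<oplus>\<^bsub>M\<^esub> m')" and ?b = "frag_of (n, m)" and ?c = "frag_of (n, m')"
    have k: "Poly_Mapping.keys ?a \<subseteq> ?S" "Poly_Mapping.keys ?b \<subseteq> ?S" "Poly_Mapping.keys ?c \<subseteq> ?S"
      using m M0_add by auto
    have k': "Poly_Mapping.keys (?a - ?b) \<subseteq> ?S" using k keys_diff[of ?a ?b] by blast
    have k'': "Poly_Mapping.keys (?a - ?b - ?c) \<subseteq> ?S" using k k' keys_diff[of "?a - ?b" ?c] by blast
    have "h (?a - ?b - ?c) = ((c m \<oplus>\<^bsub>R\<^esub> c m') \<odot>\<^bsub>N\<^esub> n) \<ominus>\<^bsub>N\<^esub> (c m \<odot>\<^bsub>N\<^esub> n) \<ominus>\<^bsub>N\<^esub> (c m' \<odot>\<^bsub>N\<^esub> n)"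
      using hdiff[OF k' k(3)] hdiff[OF k(1,2)] hf m M0_add c_add by simp
    also have "\<dots> = \<zero>\<^bsub>N\<^esub>"
    proof -
      have cl: "c m \<odot>\<^bsub>N\<^esub> n \<in> carrier N" "c m' \<odot>\<^bsub>N\<^esub> n \<in> carrier N" using m c by auto
      have "(c m \<oplus>\<^bsub>R\<^esub> c m') \<odot>\<^bsub>N\<^esub> n = (c m \<odot>\<^bsub>N\<^esub> n) \<oplus>\<^bsub>N\<^esub> (c m' \<odot>\<^bsub>N\<^esub> n)"
        using m c by (simp add: N.smult_l_distr)
      then show ?thesis using cl by (simp add: a_minus_def N.a_ac N.r_neg N.r_neg1 N.r_neg2)
    qed
    finally show ?case using k'' by simp
  next
    case (balanced r n m)
    then have m: "r \<in> carrier R" "n \<in> carrier N" "m \<in> M0" by auto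
    let ?a = "frag_of (r \<odot>\<^bsub>N\<^esub> n, m)" and ?b = "frag_of (n, r \<odot>\<^bsub>M\<^esub> m)"
    have k: "Poly_Mapping.keys ?a \<subseteq> ?S" "Poly_Mapping.keys ?b \<subseteq> ?S" using m M0_smult by auto
    have k': "Poly_Mapping.keys (?a - ?b) \<subseteq> ?S" using k keys_diff[of ?a ?b] by blast
    have "h (?a - ?b) = (c m \<odot>\<^bsub>N\<^esub> (r \<odot>\<^bsub>N\<^esub> n)) \<ominus>\<^bsub>N\<^esub> ((r \<otimes>\<^bsub>R\<^esub> c m) \<odot>\<^bsub>N\<^esub> n)"
      using hdiff[OF k] hf m M0_smult c_smult by simp
    also have "c m \<odot>\<^bsub>N\<^esub> (r \<odot>\<^bsub>N\<^esub> n) = (r \<otimes>\<^bsub>R\<^esub> c m) \<odot>\<^bsub>N\<^esub> n"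
      using m c N.smult_assoc1[of "c m" r n] by (simp add: N.m_comm)
    also have "(r \<otimes>\<^bsub>R\<^esub> c m) \<odot>\<^bsub>N\<^esub> n \<ominus>\<^bsub>N\<^esub> (r \<otimes>\<^bsub>R\<^esub> c m) \<odot>\<^bsub>N\<^esub> n = \<zero>\<^bsub>N\<^esub>"
      using m c by (simp add: a_minus_def N.r_neg)
    finally show ?case using k' by simp
  qed
  show ?thesis
    by (rule exI[of _ h]) (use hf h0 hdiff hcl rel in auto)
qed

text \<open>
  Let \<open>s\<close> act on \<open>M\<close> such that every element of \<open>M\<close> is carried into \<open>M\<^sub>0\<close> by a power of \<open>s\<close>, where
  \<open>M\<^sub>0\<close> is projective, with dual basis \<open>e\<close>, \<open>c\<close>. Then \<open>M\<close> is flat after inverting \<open>s\<close>: relations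
  of \<open>N \<otimes> M\<close> become relations of \<open>N \<otimes> M\<^sub>0\<close> after multiplication by a power of \<open>s\<close>, and an element of
  \<open>N' \<otimes> M\<^sub>0\<close> is determined by its coordinates, which may be computed in \<open>N\<close>.
\<close>

lemma flat_chart:
  assumes M: "module R M" and N: "module R N" "submodule N' R N"
    and s: "module_endo R M s"
    and M0: "M0 \<subseteq> carrier M" "\<And>m. m \<in> M0 \<Longrightarrow> s m \<in> M0"
    and M0_add: "\<And>m m'. m \<in> M0 \<Longrightarrow> m' \<in> M0 \<Longrightarrow> m \<oplus>\<^bsub>M\<^esub> m' \<in> M0"
    and M0_smult: "\<And>r m. r \<in> carrier R \<Longrightarrow> m \<in> M0 \<Longrightarrow> r \<odot>\<^bsub>M\<^esub> m \<in> M0"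
    and reach: "\<And>m. m \<in> carrier M \<Longrightarrow> \<exists>k. (s ^^ k) m \<in> M0"
    and e: "\<And>b. e b \<in> carrier M"
    and c: "\<And>b m. m \<in> M0 \<Longrightarrow> c b m \<in> carrier R"
    and c_add: "\<And>b m m'. m \<in> M0 \<Longrightarrow> m' \<in> M0 \<Longrightarrow> c b (m \<oplus>\<^bsub>M\<^esub> m') = c b m \<oplus>\<^bsub>R\<^esub> c b m'"
    and c_smult: "\<And>b r m. r \<in> carrier R \<Longrightarrow> m \<in> M0 \<Longrightarrow> c b (r \<odot>\<^bsub>M\<^esub> m) = r \<otimes>\<^bsub>R\<^esub> c b m"
    and dual: "\<And>m. m \<in> M0 \<Longrightarrow> \<exists>F. finite F \<and> (\<forall>b. b \<notin> F \<longrightarrow> c b m = \<zero>\<^bsub>R\<^esub>) \<and>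
        m = finsum M (\<lambda>b. c b m \<odot>\<^bsub>M\<^esub> e b) F"
    and t: "Poly_Mapping.keys t \<subseteq> N' \<times> carrier M" "t \<in> tensor_relations R N M"
  shows "\<exists>k. tensor_map (s ^^ k) t \<in> tensor_relations R (N\<lparr>carrier := N'\<rparr>) M"
proof -
  interpret M: module R M by fact
  interpret N: module R N by fact
  let ?N' = "N\<lparr>carrier := N'\<rparr>"
  have mN': "module R ?N'" using submodule.submodule_is_module[OF N(2,1)] .
  interpret N': module R ?N' by (rule mN')
  have aM: "abelian_group M" and aN': "abelian_group ?N'"
    using module_abelian_group M mN' by auto
  have N'sub: "N' \<subseteq> carrier N" using N.submoduleE(1)[OF N(2)] .
  let ?rel = "tensor_relations R ?N' M"
  have later: "(s ^^ (k + j)) m \<in> M0" if "(s ^^ k) m \<in> M0" for k j m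
    by (induction j) (use that M0(2) in auto)
  have later: "(s ^^ k') m \<in> M0" if "(s ^^ k) m \<in> M0" "k \<le> k'" for k k' m
    using later[OF that(1), of "k' - k"] that(2) by simp
  have endo: "module_endo R M (s ^^ k)" for k by (rule module_endo_funpow[OF s])
  have "\<exists>k. \<forall>k'\<ge>k. tensor_map (s ^^ k') t \<in> tensor_relations R N (M\<lparr>carrier := M0\<rparr>)"
    using t(2)
  proof induction
    case zero
    show ?case by (auto intro: tensor_relations.zero)
  next
    case (diff a b)
    then obtain k l where kl: "\<forall>k'\<ge>k. tensor_map (s ^^ k') a \<in> tensor_relations R N (M\<lparr>carrier := M0\<rparr>)"
      "\<forall>k'\<ge>l. tensor_map (s ^^ k') b \<in> tensor_relations R N (M\<lparr>carrier := M0\<rparr>)" by auto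
    show ?case
      by (rule exI[of _ "max k l"]) (use kl in \<open>auto simp: tensor_map_diff intro!: tensor_relations.diff\<close>)
  next
    case (add_left n n' m)
    then obtain k where k: "(s ^^ k) m \<in> M0" using reach by blast
    show ?case
    proof (rule exI[of _ k], intro allI impI)
      fix k' assume "k \<le> k'"
      then have "(s ^^ k') m \<in> M0" using later k by blast
      then show "tensor_map (s ^^ k') (frag_of (n \<oplus>\<^bsub>N\<^esub> n', m) - frag_of (n, m) - frag_of (n', m))
          \<in> tensor_relations R N (M\<lparr>carrier := M0\<rparr>)"
        unfolding tensor_map_diff tensor_map_of
        by (intro tensor_relations.add_left) (use add_left in auto)
    qed
  next
    case (add_right n m m')
    obtain k where k: "(s ^^ k) m \<in> M0" using reach add_right by blast
    obtain l where l: "(s ^^ l) m' \<in> M0" using reach add_right by blast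
    show ?case
    proof (rule exI[of _ "max k l"], intro allI impI)
      fix k' assume "max k l \<le> k'"
      then have i: "(s ^^ k') m \<in> M0" "(s ^^ k') m' \<in> M0" using later k l by auto
      have "(s ^^ k') (m \<oplus>\<^bsub>M\<^esub> m') = (s ^^ k') m \<oplus>\<^bsub>M\<lparr>carrier := M0\<rparr>\<^esub> (s ^^ k') m'"
        using endo[of k'] add_right unfolding module_endo_def by simp
      then show "tensor_map (s ^^ k') (frag_of (n, m \<oplus>\<^bsub>M\<^esub> m') - frag_of (n, m) - frag_of (n, m'))
          \<in> tensor_relations R N (M\<lparr>carrier := M0\<rparr>)"
        unfolding tensor_map_diff tensor_map_of
        using tensor_relations.add_right[of n N "(s ^^ k') m" "M\<lparr>carrier := M0\<rparr>" "(s ^^ k') m'" R] i add_right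
        by simp
    qed
  next
    case (balanced r n m)
    then obtain k where k: "(s ^^ k) m \<in> M0" using reach by blast
    show ?case
    proof (rule exI[of _ k], intro allI impI)
      fix k' assume "k \<le> k'"
      then have i: "(s ^^ k') m \<in> M0" using later k by blast
      have "(s ^^ k') (r \<odot>\<^bsub>M\<^esub> m) = r \<odot>\<^bsub>M\<lparr>carrier := M0\<rparr>\<^esub> (s ^^ k') m"
        using endo[of k'] balanced unfolding module_endo_def by simp
      then show "tensor_map (s ^^ k') (frag_of (r \<odot>\<^bsub>N\<^esub> n, m) - frag_of (n, r \<odot>\<^bsub>M\<^esub> m))
          \<in> tensor_relations R N (M\<lparr>carrier := M0\<rparr>)"
        unfolding tensor_map_diff tensor_map_of
        using tensor_relations.balanced[of r R n N "(s ^^ k') m" "M\<lparr>carrier := M0\<rparr>"] i balanced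
        by simp
    qed
  qed
  then obtain k where k: "tensor_map (s ^^ k) t \<in> tensor_relations R N (M\<lparr>carrier := M0\<rparr>)" by auto
  let ?P = "\<lambda>b h. (\<forall>n\<in>carrier N. \<forall>m\<in>M0. h (frag_of (n, m)) = c b m \<odot>\<^bsub>N\<^esub> n) \<and> h 0 = \<zero>\<^bsub>N\<^esub> \<and>
     (\<forall>x y. Poly_Mapping.keys x \<subseteq> carrier N \<times> M0 \<longrightarrow> Poly_Mapping.keys y \<subseteq> carrier N \<times> M0 \<longrightarrow>
        h (x - y) = h x \<ominus>\<^bsub>N\<^esub> h y) \<and>
     (\<forall>x. Poly_Mapping.keys x \<subseteq> carrier N \<times> M0 \<longrightarrow> h x \<in> carrier N) \<and>
     (\<forall>t \<in> tensor_relations R N (M\<lparr>carrier := M0\<rparr>).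
        Poly_Mapping.keys t \<subseteq> carrier N \<times> M0 \<and> h t = \<zero>\<^bsub>N\<^esub>)"
  have "\<forall>b. \<exists>h. ?P b h"
  proof
    fix b
    show "\<exists>h. ?P b h"
      by (rule tensor_evaluation[OF N(1), where c = "c b"]) (use c c_add c_smult M0_add M0_smult in auto)
  qed
  from choice[OF this] obtain h where h: "\<And>b. ?P b (h b)" by blast
  have h_of: "h b (frag_of (n, m)) = c b m \<odot>\<^bsub>N\<^esub> n" if "n \<in> carrier N" "m \<in> M0" for b n m
    using h[of b] that by blast
  have h_diff: "h b (x - y) = h b x \<ominus>\<^bsub>N\<^esub> h b y"
    if "Poly_Mapping.keys x \<subseteq> carrier N \<times> M0" "Poly_Mapping.keys y \<subseteq> carrier N \<times> M0" for b x y
    using h[of b] that by blast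
  have h_rel: "Poly_Mapping.keys x \<subseteq> carrier N \<times> M0" "h b x = \<zero>\<^bsub>N\<^esub>"
    if "x \<in> tensor_relations R N (M\<lparr>carrier := M0\<rparr>)" for b x
    using h[of b] that by blast+
  have h0: "h b 0 = \<zero>\<^bsub>N\<^esub>" for b using h[of b] by blast
  have zero_in: "(\<Sum>b\<in>F. frag_of (\<zero>\<^bsub>N\<^esub>, e b)) \<in> ?rel" for F
  proof (rule tensor_relations_sum)
    fix b
    show "frag_of (\<zero>\<^bsub>N\<^esub>, e b) \<in> ?rel"
      using tensor_zero_left[OF aN', of "e b" M R] e by simp
  qed
  define Q where "Q u \<longleftrightarrow> (\<forall>b. h b u \<in> N') \<and> (\<exists>F. finite F \<and> (\<forall>F'. finite F' \<longrightarrow> F \<subseteq> F' \<longrightarrow>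
      u - (\<Sum>b\<in>F'. frag_of (h b u, e b)) \<in> ?rel))" for u
  have decomp: "Q u" if "Poly_Mapping.keys u \<subseteq> N' \<times> M0" for u
    using that
  proof (rule free_Abelian_group_induct)
    have z: "\<zero>\<^bsub>N\<^esub> \<in> N'" using N'.zero_closed by simp
    show "Q 0"
      unfolding Q_def
    proof (intro conjI allI exI[of _ "{}"] impI)
      fix F'
      show "0 - (\<Sum>b\<in>F'. frag_of (h b 0, e b)) \<in> ?rel"
        unfolding h0 by (rule tensor_relations.diff[OF tensor_relations.zero zero_in])
    qed (use z h0 in auto)
  next
    fix x y
    assume 2: "Poly_Mapping.keys x \<subseteq> N' \<times> M0" "Poly_Mapping.keys y \<subseteq> N' \<times> M0" "Q x" "Q y"
    have k: "Poly_Mapping.keys x \<subseteq> carrier N \<times> M0" "Poly_Mapping.keys y \<subseteq> carrier N \<times> M0"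
      using 2 N'sub by auto
    obtain F where F: "finite F" "\<forall>F'. finite F' \<longrightarrow> F \<subseteq> F' \<longrightarrow>
        x - (\<Sum>b\<in>F'. frag_of (h b x, e b)) \<in> ?rel" using 2(3) unfolding Q_def by blast
    obtain G where G: "finite G" "\<forall>F'. finite F' \<longrightarrow> G \<subseteq> F' \<longrightarrow>
        y - (\<Sum>b\<in>F'. frag_of (h b y, e b)) \<in> ?rel" using 2(4) unfolding Q_def by blast
    have hN: "h b x \<in> N'" "h b y \<in> N'" for b using 2(3,4) unfolding Q_def by auto
    have minus: "a \<ominus>\<^bsub>?N'\<^esub> b = a \<ominus>\<^bsub>N\<^esub> b" if "a \<in> N'" "b \<in> N'" for a b
    proof -
      have "\<ominus>\<^bsub>?N'\<^esub> b = \<ominus>\<^bsub>N\<^esub> b"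
      proof (rule N.minus_equality[symmetric])
        show "(\<ominus>\<^bsub>?N'\<^esub> b) \<oplus>\<^bsub>N\<^esub> b = \<zero>\<^bsub>N\<^esub>" using N'.l_neg[of b] that by simp
        show "b \<in> carrier N" "\<ominus>\<^bsub>?N'\<^esub> b \<in> carrier N"
          using that N'sub N'.a_inv_closed[of b] by auto
      qed
      then show ?thesis by (simp add: a_minus_def)
    qed
    have "h b (x - y) \<in> N'" for b
      using N'.minus_closed[of "h b x" "h b y"] hN minus[OF hN] h_diff[OF k] by simp
    moreover have "\<exists>F. finite F \<and> (\<forall>F'. finite F' \<longrightarrow> F \<subseteq> F' \<longrightarrow>
        x - y - (\<Sum>b\<in>F'. frag_of (h b (x - y), e b)) \<in> ?rel)"
    proof (rule exI[of _ "F \<union> G"], intro conjI allI impI)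
      show "finite (F \<union> G)" using F G by simp
      fix F' assume F': "finite F'" "F \<union> G \<subseteq> F'"
      have 1: "x - (\<Sum>b\<in>F'. frag_of (h b x, e b)) - (y - (\<Sum>b\<in>F'. frag_of (h b y, e b))) \<in> ?rel"
        by (rule tensor_relations.diff) (use F G F' in auto)
      have 2: "(\<Sum>b\<in>F'. frag_of (h b x \<ominus>\<^bsub>N\<^esub> h b y, e b) - (frag_of (h b x, e b) - frag_of (h b y, e b))) \<in> ?rel"
      proof (rule tensor_relations_sum)
        fix b
        show "frag_of (h b x \<ominus>\<^bsub>N\<^esub> h b y, e b) - (frag_of (h b x, e b) - frag_of (h b y, e b)) \<in> ?rel"
          using tensor_minus_left[OF aN', of "h b x" "h b y" "e b" M R] hN minus[OF hN] e by simp
      qed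
      show "x - y - (\<Sum>b\<in>F'. frag_of (h b (x - y), e b)) \<in> ?rel"
      proof -
        have "x - y - (\<Sum>b\<in>F'. frag_of (h b (x - y), e b)) =
            x - (\<Sum>b\<in>F'. frag_of (h b x, e b)) - (y - (\<Sum>b\<in>F'. frag_of (h b y, e b))) -
            (\<Sum>b\<in>F'. frag_of (h b x \<ominus>\<^bsub>N\<^esub> h b y, e b) - (frag_of (h b x, e b) - frag_of (h b y, e b)))"
          by (simp add: h_diff[OF k] sum_subtractf)
        then show ?thesis using tensor_relations.diff[OF 1 2] by (simp only:)
      qed
    qed
    ultimately show "Q (x - y)" unfolding Q_def by blast
  next
    fix p assume "p \<in> N' \<times> M0"
    then obtain n m where p: "p = (n, m)" "n \<in> N'" "m \<in> M0" by auto
    have hp: "h b (frag_of p) = c b m \<odot>\<^bsub>N\<^esub> n" for b using h_of p N'sub by auto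
    have cn: "c b m \<odot>\<^bsub>N\<^esub> n \<in> N'" for b
      using N'.smult_closed[of "c b m" n] c p by simp
    obtain F where F: "finite F" "\<forall>b. b \<notin> F \<longrightarrow> c b m = \<zero>\<^bsub>R\<^esub>"
        "m = finsum M (\<lambda>b. c b m \<odot>\<^bsub>M\<^esub> e b) F" using dual[OF p(3)] by blast
    have "frag_of p - (\<Sum>b\<in>F'. frag_of (h b (frag_of p), e b)) \<in> ?rel"
      if F': "finite F'" "F \<subseteq> F'" for F'
    proof -
      have m: "m = finsum M (\<lambda>b. c b m \<odot>\<^bsub>M\<^esub> e b) F'"
      proof -
        have "finsum M (\<lambda>b. c b m \<odot>\<^bsub>M\<^esub> e b) F = finsum M (\<lambda>b. c b m \<odot>\<^bsub>M\<^esub> e b) F'"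
          by (rule M.add.finprod_mono_neutral_cong_left[OF F'])
             (use F e c p in auto)
        then show ?thesis using F(3) by simp
      qed
      have 1: "frag_of (n, finsum M (\<lambda>b. c b m \<odot>\<^bsub>M\<^esub> e b) F') - (\<Sum>b\<in>F'. frag_of (n, c b m \<odot>\<^bsub>M\<^esub> e b)) \<in> ?rel"
        by (rule tensor_finsum_right[OF aM]) (use p F' c e in auto)
      have 2: "(\<Sum>b\<in>F'. frag_of (c b m \<odot>\<^bsub>N\<^esub> n, e b) - frag_of (n, c b m \<odot>\<^bsub>M\<^esub> e b)) \<in> ?rel"
      proof (rule tensor_relations_sum)
        fix b
        show "frag_of (c b m \<odot>\<^bsub>N\<^esub> n, e b) - frag_of (n, c b m \<odot>\<^bsub>M\<^esub> e b) \<in> ?rel"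
          using tensor_relations.balanced[of "c b m" R n ?N' "e b" M] c p e by simp
      qed
      show ?thesis
        using tensor_relations.diff[OF 1 2] unfolding m[symmetric] hp
        by (simp add: p sum_subtractf)
    qed
    then show "Q (frag_of p)" unfolding Q_def using hp cn F(1) by auto
  qed
  let ?u = "tensor_map (s ^^ k) t"
  have "Poly_Mapping.keys ?u \<subseteq> N' \<times> M0"
    using keys_tensor_map[OF t(1), of "s ^^ k"] h_rel(1)[OF k] by blast
  from decomp[OF this] obtain F where F: "finite F" "?u - (\<Sum>b\<in>F. frag_of (h b ?u, e b)) \<in> ?rel"
    unfolding Q_def by blast
  have "?u \<in> ?rel"
    by (rule tensor_relations_cancel[OF F(2)]) (use zero_in h_rel(2)[OF k] in auto)
  then show ?thesis by blast
qed

text \<open>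
  Here \<open>a s + b s' = 1\<close>: the actions \<open>s\<close> and \<open>s'\<close> generate the unit ideal, so that an element of the tensor product
  that is annihilated by both is zero.
\<close>

lemma flat_glue:
  assumes N: "Poly_Mapping.keys t \<subseteq> carrier N \<times> carrier M"
    and s: "tensor_map s t \<in> tensor_relations R N M" "tensor_map s' t \<in> tensor_relations R N M"
    and ab: "module_endo R M a" "module_endo R M b" "module_endo R M s" "module_endo R M s'"
      "\<And>m. m \<in> carrier M \<Longrightarrow> m = a (s m) \<oplus>\<^bsub>M\<^esub> b (s' m)"
  shows "t \<in> tensor_relations R N M"
proof (rule tensor_relations_cancel)
  show "t - (tensor_map (\<lambda>m. a (s m)) t + tensor_map (\<lambda>m. b (s' m)) t) \<in> tensor_relations R N M"
    by (rule tensor_map_add[OF N]) (use ab in \<open>auto simp: module_endo_def\<close>)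
  show "tensor_map (\<lambda>m. a (s m)) t + tensor_map (\<lambda>m. b (s' m)) t \<in> tensor_relations R N M"
    using tensor_relations_plus[OF tensor_map_relations[OF ab(1) s(1)] tensor_map_relations[OF ab(2) s(2)]]
    by (simp add: tensor_map_comp)
qed

section \<open>The Danielewski variety\<close>

definition danielewski :: "nat \<Rightarrow> pt set" where
  "danielewski n = {P \<in> aff (n + 2). P 0 ^ 2 * P 1 = P 2 ^ 2 - 1}"

definition fibre_map :: "complex \<Rightarrow> pt \<Rightarrow> pt" where
  "fibre_map c Q = (\<lambda>i. if i = 0 then c else if i = 1 then (Q 0 ^ 2 - 1) / c ^ 2 else Q (i - 2))"

text \<open>
  An isomorphism, for \<open>\<epsilon> = \<plusminus>1\<close>, from an affine space with coordinates \<open>x\<close>, \<open>u\<close> and the free ones onto the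
  complement of the sheet \<open>x = 0\<close>, \<open>y = -\<epsilon>\<close>: it solves \<open>x\<^sup>2 u = y - \<epsilon>\<close> and \<open>z = (y + \<epsilon>) u\<close>.
\<close>

definition chart :: "complex \<Rightarrow> pt \<Rightarrow> pt" where
  "chart \<epsilon> Q = Q(1 := 2 * \<epsilon> * Q 1 + Q 0 ^ 2 * Q 1 ^ 2, 2 := \<epsilon> + Q 0 ^ 2 * Q 1)"

definition chart_domain :: "nat \<Rightarrow> pt set" where
  "chart_domain n = {Q \<in> aff (n + 2). Q 2 = 0}"

definition chart_image :: "nat \<Rightarrow> complex \<Rightarrow> pt set" where
  "chart_image n \<epsilon> = {P \<in> danielewski n. P 0 \<noteq> 0 \<or> P 2 = \<epsilon>}"

text \<open>
  The coordinate \<open>u = Q 1\<close> of the preimage satisfies \<open>(P 2 + \<epsilon>) u = P 1\<close> and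
  \<open>(P 0)\<^sup>2 u = P 2 - \<epsilon>\<close>. The least squares solution is continuous where the coefficients do not both
  vanish.
\<close>

definition chart_inverse :: "complex \<Rightarrow> pt \<Rightarrow> pt" where
  "chart_inverse \<epsilon> P = P(1 := (cnj (P 2 + \<epsilon>) * P 1 + cnj (P 0 ^ 2) * (P 2 - \<epsilon>)) /
       (cnj (P 2 + \<epsilon>) * (P 2 + \<epsilon>) + cnj (P 0 ^ 2) * P 0 ^ 2), 2 := 0)"

lemma polyfun_chart: "(\<lambda>Q. chart \<epsilon> Q i) \<in> polyfun"
proof -
  have "(\<lambda>Q. 2 * \<epsilon> * Q 1 + Q 0 ^ 2 * Q 1 ^ 2) \<in> polyfun" "(\<lambda>Q. \<epsilon> + Q 0 ^ 2 * Q 1) \<in> polyfun"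
    by (intro polyfun_intros)+
  then show ?thesis by (cases "i = 1"; cases "i = 2") (simp_all add: chart_def polyfun.coord)
qed

lemma polyfun_fibre_map: "(\<lambda>Q. fibre_map c Q i) \<in> polyfun"
proof -
  have "(\<lambda>Q. (Q 0 ^ 2 - 1) * (1 / c ^ 2)) \<in> polyfun" by (intro polyfun_intros)
  then show ?thesis
    by (cases "i = 0"; cases "i = 1") (simp_all add: fibre_map_def polyfun.coord polyfun.const)
qed

lemma chart_in_danielewski:
  assumes "\<epsilon>\<^sup>2 = 1" "Q \<in> chart_domain n" "n > 0"
  shows "chart \<epsilon> Q \<in> chart_image n \<epsilon>"
proof -
  have "Q 0 ^ 2 * (2 * \<epsilon> * Q 1 + Q 0 ^ 2 * Q 1 ^ 2) = (\<epsilon> + Q 0 ^ 2 * Q 1) ^ 2 - \<epsilon>\<^sup>2"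
    by (simp add: power2_eq_square algebra_simps)
  then show ?thesis
    using assms by (auto simp: chart_image_def danielewski_def chart_def chart_domain_def aff_def)
qed

lemma chart_inverse:
  assumes e: "\<epsilon>\<^sup>2 = 1" and P: "P \<in> chart_image n \<epsilon>"
  shows "chart \<epsilon> (chart_inverse \<epsilon> P) = P" "chart_inverse \<epsilon> P \<in> chart_domain n"
    "cnj (P 2 + \<epsilon>) * (P 2 + \<epsilon>) + cnj (P 0 ^ 2) * P 0 ^ 2 \<noteq> 0"
proof -
  have X: "P \<in> aff (n + 2)" "P 0 ^ 2 * P 1 = P 2 ^ 2 - 1" and Pe: "P 0 \<noteq> 0 \<or> P 2 = \<epsilon>"
    using P by (auto simp: chart_image_def danielewski_def)
  have e0: "\<epsilon> \<noteq> 0" using e by auto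
  have ee: "P 2 ^ 2 - 1 = (P 2 + \<epsilon>) * (P 2 - \<epsilon>)"
    using e by (simp add: algebra_simps power2_eq_square)
  define u where "u = (if P 0 = 0 then P 1 / (P 2 + \<epsilon>) else (P 2 - \<epsilon>) / P 0 ^ 2)"
  have u1: "(P 2 + \<epsilon>) * u = P 1" and u2: "P 0 ^ 2 * u = P 2 - \<epsilon>"
  proof -
    show "(P 2 + \<epsilon>) * u = P 1"
    proof (cases "P 0 = 0")
      case True
      then have "P 2 + \<epsilon> = 2 * \<epsilon>" using Pe by simp
      then show ?thesis using True e0 by (simp add: u_def)
    next
      case False
      have "(P 2 + \<epsilon>) * u * P 0 ^ 2 = (P 2 + \<epsilon>) * (P 2 - \<epsilon>)"
        using False by (simp add: u_def)
      also have "\<dots> = P 1 * P 0 ^ 2" using X(2) ee by (simp add: mult.commute)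
      finally show ?thesis using False by simp
    qed
    show "P 0 ^ 2 * u = P 2 - \<epsilon>" using Pe by (auto simp: u_def)
  qed
  have "P 0 \<noteq> 0 \<or> P 2 + \<epsilon> \<noteq> 0" using Pe e0 by auto
  then have pos: "(cmod (P 2 + \<epsilon>))\<^sup>2 + (cmod (P 0 ^ 2))\<^sup>2 \<noteq> 0"
    by (auto simp: sum_power2_eq_zero_iff)
  have D: "cnj (P 2 + \<epsilon>) * (P 2 + \<epsilon>) + cnj (P 0 ^ 2) * P 0 ^ 2 =
      of_real ((cmod (P 2 + \<epsilon>))\<^sup>2 + (cmod (P 0 ^ 2))\<^sup>2)"
    by (simp only: of_real_add complex_norm_square mult.commute)
  then show D0: "cnj (P 2 + \<epsilon>) * (P 2 + \<epsilon>) + cnj (P 0 ^ 2) * P 0 ^ 2 \<noteq> 0"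
    using pos by (simp only: of_real_eq_0_iff not_False_eq_True)
  have "cnj (P 2 + \<epsilon>) * P 1 + cnj (P 0 ^ 2) * (P 2 - \<epsilon>) =
      (cnj (P 2 + \<epsilon>) * (P 2 + \<epsilon>) + cnj (P 0 ^ 2) * P 0 ^ 2) * u"
    unfolding u1[symmetric] u2[symmetric] by (simp add: algebra_simps)
  then have inv: "chart_inverse \<epsilon> P = P(1 := u, 2 := 0)"
    using D0 by (simp add: chart_inverse_def)
  have P2: "P 2 = \<epsilon> + P 0 ^ 2 * u" using u2 by simp
  moreover have "2 * \<epsilon> * u + P 0 ^ 2 * u ^ 2 = (P 2 + \<epsilon>) * u"
    unfolding P2 by (simp add: algebra_simps power2_eq_square)
  ultimately show "chart \<epsilon> (chart_inverse \<epsilon> P) = P"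
    unfolding inv chart_def using u1 by (auto simp: fun_eq_iff)
  show "chart_inverse \<epsilon> P \<in> chart_domain n"
    unfolding inv chart_domain_def using X(1) by (auto simp: aff_def)
qed

lemma chart_image_eq: "\<epsilon>\<^sup>2 = 1 \<Longrightarrow> n > 0 \<Longrightarrow> chart \<epsilon> ` chart_domain n = chart_image n \<epsilon>"
proof (intro Set.set_eqI iffI)
  fix P assume e: "\<epsilon>\<^sup>2 = 1" and P: "P \<in> chart_image n \<epsilon>"
  show "P \<in> chart \<epsilon> ` chart_domain n"
    by (rule image_eqI[where x = "chart_inverse \<epsilon> P"]) (use chart_inverse[OF e P] in auto)
qed (auto simp: chart_in_danielewski)

lemma danielewski_charts: "danielewski n = chart_image n 1 \<union> chart_image n (-1)"
proof -
  have "P 2 = 1 \<or> P 2 = -1" if "P \<in> danielewski n" "P 0 = 0" for P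
    using that by (simp add: danielewski_def power2_eq_1_iff)
  then show ?thesis unfolding chart_image_def by blast
qed

lemma function_domain_chart_domain: "function_domain (chart_domain n)"
proof (rule function_domain_affine_lines)
  have "(\<lambda>_. 0) \<in> chart_domain n" by (simp add: chart_domain_def aff_def)
  then show "chart_domain n \<noteq> {}" by blast
qed (auto simp: chart_domain_def aff_def)

text \<open>The complement of the first chart is reached by curves in the second chart.\<close>

lemma vanish_on_chart:
  assumes n: "n > 0" and h: "h \<in> polyfun" "\<forall>P\<in>chart_image n 1. h P = 0" and P: "P \<in> danielewski n"
  shows "h P = 0"
proof (cases "P \<in> chart_image n 1")
  case False
  then have P': "P \<in> chart_image n (-1)" using P danielewski_charts by auto
  define Q where "Q = chart_inverse (-1) P"
  have Q: "chart (-1) Q = P" "Q \<in> chart_domain n"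
    unfolding Q_def using chart_inverse[OF _ P'] by auto
  define c where "c = (\<lambda>i. if i = 0 then [:0, 1:] else if i = 1 then [:- 2 * Q 1, 0, Q 1 ^ 2:]
      else if i = 2 then [:-1, 0, Q 1:] else [:Q i:])"
  have c: "(\<lambda>i. poly (c i) t) = chart (-1) (Q(0 := t))" for t
    by (auto simp: c_def chart_def fun_eq_iff power2_eq_square algebra_simps)
  from polyfun_along_curve[OF h(1), of c] obtain q
    where q: "\<forall>t. h (\<lambda>i. poly (c i) t) = poly q t" ..
  have "poly q t = 0" if "t \<noteq> 0" for t
  proof -
    have "Q(0 := t) \<in> chart_domain n" using Q(2) by (auto simp: chart_domain_def aff_def)
    from chart_in_danielewski[OF _ this n, of "-1"] have "chart (-1) (Q(0 := t)) \<in> danielewski n"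
      by (simp add: chart_image_def)
    moreover have "chart (-1) (Q(0 := t)) 0 = t" by (simp add: chart_def)
    ultimately have "chart (-1) (Q(0 := t)) \<in> chart_image n 1" using that by (simp add: chart_image_def)
    then show ?thesis using h(2) q[rule_format, of t] unfolding c by simp
  qed
  then have "{t. poly q t \<noteq> 0} \<subseteq> {0}" by auto
  then have "q = 0" using poly_zero_cofinite finite_subset by blast
  moreover have "h P = poly q (Q 0)"
    using q[rule_format, of "Q 0"] unfolding c using Q(1) by simp
  ultimately show ?thesis by simp
qed (use h in simp)

lemma function_domain_danielewski:
  assumes n: "n > 0"
  shows "function_domain (danielewski n)"
proof (rule function_domain_dense)
  show "function_domain (chart_image n 1)"
    using function_domain_image[OF function_domain_chart_domain, of "chart 1" n] polyfun_chart
      chart_image_eq[of 1 n] n by simp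
  show "chart_image n 1 \<subseteq> danielewski n" by (auto simp: chart_image_def)
  fix h assume "h \<in> polyfun" "\<forall>x\<in>chart_image n 1. h x = 0"
  then show "\<forall>x\<in>danielewski n. h x = 0" using vanish_on_chart[OF n] by blast
qed

lemma danielewski_point: "n > 0 \<Longrightarrow> (\<lambda>i. if i = 2 then 1 else 0) \<in> danielewski n"
  by (auto simp: danielewski_def aff_def)

lemma zariski_closed_danielewski: "zariski_closed (danielewski n)"
proof -
  have "(\<lambda>P. P 0 ^ 2 * P 1 - (P 2 ^ 2 - 1)) \<in> polyfun" by (intro polyfun_intros)
  from zariski_closed_Int[OF zariski_closed_aff[of "n + 2"] zariski_closed_zero_set[OF this]]
  show ?thesis
    by (rule back_subst[where P = zariski_closed]) (auto simp: danielewski_def)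
qed

lemma affine_variety_danielewski:
  assumes "n > 0"
  shows "affine_variety (danielewski n)"
  unfolding affine_variety_def zariski_irreducible_iff
  using zariski_closed_danielewski function_domain_danielewski[OF assms]
  by (auto simp: danielewski_def intro!: exI[of _ "n + 2"])

lemma fibre_map_image:
  assumes "c \<noteq> 0"
  shows "fibre_map c ` aff n = {P \<in> danielewski n. P 0 = c}"
proof (intro Set.set_eqI iffI)
  fix P assume "P \<in> fibre_map c ` aff n"
  then obtain Q where Q: "Q \<in> aff n" "P = fibre_map c Q" by auto
  show "P \<in> {P \<in> danielewski n. P 0 = c}"
    using Q assms by (auto simp: danielewski_def fibre_map_def aff_def)
next
  fix P assume P: "P \<in> {P \<in> danielewski n. P 0 = c}"
  define Q where "Q = (\<lambda>i. P (i + 2))"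
  have "Q \<in> aff n" using P by (auto simp: Q_def danielewski_def aff_def)
  moreover have "fibre_map c Q i = P i" for i
  proof -
    have "c ^ 2 * P 1 = P 2 ^ 2 - 1" using P by (auto simp: danielewski_def)
    then have 1: "(P 2 ^ 2 - 1) / c ^ 2 = P 1" using assms by (simp add: field_simps)
    consider "i = 0" | "i = 1" | "i \<ge> 2" by linarith
    then show ?thesis
    proof cases
      case 2
      then show ?thesis using 1 by (simp add: fibre_map_def Q_def numeral_2_eq_2)
    next
      case 3
      then have "Suc (Suc (i - 2)) = i" by simp
      then show ?thesis using 3 by (simp add: fibre_map_def Q_def)
    qed (use P in \<open>simp add: fibre_map_def\<close>)
  qed
  ultimately show "P \<in> fibre_map c ` aff n" by (intro image_eqI[of _ _ Q]) (auto simp: fun_eq_iff)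
qed

lemma zariski_closed_fibre: "zariski_closed {P \<in> danielewski n. P 0 = c}"
proof -
  have "(\<lambda>P. P 0 - c) \<in> polyfun" by (intro polyfun_intros)
  from zariski_closed_Int[OF zariski_closed_danielewski[of n] zariski_closed_zero_set[OF this]]
  show ?thesis
    by (rule back_subst[where P = zariski_closed]) auto
qed

lemma function_domain_fibre: "c \<noteq> 0 \<Longrightarrow> function_domain {P \<in> danielewski n. P 0 = c}"
  using function_domain_image[OF function_domain_aff, of "fibre_map c" n] polyfun_fibre_map
    fibre_map_image[of c n] by simp

lemma danielewski_subset_mono: "k \<le> n \<Longrightarrow> danielewski k \<subseteq> danielewski n"
  by (auto simp: danielewski_def aff_def)

text \<open>
  A flag of linear subspaces in the fibre, which is an affine space.
\<close>

lemma fibre_chain: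
  assumes "c \<noteq> 0" "k \<le> n"
  shows "irreducible_chain (\<lambda>i. {P \<in> danielewski i. P 0 = c}) k"
  unfolding irreducible_chain_def zariski_irreducible_iff
proof (intro conjI allI impI)
  fix i
  have sub: "danielewski i \<subseteq> danielewski (Suc i)" by (rule danielewski_subset_mono) simp
  define P where "P = fibre_map c (\<lambda>j. if j = i then 1 else 0)"
  have "P \<in> {P \<in> danielewski (Suc i). P 0 = c}"
    unfolding fibre_map_image[OF assms(1), symmetric] P_def by (auto simp: aff_def)
  moreover have "P (i + 2) = 1" by (simp add: P_def fibre_map_def)
  then have "P \<notin> danielewski i" by (auto simp: danielewski_def aff_def)
  ultimately show "{P \<in> danielewski i. P 0 = c} \<subset> {P \<in> danielewski (Suc i). P 0 = c}"
    using sub by blast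
qed (use zariski_closed_fibre function_domain_fibre[OF assms(1)] in auto)

lemma zariski_dim_fibre:
  assumes "c \<noteq> 0" "n > 0"
  shows "zariski_dim {P \<in> danielewski n. P 0 = c} > 0"
proof -
  have "n \<le> zariski_dim {P \<in> danielewski n. P 0 = c}"
  proof (rule zariski_dim_ge[OF fibre_chain[OF assms(1) order_refl]])
    show "{P \<in> danielewski n. P 0 = c} \<subseteq> aff (n + 2)" by (auto simp: danielewski_def)
    fix i assume "i \<le> n"
    then show "{P \<in> danielewski i. P 0 = c} \<subseteq> {P \<in> danielewski n. P 0 = c}"
      using danielewski_subset_mono[of i n] by blast
  qed
  then show ?thesis using assms by simp
qed

text \<open>
  The flag in a fibre is prolonged by the whole variety.
\<close>

lemma zariski_dim_danielewski:
  assumes n: "n > 0"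
  shows "zariski_dim (danielewski n) = n + 1"
proof -
  define Z where "Z = (\<lambda>i. if i \<le> n then {P \<in> danielewski i. P 0 = 1} else danielewski n)"
  have strict: "{P \<in> danielewski n. P 0 = 1} \<subset> danielewski n"
  proof -
    have "{P \<in> danielewski n. P 0 = 1} \<noteq> danielewski n"
    proof
      assume "{P \<in> danielewski n. P 0 = 1} = danielewski n"
      then have "(\<lambda>i. if i = 2 then 1 else 0) \<in> {P \<in> danielewski n. P 0 = 1}"
        using danielewski_point[OF n] by (simp only:)
      then show False by simp
    qed
    then show ?thesis by auto
  qed
  have ch: "irreducible_chain (\<lambda>i. {P \<in> danielewski i. P 0 = 1}) n"
    by (rule fibre_chain) auto
  have chain: "irreducible_chain Z (Suc n)"
    unfolding irreducible_chain_def
  proof (intro conjI allI impI)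
    fix i assume "i \<le> Suc n"
    then show "zariski_closed (Z i)" "zariski_irreducible (Z i)"
      using ch zariski_closed_danielewski function_domain_danielewski[OF n]
      by (auto simp: Z_def irreducible_chain_def zariski_irreducible_iff)
  next
    fix i assume "i < Suc n"
    then consider "i < n" | "i = n" by linarith
    then show "Z i \<subset> Z (Suc i)"
    proof cases
      case 1
      then have "{P \<in> danielewski i. P 0 = 1} \<subset> {P \<in> danielewski (Suc i). P 0 = 1}"
        using ch unfolding irreducible_chain_def by blast
      then show ?thesis using 1 by (simp add: Z_def)
    next
      case 2
      then show ?thesis using strict by (simp add: Z_def)
    qed
  qed
  have "zariski_dim (danielewski n) = Suc n"
  proof (rule zariski_dim_hypersurface[OF _ chain])
    have "(\<lambda>_. 0) \<in> aff (Suc (Suc n))" "(\<lambda>_. 0) \<notin> danielewski n"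
      by (auto simp: aff_def danielewski_def)
    moreover have "danielewski n \<subseteq> aff (Suc (Suc n))" by (auto simp: danielewski_def)
    ultimately show "danielewski n \<subset> aff (Suc (Suc n))" by blast
    fix i assume "i \<le> Suc n"
    then show "Z i \<subseteq> danielewski n"
      using danielewski_subset_mono[of i n] by (auto simp: Z_def)
  qed
  then show ?thesis by simp
qed

section \<open>Tangent spaces\<close>

definition tangent_form :: "pt \<Rightarrow> pt \<Rightarrow> complex" where
  "tangent_form P v = 2 * P 0 * P 1 * v 0 + P 0 ^ 2 * v 1 - 2 * P 2 * v 2"

lemma tangent_space_upper:
  assumes v: "v \<in> tangent_space (danielewski n) P"
  shows "v \<in> aff (n + 2)" "tangent_form P v = 0"
proof -
  have D: "dir_deriv h P v = 0" if "h \<in> polyfun" "\<forall>y\<in>danielewski n. h y = 0" for h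
    using v that unfolding tangent_space_def by simp
  have "v i = 0" if "i \<ge> n + 2" for i
    using D[OF polyfun.coord[of i]] that by (auto simp: danielewski_def aff_def)
  then show "v \<in> aff (n + 2)" by (simp add: aff_def)
  let ?f = "\<lambda>P. P 0 ^ 2 * P 1 - P 2 ^ 2 + 1 :: complex"
  have f: "?f \<in> polyfun" by (intro polyfun_intros)
  have "dir_deriv ?f P v = tangent_form P v"
    by (rule dir_deriv_unique)
       (auto intro!: derivative_eq_intros simp: tangent_form_def algebra_simps power2_eq_square)
  moreover have "dir_deriv ?f P v = 0" by (rule D[OF f]) (auto simp: danielewski_def)
  ultimately show "tangent_form P v = 0" by simp
qed

text \<open>The charts are submersions onto the solutions of the linearized equation.\<close>

lemma tangent_space_lower:
  assumes n: "n > 0" and P: "P \<in> danielewski n" and v: "v \<in> aff (n + 2)" "tangent_form P v = 0"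
  shows "v \<in> tangent_space (danielewski n) P"
proof -
  obtain \<epsilon> :: complex where e: "\<epsilon>\<^sup>2 = 1" "P \<in> chart_image n \<epsilon>"
    using P danielewski_charts[of n] by (metis UnE one_power2 power2_minus)
  have e0: "\<epsilon> \<noteq> 0" using e by auto
  define Q where "Q = chart_inverse \<epsilon> P"
  have Q: "chart \<epsilon> Q = P" "Q \<in> chart_domain n"
    unfolding Q_def using chart_inverse[OF e] by auto
  have PQ: "P 0 = Q 0" "P 1 = 2 * \<epsilon> * Q 1 + Q 0 ^ 2 * Q 1 ^ 2" "P 2 = \<epsilon> + Q 0 ^ 2 * Q 1"
    using Q(1) by (auto simp: chart_def)
  have T: "2 * Q 0 * P 1 * v 0 + Q 0 ^ 2 * v 1 = 2 * P 2 * v 2"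
    using v(2) by (simp add: tangent_form_def PQ(1))
  define w where "w = (if Q 0 = 0 then v 1 / (2 * \<epsilon>) else (v 2 - 2 * Q 0 * Q 1 * v 0) / Q 0 ^ 2)"
  have w: "v 2 = 2 * Q 0 * Q 1 * v 0 + Q 0 ^ 2 * w"
    "v 1 = 2 * \<epsilon> * w + 2 * Q 0 * Q 1 ^ 2 * v 0 + 2 * Q 0 ^ 2 * Q 1 * w"
  proof -
    show w2: "v 2 = 2 * Q 0 * Q 1 * v 0 + Q 0 ^ 2 * w"
      using T PQ(3) e0 by (cases "Q 0 = 0") (auto simp: w_def)
    show "v 1 = 2 * \<epsilon> * w + 2 * Q 0 * Q 1 ^ 2 * v 0 + 2 * Q 0 ^ 2 * Q 1 * w"
    proof (cases "Q 0 = 0")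
      case True
      then show ?thesis using e0 by (simp add: w_def)
    next
      case False
      have "Q 0 ^ 2 * v 1 = 2 * P 2 * v 2 - 2 * Q 0 * P 1 * v 0" using T by (simp add: algebra_simps)
      also have "\<dots> = Q 0 ^ 2 * (2 * \<epsilon> * w + 2 * Q 0 * Q 1 ^ 2 * v 0 + 2 * Q 0 ^ 2 * Q 1 * w)"
        unfolding w2 PQ by (simp add: algebra_simps power2_eq_square)
      finally show ?thesis using False by simp
    qed
  qed
  define q where "q = v(1 := w, 2 := 0)"
  have dchart: "dir_deriv (\<lambda>Q. chart \<epsilon> Q i) Q q = v i" for i
  proof -
    consider "i = 1" | "i = 2" | "i \<noteq> 1" "i \<noteq> 2" by blast
    then show ?thesis
    proof cases
      case 1
      have "dir_deriv (\<lambda>Q. 2 * \<epsilon> * Q 1 + Q 0 ^ 2 * Q 1 ^ 2) Q q =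
          2 * \<epsilon> * w + 2 * Q 0 * Q 1 ^ 2 * v 0 + 2 * Q 0 ^ 2 * Q 1 * w"
        by (rule dir_deriv_unique)
           (auto intro!: derivative_eq_intros simp: q_def algebra_simps power2_eq_square)
      then show ?thesis using 1 w(2) by (simp add: chart_def)
    next
      case 2
      have "dir_deriv (\<lambda>Q. \<epsilon> + Q 0 ^ 2 * Q 1) Q q = 2 * Q 0 * Q 1 * v 0 + Q 0 ^ 2 * w"
        by (rule dir_deriv_unique)
           (auto intro!: derivative_eq_intros simp: q_def algebra_simps power2_eq_square)
      then show ?thesis using 2 w(1) by (simp add: chart_def)
    next
      case 3
      then have "(\<lambda>Q. chart \<epsilon> Q i) = (\<lambda>Q. Q i)" by (simp add: chart_def)
      then show ?thesis using 3 by (simp add: q_def)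
    qed
  qed
  have qdom: "(\<lambda>i. Q i + t * q i) \<in> chart_domain n" for t
    using Q(2) v(1) by (auto simp: q_def chart_domain_def aff_def)
  show ?thesis
    unfolding tangent_space_def
  proof (intro CollectI ballI impI)
    fix h assume h: "h \<in> polyfun" "\<forall>y\<in>danielewski n. h y = 0"
    have "dir_deriv (\<lambda>Q. h (chart \<epsilon> Q)) Q q = dir_deriv h (chart \<epsilon> Q) (\<lambda>i. dir_deriv (\<lambda>Q. chart \<epsilon> Q i) Q q)"
      by (rule dir_deriv_compose[OF h(1) polyfun_chart])
    then have "dir_deriv h P v = dir_deriv (\<lambda>Q. h (chart \<epsilon> Q)) Q q"
      unfolding dchart Q(1) by simp
    also have "\<dots> = 0"
    proof (rule dir_deriv_unique)
      have "h (chart \<epsilon> (\<lambda>i. Q i + t * q i)) = 0" for t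
        using h(2) chart_in_danielewski[OF e(1) qdom n, of t] by (simp add: chart_image_def)
      then show "((\<lambda>t. h (chart \<epsilon> (\<lambda>i. Q i + t * q i))) has_field_derivative 0) (at 0)" by simp
    qed
    finally show "dir_deriv h P v = 0" .
  qed
qed

lemma tangent_space_danielewski:
  "n > 0 \<Longrightarrow> P \<in> danielewski n \<Longrightarrow>
   tangent_space (danielewski n) P = {v \<in> aff (n + 2). tangent_form P v = 0}"
  using tangent_space_upper tangent_space_lower by blast

lemma sum_pt: "(\<Sum>j\<in>J. f j) i = (\<Sum>j\<in>J. (f j :: pt) i)"
  by (induction J rule: infinite_finite_induct) auto

lemma dim_hyperplane:
  assumes i0: "i0 < m" "a i0 \<noteq> 0"
  shows "pt.dim {v \<in> aff m. (\<Sum>i<m. a i * v i) = 0} = m - 1"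
proof -
  let ?V = "{v \<in> aff m. (\<Sum>i<m. a i * v i) = 0}" and ?J = "{..<m} - {i0}"
  \<comment> \<open>The unit vector \<open>j\<close> is corrected in its coordinate \<open>i0\<close> to lie in the hyperplane.\<close>
  define b :: "nat \<Rightarrow> pt" where
    "b = (\<lambda>j i. if i = j then 1 else if i = i0 then - a j / a i0 else 0)"
  have inj: "inj_on b ?J"
  proof
    fix j k assume jk: "j \<in> ?J" "k \<in> ?J" "b j = b k"
    then have "b k j = 1" by (metis b_def)
    then show "j = k" using jk by (auto simp: b_def split: if_splits)
  qed
  have fin: "finite (b ` ?J)" by simp
  have comb: "(\<Sum>j\<in>?J. scl (c j) (b j)) i = (if i \<in> ?J then c i else if i = i0 then - (\<Sum>j\<in>?J. c j * a j) / a i0 else 0)"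
    for c i
  proof -
    have 1: "(\<Sum>j\<in>?J. scl (c j) (b j)) i = (\<Sum>j\<in>?J. c j * b j i)" by (simp add: sum_pt scl_def)
    consider "i \<in> ?J" | "i = i0" | "i \<notin> ?J" "i \<noteq> i0" by blast
    then show ?thesis
    proof cases
      case 1
      then have "(\<Sum>j\<in>?J. c j * b j i) = (\<Sum>j\<in>?J. if j = i then c j else 0)"
        by (intro sum.cong) (auto simp: b_def)
      then show ?thesis using 1 \<open>_ = (\<Sum>j\<in>?J. c j * b j i)\<close> by (simp add: sum.delta)
    next
      case 2
      then have "(\<Sum>j\<in>?J. c j * b j i) = (\<Sum>j\<in>?J. - (c j * a j) / a i0)"
        by (intro sum.cong) (auto simp: b_def)
      also have "\<dots> = - (\<Sum>j\<in>?J. c j * a j) / a i0"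
        by (simp add: sum_divide_distrib sum_negf)
      finally show ?thesis using 2 1 by simp
    next
      case 3
      then have "(\<Sum>j\<in>?J. c j * b j i) = 0"
        by (intro sum.neutral) (auto simp: b_def)
      then show ?thesis using 3 1 by simp
    qed
  qed
  show ?thesis
  proof (rule pt.dim_unique[of "b ` ?J"])
    show "b ` ?J \<subseteq> ?V"
    proof
      fix v assume "v \<in> b ` ?J"
      then obtain j where j: "j \<in> ?J" "v = b j" by auto
      have "(\<Sum>i<m. a i * b j i) = (\<Sum>i\<in>{j, i0}. a i * b j i)"
        by (rule sum.mono_neutral_right) (use j i0 in \<open>auto simp: b_def\<close>)
      also have "\<dots> = 0" using j i0 by (simp add: b_def)
      finally show "v \<in> ?V" using j i0 by (auto simp: aff_def b_def)
    qed
    show "?V \<subseteq> pt.span (b ` ?J)"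
    proof
      fix v assume v: "v \<in> ?V"
      have "(\<Sum>j\<in>?J. scl (v j) (b j)) i = v i" for i
      proof -
        have "(\<Sum>i<m. a i * v i) = a i0 * v i0 + (\<Sum>j\<in>?J. a j * v j)"
          using i0 by (subst sum.remove[of _ i0]) auto
        then have "a i0 * v i0 = - (\<Sum>j\<in>?J. a j * v j)"
          using v by (simp add: eq_neg_iff_add_eq_0)
        then have "- (\<Sum>j\<in>?J. v j * a j) / a i0 = v i0" using i0 by (simp add: field_simps)
        moreover have "v i = 0" if "i \<notin> ?J" "i \<noteq> i0" using that v by (auto simp: aff_def)
        ultimately show ?thesis unfolding comb by auto
      qed
      then have "v = (\<Sum>j\<in>?J. scl (v j) (b j))" by (simp add: fun_eq_iff)
      also have "\<dots> \<in> pt.span (b ` ?J)"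
        by (intro pt.span_sum pt.span_scale pt.span_base) auto
      finally show "v \<in> pt.span (b ` ?J)" .
    qed
    have coeff: "u v = 0" if u: "(\<Sum>v\<in>b ` ?J. scl (u v) v) = 0" and v: "v \<in> b ` ?J" for u v
    proof -
      obtain j where j: "j \<in> ?J" "v = b j" using v by auto
      have "(\<Sum>j\<in>?J. scl (u (b j)) (b j)) = 0" using u by (simp add: sum.reindex[OF inj])
      then have "(\<Sum>j\<in>?J. scl (u (b j)) (b j)) j = 0" by simp
      then show ?thesis unfolding comb using j by simp
    qed
    show "pt.independent (b ` ?J)"
      unfolding pt.dependent_finite[OF fin] using coeff by auto
    show "card (b ` ?J) = m - 1" using i0 by (simp add: card_image[OF inj])
  qed
qed

lemma smooth_danielewski:
  assumes n: "n > 0"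
  shows "smooth_variety (danielewski n)"
  unfolding smooth_variety_def
proof
  fix P assume P: "P \<in> danielewski n"
  define a where "a = (\<lambda>i::nat. if i = 0 then 2 * P 0 * P 1 else if i = 1 then P 0 ^ 2
      else if i = 2 then - 2 * P 2 else 0)"
  have sum: "(\<Sum>i<n + 2. a i * v i) = tangent_form P v" for v
  proof -
    have "(\<Sum>i<n + 2. a i * v i) = (\<Sum>i\<in>{0, 1, 2}. a i * v i)"
      by (rule sum.mono_neutral_right) (use n in \<open>auto simp: a_def\<close>)
    also have "\<dots> = tangent_form P v" by (simp add: a_def tangent_form_def)
    finally show ?thesis .
  qed
  have "\<exists>i0<n + 2. a i0 \<noteq> 0"
  proof (cases "P 0 = 0")
    case True
    then have "P 2 \<noteq> 0" using P by (auto simp: danielewski_def)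
    then show ?thesis using n by (intro exI[of _ 2]) (auto simp: a_def)
  next
    case False
    then show ?thesis by (intro exI[of _ 1]) (auto simp: a_def)
  qed
  then obtain i0 where "i0 < n + 2" "a i0 \<noteq> 0" by auto
  from dim_hyperplane[of i0 "n + 2" a, OF this]
  show "pt.dim (tangent_space (danielewski n) P) = zariski_dim (danielewski n)"
    unfolding sum tangent_space_danielewski[OF n P] zariski_dim_danielewski[OF n] by simp
qed

section \<open>Coordinate rings\<close>

lemma coord_ring_simps [simp]:
  "carrier (coord_ring X) = (\<lambda>h. restrict h X) ` polyfun"
  "\<one>\<^bsub>coord_ring X\<^esub> = restrict (\<lambda>_. 1) X"
  "\<zero>\<^bsub>coord_ring X\<^esub> = restrict (\<lambda>_. 0) X"
  "restrict a X \<otimes>\<^bsub>coord_ring X\<^esub> restrict b X = restrict (\<lambda>x. a x * b x) X"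
  "restrict a X \<oplus>\<^bsub>coord_ring X\<^esub> restrict b X = restrict (\<lambda>x. a x + b x) X"
  by (auto simp: coord_ring_def restrict_def fun_eq_iff)

lemma restrict_eq: "(\<And>x. x \<in> X \<Longrightarrow> a x = b x) \<Longrightarrow> restrict a X = restrict b X"
  by (auto simp: restrict_def fun_eq_iff)

lemma restrict_eqD: "restrict a X = restrict b X \<Longrightarrow> x \<in> X \<Longrightarrow> a x = b x"
  by (metis restrict_apply')

lemma coord_ring_elem: "h \<in> polyfun \<Longrightarrow> restrict h X \<in> carrier (coord_ring X)"
  by simp

lemma cring_coord_ring: "cring (coord_ring X)"
proof (rule cringI)
  show "abelian_group (coord_ring X)"
  proof (rule abelian_groupI)
    fix a b c assume "a \<in> carrier (coord_ring X)" "b \<in> carrier (coord_ring X)" "c \<in> carrier (coord_ring X)"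
    then obtain f g h where fgh: "f \<in> polyfun" "g \<in> polyfun" "h \<in> polyfun"
      and abc: "a = restrict f X" "b = restrict g X" "c = restrict h X" by auto
    show "a \<oplus>\<^bsub>coord_ring X\<^esub> b \<in> carrier (coord_ring X)"
      unfolding abc coord_ring_simps(5) by (rule coord_ring_elem) (rule polyfun.add[OF fgh(1,2)])
    show "a \<oplus>\<^bsub>coord_ring X\<^esub> b = b \<oplus>\<^bsub>coord_ring X\<^esub> a"
      unfolding abc by (simp add: add.commute)
    show "a \<oplus>\<^bsub>coord_ring X\<^esub> b \<oplus>\<^bsub>coord_ring X\<^esub> c = a \<oplus>\<^bsub>coord_ring X\<^esub> (b \<oplus>\<^bsub>coord_ring X\<^esub> c)"
      unfolding abc by (simp add: add.assoc)
    show "\<zero>\<^bsub>coord_ring X\<^esub> \<oplus>\<^bsub>coord_ring X\<^esub> a = a"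
      unfolding abc coord_ring_simps by simp
    show "\<exists>y\<in>carrier (coord_ring X). y \<oplus>\<^bsub>coord_ring X\<^esub> a = \<zero>\<^bsub>coord_ring X\<^esub>"
    proof (rule bexI[of _ "restrict (\<lambda>x. - f x) X"])
      show "restrict (\<lambda>x. - f x) X \<oplus>\<^bsub>coord_ring X\<^esub> a = \<zero>\<^bsub>coord_ring X\<^esub>"
        unfolding abc coord_ring_simps by simp
      show "restrict (\<lambda>x. - f x) X \<in> carrier (coord_ring X)"
        by (rule coord_ring_elem) (rule polyfun_uminus[OF fgh(1)])
    qed
  qed (rule coord_ring_elem[OF polyfun.const, of 0, folded coord_ring_simps(3)])
  show "Group.comm_monoid (coord_ring X)"
  proof (rule comm_monoidI)
    fix a b c assume "a \<in> carrier (coord_ring X)" "b \<in> carrier (coord_ring X)" "c \<in> carrier (coord_ring X)"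
    then obtain f g h where fgh: "f \<in> polyfun" "g \<in> polyfun" "h \<in> polyfun"
      and abc: "a = restrict f X" "b = restrict g X" "c = restrict h X" by auto
    show "a \<otimes>\<^bsub>coord_ring X\<^esub> b \<in> carrier (coord_ring X)"
      unfolding abc coord_ring_simps(4) by (rule coord_ring_elem) (rule polyfun.mult[OF fgh(1,2)])
    show "a \<otimes>\<^bsub>coord_ring X\<^esub> b = b \<otimes>\<^bsub>coord_ring X\<^esub> a"
      unfolding abc by (simp add: mult.commute)
    show "a \<otimes>\<^bsub>coord_ring X\<^esub> b \<otimes>\<^bsub>coord_ring X\<^esub> c = a \<otimes>\<^bsub>coord_ring X\<^esub> (b \<otimes>\<^bsub>coord_ring X\<^esub> c)"
      unfolding abc by (simp add: mult.assoc)
    show "\<one>\<^bsub>coord_ring X\<^esub> \<otimes>\<^bsub>coord_ring X\<^esub> a = a"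
      unfolding abc coord_ring_simps by simp
  qed (rule coord_ring_elem[OF polyfun.const, of 1, folded coord_ring_simps(2)])
  fix a b c assume "a \<in> carrier (coord_ring X)" "b \<in> carrier (coord_ring X)" "c \<in> carrier (coord_ring X)"
  then obtain f g h where abc: "a = restrict f X" "b = restrict g X" "c = restrict h X" by auto
  show "(a \<oplus>\<^bsub>coord_ring X\<^esub> b) \<otimes>\<^bsub>coord_ring X\<^esub> c =
      a \<otimes>\<^bsub>coord_ring X\<^esub> c \<oplus>\<^bsub>coord_ring X\<^esub> b \<otimes>\<^bsub>coord_ring X\<^esub> c"
    unfolding abc by (simp add: algebra_simps)
qed

lemma pullback_restrict:
  "(\<And>x. x \<in> X \<Longrightarrow> f x \<in> Y) \<Longrightarrow> pullback X f (restrict h Y) = restrict (\<lambda>x. h (f x)) X"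
  unfolding pullback_def by (rule restrict_eq) simp

lemma coord_module_simps [simp]:
  "carrier (coord_module X f) = (\<lambda>h. restrict h X) ` polyfun"
  "\<zero>\<^bsub>coord_module X f\<^esub> = restrict (\<lambda>_. 0) X"
  "restrict a X \<oplus>\<^bsub>coord_module X f\<^esub> restrict b X = restrict (\<lambda>x. a x + b x) X"
  "r \<odot>\<^bsub>coord_module X f\<^esub> m = pullback X f r \<otimes>\<^bsub>coord_ring X\<^esub> m"
  by (auto simp: coord_module_def ring.defs coord_ring_def restrict_def fun_eq_iff)

lemma morphismI:
  assumes "\<And>i. (\<lambda>x. f x i) \<in> polyfun" "\<And>x. x \<in> X \<Longrightarrow> f x \<in> Y"
  shows "morphism X Y f"
  unfolding morphism_def
proof (intro conjI ballI allI)
  fix i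
  show "\<exists>h\<in>polyfun. \<forall>x\<in>X. f x i = h x" by (rule bexI[of _ "\<lambda>x. f x i"]) (use assms in auto)
qed (use assms in auto)

lemma coord_module_smult:
  assumes "\<And>x. x \<in> X \<Longrightarrow> f x \<in> Y"
  shows "restrict r Y \<odot>\<^bsub>coord_module X f\<^esub> restrict a X = restrict (\<lambda>x. r (f x) * a x) X"
proof -
  have pb: "pullback X f (restrict r Y) = restrict (\<lambda>x. r (f x)) X"
    by (rule pullback_restrict) (rule assms)
  show ?thesis by (simp only: coord_module_simps(4) pb coord_ring_simps(4))
qed

lemma abelian_group_coord_module: "abelian_group (coord_module X f)"
proof (rule abelian_groupI)
  fix a b c assume "a \<in> carrier (coord_module X f)" "b \<in> carrier (coord_module X f)" "c \<in> carrier (coord_module X f)"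
  then obtain u g h where fgh: "u \<in> polyfun" "g \<in> polyfun" "h \<in> polyfun"
    and abc: "a = restrict u X" "b = restrict g X" "c = restrict h X" by auto
  show "a \<oplus>\<^bsub>coord_module X f\<^esub> b \<in> carrier (coord_module X f)"
    unfolding abc coord_module_simps by (rule imageI) (rule polyfun.add[OF fgh(1,2)])
  show "a \<oplus>\<^bsub>coord_module X f\<^esub> b = b \<oplus>\<^bsub>coord_module X f\<^esub> a"
    unfolding abc by (simp add: add.commute)
  show "a \<oplus>\<^bsub>coord_module X f\<^esub> b \<oplus>\<^bsub>coord_module X f\<^esub> c = a \<oplus>\<^bsub>coord_module X f\<^esub> (b \<oplus>\<^bsub>coord_module X f\<^esub> c)"
    unfolding abc by (simp add: add.assoc)
  show "\<zero>\<^bsub>coord_module X f\<^esub> \<oplus>\<^bsub>coord_module X f\<^esub> a = a"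
    unfolding abc coord_module_simps by simp
  show "\<exists>y\<in>carrier (coord_module X f). y \<oplus>\<^bsub>coord_module X f\<^esub> a = \<zero>\<^bsub>coord_module X f\<^esub>"
  proof (rule bexI[of _ "restrict (\<lambda>x. - u x) X"])
    show "restrict (\<lambda>x. - u x) X \<oplus>\<^bsub>coord_module X f\<^esub> a = \<zero>\<^bsub>coord_module X f\<^esub>"
      unfolding abc coord_module_simps by simp
    show "restrict (\<lambda>x. - u x) X \<in> carrier (coord_module X f)"
      unfolding coord_module_simps by (rule imageI) (rule polyfun_uminus[OF fgh(1)])
  qed
next
  show "\<zero>\<^bsub>coord_module X f\<^esub> \<in> carrier (coord_module X f)"
    unfolding coord_module_simps by (rule imageI) (rule polyfun.const)
qed

lemma module_coord_module:
  assumes f: "\<And>i. (\<lambda>x. f x i) \<in> polyfun" and fY: "\<And>x. x \<in> X \<Longrightarrow> f x \<in> Y"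
  shows "module (coord_ring Y) (coord_module X f)"
proof (rule moduleI[OF cring_coord_ring abelian_group_coord_module])
  have sm: "restrict r Y \<odot>\<^bsub>coord_module X f\<^esub> restrict a X = restrict (\<lambda>x. r (f x) * a x) X" for r a
    by (rule coord_module_smult) (rule fY)
  {
    fix r m assume "r \<in> carrier (coord_ring Y)" "m \<in> carrier (coord_module X f)"
    then obtain h a where h: "h \<in> polyfun" and a: "a \<in> polyfun"
      and rm: "r = restrict h Y" "m = restrict a X" by auto
    have "(\<lambda>x. h (f x) * a x) \<in> polyfun" by (rule polyfun.mult[OF polyfun_compose[OF h f] a])
    then show "r \<odot>\<^bsub>coord_module X f\<^esub> m \<in> carrier (coord_module X f)"
      unfolding rm sm by simp
  }
  {
    fix r s m assume "r \<in> carrier (coord_ring Y)" "s \<in> carrier (coord_ring Y)" "m \<in> carrier (coord_module X f)"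
    then obtain g h a where rm: "r = restrict g Y" "s = restrict h Y" "m = restrict a X" by auto
    show "(r \<oplus>\<^bsub>coord_ring Y\<^esub> s) \<odot>\<^bsub>coord_module X f\<^esub> m =
        r \<odot>\<^bsub>coord_module X f\<^esub> m \<oplus>\<^bsub>coord_module X f\<^esub> s \<odot>\<^bsub>coord_module X f\<^esub> m"
      unfolding rm sm coord_ring_simps(5) coord_module_simps(3) by (simp add: algebra_simps)
    show "(r \<otimes>\<^bsub>coord_ring Y\<^esub> s) \<odot>\<^bsub>coord_module X f\<^esub> m =
        r \<odot>\<^bsub>coord_module X f\<^esub> (s \<odot>\<^bsub>coord_module X f\<^esub> m)"
      unfolding rm sm coord_ring_simps(4) by (simp add: mult.assoc)
  }
  {
    fix r m m' assume "r \<in> carrier (coord_ring Y)" "m \<in> carrier (coord_module X f)" "m' \<in> carrier (coord_module X f)"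
    then obtain g h a where rm: "r = restrict g Y" "m = restrict h X" "m' = restrict a X" by auto
    show "r \<odot>\<^bsub>coord_module X f\<^esub> (m \<oplus>\<^bsub>coord_module X f\<^esub> m') =
        r \<odot>\<^bsub>coord_module X f\<^esub> m \<oplus>\<^bsub>coord_module X f\<^esub> r \<odot>\<^bsub>coord_module X f\<^esub> m'"
      unfolding rm sm coord_module_simps(3) by (simp add: algebra_simps)
  }
  {
    fix m assume "m \<in> carrier (coord_module X f)"
    then obtain a where m: "m = restrict a X" by auto
    show "\<one>\<^bsub>coord_ring Y\<^esub> \<odot>\<^bsub>coord_module X f\<^esub> m = m"
      unfolding m coord_ring_simps(2) sm by simp
  }
qed

lemma finsum_coord_module:
  assumes "finite F" "\<And>b. b \<in> F \<Longrightarrow> a b \<in> polyfun"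
  shows "finsum (coord_module X f) (\<lambda>b. restrict (a b) X) F = restrict (\<lambda>x. \<Sum>b\<in>F. a b x) X"
  using assms
proof (induction F)
  interpret M: abelian_group "coord_module X f" by (rule abelian_group_coord_module)
  case empty
  show ?case unfolding M.finsum_empty by simp
next
  interpret M: abelian_group "coord_module X f" by (rule abelian_group_coord_module)
  case (insert b F)
  have cl: "(\<lambda>b. restrict (a b) X) \<in> F \<rightarrow> carrier (coord_module X f)"
    "restrict (a b) X \<in> carrier (coord_module X f)"
    using insert.prems by auto
  have IH: "finsum (coord_module X f) (\<lambda>b. restrict (a b) X) F = restrict (\<lambda>x. \<Sum>b\<in>F. a b x) X"
    by (rule insert.IH) (use insert.prems in auto)
  have "finsum (coord_module X f) (\<lambda>b. restrict (a b) X) (insert b F) =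
      restrict (a b) X \<oplus>\<^bsub>coord_module X f\<^esub> restrict (\<lambda>x. \<Sum>b\<in>F. a b x) X"
    unfolding M.finsum_insert[OF insert.hyps cl] IH ..
  also have "\<dots> = restrict (\<lambda>x. \<Sum>b\<in>insert b F. a b x) X"
    unfolding coord_module_simps(3) by (rule restrict_eq) (use insert.hyps in simp)
  finally show ?case .
qed

definition mult_by :: "pt set \<Rightarrow> (pt \<Rightarrow> complex) \<Rightarrow> (pt \<Rightarrow> complex) \<Rightarrow> pt \<Rightarrow> complex" where
  "mult_by X s m = restrict (\<lambda>x. s x * m x) X"

lemma mult_by_restrict: "mult_by X s (restrict m X) = restrict (\<lambda>x. s x * m x) X"
  unfolding mult_by_def by (rule restrict_eq) simp

lemma mult_by_funpow: "(mult_by X s ^^ k) (restrict m X) = restrict (\<lambda>x. s x ^ k * m x) X"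
proof (induction k)
  case (Suc k)
  show ?case
    unfolding funpow.simps comp_def Suc mult_by_restrict by (rule restrict_eq) simp
qed simp

lemma module_endo_mult_by:
  assumes s: "s \<in> polyfun" and fY: "\<And>x. x \<in> X \<Longrightarrow> f x \<in> Y"
  shows "module_endo (coord_ring Y) (coord_module X f) (mult_by X s)"
  unfolding module_endo_def
proof (intro conjI ballI)
  have sm: "restrict r Y \<odot>\<^bsub>coord_module X f\<^esub> restrict a X = restrict (\<lambda>x. r (f x) * a x) X" for r a
    by (rule coord_module_smult) (rule fY)
  fix m assume "m \<in> carrier (coord_module X f)"
  then obtain a where a: "a \<in> polyfun" "m = restrict a X" by auto
  show "mult_by X s m \<in> carrier (coord_module X f)"
    unfolding a mult_by_restrict coord_module_simps by (rule imageI) (rule polyfun.mult[OF s a(1)])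
  {
    fix m' assume "m' \<in> carrier (coord_module X f)"
    then obtain b where b: "m' = restrict b X" by auto
    show "mult_by X s (m \<oplus>\<^bsub>coord_module X f\<^esub> m') = mult_by X s m \<oplus>\<^bsub>coord_module X f\<^esub> mult_by X s m'"
      unfolding a b mult_by_restrict coord_module_simps(3) by (simp add: algebra_simps)
  }
next
  have sm: "restrict r Y \<odot>\<^bsub>coord_module X f\<^esub> restrict a X = restrict (\<lambda>x. r (f x) * a x) X" for r a
    by (rule coord_module_smult) (rule fY)
  fix r m assume "r \<in> carrier (coord_ring Y)" "m \<in> carrier (coord_module X f)"
  then obtain g a where a: "r = restrict g Y" "m = restrict a X" by auto
  show "mult_by X s (r \<odot>\<^bsub>coord_module X f\<^esub> m) = r \<odot>\<^bsub>coord_module X f\<^esub> mult_by X s m"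
    unfolding a sm mult_by_restrict by (simp add: algebra_simps)
qed

section \<open>Monomial basis of the coordinate ring\<close>

text \<open>
  Comparison of the coefficients of \<open>t\<^sup>k\<close>, where \<open>t\<close> is the value of one of the variables, removes this
  variable.
\<close>

lemma monomials_independent:
  assumes "finite I" "finite G" "\<And>\<alpha> i. \<alpha> \<in> G \<Longrightarrow> i \<notin> I \<Longrightarrow> \<alpha> i = (0::nat)"
    and "\<And>Q :: pt. (\<Sum>\<alpha>\<in>G. d \<alpha> * (\<Prod>i\<in>I. Q i ^ \<alpha> i)) = 0" and "\<alpha> \<in> G"
  shows "d \<alpha> = (0::complex)"
  using assms
proof (induction I arbitrary: G d \<alpha>)
  case empty
  have "\<beta> = (\<lambda>_. 0)" if "\<beta> \<in> G" for \<beta> using empty.prems(2)[OF that] by auto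
  then have "G = {\<lambda>_. 0}" using empty.prems(4) by blast
  then show ?case using empty.prems(3,4) by simp
next
  case (insert j I)
  define k where "k = \<alpha> j"
  define H where "H = (\<lambda>\<alpha>. \<alpha>(j := 0)) ` {\<alpha> \<in> G. \<alpha> j = k}"
  have inj: "inj_on (\<lambda>\<alpha>. \<alpha>(j := 0)) {\<alpha> \<in> G. \<alpha> j = k}"
  proof
    fix \<beta> \<gamma> assume "\<beta> \<in> {\<alpha> \<in> G. \<alpha> j = k}" "\<gamma> \<in> {\<alpha> \<in> G. \<alpha> j = k}" and e: "\<beta>(j := 0) = \<gamma>(j := 0)"
    then have "\<beta> j = \<gamma> j" by simp
    moreover have "\<beta> i = \<gamma> i" if "i \<noteq> j" for i using fun_cong[OF e, of i] that by simp
    ultimately show "\<beta> = \<gamma>" by (metis ext)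
  qed
  have "d ((\<alpha>(j := 0))(j := k)) = 0"
  proof (rule insert.IH[of H "\<lambda>\<beta>. d (\<beta>(j := k))"])
    show "finite H" using insert.prems(1) by (simp add: H_def)
    show "\<alpha>(j := 0) \<in> H" using insert.prems(4) by (auto simp: H_def k_def)
    fix \<beta> i assume "\<beta> \<in> H" "i \<notin> I"
    then show "\<beta> i = 0" using insert.prems(2) by (auto simp: H_def)
  next
    fix Q :: pt
    define p where "p = (\<Sum>\<alpha>\<in>G. monom (d \<alpha> * (\<Prod>i\<in>I. Q i ^ \<alpha> i)) (\<alpha> j))"
    have "poly p t = 0" for t
    proof -
      have "(\<Prod>i\<in>insert j I. (Q(j := t)) i ^ \<alpha> i) = t ^ \<alpha> j * (\<Prod>i\<in>I. Q i ^ \<alpha> i)" for \<alpha> :: "nat \<Rightarrow> nat"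
      proof -
        have "(\<Prod>i\<in>I. (Q(j := t)) i ^ \<alpha> i) = (\<Prod>i\<in>I. Q i ^ \<alpha> i)"
          by (rule prod.cong) (use insert.hyps in auto)
        then show ?thesis using insert.hyps by simp
      qed
      then have "poly p t = (\<Sum>\<alpha>\<in>G. d \<alpha> * (\<Prod>i\<in>insert j I. (Q(j := t)) i ^ \<alpha> i))"
        by (simp add: p_def poly_sum poly_monom mult.commute mult.left_commute)
      then show ?thesis using insert.prems(3)[of "Q(j := t)"] by simp
    qed
    then have "p = 0" using poly_all_0_iff_0 by blast
    then have "0 = coeff p k" by simp
    also have "\<dots> = (\<Sum>\<alpha>\<in>G. if \<alpha> j = k then d \<alpha> * (\<Prod>i\<in>I. Q i ^ \<alpha> i) else 0)"
      by (simp add: p_def coeff_sum)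
    also have "\<dots> = (\<Sum>\<alpha>\<in>{\<alpha> \<in> G. \<alpha> j = k}. d \<alpha> * (\<Prod>i\<in>I. Q i ^ \<alpha> i))"
      using insert.prems(1) by (simp add: sum.inter_filter)
    also have "\<dots> = (\<Sum>\<beta>\<in>H. d (\<beta>(j := k)) * (\<Prod>i\<in>I. Q i ^ \<beta> i))"
      unfolding H_def sum.reindex[OF inj] comp_def
    proof (rule sum.cong[OF refl])
      fix \<beta> assume b: "\<beta> \<in> {\<alpha> \<in> G. \<alpha> j = k}"
      have "(\<Prod>i\<in>I. Q i ^ (\<beta>(j := 0)) i) = (\<Prod>i\<in>I. Q i ^ \<beta> i)"
        by (rule prod.cong) (use insert.hyps in auto)
      moreover have "(\<beta>(j := 0))(j := k) = \<beta>" using b by auto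
      ultimately show "d \<beta> * (\<Prod>i\<in>I. Q i ^ \<beta> i) = d ((\<beta>(j := 0))(j := k)) * (\<Prod>i\<in>I. Q i ^ (\<beta>(j := 0)) i)"
        by simp
    qed
    finally show "(\<Sum>\<beta>\<in>H. d (\<beta>(j := k)) * (\<Prod>i\<in>I. Q i ^ \<beta> i)) = 0" by simp
  qed
  then show ?case by (simp add: k_def)
qed

text \<open>
  Exponents of \<open>z\<close>, \<open>y\<close> and the free coordinates. The exponent of \<open>x\<close> is zero, since powers of \<open>x\<close> go into
  the coefficients, and that of \<open>y\<close> is at most one, because \<open>y\<^sup>2 = 1 + x\<^sup>2 z\<close>.
\<close>

definition basis_exponents :: "nat \<Rightarrow> (nat \<Rightarrow> nat) set" where
  "basis_exponents n = {\<alpha>. \<alpha> 2 \<le> 1 \<and> (\<forall>i. i \<notin> {1..<n + 2} \<longrightarrow> \<alpha> i = 0)}"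

definition basis_monomial :: "nat \<Rightarrow> (nat \<Rightarrow> nat) \<Rightarrow> pt \<Rightarrow> complex" where
  "basis_monomial n \<alpha> P = (\<Prod>i\<in>{1..<n + 2}. P i ^ \<alpha> i)"

lemma basis_monomial_polyfun: "basis_monomial n \<alpha> \<in> polyfun"
proof -
  have "(\<lambda>P. basis_monomial n \<alpha> P) \<in> polyfun"
    unfolding basis_monomial_def by (intro polyfun_prod polyfun_power polyfun.coord)
  then show ?thesis by simp
qed

lemma basis_monomial_shift:
  assumes "i \<in> {1..<n + 2}"
  shows "basis_monomial n (\<alpha>(i := \<alpha> i + k)) P = P i ^ k * basis_monomial n \<alpha> P"
proof -
  have "(\<Prod>j\<in>{1..<n + 2} - {i}. P j ^ (\<alpha>(i := \<alpha> i + k)) j) = (\<Prod>j\<in>{1..<n + 2} - {i}. P j ^ \<alpha> j)"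
    by (rule prod.cong) auto
  then show ?thesis
    unfolding basis_monomial_def prod.remove[OF finite_atLeastLessThan assms]
    by (simp only: fun_upd_same power_add mult_ac)
qed

definition expansion :: "nat \<Rightarrow> ((nat \<Rightarrow> nat) \<Rightarrow> complex poly) \<Rightarrow> (pt \<Rightarrow> complex) \<Rightarrow> bool" where
  "expansion n c h \<longleftrightarrow> finite {\<alpha>. c \<alpha> \<noteq> 0} \<and> {\<alpha>. c \<alpha> \<noteq> 0} \<subseteq> basis_exponents n \<and>
     (\<forall>P\<in>danielewski n. h P = (\<Sum>\<alpha> | c \<alpha> \<noteq> 0. poly (c \<alpha>) (P 0) * basis_monomial n \<alpha> P))"

lemma expansion_superset:
  assumes "expansion n c h" "finite F" "{\<alpha>. c \<alpha> \<noteq> 0} \<subseteq> F" "P \<in> danielewski n"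
  shows "h P = (\<Sum>\<alpha>\<in>F. poly (c \<alpha>) (P 0) * basis_monomial n \<alpha> P)"
proof -
  have "h P = (\<Sum>\<alpha> | c \<alpha> \<noteq> 0. poly (c \<alpha>) (P 0) * basis_monomial n \<alpha> P)"
    using assms unfolding expansion_def by blast
  also have "\<dots> = (\<Sum>\<alpha>\<in>F. poly (c \<alpha>) (P 0) * basis_monomial n \<alpha> P)"
    by (rule sum.mono_neutral_left) (use assms in auto)
  finally show ?thesis .
qed

lemma expansionI:
  assumes "finite F" "F \<subseteq> basis_exponents n" "\<And>\<alpha>. \<alpha> \<notin> F \<Longrightarrow> c \<alpha> = 0"
    "\<And>P. P \<in> danielewski n \<Longrightarrow> h P = (\<Sum>\<alpha>\<in>F. poly (c \<alpha>) (P 0) * basis_monomial n \<alpha> P)"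
  shows "expansion n c h"
  unfolding expansion_def
proof (intro conjI ballI)
  have sub: "{\<alpha>. c \<alpha> \<noteq> 0} \<subseteq> F" using assms(3) by auto
  show "finite {\<alpha>. c \<alpha> \<noteq> 0}" by (rule finite_subset[OF sub assms(1)])
  show "{\<alpha>. c \<alpha> \<noteq> 0} \<subseteq> basis_exponents n" using sub assms(2) by simp
  fix P assume "P \<in> danielewski n"
  then have "h P = (\<Sum>\<alpha>\<in>F. poly (c \<alpha>) (P 0) * basis_monomial n \<alpha> P)" by (rule assms(4))
  also have "\<dots> = (\<Sum>\<alpha> | c \<alpha> \<noteq> 0. poly (c \<alpha>) (P 0) * basis_monomial n \<alpha> P)"
    by (rule sum.mono_neutral_right) (use assms(1) sub in auto)
  finally show "h P = (\<Sum>\<alpha> | c \<alpha> \<noteq> 0. poly (c \<alpha>) (P 0) * basis_monomial n \<alpha> P)" .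
qed

lemma expansion_cong:
  assumes "expansion n c h" "\<And>P. P \<in> danielewski n \<Longrightarrow> g P = h P"
  shows "expansion n c g"
  using assms unfolding expansion_def by simp

lemma expansion_zero: "expansion n (\<lambda>_. 0) (\<lambda>_. 0)"
  by (rule expansionI[of "{}"]) auto

lemma expansion_add:
  assumes "expansion n c h" "expansion n d g"
  shows "expansion n (\<lambda>\<alpha>. c \<alpha> + d \<alpha>) (\<lambda>P. h P + g P)"
proof (rule expansionI)
  let ?F = "{\<alpha>. c \<alpha> \<noteq> 0} \<union> {\<alpha>. d \<alpha> \<noteq> 0}"
  show F: "finite ?F" "?F \<subseteq> basis_exponents n" using assms unfolding expansion_def by auto
  fix P assume P: "P \<in> danielewski n"
  show "h P + g P = (\<Sum>\<alpha>\<in>?F. poly (c \<alpha> + d \<alpha>) (P 0) * basis_monomial n \<alpha> P)"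
    using expansion_superset[OF assms(1) F(1) _ P] expansion_superset[OF assms(2) F(1) _ P]
    by (simp add: sum.distrib algebra_simps)
qed auto

lemma expansion_smult:
  assumes "expansion n c h"
  shows "expansion n (\<lambda>\<alpha>. p * c \<alpha>) (\<lambda>P. poly p (P 0) * h P)"
proof (rule expansionI)
  let ?F = "{\<alpha>. c \<alpha> \<noteq> 0}"
  show F: "finite ?F" "?F \<subseteq> basis_exponents n" using assms unfolding expansion_def by auto
  fix P assume P: "P \<in> danielewski n"
  show "poly p (P 0) * h P = (\<Sum>\<alpha>\<in>?F. poly (p * c \<alpha>) (P 0) * basis_monomial n \<alpha> P)"
    using expansion_superset[OF assms F(1) _ P]
    by (simp add: sum_distrib_left mult.assoc)
qed auto

lemma expansion_basis:
  assumes "\<alpha> \<in> basis_exponents n"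
  shows "expansion n (\<lambda>\<beta>. if \<beta> = \<alpha> then p else 0) (\<lambda>P. poly p (P 0) * basis_monomial n \<alpha> P)"
  by (rule expansionI[of "{\<alpha>}"]) (use assms in auto)

lemma expansion_sum:
  assumes "finite F" "\<And>\<alpha>. \<alpha> \<in> F \<Longrightarrow> \<exists>c. expansion n c (h \<alpha>)"
  shows "\<exists>c. expansion n c (\<lambda>P. \<Sum>\<alpha>\<in>F. h \<alpha> P)"
  using assms
proof (induction F)
  case empty
  show ?case using expansion_zero by auto
next
  case (insert \<alpha> F)
  obtain c where c: "expansion n c (h \<alpha>)" using insert.prems[of \<alpha>] by auto
  obtain d where d: "expansion n d (\<lambda>P. \<Sum>\<alpha>\<in>F. h \<alpha> P)" using insert.IH[OF insert.prems] by auto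
  from expansion_add[OF c d] show ?case using insert.hyps by auto
qed

text \<open>
  The one case that is not a shift of exponents is multiplication of a monomial containing \<open>y\<close> by \<open>y\<close>, where
  \<open>y\<^sup>2\<close> is replaced by \<open>1 + x\<^sup>2 z\<close>.
\<close>

lemma expansion_coord:
  assumes n: "n > 0" and h: "expansion n c h"
  shows "\<exists>d. expansion n d (\<lambda>P. P i * h P)"
proof -
  let ?e = "basis_monomial n"
  let ?F = "{\<alpha>. c \<alpha> \<noteq> 0}"
  have F: "finite ?F" "?F \<subseteq> basis_exponents n" using h unfolding expansion_def by auto
  have summand: "\<exists>d. expansion n d (\<lambda>P. poly p (P 0) * (P i * ?e \<alpha> P))" if a: "\<alpha> \<in> basis_exponents n" for p \<alpha>
  proof -
    consider "i = 0" | "i \<ge> n + 2" | "i = 2" "\<alpha> 2 = 0" | "i = 2" "\<alpha> 2 = 1" | "i \<noteq> 2" "i \<in> {1..<n + 2}"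
      using a by (fastforce simp: basis_exponents_def le_Suc_eq)
    then show ?thesis
    proof cases
      case 1
      show ?thesis
        by (rule exI, rule expansion_cong[OF expansion_basis[OF a, of "[:0, 1:] * p"]]) (use 1 in simp)
    next
      case 2
      show ?thesis
        by (rule exI, rule expansion_cong[OF expansion_zero])
           (use 2 in \<open>auto simp: danielewski_def aff_def\<close>)
    next
      case 3
      have b: "\<alpha>(2 := \<alpha> 2 + 1) \<in> basis_exponents n" using a 3 n by (auto simp: basis_exponents_def)
      show ?thesis
        by (rule exI, rule expansion_cong[OF expansion_basis[OF b, of p]])
           (use 3 n basis_monomial_shift[of 2 n \<alpha> 1] in auto)
    next
      case 4
      define \<beta> where "\<beta> = \<alpha>(2 := 0)"
      have b: "\<beta> \<in> basis_exponents n" using a by (auto simp: basis_exponents_def \<beta>_def)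
      have b': "\<beta>(1 := \<beta> 1 + 1) \<in> basis_exponents n" using b by (auto simp: basis_exponents_def)
      have "\<beta>(2 := \<beta> 2 + 1) = \<alpha>" using 4 by (auto simp: \<beta>_def fun_eq_iff)
      then have e: "?e \<alpha> P = P 2 * ?e \<beta> P" for P
        using basis_monomial_shift[of 2 n \<beta> 1 P] n by simp
      have e': "?e (\<beta>(1 := \<beta> 1 + 1)) P = P 1 * ?e \<beta> P" for P
        using basis_monomial_shift[of 1 n \<beta> 1 P] by simp
      show ?thesis
      proof (rule exI, rule expansion_cong[OF expansion_add[OF expansion_basis[OF b, of p]
              expansion_basis[OF b', of "[:0, 0, 1:] * p"]]])
        fix P assume "P \<in> danielewski n"
        then have "P 2 * P 2 = 1 + P 0 * P 0 * P 1" by (simp add: danielewski_def power2_eq_square)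
        then have "P i * ?e \<alpha> P = (1 + P 0 * P 0 * P 1) * ?e \<beta> P"
          unfolding e using 4 by (simp flip: mult.assoc)
        then show "poly p (P 0) * (P i * ?e \<alpha> P) =
            poly p (P 0) * ?e \<beta> P + poly ([:0, 0, 1:] * p) (P 0) * ?e (\<beta>(1 := \<beta> 1 + 1)) P"
          unfolding e' by (simp add: algebra_simps)
      qed
    next
      case 5
      have b: "\<alpha>(i := \<alpha> i + 1) \<in> basis_exponents n" using a 5 by (auto simp: basis_exponents_def)
      show ?thesis
        by (rule exI, rule expansion_cong[OF expansion_basis[OF b, of p]])
           (use basis_monomial_shift[OF 5(2), of \<alpha> 1] in simp)
    qed
  qed
  have "\<exists>d. expansion n d (\<lambda>P. \<Sum>\<alpha>\<in>?F. poly (c \<alpha>) (P 0) * (P i * ?e \<alpha> P))"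
    by (rule expansion_sum[OF F(1)]) (use summand F(2) in blast)
  then obtain d where d: "expansion n d (\<lambda>P. \<Sum>\<alpha>\<in>?F. poly (c \<alpha>) (P 0) * (P i * ?e \<alpha> P))" ..
  show ?thesis
  proof (rule exI, rule expansion_cong[OF d])
    fix P assume P: "P \<in> danielewski n"
    show "P i * h P = (\<Sum>\<alpha>\<in>?F. poly (c \<alpha>) (P 0) * (P i * ?e \<alpha> P))"
      using expansion_superset[OF h F(1) _ P] by (simp add: sum_distrib_left algebra_simps)
  qed
qed

lemma expansion_mult:
  assumes n: "n > 0" and a: "a \<in> polyfun" and h: "\<exists>c. expansion n c h"
  shows "\<exists>d. expansion n d (\<lambda>P. a P * h P)"
  using a h
proof (induction a arbitrary: h rule: polyfun.induct)
  case (const k)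
  then obtain c where "expansion n c h" by auto
  from expansion_smult[OF this, of "[:k:]"] show ?case by auto
next
  case (coord i)
  then show ?case using expansion_coord[OF n] by blast
next
  case (add a b)
  obtain c where c: "expansion n c (\<lambda>P. a P * h P)" using add by blast
  obtain d where d: "expansion n d (\<lambda>P. b P * h P)" using add by blast
  from expansion_add[OF c d] show ?case by (auto simp: algebra_simps)
next
  case (mult a b)
  have "\<exists>d. expansion n d (\<lambda>P. b P * h P)" by (rule mult.IH(2)[OF mult.prems])
  from mult.IH(1)[OF this] show ?case by (simp add: mult.assoc)
qed

lemma expansion_exists:
  assumes n: "n > 0" and h: "h \<in> polyfun"
  shows "\<exists>c. expansion n c h"
proof -
  have "(\<lambda>_. 0) \<in> basis_exponents n" by (simp add: basis_exponents_def)
  from expansion_basis[OF this, of 1] have "\<exists>c. expansion n c (\<lambda>_. 1)"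
    by (auto simp: basis_monomial_def)
  from expansion_mult[OF n h this] show ?thesis by simp
qed

text \<open>
  Write the expansion as \<open>A + y B\<close>, where \<open>A\<close> and \<open>B\<close> are free of \<open>y\<close>. With \<open>y\<close> also \<open>-y\<close> gives a point of
  the variety, for arbitrary values of the other coordinates; so \<open>A = 0\<close> and \<open>y\<^sup>2 B = (1 + x\<^sup>2 z) B = 0\<close>.
\<close>

lemma expansion_zero_unique:
  assumes n: "n > 0" and c: "expansion n c (\<lambda>_. 0)"
  shows "c \<alpha> = 0"
proof (rule ccontr)
  assume nz: "c \<alpha> \<noteq> 0"
  let ?F = "{\<alpha>. c \<alpha> \<noteq> 0}"
  have F: "finite ?F" "?F \<subseteq> basis_exponents n" using c unfolding expansion_def by auto
  define F0 where "F0 = {\<alpha> \<in> ?F. \<alpha> 2 = 0}"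
  define F1 where "F1 = {\<alpha> \<in> ?F. \<alpha> 2 = 1}"
  have le: "\<beta> 2 = 0 \<or> \<beta> 2 = 1" if "c \<beta> \<noteq> 0" for \<beta>
  proof -
    have "\<beta> \<in> basis_exponents n" using F(2) that by blast
    then have "\<beta> 2 \<le> 1" by (simp add: basis_exponents_def)
    then show ?thesis by linarith
  qed
  have FF: "?F = F0 \<union> F1" "F0 \<inter> F1 = {}" "finite F0" "finite F1"
  proof -
    show "?F = F0 \<union> F1" unfolding F0_def F1_def using le by blast
    show "F0 \<inter> F1 = {}" unfolding F0_def F1_def by auto
    show "finite F0" "finite F1" unfolding F0_def F1_def using F(1) by simp_all
  qed
  let ?e = "basis_monomial n"
  define A where "A = (\<lambda>Q. \<Sum>\<alpha>\<in>F0. poly (c \<alpha>) (Q 0) * ?e \<alpha> Q)"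
  define B where "B = (\<lambda>Q. \<Sum>\<alpha>\<in>F1. poly (c \<alpha>) (Q 0) * ?e (\<alpha>(2 := 0)) Q)"
  have e2: "?e \<alpha> (Q(2 := y)) = y ^ \<alpha> 2 * ?e (\<alpha>(2 := 0)) Q" for \<alpha> Q y
  proof -
    have 2: "2 \<in> {1..<n + 2}" using n by simp
    have "(\<Prod>j\<in>{1..<n + 2} - {2}. (Q(2 := y)) j ^ \<alpha> j) = (\<Prod>j\<in>{1..<n + 2} - {2}. Q j ^ (\<alpha>(2 := 0)) j)"
      by (rule prod.cong) auto
    then show ?thesis
      unfolding basis_monomial_def prod.remove[OF finite_atLeastLessThan 2]
      by (simp only: fun_upd_same power_0 mult_1)
  qed
  have AB: "A Q + y * B Q = 0" if Q: "Q \<in> aff (n + 2)" and y: "y ^ 2 = 1 + Q 0 ^ 2 * Q 1" for Q y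
  proof -
    have P: "Q(2 := y) \<in> danielewski n" using Q y n by (auto simp: danielewski_def aff_def)
    have "(\<Sum>\<alpha>\<in>?F. poly (c \<alpha>) ((Q(2 := y)) 0) * ?e \<alpha> (Q(2 := y))) = 0"
      using expansion_superset[OF c F(1) _ P] by simp
    then have "(\<Sum>\<alpha>\<in>F0. poly (c \<alpha>) (Q 0) * (y ^ \<alpha> 2 * ?e (\<alpha>(2 := 0)) Q)) +
        (\<Sum>\<alpha>\<in>F1. poly (c \<alpha>) (Q 0) * (y ^ \<alpha> 2 * ?e (\<alpha>(2 := 0)) Q)) = 0"
      unfolding FF(1) sum.union_disjoint[OF FF(3,4,2)] e2 by simp
    moreover have "(\<Sum>\<alpha>\<in>F0. poly (c \<alpha>) (Q 0) * (y ^ \<alpha> 2 * ?e (\<alpha>(2 := 0)) Q)) = A Q"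
      unfolding A_def
    proof (rule sum.cong[OF refl])
      fix \<alpha> assume "\<alpha> \<in> F0"
      then have "\<alpha> 2 = 0" by (simp add: F0_def)
      then have "\<alpha>(2 := 0) = \<alpha>" by auto
      with \<open>\<alpha> 2 = 0\<close> show "poly (c \<alpha>) (Q 0) * (y ^ \<alpha> 2 * ?e (\<alpha>(2 := 0)) Q) = poly (c \<alpha>) (Q 0) * ?e \<alpha> Q" by simp
    qed
    moreover have "(\<Sum>\<alpha>\<in>F1. poly (c \<alpha>) (Q 0) * (y ^ \<alpha> 2 * ?e (\<alpha>(2 := 0)) Q)) = y * B Q"
      unfolding B_def sum_distrib_left
    proof (rule sum.cong[OF refl])
      fix \<alpha> assume "\<alpha> \<in> F1"
      then show "poly (c \<alpha>) (Q 0) * (y ^ \<alpha> 2 * ?e (\<alpha>(2 := 0)) Q) =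
          y * (poly (c \<alpha>) (Q 0) * ?e (\<alpha>(2 := 0)) Q)" by (simp add: F1_def)
    qed
    ultimately show ?thesis by simp
  qed
  have A0: "A Q = 0" and B0: "(1 + Q 0 ^ 2 * Q 1) * B Q = 0" if Q: "Q \<in> aff (n + 2)" for Q
  proof -
    define y where "y = csqrt (1 + Q 0 ^ 2 * Q 1)"
    have y: "y ^ 2 = 1 + Q 0 ^ 2 * Q 1" "(- y) ^ 2 = 1 + Q 0 ^ 2 * Q 1" by (auto simp: y_def)
    have 1: "A Q + y * B Q = 0" "A Q + (- y) * B Q = 0" by (rule AB[OF Q y(1)], rule AB[OF Q y(2)])
    then have "A Q + A Q = 0" by (simp add: algebra_simps)
    then show "A Q = 0" by simp
    with 1 have "y * B Q = 0" by simp
    then show "(1 + Q 0 ^ 2 * Q 1) * B Q = 0" unfolding y(1)[symmetric] by auto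
  qed
  have B0: "B Q = 0" if Q: "Q \<in> aff (n + 2)" for Q
  proof (rule function_domainD[OF function_domain_aff _ _ B0 _ _ Q])
    show "(\<lambda>Q. 1 + Q 0 ^ 2 * Q 1) \<in> polyfun" by (intro polyfun_intros)
    show "B \<in> polyfun"
      unfolding B_def
      by (intro polyfun_sum polyfun.mult polyfun_poly polyfun.coord basis_monomial_polyfun)
    show "(\<lambda>_. 0) \<in> aff (n + 2)" by (simp add: aff_def)
  qed simp_all
  have supp: "\<beta> i = 0" if "\<beta> \<in> basis_exponents n" "i \<notin> {1..<n + 2}" for \<beta> i
    using that by (simp add: basis_exponents_def)
  have coeff0: "d \<beta> = 0" if G: "finite G" "\<And>\<beta> i. \<beta> \<in> G \<Longrightarrow> i \<notin> {1..<n + 2} \<Longrightarrow> \<beta> i = 0" "\<beta> \<in> G"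
    and z: "\<And>Q. Q \<in> aff (n + 2) \<Longrightarrow> Q 0 = x \<Longrightarrow> (\<Sum>\<beta>\<in>G. d \<beta> * ?e \<beta> Q) = 0"
    for G d x and \<beta> :: "nat \<Rightarrow> nat"
  proof (rule monomials_independent[of "{1..<n + 2}" G d \<beta>])
    fix Q :: pt
    define Q' where "Q' = (\<lambda>i. if i = 0 then x else if i < n + 2 then Q i else 0)"
    have "(\<Sum>\<beta>\<in>G. d \<beta> * (\<Prod>i\<in>{1..<n + 2}. Q i ^ \<beta> i)) = (\<Sum>\<beta>\<in>G. d \<beta> * ?e \<beta> Q')"
      unfolding basis_monomial_def
      by (intro sum.cong refl arg_cong2[where f = "(*)"] prod.cong) (auto simp: Q'_def)
    also have "\<dots> = 0" by (rule z) (auto simp: Q'_def aff_def)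
    finally show "(\<Sum>\<beta>\<in>G. d \<beta> * (\<Prod>i\<in>{1..<n + 2}. Q i ^ \<beta> i)) = 0" .
  qed (use G in auto)
  have "poly (c \<alpha>) x = 0" for x
  proof (cases "\<alpha> \<in> F0")
    case True
    show ?thesis
    proof (rule coeff0[where d = "\<lambda>\<alpha>. poly (c \<alpha>) x" and G = F0])
      fix Q assume "Q \<in> aff (n + 2)" "Q 0 = x"
      then show "(\<Sum>\<beta>\<in>F0. poly (c \<beta>) x * ?e \<beta> Q) = 0" using A0[of Q] by (simp add: A_def)
    next
      fix \<beta> i assume b: "\<beta> \<in> F0" "i \<notin> {1..<n + 2}"
      have "\<beta> \<in> basis_exponents n" using b(1) F(2) unfolding F0_def by blast
      then show "\<beta> i = 0" by (rule supp[OF _ b(2)])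
    qed (rule FF(3), rule True)
  next
    case False
    then have a1: "\<alpha> \<in> F1" using nz FF(1) by blast
    let ?z = "\<lambda>\<alpha>::nat \<Rightarrow> nat. \<alpha>(2 := 0)"
    have inv: "(?z \<beta>)(2 := 1) = \<beta>" if "\<beta> \<in> F1" for \<beta> using that by (auto simp: F1_def fun_eq_iff)
    have inj: "inj_on ?z F1"
      by (rule inj_on_inverseI[where g = "\<lambda>\<beta>. \<beta>(2 := 1)"]) (rule inv)
    have "(\<lambda>\<beta>. poly (c (\<beta>(2 := 1))) x) (?z \<alpha>) = 0"
    proof (rule coeff0[where d = "\<lambda>\<beta>. poly (c (\<beta>(2 := 1))) x" and G = "?z ` F1" and x = x])
      fix Q assume Q: "Q \<in> aff (n + 2)" "Q 0 = x"
      have "(\<Sum>\<beta>\<in>?z ` F1. poly (c (\<beta>(2 := 1))) x * ?e \<beta> Q) =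
          (\<Sum>\<beta>\<in>F1. poly (c ((?z \<beta>)(2 := 1))) x * ?e (?z \<beta>) Q)"
        unfolding sum.reindex[OF inj] comp_def ..
      also have "\<dots> = B Q"
        unfolding B_def by (rule sum.cong[OF refl]) (simp only: inv Q(2))
      finally show "(\<Sum>\<beta>\<in>?z ` F1. poly (c (\<beta>(2 := 1))) x * ?e \<beta> Q) = 0" using B0[OF Q(1)] by simp
    next
      fix \<beta> i assume "\<beta> \<in> ?z ` F1" "i \<notin> {1..<n + 2}"
      then obtain \<gamma> where g: "\<gamma> \<in> F1" "\<beta> = ?z \<gamma>" by blast
      have "\<gamma> \<in> basis_exponents n" using g(1) F(2) unfolding F1_def by blast
      then have "\<gamma> i = 0" by (rule supp[OF _ \<open>i \<notin> {1..<n + 2}\<close>])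
      then show "\<beta> i = 0" unfolding g(2) by simp
    qed (rule finite_imageI[OF FF(4)], rule imageI[OF a1])
    then show ?thesis using inv[OF a1] by simp
  qed
  then have "c \<alpha> = 0" using poly_all_0_iff_0 by blast
  then show False using nz by simp
qed

lemma expansion_unique:
  assumes n: "n > 0" and cd: "expansion n c h" "expansion n d h"
  shows "c = d"
proof
  fix \<alpha>
  have "expansion n (\<lambda>\<alpha>. c \<alpha> + (- 1) * d \<alpha>) (\<lambda>P. h P + poly (- 1) (P 0) * h P)"
    by (rule expansion_add[OF cd(1) expansion_smult[OF cd(2)]])
  then have "expansion n (\<lambda>\<alpha>. c \<alpha> + (- 1) * d \<alpha>) (\<lambda>_. 0)"
    by (rule expansion_cong) simp
  from expansion_zero_unique[OF n this, of \<alpha>] show "c \<alpha> = d \<alpha>" by simp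
qed

section \<open>Flatness of the fibration\<close>

definition projection :: "pt \<Rightarrow> pt" where
  "projection P = (\<lambda>i. if i = 0 then P 0 else 0)"

lemma polyfun_projection: "(\<lambda>P. projection P i) \<in> polyfun"
  by (cases "i = 0") (simp_all add: projection_def polyfun.intros)

lemma projection_aff: "projection P \<in> aff 1"
  by (simp add: projection_def aff_def)

lemma aff_1_eq: "q \<in> aff 1 \<Longrightarrow> q = (\<lambda>i. if i = 0 then q 0 else 0)"
  by (auto simp: aff_def fun_eq_iff)

lemma coord_ring_line:
  assumes "r \<in> polyfun"
  shows "\<exists>p. \<forall>q\<in>aff 1. r q = poly p (q 0)"
proof -
  from polyfun_along_curve[OF assms, of "\<lambda>i. if i = 0 then [:0, 1:] else 0"] obtain p
    where p: "\<forall>t. r (\<lambda>i. poly (if i = 0 then [:0, 1:] else 0) t) = poly p t" ..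
  have "r q = poly p (q 0)" if "q \<in> aff 1" for q
  proof -
    have "q = (\<lambda>i. poly (if i = 0 then [:0, 1:] else 0) (q 0))"
      by (subst aff_1_eq[OF that]) auto
    then show ?thesis using p[rule_format, of "q 0"] by simp
  qed
  then show ?thesis by blast
qed

text \<open>
  The coordinate ring is free over the polynomials in \<open>x\<close>. The criterion for flatness is used with the identity
  as \<open>s\<close> and the whole module as \<open>M\<^sub>0\<close>.
\<close>

lemma flat_projection:
  assumes n: "n > 0"
  shows "flat_morphism (danielewski n) (aff 1) projection"
proof -
  let ?X = "danielewski n" and ?R = "coord_ring (aff 1)"
  let ?M = "coord_module ?X projection"
  have M: "module ?R ?M" by (rule module_coord_module[OF polyfun_projection projection_aff])
  have sm: "restrict r (aff 1) \<odot>\<^bsub>?M\<^esub> restrict a ?X = restrict (\<lambda>x. r (projection x) * a x) ?X" for r a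
    by (rule coord_module_smult) (rule projection_aff)
  define cf where "cf m = (THE c. expansion n c m)" for m
  have cf_eq: "cf m = c" if "expansion n c m" for c m
    unfolding cf_def
  proof (rule the_equality)
    show "expansion n c m" by (rule that)
    fix d assume d: "expansion n d m"
    show "d = c" by (rule expansion_unique[OF n d that])
  qed
  have ex: "expansion n (cf (restrict h ?X)) (restrict h ?X)" if h: "h \<in> polyfun" for h
  proof -
    obtain c where "expansion n c h" using expansion_exists[OF n h] by auto
    then have "expansion n c (restrict h ?X)" by (rule expansion_cong) simp
    then show ?thesis using cf_eq by simp
  qed
  define c where "c = (\<lambda>\<alpha> m. restrict (\<lambda>q. poly (cf m \<alpha>) (q 0)) (aff 1))"
  have c_poly: "(\<lambda>q::pt. poly p (q 0)) \<in> polyfun" for p by (intro polyfun_poly polyfun.coord)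
  have flat: "t \<in> tensor_relations ?R (N\<lparr>carrier := N'\<rparr>) ?M"
    if N: "module ?R N" "submodule N' ?R N"
      and t: "Poly_Mapping.keys t \<subseteq> N' \<times> carrier ?M" "t \<in> tensor_relations ?R N ?M"
    for N :: "(pt \<Rightarrow> complex, pt \<Rightarrow> complex) module" and N' t
  proof -
    have "\<exists>k. tensor_map ((\<lambda>m. m) ^^ k) t \<in> tensor_relations ?R (N\<lparr>carrier := N'\<rparr>) ?M"
    proof (rule flat_chart[OF M N, where c = c and ?M0.0 = "carrier ?M" and s = "\<lambda>m. m"
          and e = "\<lambda>\<alpha>. restrict (basis_monomial n \<alpha>) ?X"])
      show "module_endo ?R ?M (\<lambda>m. m)"
        unfolding module_endo_def by simp
      fix m m' assume mm: "m \<in> carrier ?M" "m' \<in> carrier ?M"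
      then obtain h g where hg: "h \<in> polyfun" "g \<in> polyfun" "m = restrict h ?X" "m' = restrict g ?X" by auto
      show "m \<oplus>\<^bsub>?M\<^esub> m' \<in> carrier ?M"
        using abelian_groupE(1)[OF module_abelian_group[OF M] mm] .
      fix \<alpha>
      have "expansion n (\<lambda>\<alpha>. cf m \<alpha> + cf m' \<alpha>) (\<lambda>P. m P + m' P)"
        unfolding hg(3,4) by (rule expansion_add[OF ex[OF hg(1)] ex[OF hg(2)]])
      then have "expansion n (\<lambda>\<alpha>. cf m \<alpha> + cf m' \<alpha>) (m \<oplus>\<^bsub>?M\<^esub> m')"
        by (rule expansion_cong) (simp add: hg)
      from cf_eq[OF this] show "c \<alpha> (m \<oplus>\<^bsub>?M\<^esub> m') = c \<alpha> m \<oplus>\<^bsub>?R\<^esub> c \<alpha> m'"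
        unfolding c_def by simp
    next
      fix r m assume rm: "r \<in> carrier ?R" "m \<in> carrier ?M"
      then show "r \<odot>\<^bsub>?M\<^esub> m \<in> carrier ?M" by (rule module.smult_closed[OF M])
      obtain g h where hg: "g \<in> polyfun" "r = restrict g (aff 1)" "h \<in> polyfun" "m = restrict h ?X"
        using rm by auto
      from coord_ring_line[OF hg(1)] obtain p where p: "\<forall>q\<in>aff 1. g q = poly p (q 0)" ..
      have r: "r = restrict (\<lambda>q. poly p (q 0)) (aff 1)"
        unfolding hg(2) by (rule restrict_eq) (use p in blast)
      fix \<alpha>
      have "expansion n (\<lambda>\<alpha>. p * cf m \<alpha>) (\<lambda>P. poly p (P 0) * m P)"
        unfolding hg(4) by (rule expansion_smult[OF ex[OF hg(3)]])
      then have "expansion n (\<lambda>\<alpha>. p * cf m \<alpha>) (r \<odot>\<^bsub>?M\<^esub> m)"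
        unfolding r hg(4) sm by (rule expansion_cong) (simp add: projection_def)
      from cf_eq[OF this] show "c \<alpha> (r \<odot>\<^bsub>?M\<^esub> m) = r \<otimes>\<^bsub>?R\<^esub> c \<alpha> m"
        unfolding c_def r by simp
    next
      fix m assume m: "m \<in> carrier ?M"
      show "\<exists>k. ((\<lambda>m. m) ^^ k) m \<in> carrier ?M" by (rule exI[of _ 0]) (use m in simp)
      fix \<alpha>
      show "c \<alpha> m \<in> carrier ?R" unfolding c_def by (rule coord_ring_elem[OF c_poly])
    next
      fix m assume "m \<in> carrier ?M"
      then obtain h where h: "h \<in> polyfun" "m = restrict h ?X" by auto
      define F where "F = {\<alpha>. cf m \<alpha> \<noteq> 0}"
      have em: "expansion n (cf m) m" unfolding h(2) by (rule ex[OF h(1)])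
      then have F: "finite F" unfolding expansion_def F_def by simp
      show "\<exists>F. finite F \<and> (\<forall>\<alpha>. \<alpha> \<notin> F \<longrightarrow> c \<alpha> m = \<zero>\<^bsub>?R\<^esub>) \<and>
          m = finsum ?M (\<lambda>\<alpha>. c \<alpha> m \<odot>\<^bsub>?M\<^esub> restrict (basis_monomial n \<alpha>) ?X) F"
      proof (intro exI[of _ F] conjI allI impI)
        fix \<alpha> assume "\<alpha> \<notin> F"
        then show "c \<alpha> m = \<zero>\<^bsub>?R\<^esub>" by (simp add: F_def c_def)
      next
        have "finsum ?M (\<lambda>\<alpha>. c \<alpha> m \<odot>\<^bsub>?M\<^esub> restrict (basis_monomial n \<alpha>) ?X) F =
            finsum ?M (\<lambda>\<alpha>. restrict (\<lambda>P. poly (cf m \<alpha>) (P 0) * basis_monomial n \<alpha> P) ?X) F"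
          unfolding c_def sm by (simp add: projection_def)
        also have "\<dots> = restrict (\<lambda>P. \<Sum>\<alpha>\<in>F. poly (cf m \<alpha>) (P 0) * basis_monomial n \<alpha> P) ?X"
          by (rule finsum_coord_module[OF F])
             (intro polyfun.mult polyfun_poly polyfun.coord basis_monomial_polyfun)
        also have "\<dots> = restrict m ?X"
          by (rule restrict_eq) (simp add: expansion_superset[OF em F] F_def)
        finally show "m = finsum ?M (\<lambda>\<alpha>. c \<alpha> m \<odot>\<^bsub>?M\<^esub> restrict (basis_monomial n \<alpha>) ?X) F"
          by (simp add: h(2))
      qed (rule F)
    next
      fix \<alpha>
      show "restrict (basis_monomial n \<alpha>) ?X \<in> carrier ?M" by (simp add: basis_monomial_polyfun)
    qed (use t in auto)
    then obtain k where k: "tensor_map ((\<lambda>m. m) ^^ k) t \<in> tensor_relations ?R (N\<lparr>carrier := N'\<rparr>) ?M" ..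
    have "((\<lambda>m. m) ^^ k) = (\<lambda>m::pt \<Rightarrow> complex. m)" by (induction k) auto
    moreover have "tensor_map (\<lambda>m. m) t = t"
      using frag_expansion[of t] by (simp add: tensor_map_def)
    ultimately show ?thesis using k by simp
  qed
  show ?thesis
    unfolding flat_morphism_def flat_module_def
    using morphismI[of projection ?X "aff 1", OF polyfun_projection projection_aff] M flat by blast
qed

section \<open>The etale endomorphism\<close>

text \<open>
  The polynomials \<open>4 y\<^sup>3 - 3 y\<close> and \<open>4 y\<^sup>2 - 1\<close> are the Chebyshev polynomials \<open>T\<^sub>3\<close> and \<open>U\<^sub>2\<close>. They satisfy
  \<open>T\<^sub>3\<^sup>2 - 1 = (y\<^sup>2 - 1) U\<^sub>2\<^sup>2\<close>, so that the equation \<open>x\<^sup>2 z = y\<^sup>2 - 1\<close> is preserved, with the same \<open>z\<close>.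
\<close>

definition endo :: "pt \<Rightarrow> pt" where
  "endo P = P(0 := P 0 * (4 * P 2 ^ 2 - 1), 2 := 4 * P 2 ^ 3 - 3 * P 2)"

lemma endo_simps [simp]:
  "endo P 0 = P 0 * (4 * P 2 ^ 2 - 1)" "endo P (Suc 0) = P (Suc 0)" "endo P 2 = 4 * P 2 ^ 3 - 3 * P 2"
  "i \<noteq> 0 \<Longrightarrow> i \<noteq> 2 \<Longrightarrow> endo P i = P i"
  by (auto simp: endo_def)

lemma polyfun_endo: "(\<lambda>P. endo P i) \<in> polyfun"
proof -
  have "(\<lambda>P. P 0 * (4 * P 2 ^ 2 - 1)) \<in> polyfun" "(\<lambda>P. 4 * P 2 ^ 3 - 3 * P 2) \<in> polyfun"
    by (intro polyfun_intros)+
  then show ?thesis by (cases "i = 0"; cases "i = 2") (simp_all add: endo_def polyfun.coord)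
qed

lemma endo_danielewski:
  assumes P: "P \<in> danielewski n"
  shows "endo P \<in> danielewski n"
proof -
  have X: "P \<in> aff (n + 2)" "P 0 ^ 2 * P 1 = P 2 ^ 2 - 1" using P by (auto simp: danielewski_def)
  have "(P 0 * (4 * P 2 ^ 2 - 1)) ^ 2 * P 1 = (P 0 ^ 2 * P 1) * (4 * P 2 ^ 2 - 1) ^ 2"
    by (simp add: power_mult_distrib)
  also have "\<dots> = (4 * P 2 ^ 3 - 3 * P 2) ^ 2 - 1"
    unfolding X(2) by (simp add: power2_eq_square power3_eq_cube algebra_simps)
  finally have main: "(P 0 * (4 * P 2 ^ 2 - 1)) ^ 2 * P 1 = (4 * P 2 ^ 3 - 3 * P 2) ^ 2 - 1" .
  show ?thesis
  proof (cases "n = 0")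
    case True
    with X(1) have "P 2 = 0" by (simp add: aff_def)
    then show ?thesis using X(1) main True
      by (auto simp: danielewski_def aff_def endo_def)
  next
    case False
    then show ?thesis using X(1) main
      by (auto simp: danielewski_def aff_def endo_def)
  qed
qed

text \<open>
  For \<open>P 1 = u\<^sup>2 \<noteq> 0\<close> the equation \<open>(P 2)\<^sup>2 - (u P 0)\<^sup>2 = 1\<close> is parametrized by \<open>s = P 2 + u P 0 \<noteq> 0\<close>, and the
  endomorphism becomes \<open>s \<mapsto> s\<^sup>3\<close>.
\<close>

definition hyperbola_point :: "pt \<Rightarrow> complex \<Rightarrow> complex \<Rightarrow> pt" where
  "hyperbola_point Q u s = Q(0 := (s - 1 / s) / (2 * u), 1 := u ^ 2, 2 := (s + 1 / s) / 2)"

lemma hyperbola_point_danielewski: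
  assumes "Q \<in> aff (n + 2)" "n > 0" "u \<noteq> 0" "s \<noteq> 0"
  shows "hyperbola_point Q u s \<in> danielewski n"
proof -
  have "((s - 1 / s) / (2 * u)) ^ 2 * u ^ 2 = ((s + 1 / s) / 2) ^ 2 - 1"
    using assms by (simp add: field_simps power2_eq_square)
  then show ?thesis using assms by (auto simp: danielewski_def hyperbola_point_def aff_def)
qed

lemma endo_hyperbola_point:
  assumes "u \<noteq> 0" "s \<noteq> 0"
  shows "endo (hyperbola_point Q u s) = hyperbola_point Q u (s ^ 3)"
proof -
  have "(s - 1 / s) / (2 * u) * (4 * ((s + 1 / s) / 2) ^ 2 - 1) = (s ^ 3 - 1 / s ^ 3) / (2 * u)"
    using assms by (simp add: field_simps power2_eq_square power3_eq_cube)
  moreover have "4 * ((s + 1 / s) / 2) ^ 3 - 3 * ((s + 1 / s) / 2) = (s ^ 3 + 1 / s ^ 3) / 2"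
    using assms by (simp add: field_simps power2_eq_square power3_eq_cube)
  ultimately show ?thesis
    by (auto simp: endo_def hyperbola_point_def fun_eq_iff)
qed

lemma hyperbola_point_exists:
  assumes P: "P \<in> danielewski n" "P 1 \<noteq> 0"
  shows "\<exists>u s. u \<noteq> 0 \<and> s \<noteq> 0 \<and> P = hyperbola_point P u (s ^ 3)"
proof -
  define u where "u = csqrt (P 1)"
  have u: "u ^ 2 = P 1" "u \<noteq> 0" using P by (auto simp: u_def)
  define \<sigma> where "\<sigma> = P 2 + u * P 0"
  have X: "P 0 ^ 2 * P 1 = P 2 ^ 2 - 1" using P by (simp add: danielewski_def)
  have "\<sigma> * (P 2 - u * P 0) = P 2 ^ 2 - P 0 ^ 2 * u ^ 2"
    by (simp add: \<sigma>_def power2_eq_square algebra_simps)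
  then have one: "\<sigma> * (P 2 - u * P 0) = 1"
    unfolding u(1) X by simp
  then have s0: "\<sigma> \<noteq> 0" by auto
  have inv: "1 / \<sigma> = P 2 - u * P 0" using one s0 by (simp add: divide_eq_eq mult.commute)
  define s where "s = exp (Ln \<sigma> / 3)"
  have "s ^ 3 = exp (3 * (Ln \<sigma> / 3))" unfolding s_def by (metis exp_of_nat_mult of_nat_numeral)
  then have s: "s ^ 3 = \<sigma>" "s \<noteq> 0" using s0 by (auto simp: s_def)
  have "hyperbola_point P u \<sigma> = P"
    unfolding hyperbola_point_def inv using u by (auto simp: \<sigma>_def fun_eq_iff field_simps)
  then have "P = hyperbola_point P u (s ^ 3)" unfolding s(1) by simp
  then show ?thesis using u(2) s(2) by blast
qed

lemma cube_root_of_unity: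
  obtains w :: complex where "w\<^sup>2 + w + 1 = 0" "w \<noteq> 0" "w \<noteq> 1"
proof -
  define w :: complex where "w = (csqrt (-3) - 1) / 2"
  have "(csqrt (-3))\<^sup>2 = -3" by (rule power2_csqrt)
  then have "w\<^sup>2 + w + 1 = 0" by (simp add: w_def power2_eq_square field_simps)
  moreover from this have "w \<noteq> 0" "w \<noteq> 1" by (auto simp: power2_eq_square)
  ultimately show ?thesis by (rule that)
qed

text \<open>
  The points \<open>s\<close>, \<open>w s\<close>, \<open>w\<^sup>2 s\<close> of a hyperbola, with \<open>w\<close> a primitive third root of unity, have the same
  image under the endomorphism, and they are not on a line.
\<close>

lemma endo_independent:
  assumes n: "n > 0" and abc: "a \<in> polyfun" "b \<in> polyfun" "c \<in> polyfun"
    and rel: "\<And>P. P \<in> danielewski n \<Longrightarrow> a (endo P) + P 0 * b (endo P) + P 2 * c (endo P) = 0"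
    and P: "P \<in> danielewski n"
  shows "a P = 0 \<and> b P = 0 \<and> c P = 0"
proof -
  have gen: "a P = 0 \<and> b P = 0 \<and> c P = 0" if P: "P \<in> danielewski n" "P 1 \<noteq> 0" for P
  proof -
    obtain u s where us: "u \<noteq> 0" "s \<noteq> 0" "P = hyperbola_point P u (s ^ 3)"
      using hyperbola_point_exists[OF P] by blast
    obtain w :: complex where w: "w\<^sup>2 + w + 1 = 0" "w \<noteq> 0" "w \<noteq> 1" by (rule cube_root_of_unity)
    have w3: "w ^ 3 = 1"
    proof -
      have "w ^ 3 - 1 = (w - 1) * (w\<^sup>2 + w + 1)" by (simp add: power2_eq_square power3_eq_cube algebra_simps)
      then show ?thesis unfolding w(1) by simp
    qed
    have Q: "P \<in> aff (n + 2)" using P by (simp add: danielewski_def)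
    have eq: "a P + (r * s - 1 / (r * s)) / (2 * u) * b P + (r * s + 1 / (r * s)) / 2 * c P = 0"
      if r: "r ^ 3 = 1" for r
    proof -
      have r0: "r \<noteq> 0" using r by auto
      have "endo (hyperbola_point P u (r * s)) = P"
        using endo_hyperbola_point[of u "r * s" P] us r0 r by (simp add: power_mult_distrib)
      moreover have "hyperbola_point P u (r * s) \<in> danielewski n"
        by (rule hyperbola_point_danielewski) (use Q n us r0 in auto)
      ultimately show ?thesis
        using rel[of "hyperbola_point P u (r * s)"] by (simp add: hyperbola_point_def)
    qed
    define \<beta> where "\<beta> = b P / u"
    define A where "A = s * (\<beta> + c P) / 2"
    define B where "B = (c P - \<beta>) / (2 * s)"
    \<comment> \<open>The relation at the preimage with parameter \<open>r s\<close> is a Laurent polynomial in \<open>r\<close> with exponents \<open>-1, 0, 1\<close>; the three cube roots of unity determine its coefficients.\<close>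
    have eqAB: "a P + r * A + B / r = 0" if r: "r ^ 3 = 1" for r
    proof -
      have r0: "r \<noteq> 0" using r by auto
      have 1: "(r * s - 1 / (r * s)) / (2 * u) * b P = (r * s - 1 / (r * s)) / 2 * \<beta>"
        by (simp add: \<beta>_def)
      have 2: "r * A + B / r = (r * s - 1 / (r * s)) / 2 * \<beta> + (r * s + 1 / (r * s)) / 2 * c P"
        using r0 us(2) by (simp add: A_def B_def field_simps)
      have "a P + (r * A + B / r) = 0"
        unfolding 2 using eq[OF r] unfolding 1 by (simp only: add.assoc)
      then show ?thesis by (simp only: add.assoc)
    qed
    have e1: "a P + A + B = 0" using eqAB[of 1] by simp
    have iw: "1 / w = w\<^sup>2" using w3 w(2) by (simp add: field_simps power2_eq_square power3_eq_cube)
    have Bw: "B / w = w\<^sup>2 * B"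
    proof -
      have "B / w = B * (1 / w)" by simp
      then show ?thesis unfolding iw by (simp only: mult.commute)
    qed
    have e2: "a P + w * A + w\<^sup>2 * B = 0" using eqAB[OF w3] unfolding Bw .
    have "(w\<^sup>2) ^ 3 = (w ^ 3)\<^sup>2" by (simp flip: power_mult)
    then have w23: "(w\<^sup>2) ^ 3 = 1" unfolding w3 by simp
    have iw2: "1 / w\<^sup>2 = w" using w3 w(2) by (simp add: field_simps power2_eq_square power3_eq_cube)
    have Bw2: "B / w\<^sup>2 = w * B"
    proof -
      have "B / w\<^sup>2 = B * (1 / w\<^sup>2)" by simp
      then show ?thesis unfolding iw2 by (simp only: mult.commute)
    qed
    have e3: "a P + w\<^sup>2 * A + w * B = 0" using eqAB[OF w23] unfolding Bw2 .
    have "3 * a P + (A + B) * (w\<^sup>2 + w + 1) = (a P + A + B) + (a P + w * A + w\<^sup>2 * B) + (a P + w\<^sup>2 * A + w * B)"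
      by (simp add: algebra_simps)
    then have a0: "a P = 0" unfolding e1 e2 e3 w(1) by simp
    then have BA: "B = - A" using e1 by (simp add: eq_neg_iff_add_eq_0 add.commute)
    have "A * (w * (1 - w)) = 0" using e2 unfolding a0 BA by (simp add: power2_eq_square algebra_simps)
    then have A0: "A = 0" using w by simp
    then have 1: "\<beta> + c P = 0" "c P - \<beta> = 0" using BA us by (auto simp: A_def B_def)
    then have "c P + c P = 0" by (simp add: algebra_simps)
    then have c0: "c P = 0" by simp
    then have "\<beta> = 0" using 1 by simp
    then have "c P = 0" "b P = 0" using us(1) c0 by (auto simp: \<beta>_def)
    then show ?thesis using a0 by simp
  qed
  define P1 :: pt where "P1 = (\<lambda>i. if i = 0 then 1 else if i = 1 then -1 else 0)"
  have P1: "P1 \<in> danielewski n" "P1 1 \<noteq> 0" by (auto simp: P1_def danielewski_def aff_def)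
  have "h P = 0" if h: "h \<in> polyfun" "\<And>P. P \<in> danielewski n \<Longrightarrow> P 1 \<noteq> 0 \<Longrightarrow> h P = 0" for h
  proof (rule function_domainD[OF function_domain_danielewski[OF n] polyfun.coord[of 1] h(1) _ P1 P])
    fix x assume "x \<in> danielewski n"
    then show "x 1 * h x = 0" using h(2)[of x] by auto
  qed
  then show ?thesis using gen abc by blast
qed

section \<open>Flatness of the endomorphism\<close>

definition base_combination :: "(pt \<Rightarrow> pt) \<Rightarrow> (nat \<Rightarrow> pt \<Rightarrow> complex) \<Rightarrow> nat \<Rightarrow> (nat \<Rightarrow> pt \<Rightarrow> complex) \<Rightarrow> pt \<Rightarrow> complex" where
  "base_combination f e r a P = (\<Sum>b<r. a b (f P) * e b P)"

text \<open>
  The elements \<open>e\<close> are linearly independent over the image of the coordinate ring of \<open>Y\<close>, and after multiplication by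
  a power of \<open>s\<close> every function is a combination of them. So the combinations form a free submodule \<open>M\<^sub>0\<close>
  to which the criterion for flatness applies.
\<close>

lemma flat_free_chart:
  fixes N :: "(pt \<Rightarrow> complex, pt \<Rightarrow> complex) module"
  assumes f: "\<And>i. (\<lambda>x. f x i) \<in> polyfun" and fY: "\<And>x. x \<in> X \<Longrightarrow> f x \<in> Y"
    and s: "s \<in> polyfun" and e: "\<And>b. e b \<in> polyfun"
    and indep: "\<And>a b x. (\<forall>b. a b \<in> polyfun) \<Longrightarrow> (\<forall>P\<in>X. base_combination f e r a P = 0) \<Longrightarrow> b < r \<Longrightarrow> x \<in> Y \<Longrightarrow> a b x = 0"
    and stable: "\<And>a. (\<forall>b. a b \<in> polyfun) \<Longrightarrow>
        \<exists>a'. (\<forall>b. a' b \<in> polyfun) \<and> (\<forall>P\<in>X. s P * base_combination f e r a P = base_combination f e r a' P)"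
    and reach: "\<And>h. h \<in> polyfun \<Longrightarrow>
        \<exists>k a. (\<forall>b. a b \<in> polyfun) \<and> (\<forall>P\<in>X. s P ^ k * h P = base_combination f e r a P)"
    and N: "module (coord_ring Y) N" "submodule N' (coord_ring Y) N"
    and t: "Poly_Mapping.keys t \<subseteq> N' \<times> carrier (coord_module X f)"
      "t \<in> tensor_relations (coord_ring Y) N (coord_module X f)"
  shows "\<exists>k. tensor_map (mult_by X s ^^ k) t \<in> tensor_relations (coord_ring Y) (N\<lparr>carrier := N'\<rparr>) (coord_module X f)"
proof -
  let ?R = "coord_ring Y" and ?M = "coord_module X f"
  have M: "module ?R ?M" by (rule module_coord_module[OF f fY])
  have sm: "restrict r Y \<odot>\<^bsub>?M\<^esub> restrict a X = restrict (\<lambda>x. r (f x) * a x) X" for r a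
    by (rule coord_module_smult) (rule fY)
  define rep where "rep m a \<longleftrightarrow> (\<forall>b. a b \<in> polyfun) \<and> (\<forall>P\<in>X. m P = base_combination f e r a P)" for m a
  have rep_polyfun: "a b \<in> polyfun" if "rep m a" for m a b using that unfolding rep_def by blast
  have rep_eq: "m P = base_combination f e r a P" if "rep m a" "P \<in> X" for m a P
    using that unfolding rep_def by blast
  define M0 where "M0 = {m \<in> carrier ?M. \<exists>a. rep m a}"
  \<comment> \<open>The coefficients are unique by independence; see \<open>c_eq\<close> below.\<close>
  define c where "c b m = restrict (if b < r then (SOME a. rep m a) b else (\<lambda>_. 0)) Y" for b m
  have co_poly: "base_combination f e r a \<in> polyfun" if "\<forall>b. a b \<in> polyfun" for a
  proof -
    have "(\<lambda>P. base_combination f e r a P) \<in> polyfun"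
      unfolding base_combination_def
    proof (rule polyfun_sum)
      fix b
      have "a b \<in> polyfun" using that by blast
      from polyfun.mult[OF polyfun_compose[OF this f] e[of b]]
      show "(\<lambda>x. a b (f x) * e b x) \<in> polyfun" .
    qed
    then show ?thesis by simp
  qed
  have M0I: "restrict h X \<in> M0" if a: "\<forall>b. a b \<in> polyfun" and h: "\<And>P. P \<in> X \<Longrightarrow> h P = base_combination f e r a P" for h a
  proof -
    have "restrict h X = restrict (base_combination f e r a) X" by (rule restrict_eq) (rule h)
    then have "restrict h X \<in> carrier ?M" using co_poly[OF a] by simp
    moreover have "rep (restrict h X) a" unfolding rep_def using a h by simp
    ultimately show ?thesis unfolding M0_def by blast
  qed
  have M0E: "\<exists>h a. h \<in> polyfun \<and> m = restrict h X \<and> rep m a" if "m \<in> M0" for m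
    using that unfolding M0_def by auto
  have c_eq: "c b m = restrict (a b) Y" if ra: "rep m a" and b: "b < r" for b m a
  proof -
    let ?a = "SOME a. rep m a"
    have rs: "rep m ?a" by (rule someI[of "rep m"]) (rule ra)
    have "?a b x = a b x" if x: "x \<in> Y" for x
    proof -
      have "(\<lambda>x. ?a b x - a b x) x = 0"
      proof (rule indep[of "\<lambda>b x. ?a b x - a b x", OF _ _ b x])
        show "\<forall>b. (\<lambda>x. ?a b x - a b x) \<in> polyfun"
        proof
          fix b
          show "(\<lambda>x. ?a b x - a b x) \<in> polyfun"
            by (rule polyfun_diff[OF rep_polyfun[OF rs] rep_polyfun[OF ra]])
        qed
        show "\<forall>P\<in>X. base_combination f e r (\<lambda>b x. ?a b x - a b x) P = 0"
        proof
          fix P assume P: "P \<in> X"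
          have "base_combination f e r ?a P = base_combination f e r a P"
            using rep_eq[OF rs P] rep_eq[OF ra P] by (rule trans[OF sym])
          then show "base_combination f e r (\<lambda>b x. ?a b x - a b x) P = 0"
            by (simp add: base_combination_def left_diff_distrib sum_subtractf)
        qed
      qed
      then show ?thesis by simp
    qed
    then show ?thesis using b unfolding c_def by (auto intro: restrict_eq)
  qed
  have c_0: "c b m = \<zero>\<^bsub>?R\<^esub>" if "\<not> b < r" for b m using that by (simp add: c_def)
  show ?thesis
  proof (rule flat_chart[OF M N, where c = c and ?M0.0 = M0 and e = "\<lambda>b. restrict (e b) X"])
    show "module_endo ?R ?M (mult_by X s)" by (rule module_endo_mult_by[OF s fY])
    show "M0 \<subseteq> carrier ?M" by (auto simp: M0_def)
    show "restrict (e b) X \<in> carrier ?M" for b by (simp add: e)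
    show "Poly_Mapping.keys t \<subseteq> N' \<times> carrier ?M" "t \<in> tensor_relations ?R N ?M" using t by auto
  next
    fix m assume "m \<in> M0"
    then obtain h a where h: "h \<in> polyfun" "m = restrict h X" "rep m a" using M0E by blast
    obtain a' where a': "\<forall>b. a' b \<in> polyfun" "\<forall>P\<in>X. s P * base_combination f e r a P = base_combination f e r a' P"
      using stable[of a] h(3) unfolding rep_def by blast
    show "mult_by X s m \<in> M0"
      unfolding h(2) mult_by_restrict
    proof (rule M0I[OF a'(1)])
      fix P assume P: "P \<in> X"
      have "h P = base_combination f e r a P" using rep_eq[OF h(3) P] P unfolding h(2) by simp
      then show "s P * h P = base_combination f e r a' P" using a'(2) P by simp
    qed
  next
    fix m m' assume "m \<in> M0" "m' \<in> M0"
    then obtain h a h' a' where h: "h \<in> polyfun" "m = restrict h X" "rep m a"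
      and h': "h' \<in> polyfun" "m' = restrict h' X" "rep m' a'" using M0E by metis
    have sum: "m \<oplus>\<^bsub>?M\<^esub> m' = restrict (\<lambda>x. h x + h' x) X" unfolding h(2) h'(2) by simp
    let ?a = "\<lambda>b x. a b x + a' b x"
    have pa: "\<forall>b. ?a b \<in> polyfun"
    proof
      fix b
      show "?a b \<in> polyfun" by (rule polyfun.add[OF rep_polyfun[OF h(3)] rep_polyfun[OF h'(3)]])
    qed
    have hs: "h P + h' P = base_combination f e r ?a P" if "P \<in> X" for P
    proof -
      have "h P = base_combination f e r a P" "h' P = base_combination f e r a' P"
        using rep_eq[OF h(3) that] rep_eq[OF h'(3) that] that unfolding h(2) h'(2) by simp_all
      then show ?thesis by (simp add: base_combination_def distrib_right sum.distrib)
    qed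
    show "m \<oplus>\<^bsub>?M\<^esub> m' \<in> M0" unfolding sum by (rule M0I[OF pa hs])
    have rs: "rep (m \<oplus>\<^bsub>?M\<^esub> m') ?a" unfolding sum rep_def using pa hs by simp
    fix b
    show "c b (m \<oplus>\<^bsub>?M\<^esub> m') = c b m \<oplus>\<^bsub>?R\<^esub> c b m'"
    proof (cases "b < r")
      case True
      show ?thesis unfolding c_eq[OF rs True] c_eq[OF h(3) True] c_eq[OF h'(3) True] by simp
    next
      case False
      show ?thesis unfolding c_0[OF False] by simp
    qed
  next
    fix q m assume q: "q \<in> carrier ?R" and "m \<in> M0"
    then obtain h a where h: "h \<in> polyfun" "m = restrict h X" "rep m a" using M0E by blast
    obtain g where g: "g \<in> polyfun" "q = restrict g Y" using q by auto
    have prod: "q \<odot>\<^bsub>?M\<^esub> m = restrict (\<lambda>x. g (f x) * h x) X" unfolding h(2) g(2) sm ..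
    let ?a = "\<lambda>b x. g x * a b x"
    have pa: "\<forall>b. ?a b \<in> polyfun"
    proof
      fix b
      show "?a b \<in> polyfun" by (rule polyfun.mult[OF g(1) rep_polyfun[OF h(3)]])
    qed
    have hs: "g (f P) * h P = base_combination f e r ?a P" if "P \<in> X" for P
    proof -
      have "h P = base_combination f e r a P" using rep_eq[OF h(3) that] that unfolding h(2) by simp
      then show ?thesis by (simp add: base_combination_def sum_distrib_left mult.assoc)
    qed
    show "q \<odot>\<^bsub>?M\<^esub> m \<in> M0" unfolding prod by (rule M0I[OF pa hs])
    have rs: "rep (q \<odot>\<^bsub>?M\<^esub> m) ?a" unfolding prod rep_def using pa hs by simp
    fix b
    show "c b (q \<odot>\<^bsub>?M\<^esub> m) = q \<otimes>\<^bsub>?R\<^esub> c b m"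
    proof (cases "b < r")
      case True
      show ?thesis unfolding c_eq[OF rs True] c_eq[OF h(3) True] by (simp add: g(2))
    next
      case False
      show ?thesis unfolding c_0[OF False] g(2) by simp
    qed
  next
    fix m assume "m \<in> carrier ?M"
    then obtain h where h: "h \<in> polyfun" "m = restrict h X" by auto
    obtain k a where a: "\<forall>b. a b \<in> polyfun" "\<forall>P\<in>X. s P ^ k * h P = base_combination f e r a P"
      using reach[OF h(1)] by blast
    have "(mult_by X s ^^ k) m \<in> M0"
      unfolding h(2) mult_by_funpow by (rule M0I[OF a(1)]) (use a(2) in blast)
    then show "\<exists>k. (mult_by X s ^^ k) m \<in> M0" by blast
  next
    fix b m assume "m \<in> M0"
    then obtain h a where h: "rep m a" using M0E by blast
    show "c b m \<in> carrier ?R"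
    proof (cases "b < r")
      case True
      show ?thesis unfolding c_eq[OF h True] by (rule coord_ring_elem[OF rep_polyfun[OF h]])
    next
      case False
      show ?thesis unfolding c_0[OF False] coord_ring_simps(3) by (rule coord_ring_elem[OF polyfun.const])
    qed
  next
    fix m assume "m \<in> M0"
    then obtain h a where h: "h \<in> polyfun" "m = restrict h X" "rep m a" using M0E by blast
    show "\<exists>F. finite F \<and> (\<forall>b. b \<notin> F \<longrightarrow> c b m = \<zero>\<^bsub>?R\<^esub>) \<and>
        m = finsum ?M (\<lambda>b. c b m \<odot>\<^bsub>?M\<^esub> restrict (e b) X) F"
    proof (intro exI[of _ "{..<r}"] conjI allI impI)
      fix b assume "b \<notin> {..<r}"
      then show "c b m = \<zero>\<^bsub>?R\<^esub>" using c_0 by simp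
    next
      let ?g = "\<lambda>b x. a b (f x) * e b x"
      have pg: "?g b \<in> polyfun" for b
      proof -
        show ?thesis by (rule polyfun.mult[OF polyfun_compose[OF rep_polyfun[OF h(3)] f] e[of b]])
      qed
      have "finsum ?M (\<lambda>b. c b m \<odot>\<^bsub>?M\<^esub> restrict (e b) X) {..<r} =
          finsum ?M (\<lambda>b. restrict (?g b) X) {..<r}"
      proof (rule abelian_monoid.finsum_cong')
        show "abelian_monoid ?M" using abelian_group_coord_module by (rule abelian_group.axioms(1))
        show "(\<lambda>b. restrict (?g b) X) \<in> {..<r} \<rightarrow> carrier ?M" using pg by simp
        fix b assume "b \<in> {..<r}"
        then have "b < r" by simp
        show "c b m \<odot>\<^bsub>?M\<^esub> restrict (e b) X = restrict (?g b) X"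
          unfolding c_eq[OF h(3) \<open>b < r\<close>] sm ..
      qed simp
      also have "\<dots> = restrict (\<lambda>x. \<Sum>b<r. ?g b x) X"
        by (rule finsum_coord_module) (use pg in auto)
      also have "\<dots> = m"
        unfolding h(2)
      proof (rule restrict_eq)
        fix P assume P: "P \<in> X"
        show "(\<Sum>b<r. ?g b P) = h P"
          using rep_eq[OF h(3) P] P unfolding h(2) by (simp add: base_combination_def)
      qed
      finally show "m = finsum ?M (\<lambda>b. c b m \<odot>\<^bsub>?M\<^esub> restrict (e b) X) {..<r}" ..
    qed simp
  qed
qed

lemma polyfun_closed_under:
  fixes D :: "(pt \<Rightarrow> complex) set"
  assumes one: "(\<lambda>_. 1) \<in> D"
    and add: "\<And>a b. a \<in> D \<Longrightarrow> b \<in> D \<Longrightarrow> (\<lambda>P. a P + b P) \<in> D"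
    and scale: "\<And>c a. a \<in> D \<Longrightarrow> (\<lambda>P. c * a P) \<in> D"
    and coord: "\<And>i a. a \<in> D \<Longrightarrow> (\<lambda>P. P i * a P) \<in> D"
    and h: "h \<in> polyfun"
  shows "h \<in> D"
proof -
  have "\<forall>a\<in>D. (\<lambda>P. h P * a P) \<in> D"
    using h
  proof (induction h rule: polyfun.induct)
    case (add u v)
    show ?case
    proof
      fix a assume "a \<in> D"
      have "(\<lambda>P. u P * a P + v P * a P) \<in> D"
        by (rule assms(2)[OF bspec[OF add.IH(1) \<open>a \<in> D\<close>] bspec[OF add.IH(2) \<open>a \<in> D\<close>]])
      then show "(\<lambda>P. (u P + v P) * a P) \<in> D" by (simp add: distrib_right)
    qed
  next
    case (mult u v)
    show ?case
    proof
      fix a assume "a \<in> D"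
      then have "(\<lambda>P. v P * a P) \<in> D" using mult by blast
      from bspec[OF mult.IH(1) this] have "(\<lambda>P. u P * (v P * a P)) \<in> D" .
      then show "(\<lambda>P. u P * v P * a P) \<in> D" by (simp add: mult.assoc)
    qed
  qed (use scale coord in auto)
  from bspec[OF this one] show ?thesis by simp
qed

definition triple :: "(pt \<Rightarrow> complex) \<Rightarrow> (pt \<Rightarrow> complex) \<Rightarrow> (pt \<Rightarrow> complex) \<Rightarrow> nat \<Rightarrow> pt \<Rightarrow> complex" where
  "triple a b c = (\<lambda>i. if i = 0 then a else if i = 1 then b else c)"

lemma base_combination_triple:
  "base_combination endo (triple u v w) 3 a P = a 0 (endo P) * u P + a 1 (endo P) * v P + a 2 (endo P) * w P"
  by (simp add: base_combination_def triple_def numeral_3_eq_3 numeral_2_eq_2)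

lemma triple_simps [simp]: "triple a b c 0 = a" "triple a b c (Suc 0) = b" "triple a b c 2 = c"
  by (simp_all add: triple_def)

lemma triple_polyfun: "a \<in> polyfun \<Longrightarrow> b \<in> polyfun \<Longrightarrow> c \<in> polyfun \<Longrightarrow> triple a b c i \<in> polyfun"
  by (simp add: triple_def)

lemma danielewski_square: "P \<in> danielewski n \<Longrightarrow> P 2 * P 2 = 1 + P 0 * P 0 * P 1"
  by (simp add: danielewski_def power2_eq_square)

text \<open>With \<open>u\<^sup>2 = P 1\<close> and \<open>s = P 2 + u P 0\<close> these are the formulas for \<open>s\<^sup>2 = s\<^sup>3 s\<^sup>-\<^sup>1\<close>.\<close>

lemma endo_relations:
  assumes P: "P \<in> danielewski n"
  shows "2 * P 1 * P 0 * P 0 = P 2 * endo P 2 - P 1 * P 0 * endo P 0 - 1"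
    "2 * P 0 * P 2 = endo P 0 * P 2 - endo P 2 * P 0"
    "2 * P 2 * P 2 = 1 + P 2 * endo P 2 - P 1 * P 0 * endo P 0"
proof -
  define x y z where "x = P 0" "y = P 2" "z = P 1"
  have R: "x * x * z = y * y - 1" using danielewski_square[OF P] by (simp add: x_y_z_def)
  have e: "endo P 0 = x * (4 * y * y - 1)" "endo P 2 = 4 * y * y * y - 3 * y"
    by (simp_all add: x_y_z_def power2_eq_square power3_eq_cube)
  have "y * (4 * y * y * y - 3 * y) - (x * x * z) * (4 * y * y - 1) - 1 = 2 * (x * x * z)"
    unfolding R by (simp add: algebra_simps)
  then have 1: "2 * z * x * x = y * endo P 2 - z * x * endo P 0 - 1"
    unfolding e by (simp add: algebra_simps)
  then show "2 * P 1 * P 0 * P 0 = P 2 * endo P 2 - P 1 * P 0 * endo P 0 - 1"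
    by (simp add: x_y_z_def)
  have "2 * x * y = endo P 0 * y - endo P 2 * x" unfolding e by (simp add: algebra_simps)
  then show "2 * P 0 * P 2 = endo P 0 * P 2 - endo P 2 * P 0" by (simp add: x_y_z_def)
  have yy: "y * y = 1 + x * x * z" using R by (simp add: algebra_simps)
  have "2 * y * y = 2 * (y * y)" by simp
  also have "\<dots> = 2 + 2 * z * x * x" unfolding yy by (simp add: algebra_simps)
  finally have "2 * y * y = 1 + y * endo P 2 - z * x * endo P 0" unfolding 1 by simp
  then show "2 * P 2 * P 2 = 1 + P 2 * endo P 2 - P 1 * P 0 * endo P 0" by (simp add: x_y_z_def)
qed

lemma halve: "2 * a * b = c \<Longrightarrow> a * b = c / (2::complex)"
  by (simp add: field_simps)

lemma halve3: "2 * a * b * d = c \<Longrightarrow> a * b * d = c / (2::complex)"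
  by (simp add: field_simps)

text \<open>
  By the last formula of \<open>endo_relations\<close>, \<open>y\<^sup>2\<close> is a combination of \<open>1, x, y\<close> whose coefficient at \<open>x\<close> is
  \<open>- x' z / 2\<close>, where \<open>x'\<close> is the first coordinate of the image. This does not vanish identically, so the claim follows from
  the independence of \<open>1, x, y\<close>.
\<close>

lemma cubic_basis_independent:
  assumes n: "n > 0" and a: "\<forall>b. a b \<in> polyfun"
    and z: "\<forall>P\<in>danielewski n. base_combination endo (triple (\<lambda>_. 1) (\<lambda>P. P 2) (\<lambda>P. P 2 * P 2)) 3 a P = 0"
    and P: "P \<in> danielewski n"
  shows "a 0 P = 0 \<and> a 1 P = 0 \<and> a 2 P = 0"
proof -
  let ?X = "danielewski n"
  define A where "A = (\<lambda>P. a 0 P + a 2 P * (1 / 2))"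
  define B where "B = (\<lambda>P. - (P 1 * P 0 * a 2 P) * (1 / 2))"
  define C where "C = (\<lambda>P. a 1 P + P 2 * a 2 P * (1 / 2))"
  have ap: "a 0 \<in> polyfun" "a 1 \<in> polyfun" "a 2 \<in> polyfun" using a by blast+
  have "A \<in> polyfun" unfolding A_def by (intro polyfun.add polyfun.mult polyfun.const ap)
  moreover have "B \<in> polyfun" unfolding B_def by (intro polyfun.mult polyfun_uminus polyfun.const polyfun.coord ap)
  moreover have "C \<in> polyfun" unfolding C_def by (intro polyfun.add polyfun.mult polyfun.const polyfun.coord ap)
  moreover have "A (endo P) + P 0 * B (endo P) + P 2 * C (endo P) = 0" if P: "P \<in> ?X" for P
  proof -
    have z': "a 0 (endo P) + a 1 (endo P) * P 2 + a 2 (endo P) * (P 2 * P 2) = 0"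
      using z[rule_format, OF P] unfolding base_combination_triple by (simp only: mult_1_right)
    have r: "P 2 * P 2 = (1 + P 2 * endo P 2 - P 1 * P 0 * endo P 0) / 2"
      by (rule halve[OF endo_relations(3)[OF P]])
    have e1: "endo P 1 = P 1" by (simp add: endo_def)
    have "A (endo P) + P 0 * B (endo P) + P 2 * C (endo P) = a 0 (endo P) + a 1 (endo P) * P 2 +
        a 2 (endo P) * ((1 + P 2 * endo P 2 - P 1 * P 0 * endo P 0) / 2)"
      unfolding A_def B_def C_def e1 by (simp add: field_simps del: endo_simps)
    then show ?thesis using z' unfolding r by (simp only:)
  qed
  ultimately have *: "A P = 0 \<and> B P = 0 \<and> C P = 0" if "P \<in> ?X" for P
    using endo_independent[OF n, of A B C P] that by blast
  define P1 :: pt where "P1 = (\<lambda>i. if i = 0 then 1 else if i = 1 then -1 else 0)"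
  have P1: "P1 \<in> ?X" "P1 1 * P1 0 \<noteq> 0" by (auto simp: P1_def danielewski_def aff_def)
  have "a 2 P = 0"
  proof (rule function_domainD[where a = "\<lambda>P. P 1 * P 0" and b = "a 2" and x = P and y = P1,
        OF function_domain_danielewski[OF n] _ ap(3) _ P1 P])
    show "(\<lambda>P. P 1 * P 0) \<in> polyfun" by (intro polyfun.mult polyfun.coord)
    fix x assume "x \<in> ?X"
    from *[OF this] show "x 1 * x 0 * a 2 x = 0" by (simp add: B_def)
  qed
  then show ?thesis using *[OF P] by (simp add: A_def C_def)
qed

text \<open>
  The formulas of \<open>endo_relations\<close> express \<open>x y\<close>, \<open>y\<^sup>2\<close> and \<open>z x\<^sup>2\<close> by \<open>1, x, y\<close>. So each multiplication by \<open>x\<close> costs one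
  factor \<open>z\<close>.
\<close>

lemma hyperbola_basis_spans:
  assumes h: "h \<in> polyfun"
  shows "\<exists>k a. (\<forall>b. a b \<in> polyfun) \<and>
    (\<forall>P\<in>danielewski n. P 1 ^ k * h P = base_combination endo (triple (\<lambda>_. 1) (\<lambda>P. P 0) (\<lambda>P. P 2)) 3 a P)"
proof -
  let ?X = "danielewski n"
  define D where "D = {h. \<exists>k u v w. u \<in> polyfun \<and> v \<in> polyfun \<and> w \<in> polyfun \<and>
    (\<forall>P\<in>?X. P 1 ^ k * h P = u (endo P) + v (endo P) * P 0 + w (endo P) * P 2)}"
  have DI: "h \<in> D" if "u \<in> polyfun" "v \<in> polyfun" "w \<in> polyfun"
    "\<And>P. P \<in> ?X \<Longrightarrow> P 1 ^ k * h P = u (endo P) + v (endo P) * P 0 + w (endo P) * P 2" for h k u v w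
    unfolding D_def using that by blast
  have DE: "\<exists>k u v w. u \<in> polyfun \<and> v \<in> polyfun \<and> w \<in> polyfun \<and>
    (\<forall>P\<in>?X. P 1 ^ k * h P = u (endo P) + v (endo P) * P 0 + w (endo P) * P 2)" if "h \<in> D" for h
    using that unfolding D_def by simp
  have e1: "endo P 1 = P 1" for P by (simp add: endo_def)
  have "h \<in> D"
  proof (rule polyfun_closed_under[OF _ _ _ _ h])
    show "(\<lambda>_. 1) \<in> D"
      by (rule DI[of "\<lambda>_. 1" "\<lambda>_. 0" "\<lambda>_. 0" 0]) (simp_all add: polyfun.const)
  next
    fix f g assume "f \<in> D" "g \<in> D"
    then obtain k u v w k' u' v' w' where p: "u \<in> polyfun" "v \<in> polyfun" "w \<in> polyfun"
      "u' \<in> polyfun" "v' \<in> polyfun" "w' \<in> polyfun"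
      and f: "\<forall>P\<in>?X. P 1 ^ k * f P = u (endo P) + v (endo P) * P 0 + w (endo P) * P 2"
      and g: "\<forall>P\<in>?X. P 1 ^ k' * g P = u' (endo P) + v' (endo P) * P 0 + w' (endo P) * P 2"
      using DE[of f] DE[of g] by metis
    have q: "(\<lambda>P. P 1 ^ k' * a P + P 1 ^ k * b P) \<in> polyfun" if "a \<in> polyfun" "b \<in> polyfun" for a b
      by (intro polyfun.add polyfun.mult polyfun_power polyfun.coord that)
    show "(\<lambda>P. f P + g P) \<in> D"
    proof (rule DI[OF q[OF p(1,4)] q[OF p(2,5)] q[OF p(3,6)]])
      fix P assume P: "P \<in> ?X"
      have "P 1 ^ (k + k') * (f P + g P) = P 1 ^ k' * (P 1 ^ k * f P) + P 1 ^ k * (P 1 ^ k' * g P)"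
        by (simp add: power_add algebra_simps)
      also have "\<dots> = P 1 ^ k' * (u (endo P) + v (endo P) * P 0 + w (endo P) * P 2) +
          P 1 ^ k * (u' (endo P) + v' (endo P) * P 0 + w' (endo P) * P 2)"
        using f g P by simp
      finally show "P 1 ^ (k + k') * (f P + g P) =
        (endo P 1 ^ k' * u (endo P) + endo P 1 ^ k * u' (endo P)) +
        (endo P 1 ^ k' * v (endo P) + endo P 1 ^ k * v' (endo P)) * P 0 +
        (endo P 1 ^ k' * w (endo P) + endo P 1 ^ k * w' (endo P)) * P 2"
        unfolding e1 by (simp add: algebra_simps)
    qed
  next
    fix c :: complex and f assume "f \<in> D"
    then obtain k u v w where p: "u \<in> polyfun" "v \<in> polyfun" "w \<in> polyfun"
      and f: "\<forall>P\<in>?X. P 1 ^ k * f P = u (endo P) + v (endo P) * P 0 + w (endo P) * P 2"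
      using DE by blast
    have q: "(\<lambda>P. c * a P) \<in> polyfun" if "a \<in> polyfun" for a
      by (rule polyfun.mult[OF polyfun.const that])
    show "(\<lambda>P. c * f P) \<in> D"
    proof (rule DI[OF q[OF p(1)] q[OF p(2)] q[OF p(3)]])
      fix P assume P: "P \<in> ?X"
      have "P 1 ^ k * (c * f P) = c * (P 1 ^ k * f P)" by simp
      also have "\<dots> = c * (u (endo P) + v (endo P) * P 0 + w (endo P) * P 2)" using f P by simp
      finally show "P 1 ^ k * (c * f P) = c * u (endo P) + c * v (endo P) * P 0 + c * w (endo P) * P 2"
        by (simp add: algebra_simps)
    qed
  next
    fix i :: nat and f assume "f \<in> D"
    then obtain k u v w where p: "u \<in> polyfun" "v \<in> polyfun" "w \<in> polyfun"
      and f: "\<forall>P\<in>?X. P 1 ^ k * f P = u (endo P) + v (endo P) * P 0 + w (endo P) * P 2"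
      using DE by blast
    consider "i = 0" | "i = 2" | "i \<noteq> 0" "i \<noteq> 2" by blast
    then show "(\<lambda>P. P i * f P) \<in> D"
    proof cases
      case 1
      show ?thesis
      proof (rule DI[where k = "Suc k" and u = "\<lambda>Q. - (1 / 2) * v Q"
            and v = "\<lambda>Q. Q 1 * u Q - Q 1 * Q 0 * v Q * (1 / 2) - Q 1 * Q 2 * w Q * (1 / 2)"
            and w = "\<lambda>Q. Q 2 * v Q * (1 / 2) + Q 1 * Q 0 * w Q * (1 / 2)"])
        show "(\<lambda>Q. - (1 / 2) * v Q) \<in> polyfun" by (intro polyfun.mult polyfun.const p)
        show "(\<lambda>Q. Q 1 * u Q - Q 1 * Q 0 * v Q * (1 / 2) - Q 1 * Q 2 * w Q * (1 / 2)) \<in> polyfun"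
          by (intro polyfun_diff polyfun.mult polyfun.const polyfun.coord p)
        show "(\<lambda>Q. Q 2 * v Q * (1 / 2) + Q 1 * Q 0 * w Q * (1 / 2)) \<in> polyfun"
          by (intro polyfun.add polyfun.mult polyfun.const polyfun.coord p)
        fix P assume P: "P \<in> ?X"
        define U V W where "U = u (endo P)" "V = v (endo P)" "W = w (endo P)"
        have f': "P 1 ^ k * f P = U + V * P 0 + W * P 2" using f P by (simp add: U_V_W_def)
        have r1: "P 1 * P 0 * P 0 = (P 2 * endo P 2 - P 1 * P 0 * endo P 0 - 1) / 2"
          by (rule halve3[OF endo_relations(1)[OF P]])
        have r2: "P 0 * P 2 = (endo P 0 * P 2 - endo P 2 * P 0) / 2"
          by (rule halve[OF endo_relations(2)[OF P]])
        have "P 1 ^ Suc k * (P 0 * f P) = P 1 * P 0 * (P 1 ^ k * f P)" by simp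
        also have "\<dots> = P 1 * P 0 * U + V * (P 1 * P 0 * P 0) + P 1 * W * (P 0 * P 2)"
          unfolding f' by (simp add: algebra_simps)
        also have "\<dots> = - (1 / 2) * V + (P 1 * U - P 1 * endo P 0 * V * (1 / 2) - P 1 * endo P 2 * W * (1 / 2)) * P 0 +
            (endo P 2 * V * (1 / 2) + P 1 * endo P 0 * W * (1 / 2)) * P 2"
          unfolding r1 r2 by (simp add: field_simps del: endo_simps)
        finally show "P 1 ^ Suc k * (P i * f P) = - (1 / 2) * v (endo P) +
            (endo P 1 * u (endo P) - endo P 1 * endo P 0 * v (endo P) * (1 / 2) - endo P 1 * endo P 2 * w (endo P) * (1 / 2)) * P 0 +
            (endo P 2 * v (endo P) * (1 / 2) + endo P 1 * endo P 0 * w (endo P) * (1 / 2)) * P 2"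
          unfolding 1 e1 U_V_W_def .
      qed
    next
      case 2
      show ?thesis
      proof (rule DI[where k = k and u = "\<lambda>Q. (1 / 2) * w Q"
            and v = "\<lambda>Q. - (1 / 2) * Q 2 * v Q - Q 1 * Q 0 * w Q * (1 / 2)"
            and w = "\<lambda>Q. u Q + Q 0 * v Q * (1 / 2) + Q 2 * w Q * (1 / 2)"])
        show "(\<lambda>Q. (1 / 2) * w Q) \<in> polyfun" by (intro polyfun.mult polyfun.const p)
        show "(\<lambda>Q. - (1 / 2) * Q 2 * v Q - Q 1 * Q 0 * w Q * (1 / 2)) \<in> polyfun"
          by (intro polyfun_diff polyfun.mult polyfun.const polyfun.coord p)
        show "(\<lambda>Q. u Q + Q 0 * v Q * (1 / 2) + Q 2 * w Q * (1 / 2)) \<in> polyfun"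
          by (intro polyfun.add polyfun.mult polyfun.const polyfun.coord p)
        fix P assume P: "P \<in> ?X"
        define U V W where "U = u (endo P)" "V = v (endo P)" "W = w (endo P)"
        have f': "P 1 ^ k * f P = U + V * P 0 + W * P 2" using f P by (simp add: U_V_W_def)
        have r2: "P 0 * P 2 = (endo P 0 * P 2 - endo P 2 * P 0) / 2"
          by (rule halve[OF endo_relations(2)[OF P]])
        have r3: "P 2 * P 2 = (1 + P 2 * endo P 2 - P 1 * P 0 * endo P 0) / 2"
          by (rule halve[OF endo_relations(3)[OF P]])
        have "P 1 ^ k * (P 2 * f P) = P 2 * (P 1 ^ k * f P)" by simp
        also have "\<dots> = P 2 * U + V * (P 0 * P 2) + W * (P 2 * P 2)"
          unfolding f' by (simp add: algebra_simps)
        also have "\<dots> = (1 / 2) * W + (- (1 / 2) * endo P 2 * V - P 1 * endo P 0 * W * (1 / 2)) * P 0 +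
            (U + endo P 0 * V * (1 / 2) + endo P 2 * W * (1 / 2)) * P 2"
          unfolding r2 r3 by (simp add: field_simps del: endo_simps)
        finally show "P 1 ^ k * (P i * f P) = (1 / 2) * w (endo P) +
            (- (1 / 2) * endo P 2 * v (endo P) - endo P 1 * endo P 0 * w (endo P) * (1 / 2)) * P 0 +
            (u (endo P) + endo P 0 * v (endo P) * (1 / 2) + endo P 2 * w (endo P) * (1 / 2)) * P 2"
          unfolding 2 e1 U_V_W_def .
      qed
    next
      case 3
      have q: "(\<lambda>P. P i * a P) \<in> polyfun" if "a \<in> polyfun" for a
        by (rule polyfun.mult[OF polyfun.coord that])
      show ?thesis
      proof (rule DI[OF q[OF p(1)] q[OF p(2)] q[OF p(3)]])
        fix P assume P: "P \<in> ?X"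
        have "P 1 ^ k * (P i * f P) = P i * (P 1 ^ k * f P)" by simp
        also have "\<dots> = P i * (u (endo P) + v (endo P) * P 0 + w (endo P) * P 2)" using f P by simp
        finally show "P 1 ^ k * (P i * f P) =
            endo P i * u (endo P) + endo P i * v (endo P) * P 0 + endo P i * w (endo P) * P 2"
          unfolding endo_simps(4)[OF 3] by (simp add: algebra_simps)
      qed
    qed
  qed
  from DE[OF this] obtain k u v w where p: "u \<in> polyfun" "v \<in> polyfun" "w \<in> polyfun"
    and f: "\<forall>P\<in>?X. P 1 ^ k * h P = u (endo P) + v (endo P) * P 0 + w (endo P) * P 2" by blast
  show ?thesis
  proof (intro exI[of _ k] exI[of _ "triple u v w"] conjI allI ballI)
    show "triple u v w b \<in> polyfun" for b by (rule triple_polyfun[OF p])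
    show "P 1 ^ k * h P = base_combination endo (triple (\<lambda>_. 1) (\<lambda>P. P 0) (\<lambda>P. P 2)) 3 (triple u v w) P" if "P \<in> ?X" for P
      unfolding base_combination_triple using f that by simp
  qed
qed

text \<open>
  The coordinate \<open>y\<close> is a zero of the cubic polynomial \<open>4 Y\<^sup>3 - 3 Y - y'\<close> over the image, and \<open>(4 y\<^sup>2 - 1) x\<close> is in
  the image.
\<close>

lemma cubic_basis_spans:
  assumes h: "h \<in> polyfun"
  shows "\<exists>k a. (\<forall>b. a b \<in> polyfun) \<and> (\<forall>P\<in>danielewski n. (4 * P 2 ^ 2 - 1) ^ k * h P =
    base_combination endo (triple (\<lambda>_. 1) (\<lambda>P. P 2) (\<lambda>P. P 2 * P 2)) 3 a P)"
proof -
  let ?X = "danielewski n"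
  let ?g = "\<lambda>P::pt. 4 * P 2 ^ 2 - 1"
  define L where "L = {h. \<exists>u v w. u \<in> polyfun \<and> v \<in> polyfun \<and> w \<in> polyfun \<and>
    (\<forall>P. h P = u (endo P) + v (endo P) * P 2 + w (endo P) * (P 2 * P 2))}"
  have LI: "h \<in> L" if "u \<in> polyfun" "v \<in> polyfun" "w \<in> polyfun"
    "\<And>P. h P = u (endo P) + v (endo P) * P 2 + w (endo P) * (P 2 * P 2)" for h u v w
    unfolding L_def using that by blast
  have LE: "\<exists>u v w. u \<in> polyfun \<and> v \<in> polyfun \<and> w \<in> polyfun \<and>
    (\<forall>P. h P = u (endo P) + v (endo P) * P 2 + w (endo P) * (P 2 * P 2))" if "h \<in> L" for h
    using that unfolding L_def by simp
  have L_add: "(\<lambda>P. f P + g P) \<in> L" if fg: "f \<in> L" "g \<in> L" for f g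
  proof -
    obtain u v w where p: "u \<in> polyfun" "v \<in> polyfun" "w \<in> polyfun"
      and f: "\<forall>P. f P = u (endo P) + v (endo P) * P 2 + w (endo P) * (P 2 * P 2)" using LE[OF fg(1)] by blast
    obtain u' v' w' where p': "u' \<in> polyfun" "v' \<in> polyfun" "w' \<in> polyfun"
      and g: "\<forall>P. g P = u' (endo P) + v' (endo P) * P 2 + w' (endo P) * (P 2 * P 2)" using LE[OF fg(2)] by blast
    show ?thesis
      by (rule LI[OF polyfun.add[OF p(1) p'(1)] polyfun.add[OF p(2) p'(2)] polyfun.add[OF p(3) p'(3)]])
         (simp add: f g algebra_simps)
  qed
  have L_base: "(\<lambda>P. r (endo P) * f P) \<in> L" if r: "r \<in> polyfun" and f: "f \<in> L" for r f
  proof -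
    obtain u v w where p: "u \<in> polyfun" "v \<in> polyfun" "w \<in> polyfun"
      and f: "\<forall>P. f P = u (endo P) + v (endo P) * P 2 + w (endo P) * (P 2 * P 2)" using LE[OF f] by blast
    show ?thesis
      by (rule LI[OF polyfun.mult[OF r p(1)] polyfun.mult[OF r p(2)] polyfun.mult[OF r p(3)]])
         (simp add: f algebra_simps)
  qed
  have L_y: "(\<lambda>P. P 2 * f P) \<in> L" if f: "f \<in> L" for f
  proof -
    obtain u v w where p: "u \<in> polyfun" "v \<in> polyfun" "w \<in> polyfun"
      and f: "\<forall>P. f P = u (endo P) + v (endo P) * P 2 + w (endo P) * (P 2 * P 2)" using LE[OF f] by blast
    show ?thesis
    proof (rule LI[where u = "\<lambda>Q. Q 2 * w Q * (1 / 4)" and v = "\<lambda>Q. u Q + w Q * (3 / 4)" and w = v])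
      show "(\<lambda>Q. Q 2 * w Q * (1 / 4)) \<in> polyfun" by (intro polyfun.mult polyfun.const polyfun.coord p)
      show "(\<lambda>Q. u Q + w Q * (3 / 4)) \<in> polyfun" by (intro polyfun.add polyfun.mult polyfun.const p)
      fix P
      have c: "P 2 * (P 2 * P 2) = endo P 2 * (1 / 4) + (3 / 4) * P 2"
        by (simp add: power3_eq_cube field_simps)
      have "P 2 * f P = u (endo P) * P 2 + v (endo P) * (P 2 * P 2) + w (endo P) * (P 2 * (P 2 * P 2))"
        by (simp add: f algebra_simps)
      then show "P 2 * f P = endo P 2 * w (endo P) * (1 / 4) + (u (endo P) + w (endo P) * (3 / 4)) * P 2 +
          v (endo P) * (P 2 * P 2)"
        unfolding c by (simp add: algebra_simps del: endo_simps)
    qed (rule p)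
  qed
  have L_g: "(\<lambda>P. ?g P * f P) \<in> L" if f: "f \<in> L" for f
  proof -
    have 1: "(\<lambda>P. 4 * (P 2 * (P 2 * f P))) \<in> L"
      using L_base[OF polyfun.const[of 4] L_y[OF L_y[OF f]]] .
    have 2: "(\<lambda>P. -1 * f P) \<in> L" using L_base[OF polyfun.const[of "-1"] f] .
    from L_add[OF 1 2] show ?thesis by (simp add: power2_eq_square algebra_simps)
  qed
  have L_gk: "(\<lambda>P. ?g P ^ k * f P) \<in> L" if f: "f \<in> L" for f k
  proof (induction k)
    case (Suc k)
    from L_g[OF Suc] show ?case by (simp add: mult.assoc)
  qed (use f in simp)
  have one: "(\<lambda>_. 1) \<in> L"
    by (rule LI[of "\<lambda>_. 1" "\<lambda>_. 0" "\<lambda>_. 0"]) (simp_all add: polyfun.const)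
  define D where "D = {h. \<exists>k. (\<lambda>P. ?g P ^ k * h P) \<in> L}"
  have "h \<in> D"
  proof (rule polyfun_closed_under[OF _ _ _ _ h])
    show "(\<lambda>_. 1) \<in> D" unfolding D_def using one by (auto intro: exI[of _ 0])
  next
    fix f g assume "f \<in> D" "g \<in> D"
    then obtain k l where kl: "(\<lambda>P. ?g P ^ k * f P) \<in> L" "(\<lambda>P. ?g P ^ l * g P) \<in> L" unfolding D_def by blast
    have "(\<lambda>P. ?g P ^ (k + l) * (f P + g P)) \<in> L"
      using L_add[OF L_gk[OF kl(1), of l] L_gk[OF kl(2), of k]] by (simp add: power_add algebra_simps)
    then show "(\<lambda>P. f P + g P) \<in> D" unfolding D_def by blast
  next
    fix c :: complex and f assume "f \<in> D"
    then obtain k where k: "(\<lambda>P. ?g P ^ k * f P) \<in> L" unfolding D_def by blast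
    have "(\<lambda>P. ?g P ^ k * (c * f P)) \<in> L"
      using L_base[OF polyfun.const[of c] k] by (simp add: mult.left_commute)
    then show "(\<lambda>P. c * f P) \<in> D" unfolding D_def by blast
  next
    fix i :: nat and f assume "f \<in> D"
    then obtain k where k: "(\<lambda>P. ?g P ^ k * f P) \<in> L" unfolding D_def by blast
    consider "i = 0" | "i = 2" | "i \<noteq> 0" "i \<noteq> 2" by blast
    then show "(\<lambda>P. P i * f P) \<in> D"
    proof cases
      case 1
      have "(\<lambda>P. ?g P ^ Suc k * (P 0 * f P)) \<in> L"
        using L_base[OF polyfun.coord[of 0] k] by (simp add: algebra_simps)
      then show ?thesis unfolding D_def 1 by blast
    next
      case 2
      have "(\<lambda>P. ?g P ^ k * (P 2 * f P)) \<in> L"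
        using L_y[OF k] by (simp add: mult.left_commute)
      then show ?thesis unfolding D_def 2 by blast
    next
      case 3
      have "(\<lambda>P. ?g P ^ k * (P i * f P)) \<in> L"
        using L_base[OF polyfun.coord[of i] k] unfolding endo_simps(4)[OF 3] by (simp add: mult.left_commute)
      then show ?thesis unfolding D_def by blast
    qed
  qed
  then obtain k where "(\<lambda>P. ?g P ^ k * h P) \<in> L" unfolding D_def by blast
  from LE[OF this] obtain u v w where p: "u \<in> polyfun" "v \<in> polyfun" "w \<in> polyfun"
    and f: "\<forall>P. ?g P ^ k * h P = u (endo P) + v (endo P) * P 2 + w (endo P) * (P 2 * P 2)" by blast
  show ?thesis
  proof (intro exI[of _ k] exI[of _ "triple u v w"] conjI allI ballI)
    show "triple u v w b \<in> polyfun" for b by (rule triple_polyfun[OF p])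
    show "?g P ^ k * h P = base_combination endo (triple (\<lambda>_. 1) (\<lambda>P. P 2) (\<lambda>P. P 2 * P 2)) 3 (triple u v w) P" for P
      unfolding base_combination_triple using f by simp
  qed
qed

lemma bezout_power:
  assumes ab: "a \<in> polyfun" "b \<in> polyfun"
    and pq: "p \<in> polyfun" "q \<in> polyfun" "\<And>x. x \<in> X \<Longrightarrow> p x * a x + q x * b x = 1"
  shows "\<exists>p\<in>polyfun. \<exists>q\<in>polyfun. \<forall>x\<in>X. p x * a x ^ k + q x * b x = (1::complex)"
proof (induction k)
  case 0
  show ?case by (rule bexI[of _ "\<lambda>_. 1"], rule bexI[of _ "\<lambda>_. 0"]) (auto intro: polyfun.const)
next
  case (Suc k)
  then obtain r s where rs: "r \<in> polyfun" "s \<in> polyfun" "\<forall>x\<in>X. r x * a x ^ k + s x * b x = 1" by blast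
  show ?case
  proof (rule bexI[of _ "\<lambda>x. p x * r x"], rule bexI[of _ "\<lambda>x. p x * a x * s x + q x"], intro ballI)
    fix x assume x: "x \<in> X"
    have "p x * r x * a x ^ Suc k + (p x * a x * s x + q x) * b x =
        p x * a x * (r x * a x ^ k + s x * b x) + q x * b x" by (simp add: algebra_simps)
    then show "p x * r x * a x ^ Suc k + (p x * a x * s x + q x) * b x = 1" using rs(3) pq(3) x by simp
  qed (intro polyfun.add polyfun.mult ab pq rs)+
qed

lemma bezout_powers:
  assumes ab: "a \<in> polyfun" "b \<in> polyfun"
    and pq: "p \<in> polyfun" "q \<in> polyfun" "\<And>x. x \<in> X \<Longrightarrow> p x * a x + q x * b x = 1"
  shows "\<exists>p\<in>polyfun. \<exists>q\<in>polyfun. \<forall>x\<in>X. p x * a x ^ k + q x * b x ^ l = (1::complex)"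
proof -
  obtain r s where rs: "r \<in> polyfun" "s \<in> polyfun" "\<forall>x\<in>X. r x * a x ^ k + s x * b x = 1"
    using bezout_power[OF ab pq] by blast
  have "\<exists>p\<in>polyfun. \<exists>q\<in>polyfun. \<forall>x\<in>X. p x * b x ^ l + q x * a x ^ k = 1"
  proof (rule bezout_power[OF ab(2) polyfun_power[OF ab(1)] rs(2,1)])
    fix x assume "x \<in> X"
    then show "s x * b x + r x * a x ^ k = 1" using rs(3) by (simp add: add.commute)
  qed
  then obtain p q where "p \<in> polyfun" "q \<in> polyfun" "\<forall>x\<in>X. p x * b x ^ l + q x * a x ^ k = 1" by blast
  then show ?thesis by (intro bexI[of _ q] bexI[of _ p]) (auto simp: add.commute)
qed

text \<open>
  The functions \<open>z\<close> and \<open>4 y\<^sup>2 - 1\<close>, for which there are bases, generate the unit ideal: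
  \<open>- 4 x\<^sup>2 z / 3 + (4 y\<^sup>2 - 1) / 3 = 1\<close>.
\<close>

lemma flat_endo:
  assumes n: "n > 0"
  shows "flat_morphism (danielewski n) (danielewski n) endo"
proof -
  let ?X = "danielewski n"
  let ?R = "coord_ring ?X" and ?M = "coord_module ?X endo"
  have M: "module ?R ?M" by (rule module_coord_module[OF polyfun_endo endo_danielewski])
  let ?z = "\<lambda>P::pt. P 1" and ?g = "\<lambda>P::pt. 4 * P 2 ^ 2 - 1"
  have zp: "?z \<in> polyfun" by (rule polyfun.coord)
  have gp: "?g \<in> polyfun" by (intro polyfun_intros)
  have yp: "(\<lambda>P. P 2 * P 2) \<in> polyfun" by (intro polyfun.mult polyfun.coord)
  let ?e = "triple (\<lambda>_. 1) (\<lambda>P. P 0) (\<lambda>P. P 2)" and ?e' = "triple (\<lambda>_. 1) (\<lambda>P. P 2) (\<lambda>P. P 2 * P 2)"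
  have ep: "?e b \<in> polyfun" for b by (rule triple_polyfun[OF polyfun.const polyfun.coord polyfun.coord])
  have ep': "?e' b \<in> polyfun" for b by (rule triple_polyfun[OF polyfun.const polyfun.coord yp])
  have b3: "b = 0 \<or> b = 1 \<or> b = 2" if "b < 3" for b :: nat using that by auto
  have flat: "t \<in> tensor_relations ?R (N\<lparr>carrier := N'\<rparr>) ?M"
    if N: "module ?R N" "submodule N' ?R N"
      and t: "Poly_Mapping.keys t \<subseteq> N' \<times> carrier ?M" "t \<in> tensor_relations ?R N ?M"
    for N :: "(pt \<Rightarrow> complex, pt \<Rightarrow> complex) module" and N' t
  proof -
    have "\<exists>k. tensor_map (mult_by ?X ?z ^^ k) t \<in> tensor_relations ?R (N\<lparr>carrier := N'\<rparr>) ?M"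
    proof (rule flat_free_chart[OF polyfun_endo endo_danielewski zp ep _ _ _ N t, where r = 3])
      fix a :: "nat \<Rightarrow> pt \<Rightarrow> complex" and b :: nat and x assume a: "\<forall>b. a b \<in> polyfun" and z: "\<forall>P\<in>?X. base_combination endo ?e 3 a P = 0"
        and b: "b < 3" and x: "x \<in> ?X"
      have ap: "a 0 \<in> polyfun" "a 1 \<in> polyfun" "a 2 \<in> polyfun" using a by blast+
      have "a 0 x = 0 \<and> a 1 x = 0 \<and> a 2 x = 0"
      proof (rule endo_independent[OF n ap _ x])
        fix P assume "P \<in> ?X"
        with z have "base_combination endo ?e 3 a P = 0" by blast
        then show "a 0 (endo P) + P 0 * a 1 (endo P) + P 2 * a 2 (endo P) = 0"
          unfolding base_combination_triple by (simp add: mult.commute)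
      qed
      then show "a b x = 0" using b3[OF b] by auto
    next
      fix a :: "nat \<Rightarrow> pt \<Rightarrow> complex" assume a: "\<forall>b. a b \<in> polyfun"
      show "\<exists>a'. (\<forall>b. a' b \<in> polyfun) \<and>
          (\<forall>P\<in>?X. P 1 * base_combination endo ?e 3 a P = base_combination endo ?e 3 a' P)"
      proof (intro exI[of _ "\<lambda>b Q. Q 1 * a b Q"] conjI allI ballI)
        fix b :: nat
        have "a b \<in> polyfun" using a by blast
        then show "(\<lambda>Q. Q 1 * a b Q) \<in> polyfun" by (rule polyfun.mult[OF polyfun.coord])
      next
        fix P
        have "endo P 1 = P 1" by (simp add: endo_def)
        then show "P 1 * base_combination endo ?e 3 a P = base_combination endo ?e 3 (\<lambda>b Q. Q 1 * a b Q) P"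
          unfolding base_combination_triple by (simp only:) (simp add: algebra_simps)
      qed
    next
      fix h :: "pt \<Rightarrow> complex" assume "h \<in> polyfun"
      then show "\<exists>k a. (\<forall>b. a b \<in> polyfun) \<and> (\<forall>P\<in>?X. P 1 ^ k * h P = base_combination endo ?e 3 a P)"
        by (rule hyperbola_basis_spans)
    qed
    then obtain k where k: "tensor_map (mult_by ?X ?z ^^ k) t \<in> tensor_relations ?R (N\<lparr>carrier := N'\<rparr>) ?M" ..
    have "\<exists>k. tensor_map (mult_by ?X ?g ^^ k) t \<in> tensor_relations ?R (N\<lparr>carrier := N'\<rparr>) ?M"
    proof (rule flat_free_chart[OF polyfun_endo endo_danielewski gp ep' _ _ _ N t, where r = 3])
      fix a :: "nat \<Rightarrow> pt \<Rightarrow> complex" and b :: nat and x assume a: "\<forall>b. a b \<in> polyfun" and z: "\<forall>P\<in>?X. base_combination endo ?e' 3 a P = 0"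
        and b: "b < 3" and x: "x \<in> ?X"
      have "a 0 x = 0 \<and> a 1 x = 0 \<and> a 2 x = 0" by (rule cubic_basis_independent[OF n a z x])
      then show "a b x = 0" using b3[OF b] by auto
    next
      fix a :: "nat \<Rightarrow> pt \<Rightarrow> complex" assume a: "\<forall>b. a b \<in> polyfun"
      let ?u = "a 0" and ?v = "a 1" and ?w = "a 2"
      have p: "?u \<in> polyfun" "?v \<in> polyfun" "?w \<in> polyfun" using a by blast+
      \<comment> \<open>Multiplication by \<open>4 y\<^sup>2 - 1\<close> with respect to \<open>1, y, y\<^sup>2\<close>, using \<open>4 y\<^sup>3 = y' + 3 y\<close>.\<close>
      let ?a = "triple (\<lambda>Q. Q 2 * ?v Q - ?u Q) (\<lambda>Q. Q 2 * ?w Q + 2 * ?v Q) (\<lambda>Q. 4 * ?u Q + 2 * ?w Q)"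
      have pa: "?a b \<in> polyfun" for b
        by (rule triple_polyfun) (intro polyfun.add polyfun_diff polyfun.mult polyfun.const polyfun.coord p)+
      have eq: "?g P * base_combination endo ?e' 3 a P = base_combination endo ?e' 3 ?a P" for P
        unfolding base_combination_triple by (simp add: power2_eq_square power3_eq_cube algebra_simps)
      show "\<exists>a'. (\<forall>b. a' b \<in> polyfun) \<and>
          (\<forall>P\<in>?X. ?g P * base_combination endo ?e' 3 a P = base_combination endo ?e' 3 a' P)"
        by (intro exI[of _ ?a] conjI allI ballI pa eq)
    next
      fix h :: "pt \<Rightarrow> complex" assume "h \<in> polyfun"
      then show "\<exists>k a. (\<forall>b. a b \<in> polyfun) \<and> (\<forall>P\<in>?X. ?g P ^ k * h P = base_combination endo ?e' 3 a P)"
        by (rule cubic_basis_spans)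
    qed
    then obtain l where l: "tensor_map (mult_by ?X ?g ^^ l) t \<in> tensor_relations ?R (N\<lparr>carrier := N'\<rparr>) ?M" ..
    have "\<exists>p\<in>polyfun. \<exists>q\<in>polyfun. \<forall>P\<in>?X. p P * ?z P ^ k + q P * ?g P ^ l = 1"
    proof (rule bezout_powers[OF zp gp])
      show "(\<lambda>P. - (4 / 3) * P 0 * P 0) \<in> polyfun" by (intro polyfun.mult polyfun.const polyfun.coord)
      show "(\<lambda>_. 1 / 3) \<in> polyfun" by (rule polyfun.const)
      fix P assume "P \<in> ?X"
      then have "P 2 ^ 2 = 1 + P 0 * P 0 * P 1" using danielewski_square by (simp add: power2_eq_square)
      then show "- (4 / 3) * P 0 * P 0 * P 1 + 1 / 3 * (4 * P 2 ^ 2 - 1) = 1" by (simp add: field_simps)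
    qed
    then obtain p q where pq: "p \<in> polyfun" "q \<in> polyfun" "\<forall>P\<in>?X. p P * ?z P ^ k + q P * ?g P ^ l = 1" by blast
    show ?thesis
    proof (rule flat_glue[OF _ k l])
      have "N' \<subseteq> carrier (N\<lparr>carrier := N'\<rparr>)" by simp
      then show "Poly_Mapping.keys t \<subseteq> carrier (N\<lparr>carrier := N'\<rparr>) \<times> carrier ?M" using t(1) by auto
      show "module_endo ?R ?M (mult_by ?X p)" "module_endo ?R ?M (mult_by ?X q)"
        by (rule module_endo_mult_by[OF pq(1) endo_danielewski], simp,
            rule module_endo_mult_by[OF pq(2) endo_danielewski], simp)
      show "module_endo ?R ?M (mult_by ?X ?z ^^ k)"
        by (rule module_endo_funpow, rule module_endo_mult_by[OF zp endo_danielewski])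
      show "module_endo ?R ?M (mult_by ?X ?g ^^ l)"
        by (rule module_endo_funpow, rule module_endo_mult_by[OF gp endo_danielewski])
      fix m assume "m \<in> carrier ?M"
      then obtain h where h: "m = restrict h ?X" by auto
      show "m = mult_by ?X p ((mult_by ?X ?z ^^ k) m) \<oplus>\<^bsub>?M\<^esub> mult_by ?X q ((mult_by ?X ?g ^^ l) m)"
        unfolding h mult_by_funpow mult_by_restrict coord_module_simps(3)
      proof (rule restrict_eq)
        fix P assume "P \<in> ?X"
        then have "(p P * ?z P ^ k + q P * ?g P ^ l) * h P = h P" using pq(3) by simp
        then show "h P = p P * (P 1 ^ k * h P) + q P * (?g P ^ l * h P)" by (simp add: algebra_simps)
      qed
    qed
  qed
  show ?thesis
    unfolding flat_morphism_def flat_module_def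
    using morphismI[of endo ?X ?X, OF polyfun_endo endo_danielewski] M flat by blast
qed

section \<open>Fibre ideals\<close>

lemma fibre_ideal_gens:
  assumes f: "\<And>i. (\<lambda>x. f x i) \<in> polyfun" and fY: "\<And>x. x \<in> X \<Longrightarrow> f x \<in> Y"
  shows "pullback X f ` {h \<in> carrier (coord_ring Y). h y = 0} \<subseteq> carrier (coord_ring X)"
proof
  fix m assume "m \<in> pullback X f ` {h \<in> carrier (coord_ring Y). h y = 0}"
  then obtain h where h: "h \<in> polyfun" "m = pullback X f (restrict h Y)" by auto
  have "m = restrict (\<lambda>x. h (f x)) X" unfolding h(2) by (rule pullback_restrict) (rule fY)
  then show "m \<in> carrier (coord_ring X)" using coord_ring_elem[OF polyfun_compose[OF h(1) f]] by simp
qed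

lemma ideal_fibre_ideal:
  assumes f: "\<And>i. (\<lambda>x. f x i) \<in> polyfun" and fY: "\<And>x. x \<in> X \<Longrightarrow> f x \<in> Y"
  shows "ideal (fibre_ideal X Y f y) (coord_ring X)"
  unfolding fibre_ideal_def
  by (rule ring.genideal_ideal[OF cring.axioms(1)[OF cring_coord_ring] fibre_ideal_gens[OF f fY]])

lemma fibre_ideal_generator:
  assumes f: "\<And>i. (\<lambda>x. f x i) \<in> polyfun" and fY: "\<And>x. x \<in> X \<Longrightarrow> f x \<in> Y"
    and h: "h \<in> polyfun" "h y = 0" and y: "y \<in> Y"
  shows "restrict (\<lambda>x. h (f x)) X \<in> fibre_ideal X Y f y"
proof -
  have "restrict (\<lambda>x. h (f x)) X = pullback X f (restrict h Y)"
    by (rule pullback_restrict[symmetric]) (rule fY)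
  moreover have "restrict h Y \<in> {h \<in> carrier (coord_ring Y). h y = 0}" using h y by simp
  ultimately have "restrict (\<lambda>x. h (f x)) X \<in> pullback X f ` {h \<in> carrier (coord_ring Y). h y = 0}" by blast
  then show ?thesis
    unfolding fibre_ideal_def
    using ring.genideal_self[OF cring.axioms(1)[OF cring_coord_ring] fibre_ideal_gens[OF f fY]] by blast
qed

lemma ideal_add:
  assumes I: "ideal I (coord_ring X)" and ab: "restrict a X \<in> I" "restrict b X \<in> I"
  shows "restrict (\<lambda>x. a x + b x) X \<in> I"
  using additive_subgroup.a_closed[OF ideal.axioms(1)[OF I] ab] by simp

lemma ideal_mult:
  assumes I: "ideal I (coord_ring X)" and a: "restrict a X \<in> I" and b: "b \<in> polyfun"
  shows "restrict (\<lambda>x. b x * a x) X \<in> I"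
  using ideal.I_l_closed[OF I a coord_ring_elem[OF b]] by simp

lemma ideal_zero: "ideal I (coord_ring X) \<Longrightarrow> restrict (\<lambda>_. 0) X \<in> I"
  using additive_subgroup.zero_closed[OF ideal.axioms(1)] by fastforce

section \<open>The fibration\<close>

lemma projection_eq_iff:
  assumes q: "q \<in> aff 1"
  shows "projection P = q \<longleftrightarrow> P 0 = q 0"
proof
  assume "projection P = q"
  from fun_cong[OF this, of 0] show "P 0 = q 0" by (simp add: projection_def)
next
  assume e: "P 0 = q 0"
  show "projection P = q"
  proof
    fix i
    show "projection P i = q i"
      using e q by (cases "i = 0") (auto simp: projection_def aff_def)
  qed
qed

lemma fibre_map_in: "c \<noteq> 0 \<Longrightarrow> Q \<in> aff n \<Longrightarrow> fibre_map c Q \<in> danielewski n"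
  using fibre_map_image[of c n] by blast

lemma fibre_map_simps [simp]:
  "fibre_map c Q 0 = c" "fibre_map c Q (Suc 0) = (Q 0 ^ 2 - 1) / c ^ 2" "fibre_map c Q (Suc (Suc i)) = Q i"
  by (simp_all add: fibre_map_def)

text \<open>Modulo \<open>P 0 - c\<close> every function is determined by its restriction to the fibre.\<close>

lemma fibre_ideal_congruence:
  assumes c: "c \<noteq> 0" and y: "y \<in> aff 1" "y 0 = c" and a: "a \<in> polyfun"
  shows "restrict (\<lambda>P. a P - a (fibre_map c (\<lambda>i. P (i + 2)))) (danielewski n)
    \<in> fibre_ideal (danielewski n) (aff 1) projection y"
proof -
  let ?X = "danielewski n" and ?I = "fibre_ideal (danielewski n) (aff 1) projection y"
  let ?\<phi> = "\<lambda>P. fibre_map c (\<lambda>i. P (i + 2))"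
  have I: "ideal ?I (coord_ring ?X)" by (rule ideal_fibre_ideal[OF polyfun_projection projection_aff])
  have \<phi>: "(\<lambda>P. ?\<phi> P i) \<in> polyfun" for i
    by (rule polyfun_compose[OF polyfun_fibre_map]) (rule polyfun.coord)
  have gen: "restrict (\<lambda>P. P 0 - c) ?X \<in> ?I"
  proof -
    have "(\<lambda>q. q 0 - c) \<in> polyfun" by (intro polyfun_diff polyfun.coord polyfun.const)
    from fibre_ideal_generator[OF polyfun_projection projection_aff this _ y(1), of ?X]
    moreover have "projection x 0 = x 0" for x by (simp add: projection_def)
    ultimately show ?thesis using y(2) by simp
  qed
  have cong: "restrict g ?X \<in> ?I" if "restrict h ?X \<in> ?I" "\<And>P. P \<in> ?X \<Longrightarrow> g P = h P" for g h
    using that(1) restrict_eq[of ?X g h, OF that(2)] by simp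
  show ?thesis
    using a
  proof (induction a rule: polyfun.induct)
    case (const k)
    show ?case by (rule cong[OF ideal_zero[OF I]]) simp
  next
    case (coord i)
    consider "i = 0" | "i = 1" | j where "i = Suc (Suc j)" by (metis One_nat_def not0_implies_Suc)
    then show ?case
    proof cases
      case 1
      show ?thesis by (rule cong[OF gen]) (simp add: 1)
    next
      case 2
      have p: "(\<lambda>P. - (P 0 + c) * P 1 * (1 / c ^ 2)) \<in> polyfun"
        by (intro polyfun.mult polyfun_uminus polyfun.add polyfun.coord polyfun.const)
      show ?thesis
      proof (rule cong[OF ideal_mult[OF I gen p]])
        fix P assume "P \<in> ?X"
        then have e: "P 2 ^ 2 - 1 = P 0 ^ 2 * P 1" by (simp add: danielewski_def)
        have "P 1 - ?\<phi> P 1 = P 1 - P 0 ^ 2 * P 1 / c ^ 2"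
          using e by (simp add: numeral_2_eq_2)
        also have "\<dots> = - (P 0 + c) * P 1 * (1 / c ^ 2) * (P 0 - c)"
          using c by (simp add: field_simps power2_eq_square)
        finally show "P i - ?\<phi> P i = - (P 0 + c) * P 1 * (1 / c ^ 2) * (P 0 - c)" unfolding 2 .
      qed
    next
      case 3
      show ?thesis by (rule cong[OF ideal_zero[OF I]]) (simp add: 3)
    qed
  next
    case (add a b)
    show ?case by (rule cong[OF ideal_add[OF I add.IH]]) simp
  next
    case (mult a b)
    have b': "(\<lambda>P. b P) \<in> polyfun" using mult by simp
    have a': "(\<lambda>P. a (?\<phi> P)) \<in> polyfun" by (rule polyfun_compose[OF mult.hyps(1) \<phi>])
    show ?case
      by (rule cong[OF ideal_add[OF I ideal_mult[OF I mult.IH(1) b'] ideal_mult[OF I mult.IH(2) a']]])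
         (simp add: algebra_simps)
  qed
qed

text \<open>
  The kernel is the fibre ideal, because modulo it every function is congruent to one pulled back from the fibre.
\<close>

lemma fibre_restriction:
  fixes n :: nat
  assumes c: "c \<noteq> 0" and y: "y \<in> aff 1" "y 0 = c"
  defines "h \<equiv> \<lambda>m :: pt \<Rightarrow> complex. restrict (\<lambda>Q. m (fibre_map c Q)) (aff n)"
  shows "ring_hom_ring (coord_ring (danielewski n)) (coord_ring (aff n)) h"
    "h ` carrier (coord_ring (danielewski n)) = carrier (coord_ring (aff n))"
    "a_kernel (coord_ring (danielewski n)) (coord_ring (aff n)) h =
       fibre_ideal (danielewski n) (aff 1) projection y"
proof -
  let ?X = "danielewski n" and ?R = "coord_ring (danielewski n)" and ?S = "coord_ring (aff n)"
  let ?I = "fibre_ideal (danielewski n) (aff 1) projection y"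
  have R: "ring ?R" and S: "ring ?S" using cring.axioms(1)[OF cring_coord_ring] by auto
  have hr: "h (restrict a ?X) = restrict (\<lambda>Q. a (fibre_map c Q)) (aff n)" for a
    unfolding h_def by (rule restrict_eq) (simp add: fibre_map_in[OF c])
  have "h \<in> Ring.ring_hom ?R ?S"
  proof (rule ring_hom_memI)
    fix m assume "m \<in> carrier ?R"
    then obtain a where a: "a \<in> polyfun" "m = restrict a ?X" by auto
    show "h m \<in> carrier ?S"
      unfolding a(2) hr by (rule coord_ring_elem[OF polyfun_compose[OF a(1) polyfun_fibre_map]])
    fix m' assume "m' \<in> carrier ?R"
    then obtain b where b: "m' = restrict b ?X" by auto
    show "h (m \<otimes>\<^bsub>?R\<^esub> m') = h m \<otimes>\<^bsub>?S\<^esub> h m'" "h (m \<oplus>\<^bsub>?R\<^esub> m') = h m \<oplus>\<^bsub>?S\<^esub> h m'"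
      unfolding a(2) b coord_ring_simps(4,5) hr by simp_all
  next
    show "h \<one>\<^bsub>?R\<^esub> = \<one>\<^bsub>?S\<^esub>" unfolding coord_ring_simps(2) hr ..
  qed
  then show hom: "ring_hom_ring ?R ?S h" by (rule ring_hom_ringI2[OF R S])
  show "h ` carrier ?R = carrier ?S"
  proof
    show "h ` carrier ?R \<subseteq> carrier ?S"
      using \<open>h \<in> Ring.ring_hom ?R ?S\<close> unfolding Ring.ring_hom_def by auto
    show "carrier ?S \<subseteq> h ` carrier ?R"
    proof
      fix m assume "m \<in> carrier ?S"
      then obtain b where b: "b \<in> polyfun" "m = restrict b (aff n)" by auto
      have p: "(\<lambda>P. b (\<lambda>i. P (i + 2))) \<in> polyfun" by (rule polyfun_compose[OF b(1) polyfun.coord])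
      have "h (restrict (\<lambda>P. b (\<lambda>i. P (i + 2))) ?X) = m" unfolding hr b(2) by simp
      then show "m \<in> h ` carrier ?R" using coord_ring_elem[OF p] by blast
    qed
  qed
  have I: "ideal ?I ?R" by (rule ideal_fibre_ideal[OF polyfun_projection projection_aff])
  show "a_kernel ?R ?S h = ?I"
  proof
    show "?I \<subseteq> a_kernel ?R ?S h"
      unfolding fibre_ideal_def
    proof (rule ring.genideal_minimal[OF R ring_hom_ring.kernel_is_ideal[OF hom]], rule subsetI)
      fix m assume "m \<in> pullback ?X projection ` {h \<in> carrier (coord_ring (aff 1)). h y = 0}"
      then obtain g where g: "g \<in> polyfun" "restrict g (aff 1) y = 0" "m = pullback ?X projection (restrict g (aff 1))"
        by auto
      have m: "m = restrict (\<lambda>x. g (projection x)) ?X"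
        unfolding g(3) by (rule pullback_restrict) (rule projection_aff)
      have pr: "projection (fibre_map c Q) = y" for Q
        unfolding projection_eq_iff[OF y(1)] using y(2) by simp
      have "h m = \<zero>\<^bsub>?S\<^esub>" unfolding m hr pr using g(2) y(1) by simp
      moreover have "m \<in> carrier ?R"
        unfolding m by (rule coord_ring_elem[OF polyfun_compose[OF g(1) polyfun_projection]])
      ultimately show "m \<in> a_kernel ?R ?S h" unfolding a_kernel_def' by blast
    qed
    show "a_kernel ?R ?S h \<subseteq> ?I"
    proof
      fix m assume "m \<in> a_kernel ?R ?S h"
      then have m: "m \<in> carrier ?R" "h m = \<zero>\<^bsub>?S\<^esub>" unfolding a_kernel_def' by auto
      then obtain a where a: "a \<in> polyfun" "m = restrict a ?X" by auto
      have z: "a (fibre_map c Q) = 0" if "Q \<in> aff n" for Q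
        using m(2) that unfolding a(2) hr coord_ring_simps(3) by (rule restrict_eqD)
      have "restrict a ?X = restrict (\<lambda>P. a P - a (fibre_map c (\<lambda>i. P (i + 2)))) ?X"
      proof (rule restrict_eq)
        fix P assume "P \<in> ?X"
        then have "(\<lambda>i. P (i + 2)) \<in> aff n" by (auto simp: danielewski_def aff_def)
        from z[OF this] show "a P = a P - a (fibre_map c (\<lambda>i. P (i + 2)))" by simp
      qed
      then show "m \<in> ?I" unfolding a(2) using fibre_ideal_congruence[OF c y a(1), of n] by simp
    qed
  qed
qed

lemma fibre_iso:
  assumes c: "c \<noteq> 0" and y: "y \<in> aff 1" "y 0 = c"
  shows "fibre_iso_affine_space n (danielewski n) (aff 1) projection y"
    and "reduced_ring (fibre_ring (danielewski n) (aff 1) projection y)"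
proof -
  let ?X = "danielewski n" and ?R = "coord_ring (danielewski n)" and ?S = "coord_ring (aff n)"
  let ?I = "fibre_ideal (danielewski n) (aff 1) projection y"
  let ?Q = "fibre_ring (danielewski n) (aff 1) projection y"
  define h :: "(pt \<Rightarrow> complex) \<Rightarrow> pt \<Rightarrow> complex"
    where "h = (\<lambda>m. restrict (\<lambda>Q. m (fibre_map c Q)) (aff n))"
  note fr = fibre_restriction[OF c y, of n, folded h_def]
  interpret h: ring_hom_ring ?R ?S h by (rule fr(1))
  define \<phi> where "\<phi> = (\<lambda>Z. the_elem (h ` Z))"
  have Q: "?Q = ?R Quot (a_kernel ?R ?S h)" unfolding fibre_ring_def fr(3) ..
  have iso: "\<phi> \<in> ring_iso ?Q ?S"
    unfolding Q \<phi>_def by (rule h.FactRing_iso_set[OF fr(2)])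
  have const: "\<phi> (?I +>\<^bsub>?R\<^esub> restrict (\<lambda>_. k) ?X) = restrict (\<lambda>_. k) (aff n)" for k
  proof -
    have "\<phi> (?I +>\<^bsub>?R\<^esub> restrict (\<lambda>_. k) ?X) = h (restrict (\<lambda>_. k) ?X)"
      unfolding \<phi>_def fr(3)[symmetric] by (rule h.the_elem_simp[OF coord_ring_elem[OF polyfun.const]])
    also have "\<dots> = restrict (\<lambda>_. k) (aff n)"
      unfolding h_def by (rule restrict_eq) (simp add: fibre_map_in[OF c])
    finally show ?thesis .
  qed
  show "fibre_iso_affine_space n ?X (aff 1) projection y"
    unfolding fibre_iso_affine_space_def by (intro bexI[of _ \<phi>] allI const iso)
  have I: "ideal ?I ?R" by (rule ideal_fibre_ideal[OF polyfun_projection projection_aff])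
  have ringQ: "ring ?Q" unfolding fibre_ring_def by (rule ideal.quotient_is_ring[OF I])
  have S: "ring ?S" by (rule cring.axioms(1)[OF cring_coord_ring])
  have hom: "\<phi> \<in> Ring.ring_hom ?Q ?S" and bij: "bij_betw \<phi> (carrier ?Q) (carrier ?S)"
    using iso unfolding ring_iso_def by auto
  interpret p: ring_hom_ring ?Q ?S \<phi> by (rule ring_hom_ringI2[OF ringQ S hom])
  have pow: "restrict b (aff n) [^]\<^bsub>?S\<^esub> k = restrict (\<lambda>x. b x ^ k) (aff n)" for b and k :: nat
  proof (induction k)
    case 0
    show ?case using monoid.nat_pow_0[OF ring.is_monoid[OF S], of "restrict b (aff n)"] by simp
  next
    case (Suc k)
    show ?case
      unfolding monoid.nat_pow_Suc[OF ring.is_monoid[OF S]] Suc coord_ring_simps(4)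
      by (rule restrict_eq) (simp add: mult.commute)
  qed
  show "reduced_ring ?Q"
    unfolding reduced_ring_def
  proof (intro ballI allI impI)
    fix a and k :: nat assume a: "a \<in> carrier ?Q" "a [^]\<^bsub>?Q\<^esub> k = \<zero>\<^bsub>?Q\<^esub>"
    have "\<phi> a \<in> carrier ?S" using a(1) by (rule p.hom_closed)
    then obtain b where b: "\<phi> a = restrict b (aff n)" by auto
    have "\<phi> a [^]\<^bsub>?S\<^esub> k = \<zero>\<^bsub>?S\<^esub>" using p.hom_nat_pow[OF a(1), of k] a(2) p.hom_zero by simp
    then have "restrict (\<lambda>x. b x ^ k) (aff n) = restrict (\<lambda>_. 0) (aff n)"
      unfolding b pow coord_ring_simps(3) .
    then have "b x ^ k = 0" if "x \<in> aff n" for x using that by (rule restrict_eqD)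
    then have "b x = 0" if "x \<in> aff n" for x using that by (metis power_not_zero)
    then have "\<phi> a = \<zero>\<^bsub>?S\<^esub>" unfolding b coord_ring_simps(3) by (rule restrict_eq)
    then have "\<phi> a = \<phi> \<zero>\<^bsub>?Q\<^esub>" using p.hom_zero by simp
    then show "a = \<zero>\<^bsub>?Q\<^esub>"
      using bij a(1) ring.ring_simprules(2)[OF ringQ] unfolding bij_betw_def inj_on_def by blast
  qed
qed

lemma fibre_projection:
  assumes "y \<in> aff 1"
  shows "fibre (danielewski n) projection y = {P \<in> danielewski n. P 0 = y 0}"
  unfolding fibre_def projection_eq_iff[OF assms] ..

lemma general_point_line:
  assumes "\<And>y. y \<in> aff 1 \<Longrightarrow> y 0 \<noteq> 0 \<Longrightarrow> Q y"
  shows "general_point (aff 1) Q"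
  unfolding general_point_def
proof (intro exI conjI)
  let ?U = "{y \<in> aff 1. y 0 \<noteq> 0}"
  have "aff 1 - ?U = aff 1 \<inter> {y. y 0 = 0}" by auto
  then show "zariski_open_in (aff 1) ?U"
    unfolding zariski_open_in_def
    using zariski_closed_Int[OF zariski_closed_aff zariski_closed_zero_set[OF polyfun.coord[of 0]], of 1]
    by simp
  have "(\<lambda>i. if i = 0 then 1 else 0) \<in> ?U" by (simp add: aff_def)
  then show "?U \<noteq> {}" by blast
qed (use assms in auto)

lemma affine_space_fibered_danielewski:
  assumes n: "n > 0"
  shows "affine_space_fibered n (danielewski n) (aff 1)"
  unfolding affine_space_fibered_def fibration_def faithfully_flat_def
proof (intro exI[of _ projection] conjI)
  show "flat_morphism (danielewski n) (aff 1) projection" by (rule flat_projection[OF n])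
  show "projection ` danielewski n = aff 1"
  proof
    show "projection ` danielewski n \<subseteq> aff 1" using projection_aff by blast
    show "aff 1 \<subseteq> projection ` danielewski n"
    proof
      fix q assume q: "q \<in> aff 1"
      let ?P = "\<lambda>i. if i = 0 then q 0 else if i = 2 then 1 else 0 :: complex"
      have "?P \<in> danielewski n" using n by (auto simp: danielewski_def aff_def)
      moreover have "projection ?P = q" unfolding projection_eq_iff[OF q] by simp
      ultimately show "q \<in> projection ` danielewski n" by (intro image_eqI[of _ _ ?P]) auto
    qed
  qed
  show "general_point (aff 1) (fibre_iso_affine_space n (danielewski n) (aff 1) projection)"
    by (rule general_point_line) (rule fibre_iso(1)[OF _ _ refl])
  show "general_point (aff 1) (\<lambda>y. zariski_irreducible (fibre (danielewski n) projection y) \<and>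
      reduced_ring (fibre_ring (danielewski n) (aff 1) projection y) \<and>
      0 < zariski_dim (fibre (danielewski n) projection y))"
  proof (rule general_point_line)
    fix y :: pt assume y: "y \<in> aff 1" "y 0 \<noteq> 0"
    show "zariski_irreducible (fibre (danielewski n) projection y) \<and>
      reduced_ring (fibre_ring (danielewski n) (aff 1) projection y) \<and>
      0 < zariski_dim (fibre (danielewski n) projection y)"
      unfolding fibre_projection[OF y(1)] zariski_irreducible_iff
      using function_domain_fibre[OF y(2)] fibre_iso(2)[OF y(2,1) refl] zariski_dim_fibre[OF y(2) n] by blast
  qed
qed

section \<open>Rationality\<close>

lemma regular_on_quotient:
  assumes "a \<in> polyfun" "b \<in> polyfun" "\<And>x. x \<in> U \<Longrightarrow> b x \<noteq> 0 \<and> \<phi> x = a x / b x"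
  shows "regular_on U \<phi>"
  unfolding regular_on_def using assms by blast

text \<open>
  Where \<open>x \<noteq> 0\<close>, the equation can be solved for \<open>z\<close>.
\<close>

lemma rational_danielewski:
  assumes n: "n > 0"
  shows "rational_variety (danielewski n)"
proof -
  let ?X = "danielewski n"
  let ?U = "{P \<in> ?X. P 0 \<noteq> 0}" and ?V = "{Q \<in> aff (n + 1). Q 0 \<noteq> 0}"
  define f :: "pt \<Rightarrow> pt" where "f = (\<lambda>P i. if i = 0 then P 0 else P (i + 1))"
  define g :: "pt \<Rightarrow> pt" where
    "g = (\<lambda>Q i. if i = 0 then Q 0 else if i = 1 then (Q 1 ^ 2 - 1) / Q 0 ^ 2 else Q (i - 1))"
  have "zariski_open_in ?X ?U"
  proof -
    have "?X - ?U = ?X \<inter> {P. P 0 = 0}" by auto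
    then show ?thesis
      unfolding zariski_open_in_def
      using zariski_closed_Int[OF zariski_closed_danielewski zariski_closed_zero_set[OF polyfun.coord[of 0]], of n]
      by simp
  qed
  moreover have "?U \<noteq> {}"
  proof -
    have "(\<lambda>i. if i = 0 \<or> i = 2 then 1 else 0) \<in> ?U" using n by (auto simp: danielewski_def aff_def)
    then show ?thesis by blast
  qed
  moreover have "zariski_open_in (aff (n + 1)) ?V"
  proof -
    have "aff (n + 1) - ?V = aff (n + 1) \<inter> {P. P 0 = 0}" by auto
    then show ?thesis
      unfolding zariski_open_in_def
      using zariski_closed_Int[OF zariski_closed_aff zariski_closed_zero_set[OF polyfun.coord[of 0]], of "n + 1"]
      by simp
  qed
  moreover have "?V \<noteq> {}"
  proof -
    have "(\<lambda>i. if i = 0 then 1 else 0) \<in> ?V" by (simp add: aff_def)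
    then show ?thesis by blast
  qed
  moreover have "\<forall>i. regular_on ?U (\<lambda>x. f x i)"
  proof
    fix i
    show "regular_on ?U (\<lambda>x. f x i)"
      by (rule regular_on_quotient[OF polyfun.coord[of "if i = 0 then 0 else i + 1"] polyfun.const[of 1]])
         (simp add: f_def)
  qed
  moreover have "\<forall>i. regular_on ?V (\<lambda>y. g y i)"
  proof
    fix i
    show "regular_on ?V (\<lambda>y. g y i)"
    proof (cases "i = 1")
      case True
      have p: "(\<lambda>Q. Q 1 ^ 2 - 1) \<in> polyfun" "(\<lambda>Q. Q 0 ^ 2) \<in> polyfun" by (intro polyfun_intros)+
      show ?thesis by (rule regular_on_quotient[OF p]) (simp add: g_def True)
    next
      case False
      show ?thesis
        by (rule regular_on_quotient[OF polyfun.coord[of "if i = 0 then 0 else i - 1"] polyfun.const[of 1]])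
           (use False in \<open>simp add: g_def\<close>)
    qed
  qed
  moreover have "\<forall>x\<in>?U. f x \<in> ?V \<and> g (f x) = x"
  proof
    fix x assume x: "x \<in> ?U"
    then have e: "x 0 ^ 2 * x 1 = x 2 ^ 2 - 1" "x \<in> aff (n + 2)" "x 0 \<noteq> 0" by (auto simp: danielewski_def)
    have "f x \<in> ?V" using e(2,3) by (auto simp: f_def aff_def)
    moreover have "g (f x) i = x i" for i
    proof -
      have "(x 2 ^ 2 - 1) / x 0 ^ 2 = x 1" unfolding e(1)[symmetric] using e(3) by simp
      then show ?thesis by (auto simp: g_def f_def numeral_2_eq_2)
    qed
    ultimately show "f x \<in> ?V \<and> g (f x) = x" by (auto simp: fun_eq_iff)
  qed
  moreover have "\<forall>y\<in>?V. g y \<in> ?U \<and> f (g y) = y"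
  proof
    fix y assume y: "y \<in> ?V"
    have "g y \<in> ?U" using y n by (auto simp: g_def danielewski_def aff_def)
    moreover have "f (g y) i = y i" for i by (simp add: f_def g_def)
    ultimately show "g y \<in> ?U \<and> f (g y) = y" by (auto simp: fun_eq_iff)
  qed
  ultimately show ?thesis unfolding rational_variety_def by blast
qed

section \<open>Simple connectedness\<close>

text \<open>A set that is parametrized by an affine subspace inherits straight line homotopies.\<close>

lemma linear_parametrization:
  fixes S D :: "pt set"
  assumes \<psi>: "continuous_on S \<psi>" "\<And>x. x \<in> S \<Longrightarrow> \<psi> x \<in> D"
    and \<phi>: "continuous_on UNIV \<phi>" "\<And>y. y \<in> D \<Longrightarrow> \<phi> y \<in> S"
    and inv: "\<And>x. x \<in> S \<Longrightarrow> \<phi> (\<psi> x) = x"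
    and D: "\<And>x y t. x \<in> D \<Longrightarrow> y \<in> D \<Longrightarrow> (\<lambda>i. x i + of_real t * (y i - x i)) \<in> D"
  shows "paths_homotopic_in S" "path_connected S"
proof -
  have coord: "continuous_on A (\<lambda>x. g x i)" if "continuous_on A g" for A and g :: "'b::topological_space \<Rightarrow> pt" and i
    by (rule continuous_on_product_then_coordinatewise[OF that])
  show "paths_homotopic_in S"
    unfolding paths_homotopic_in_def
  proof (intro allI impI, elim conjE)
    fix p q assume p: "path p" "path_image p \<subseteq> S" and q: "path q" "path_image q \<subseteq> S"
      and ends: "pathstart p = pathstart q" "pathfinish p = pathfinish q"
    have pS: "p t \<in> S" "q t \<in> S" if "t \<in> {0..1}" for t
      using p(2) q(2) that by (auto simp: path_image_def)
    define H where "H = (\<lambda>st. \<phi> (\<lambda>i. \<psi> (p (snd st)) i + of_real (fst st) * (\<psi> (q (snd st)) i - \<psi> (p (snd st)) i)))"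
    have cp: "continuous_on ({0..1::real} \<times> {0..1::real}) (\<lambda>st. \<psi> (p (snd st)) i)" for i
    proof (rule coord)
      have "continuous_on ({0..1::real} \<times> {0..1::real}) (\<lambda>st. p (snd st))"
        by (rule continuous_on_compose2[OF p(1)[unfolded path_def] continuous_on_snd[OF continuous_on_id]]) auto
      then show "continuous_on ({0..1::real} \<times> {0..1::real}) (\<lambda>st. \<psi> (p (snd st)))"
        by (rule continuous_on_compose2[OF \<psi>(1)]) (use pS in auto)
    qed
    have cq: "continuous_on ({0..1::real} \<times> {0..1::real}) (\<lambda>st. \<psi> (q (snd st)) i)" for i
    proof (rule coord)
      have "continuous_on ({0..1::real} \<times> {0..1::real}) (\<lambda>st. q (snd st))"
        by (rule continuous_on_compose2[OF q(1)[unfolded path_def] continuous_on_snd[OF continuous_on_id]]) auto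
      then show "continuous_on ({0..1::real} \<times> {0..1::real}) (\<lambda>st. \<psi> (q (snd st)))"
        by (rule continuous_on_compose2[OF \<psi>(1)]) (use pS in auto)
    qed
    show "homotopic_paths S p q"
      unfolding homotopic_paths
    proof (intro exI[of _ H] conjI ballI)
      show "continuous_on ({0..1} \<times> {0..1}) H"
        unfolding H_def
      proof (rule continuous_on_compose2[OF \<phi>(1)])
        show "continuous_on ({0..1} \<times> {0..1})
            (\<lambda>st i. \<psi> (p (snd st)) i + of_real (fst st) * (\<psi> (q (snd st)) i - \<psi> (p (snd st)) i))"
          by (rule continuous_on_coordinatewise_then_product) (intro continuous_intros cp cq)
      qed simp
      show "H \<in> {0..1} \<times> {0..1} \<rightarrow> S"
        unfolding H_def using D \<psi>(2) \<phi>(2) pS by auto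
      show "H (0, x) = p x" if "x \<in> {0..1}" for x using inv[OF pS(1)[OF that]] by (simp add: H_def)
      show "H (1, x) = q x" if "x \<in> {0..1}" for x using inv[OF pS(2)[OF that]] by (simp add: H_def)
      fix t :: real assume "t \<in> {0..1}"
      have i: "\<phi> (\<psi> (p 0)) = p 0" "\<phi> (\<psi> (p 1)) = p 1" using inv pS by auto
      show "pathstart (H \<circ> Pair t) = pathstart p" "pathfinish (H \<circ> Pair t) = pathfinish p"
        using ends i by (simp_all add: H_def pathstart_def pathfinish_def)
    qed
  qed
  show "path_connected S"
    unfolding path_connected_def
  proof (intro ballI)
    fix x y assume xy: "x \<in> S" "y \<in> S"
    define g where "g = (\<lambda>t. \<phi> (\<lambda>i. \<psi> x i + of_real t * (\<psi> y i - \<psi> x i)))"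
    have "path g"
      unfolding path_def g_def
    proof (rule continuous_on_compose2[OF \<phi>(1)])
      show "continuous_on {0..1} (\<lambda>t i. \<psi> x i + of_real t * (\<psi> y i - \<psi> x i))"
        by (rule continuous_on_coordinatewise_then_product) (intro continuous_intros)
    qed simp
    moreover have "path_image g \<subseteq> S" unfolding path_image_def g_def using D \<psi>(2) \<phi>(2) xy by auto
    moreover have "pathstart g = x" "pathfinish g = y"
      using inv xy by (simp_all add: g_def pathstart_def pathfinish_def)
    ultimately show "\<exists>g. path g \<and> path_image g \<subseteq> S \<and> pathstart g = x \<and> pathfinish g = y" by blast
  qed
qed

lemma continuous_coord: "continuous_on A (\<lambda>P::pt. P i)"
  by (rule continuous_polyfun[OF polyfun.coord])

lemma chart_image_topology:
  assumes e: "\<epsilon>\<^sup>2 = 1" and n: "n > 0"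
  shows "paths_homotopic_in (chart_image n \<epsilon>)" "path_connected (chart_image n \<epsilon>)"
    "openin (top_of_set (danielewski n)) (chart_image n \<epsilon>)"
proof -
  have cont: "continuous_on (chart_image n \<epsilon>) (chart_inverse \<epsilon>)"
  proof (rule continuous_on_coordinatewise_then_product)
    fix i :: nat
    consider "i = 1" | "i = 2" | "i \<noteq> 1" "i \<noteq> 2" by blast
    then show "continuous_on (chart_image n \<epsilon>) (\<lambda>P. chart_inverse \<epsilon> P i)"
    proof cases
      case 1
      have "continuous_on (chart_image n \<epsilon>) (\<lambda>P. (cnj (P 2 + \<epsilon>) * P 1 + cnj (P 0 ^ 2) * (P 2 - \<epsilon>)) /
          (cnj (P 2 + \<epsilon>) * (P 2 + \<epsilon>) + cnj (P 0 ^ 2) * P 0 ^ 2))"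
        by (intro continuous_intros continuous_coord ballI) (rule chart_inverse(3)[OF e])
      then show ?thesis unfolding 1 by (simp add: chart_inverse_def)
    next
      case 2
      then show ?thesis by (simp add: chart_inverse_def)
    next
      case 3
      then show ?thesis using continuous_coord by (simp add: chart_inverse_def)
    qed
  qed
  have cont': "continuous_on UNIV (chart \<epsilon>)"
    by (rule continuous_on_coordinatewise_then_product) (rule continuous_polyfun[OF polyfun_chart])
  have D: "(\<lambda>i. x i + of_real t * (y i - x i)) \<in> chart_domain n"
    if "x \<in> chart_domain n" "y \<in> chart_domain n" for x y t
    using that by (auto simp: chart_domain_def aff_def)
  note param = linear_parametrization[where \<psi> = "chart_inverse \<epsilon>" and \<phi> = "chart \<epsilon>" and D = "chart_domain n"]
  show "paths_homotopic_in (chart_image n \<epsilon>)"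
    by (rule param(1))
       (assumption | rule cont cont' chart_inverse(1,2)[OF e] chart_in_danielewski[OF e _ n] D)+
  show "path_connected (chart_image n \<epsilon>)"
    by (rule param(2))
       (assumption | rule cont cont' chart_inverse(1,2)[OF e] chart_in_danielewski[OF e _ n] D)+
  have "open ({P::pt. P 0 \<noteq> 0} \<union> {P. P 2 \<noteq> - \<epsilon>})"
    by (intro open_Un open_Collect_neq continuous_coord continuous_on_const)
  moreover have "chart_image n \<epsilon> = danielewski n \<inter> ({P. P 0 \<noteq> 0} \<union> {P. P 2 \<noteq> - \<epsilon>})"
  proof -
    have "P 2 = \<epsilon> \<longleftrightarrow> P 2 \<noteq> - \<epsilon>" if "P \<in> danielewski n" "P 0 = 0" for P
    proof -
      have "P 2 ^ 2 = \<epsilon>\<^sup>2" using that e by (simp add: danielewski_def)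
      then have "P 2 = \<epsilon> \<or> P 2 = - \<epsilon>" by (simp add: power2_eq_iff)
      moreover have "\<epsilon> \<noteq> - \<epsilon>" using e by auto
      ultimately show ?thesis by metis
    qed
    then show ?thesis unfolding chart_image_def by blast
  qed
  ultimately show "openin (top_of_set (danielewski n)) (chart_image n \<epsilon>)"
    unfolding openin_open by blast
qed

text \<open>
  The coordinate \<open>x\<close> moves along a path in the punctured plane and the others along line segments, except
  for \<open>z\<close>, which they determine.
\<close>

lemma path_connected_nonzero_part:
  "path_connected {P \<in> danielewski n. P 0 \<noteq> 0}"
  unfolding path_connected_def
proof (intro ballI)
  fix P Q assume PQ: "P \<in> {P \<in> danielewski n. P 0 \<noteq> 0}" "Q \<in> {P \<in> danielewski n. P 0 \<noteq> 0}"
  then have X: "P \<in> aff (n + 2)" "P 0 ^ 2 * P 1 = P 2 ^ 2 - 1" "P 0 \<noteq> 0"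
    "Q \<in> aff (n + 2)" "Q 0 ^ 2 * Q 1 = Q 2 ^ 2 - 1" "Q 0 \<noteq> 0" by (auto simp: danielewski_def)
  have "path_connected (- {0 :: complex})"
    by (rule path_connected_complement_countable) auto
  then obtain \<xi> where \<xi>: "path \<xi>" "path_image \<xi> \<subseteq> - {0}" "pathstart \<xi> = P 0" "pathfinish \<xi> = Q 0"
    using X(3,6) unfolding path_connected_def by (metis ComplI singletonD)
  define l where "l i t = P i + of_real t * (Q i - P i)" for i and t :: real
  define g where "g = (\<lambda>t i. if i = 0 then \<xi> t else if i = 1 then (l 2 t ^ 2 - 1) / \<xi> t ^ 2 else l i t)"
  have nz: "\<xi> t \<noteq> 0" if "t \<in> {0..1}" for t using \<xi>(2) that by (auto simp: path_image_def)
  have c\<xi>: "continuous_on {0..1} \<xi>" using \<xi>(1) by (simp add: path_def)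
  have cl: "continuous_on {0..1} (l i)" for i unfolding l_def by (intro continuous_intros)
  have "path g"
    unfolding path_def
  proof (rule continuous_on_coordinatewise_then_product)
    fix i :: nat
    consider "i = 0" | "i = 1" | "i \<noteq> 0" "i \<noteq> 1" by blast
    then show "continuous_on {0..1} (\<lambda>t. g t i)"
    proof cases
      case 1
      then show ?thesis using c\<xi> by (simp add: g_def)
    next
      case 2
      have "continuous_on {0..1} (\<lambda>t. (l 2 t ^ 2 - 1) / \<xi> t ^ 2)"
        by (intro continuous_intros c\<xi> cl) (use nz in auto)
      then show ?thesis unfolding 2 by (simp add: g_def)
    next
      case 3
      then show ?thesis using cl[of i] by (simp add: g_def)
    qed
  qed
  moreover have "path_image g \<subseteq> {P \<in> danielewski n. P 0 \<noteq> 0}"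
  proof
    fix y assume "y \<in> path_image g"
    then obtain t where t: "t \<in> {0..1}" "y = g t" by (auto simp: path_image_def)
    have "g t \<in> aff (n + 2)" using X(1,4) by (auto simp: g_def aff_def l_def)
    moreover have "g t 0 ^ 2 * g t 1 = g t 2 ^ 2 - 1" using nz[OF t(1)] by (simp add: g_def)
    moreover have "g t 0 \<noteq> 0" using nz[OF t(1)] by (simp add: g_def)
    ultimately show "y \<in> {P \<in> danielewski n. P 0 \<noteq> 0}" unfolding t(2) danielewski_def by simp
  qed
  moreover have "pathstart g = P"
  proof
    fix i
    have "\<xi> 0 = P 0" using \<xi>(3) by (simp add: pathstart_def)
    moreover have "(P 2 ^ 2 - 1) / P 0 ^ 2 = P 1" unfolding X(2)[symmetric] using X(3) by simp
    ultimately show "pathstart g i = P i" by (auto simp: pathstart_def g_def l_def)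
  qed
  moreover have "pathfinish g = Q"
  proof
    fix i
    have "\<xi> 1 = Q 0" using \<xi>(4) by (simp add: pathfinish_def)
    moreover have "(Q 2 ^ 2 - 1) / Q 0 ^ 2 = Q 1" unfolding X(5)[symmetric] using X(6) by simp
    ultimately show "pathfinish g i = Q i" by (auto simp: pathfinish_def g_def l_def)
  qed
  ultimately show "\<exists>g. path g \<and> path_image g \<subseteq> {P \<in> danielewski n. P 0 \<noteq> 0} \<and> pathstart g = P \<and> pathfinish g = Q"
    by blast
qed

lemma simply_connected_danielewski:
  assumes n: "n > 0"
  shows "simply_connected (danielewski n)"
proof -
  let ?U = "chart_image n 1" and ?V = "chart_image n (-1)"
  have X: "danielewski n = ?U \<union> ?V" by (rule danielewski_charts)
  have U: "paths_homotopic_in ?U" "path_connected ?U" "openin (top_of_set (?U \<union> ?V)) ?U"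
    using chart_image_topology[of 1 n] n X by auto
  have V: "paths_homotopic_in ?V" "path_connected ?V" "openin (top_of_set (?U \<union> ?V)) ?V"
    using chart_image_topology[of "-1" n] n X by auto
  have I: "?U \<inter> ?V = {P \<in> danielewski n. P 0 \<noteq> 0}" by (auto simp: chart_image_def)
  have "(\<lambda>i. if i = 0 \<or> i = 2 then 1 else 0) \<in> ?U \<inter> ?V"
    unfolding I using n by (auto simp: danielewski_def aff_def)
  then have ne: "?U \<inter> ?V \<noteq> {}" by blast
  have "path_connected (?U \<inter> ?V)" unfolding I by (rule path_connected_nonzero_part)
  from simply_connected_Un[OF U(3,1,2) V(3,1,2) this ne] show ?thesis unfolding X .
qed

section \<open>The endomorphism is etale and not proper\<close>

text \<open>
  Working modulo the fibre ideal, with functions that do not vanish at the given point inverted: the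
  ideal \<open>{h. \<exists>s. s P \<noteq> 0 \<and> s h \<in> I}\<close> contains all functions that vanish at \<open>P\<close> as soon as it contains
  the functions \<open>x\<^sub>i - x\<^sub>i(P)\<close>.
\<close>

lemma unramified_endo:
  assumes n: "n > 0"
  shows "unramified (danielewski n) (danielewski n) endo"
  unfolding unramified_def
proof (intro ballI impI)
  let ?X = "danielewski n"
  fix P m assume P: "P \<in> ?X" and m: "m \<in> carrier (coord_ring ?X)" "m P = 0"
  let ?I = "fibre_ideal ?X ?X endo (endo P)"
  have I: "ideal ?I (coord_ring ?X)" by (rule ideal_fibre_ideal[OF polyfun_endo endo_danielewski])
  define good where "good h \<longleftrightarrow> (\<exists>s\<in>polyfun. s P \<noteq> 0 \<and> restrict (\<lambda>Q. s Q * h Q) ?X \<in> ?I)" for h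
  have cong: "restrict g ?X \<in> ?I" if "restrict h ?X \<in> ?I" "\<And>Q. Q \<in> ?X \<Longrightarrow> g Q = h Q" for g h
    using that(1) restrict_eq[of ?X g h, OF that(2)] by (simp only:)
  have goodI: "good h" if "s \<in> polyfun" "s P \<noteq> 0" "restrict (\<lambda>Q. s Q * h Q) ?X \<in> ?I" for s h
    unfolding good_def using that by blast
  have good_cong: "good g" if h: "good h" and e: "\<And>Q. Q \<in> ?X \<Longrightarrow> g Q = h Q" for g h
  proof -
    obtain s where s: "s \<in> polyfun" "s P \<noteq> 0" "restrict (\<lambda>Q. s Q * h Q) ?X \<in> ?I" using h unfolding good_def by blast
    show ?thesis by (rule goodI[OF s(1,2) cong[OF s(3)]]) (simp add: e)
  qed
  have good_in: "good h" if "restrict h ?X \<in> ?I" for h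
    by (rule goodI[OF polyfun.const[of 1]]) (use that in simp_all)
  have good_add: "good (\<lambda>Q. a Q + b Q)" if ab: "good a" "good b" for a b
  proof -
    obtain s where s: "s \<in> polyfun" "s P \<noteq> 0" "restrict (\<lambda>Q. s Q * a Q) ?X \<in> ?I" using ab(1) unfolding good_def by blast
    obtain r where r: "r \<in> polyfun" "r P \<noteq> 0" "restrict (\<lambda>Q. r Q * b Q) ?X \<in> ?I" using ab(2) unfolding good_def by blast
    show ?thesis
    proof (rule goodI[OF polyfun.mult[OF s(1) r(1)]])
      show "s P * r P \<noteq> 0" using s r by simp
      show "restrict (\<lambda>Q. s Q * r Q * (a Q + b Q)) ?X \<in> ?I"
        by (rule cong[OF ideal_add[OF I ideal_mult[OF I s(3) r(1)] ideal_mult[OF I r(3) s(1)]]])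
           (simp add: algebra_simps)
    qed
  qed
  have good_mult: "good (\<lambda>Q. b Q * a Q)" if a: "good a" and b: "b \<in> polyfun" for a b
  proof -
    obtain s where s: "s \<in> polyfun" "s P \<noteq> 0" "restrict (\<lambda>Q. s Q * a Q) ?X \<in> ?I" using a unfolding good_def by blast
    show ?thesis
      by (rule goodI[OF s(1,2)], rule cong[OF ideal_mult[OF I s(3) b]]) (simp add: algebra_simps)
  qed
  have good_cancel: "good a" if a: "good (\<lambda>Q. u Q * a Q)" and u: "u \<in> polyfun" "u P \<noteq> 0" for a u
  proof -
    obtain s where s: "s \<in> polyfun" "s P \<noteq> 0" "restrict (\<lambda>Q. s Q * (u Q * a Q)) ?X \<in> ?I"
      using a unfolding good_def by blast
    show ?thesis
    proof (rule goodI[OF polyfun.mult[OF s(1) u(1)]])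
      show "s P * u P \<noteq> 0" using s u by simp
      show "restrict (\<lambda>Q. s Q * u Q * a Q) ?X \<in> ?I"
        by (rule cong[OF s(3)]) (simp add: mult.assoc)
    qed
  qed
  have gen: "good (\<lambda>Q. endo Q i - endo P i)" for i
  proof -
    have "(\<lambda>Q. Q i - endo P i) \<in> polyfun" by (intro polyfun_diff polyfun.coord polyfun.const)
    from fibre_ideal_generator[OF polyfun_endo endo_danielewski this _ endo_danielewski[OF P]]
    show ?thesis by (intro good_in) simp
  qed
  have Xeq: "Q 0 * Q 0 * Q 1 = Q 2 * Q 2 - 1" if "Q \<in> ?X" for Q
    using danielewski_square[OF that] by simp
  define x y z where "x = P 0" and "y = P 2" and "z = P 1"
  have E: "endo Q 0 = Q 0 * (4 * (Q 2 * Q 2) - 1)" "endo Q 2 = 4 * (Q 2 * Q 2 * Q 2) - 3 * Q 2" "endo Q 1 = Q 1" for Q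
    by (simp_all add: power2_eq_square power3_eq_cube)
  note p_intros = polyfun_diff polyfun.add polyfun.mult polyfun.coord polyfun.const
  have xy: "good (\<lambda>Q. Q 0 - x) \<and> good (\<lambda>Q. Q 2 - y)"
  \<comment> \<open>Away from \<open>4 y\<^sup>2 = 1\<close>, \<open>T\<^sub>3\<close> is unramified at \<open>y\<close>, as \<open>T\<^sub>3'(y) = 3 (4 y\<^sup>2 - 1)\<close>, and the factor of \<open>x\<close> in the first component is a unit. At the other points \<open>x \<noteq> 0\<close>, and the first component \<open>x (4 y\<^sup>2 - 1)\<close> detects \<open>y\<close>, whereupon \<open>z\<close> and the equation detect \<open>x\<close>.\<close>
  proof (cases "4 * (y * y) - 1 = 0")
    case False
    let ?s = "\<lambda>Q. 4 * (Q 2 * Q 2 + Q 2 * y + y * y) - 3"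
    have "good (\<lambda>Q. ?s Q * (Q 2 - y))"
      by (rule good_cong[OF gen[of 2]]) (simp only: E, simp add: y_def algebra_simps)
    moreover have "?s \<in> polyfun" by (intro p_intros)
    moreover have "?s P \<noteq> 0"
    proof -
      have "?s P = 3 * (4 * (y * y) - 1)" by (simp add: y_def algebra_simps)
      then show ?thesis using False by simp
    qed
    ultimately have gy: "good (\<lambda>Q. Q 2 - y)" by (rule good_cancel)
    have b: "(\<lambda>Q. - 4 * Q 0 * (Q 2 + y)) \<in> polyfun" by (intro p_intros)
    have "good (\<lambda>Q. (4 * (y * y) - 1) * (Q 0 - x))"
      by (rule good_cong[OF good_add[OF gen[of 0] good_mult[OF gy b]]])
         (simp only: E, simp add: x_def y_def algebra_simps)
    then have "good (\<lambda>Q. Q 0 - x)"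
      by (rule good_cancel[OF _ polyfun.const]) (rule False)
    then show ?thesis using gy by simp
  next
    case True
    then have yy: "y * y = 1 / 4" by (simp add: field_simps)
    have "x * x * z = y * y - 1" using Xeq[OF P] by (simp add: x_def y_def z_def)
    then have xz: "x * x * z = - 3 / 4" unfolding yy by simp
    have x0: "x \<noteq> 0" "z \<noteq> 0" "y \<noteq> 0" using xz yy by auto
    have "P 2 * P 2 = 1 / 4" using yy by (simp add: y_def)
    then have q: "4 * (P 2 * P 2) = 4 * (1 / 4)" by (rule arg_cong)
    have e0: "endo P 0 = 0" unfolding E q by simp
    let ?s = "\<lambda>Q. 4 * Q 0 * (Q 2 + y)"
    have "good (\<lambda>Q. ?s Q * (Q 2 - y))"
    proof (rule good_cong[OF gen[of 0]])
      fix Q :: pt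
      have "?s Q * (Q 2 - y) = Q 0 * (4 * (Q 2 * Q 2) - 4 * (y * y))" by (simp add: algebra_simps)
      also have "\<dots> = endo Q 0 - endo P 0" unfolding e0 E(1)[of Q] yy by simp
      finally show "?s Q * (Q 2 - y) = endo Q 0 - endo P 0" .
    qed
    moreover have "?s \<in> polyfun" by (intro p_intros)
    moreover have "?s P \<noteq> 0" using x0 by (simp add: x_def y_def)
    ultimately have gy: "good (\<lambda>Q. Q 2 - y)" by (rule good_cancel)
    have gz: "good (\<lambda>Q. Q 1 - z)"
      by (rule good_cong[OF gen[of 1]]) (simp only: E z_def)
    let ?u = "\<lambda>Q. Q 1 * (Q 0 + x)"
    have b1: "(\<lambda>Q. Q 2 + y) \<in> polyfun" and b2: "(\<lambda>Q. - (x * x)) \<in> polyfun" by (intro p_intros)+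
    have "good (\<lambda>Q. ?u Q * (Q 0 - x))"
    proof (rule good_cong[OF good_add[OF good_mult[OF gy b1] good_mult[OF gz b2]]])
      fix Q assume Q: "Q \<in> ?X"
      have "?u Q * (Q 0 - x) = Q 0 * Q 0 * Q 1 - x * x * Q 1" by (simp add: algebra_simps)
      also have "\<dots> = Q 2 * Q 2 - 1 - x * x * Q 1" unfolding Xeq[OF Q] ..
      also have "\<dots> = Q 2 * Q 2 - y * y + x * x * z - x * x * Q 1" unfolding xz yy by simp
      finally show "?u Q * (Q 0 - x) = (Q 2 + y) * (Q 2 - y) + - (x * x) * (Q 1 - z)"
        by (simp add: algebra_simps)
    qed
    moreover have "?u \<in> polyfun" by (intro p_intros)
    moreover have "?u P \<noteq> 0" using x0 by (simp add: x_def z_def)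
    ultimately have "good (\<lambda>Q. Q 0 - x)" by (rule good_cancel)
    then show ?thesis using gy by simp
  qed
  have good_coord: "good (\<lambda>Q. Q i - P i)" for i
  proof -
    consider "i = 0" | "i = 2" | "i \<noteq> 0" "i \<noteq> 2" by blast
    then show ?thesis
    proof cases
      case 3
      then show ?thesis using gen[of i] by simp
    qed (use xy x_def y_def in simp_all)
  qed
  have zero: "good (\<lambda>_. 0)" by (rule good_in) (rule ideal_zero[OF I])
  have all: "good (\<lambda>Q. h Q - h P)" if "h \<in> polyfun" for h
    using that
  proof (induction h rule: polyfun.induct)
    case (const c)
    show ?case using zero by simp
  next
    case (coord i)
    show ?case by (rule good_coord)
  next
    case (add a b)
    show ?case by (rule good_cong[OF good_add[OF add.IH]]) simp
  next
    case (mult a b)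
    show ?case
      by (rule good_cong[OF good_add[OF good_mult[OF mult.IH(1) mult.hyps(2)]
            good_mult[OF mult.IH(2) polyfun.const[of "a P"]]]]) (simp add: algebra_simps)
  qed
  obtain h where h: "h \<in> polyfun" "m = restrict h ?X" using m(1) by auto
  have "h P = 0" using m(2) P unfolding h(2) by simp
  then have "good h" using all[OF h(1)] by simp
  then obtain s where s: "s \<in> polyfun" "s P \<noteq> 0" "restrict (\<lambda>Q. s Q * h Q) ?X \<in> ?I" unfolding good_def by blast
  show "\<exists>s\<in>carrier (coord_ring ?X). s P \<noteq> 0 \<and> s \<otimes>\<^bsub>coord_ring ?X\<^esub> m \<in> ?I"
  proof (rule bexI[of _ "restrict s ?X"], rule conjI)
    show "restrict s ?X P \<noteq> 0" using s(2) P by simp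
    show "restrict s ?X \<otimes>\<^bsub>coord_ring ?X\<^esub> m \<in> ?I" unfolding h(2) coord_ring_simps(4) by (rule s(3))
    show "restrict s ?X \<in> carrier (coord_ring ?X)" by (rule coord_ring_elem[OF s(1)])
  qed
qed

lemma etale_endo: "n > 0 \<Longrightarrow> etale (danielewski n) (danielewski n) endo"
  unfolding etale_def using flat_endo unramified_endo by blast

lemma zariski_closed_preimage:
  assumes S: "zariski_closed S" and f: "\<And>i. (\<lambda>x. f x i) \<in> polyfun"
  shows "zariski_closed {x. f x \<in> S}"
proof -
  obtain H where H: "H \<subseteq> polyfun" "S = {x. \<forall>h\<in>H. h x = 0}" using S unfolding zariski_closed_def by auto
  show ?thesis
  proof (rule zariski_closedI)
    show "(\<lambda>h x. h (f x)) ` H \<subseteq> polyfun"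
    proof
      fix g assume "g \<in> (\<lambda>h x. h (f x)) ` H"
      then obtain h where h: "h \<in> H" "g = (\<lambda>x. h (f x))" by auto
      have "h \<in> polyfun" using h(1) H(1) by blast
      then show "g \<in> polyfun" unfolding h(2) by (rule polyfun_compose[OF _ f])
    qed
    show "{x. f x \<in> S} = {x. \<forall>h\<in>(\<lambda>h x. h (f x)) ` H. h x = 0}" using H(2) by auto
  qed
qed

text \<open>
  Over the line \<open>P 0 = 0\<close>, \<open>P 2 = 1\<close> the preimage with \<open>P 2 = - 1 / 2\<close> consists of the points with
  \<open>(P 0)\<^sup>2 P 1 = - 3 / 4\<close>, which lie over the points \<open>P 1 \<noteq> 0\<close> of the line.
\<close>

lemma not_proper_endo:
  assumes n: "n > 0"
  shows "\<not> proper_morphism (danielewski n) (danielewski n) endo"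
proof
  let ?X = "danielewski n"
  assume proper: "proper_morphism ?X ?X endo"
  \<comment> \<open>The base change is along the line \<open>x = 0\<close>, \<open>y = 1\<close> with parameter \<open>z\<close>.\<close>
  define g :: "pt \<Rightarrow> pt" where "g = (\<lambda>q i. if i = 1 then q 0 else if i = 2 then 1 else 0)"
  have gp: "(\<lambda>q. g q i) \<in> polyfun" for i
    by (cases "i = 1"; cases "i = 2") (simp_all add: g_def polyfun.intros)
  have gX: "g q \<in> ?X" for q using n by (auto simp: g_def danielewski_def aff_def)
  have mor: "morphism (aff 1) ?X g" by (rule morphismI[OF gp gX])
  define a b :: "pt \<Rightarrow> pt" where "a = (\<lambda>Q i. Q (2 * i))" and "b = (\<lambda>Q i. Q (2 * i + 1))"
  have ap: "(\<lambda>Q. a Q i) \<in> polyfun" "(\<lambda>Q. b Q i) \<in> polyfun" for i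
    by (simp_all add: a_def b_def polyfun.coord)
  have pair: "pair_pt (a Q) (b Q) = Q" for Q
    by (auto simp: pair_pt_def a_def b_def fun_eq_iff)
  have ab: "a (pair_pt x z) = x" "b (pair_pt x z) = z" for x z
    by (auto simp: pair_pt_def a_def b_def fun_eq_iff)
  define C where "C = {Q. a Q \<in> ?X} \<inter> {Q. b Q \<in> aff 1} \<inter> (\<Inter>i. {Q. endo (a Q) i - g (b Q) i = 0}) \<inter>
      {Q. a Q 2 + 1 / 2 = 0}"
  have "zariski_closed (\<Inter>i\<in>UNIV. {Q. endo (a Q) i - g (b Q) i = 0})"
    by (rule zariski_closed_Inter, rule zariski_closed_zero_set)
       (rule polyfun_diff[OF polyfun_compose[OF polyfun_endo ap(1)] polyfun_compose[OF gp ap(2)]])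
  moreover have "zariski_closed {Q. a Q 2 + 1 / 2 = 0}"
    by (rule zariski_closed_zero_set) (rule polyfun.add[OF ap(1) polyfun.const])
  ultimately have C: "zariski_closed C"
    unfolding C_def
    using zariski_closed_preimage[OF zariski_closed_danielewski[of n] ap(1)]
      zariski_closed_preimage[OF zariski_closed_aff[of 1] ap(2)]
    by (intro zariski_closed_Int) auto
  have mem: "pair_pt x z \<in> C \<longleftrightarrow> x \<in> ?X \<and> z \<in> aff 1 \<and> endo x = g z \<and> x 2 = - (1 / 2)" for x z
    unfolding C_def by (auto simp: ab fun_eq_iff eq_neg_iff_add_eq_0)
  have sub: "C \<subseteq> fibre_product ?X endo (aff 1) g"
  proof
    fix Q assume "Q \<in> C"
    then have "pair_pt (a Q) (b Q) \<in> C" by (simp add: pair)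
    then have "a Q \<in> ?X" "b Q \<in> aff 1" "endo (a Q) = g (b Q)" unfolding mem by auto
    then show "Q \<in> fibre_product ?X endo (aff 1) g"
      unfolding fibre_product_def using pair[of Q] by (intro CollectI exI[of _ "a Q"] exI[of _ "b Q"]) simp
  qed
  let ?S = "{z \<in> aff 1. \<exists>x\<in>?X. pair_pt x z \<in> C}"
  have closed: "zariski_closed ?S"
    using proper mor sub C zariski_closed_aff[of 1] unfolding proper_morphism_def by blast
  have S_iff: "z \<in> ?S \<longleftrightarrow> z 0 \<noteq> 0" if z: "z \<in> aff 1" for z
  proof
    assume "z \<in> ?S"
    then obtain x where x: "x \<in> ?X" "endo x = g z" "x 2 = - (1 / 2)" unfolding mem by auto
    have "x 1 = z 0" using fun_cong[OF x(2), of 1] by (simp add: g_def)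
    then show "z 0 \<noteq> 0" using danielewski_square[OF x(1)] x(3) by auto
  next
    assume z0: "z 0 \<noteq> 0"
    define x :: pt where
      "x = (\<lambda>i. if i = 0 then csqrt (- (3 / 4) / z 0) else if i = 1 then z 0 else if i = 2 then - (1 / 2) else 0)"
    have "x 0 ^ 2 * x 1 = x 2 ^ 2 - 1"
    proof -
      have "x 0 ^ 2 = - (3 / 4) / z 0" unfolding x_def by simp
      then show ?thesis using z0 by (simp add: x_def power2_eq_square)
    qed
    then have "x \<in> ?X" using n by (auto simp: danielewski_def aff_def x_def)
    moreover have "endo x = g z"
      by (auto simp: fun_eq_iff endo_def g_def x_def power2_eq_square power3_eq_cube)
    moreover have "x 2 = - (1 / 2)" by (simp add: x_def)
    ultimately show "z \<in> ?S" using z mem by auto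
  qed
  have zero: "(\<lambda>_. 0) \<in> aff 1" by (simp add: aff_def)
  then have "(\<lambda>_. 0) \<notin> ?S" using S_iff by auto
  from zariski_closed_separate[OF closed this] obtain h
    where h: "h \<in> polyfun" "\<forall>z\<in>?S. h z = 0" "h (\<lambda>_. 0) \<noteq> 0" by auto
  from coord_ring_line[OF h(1)] obtain p where p: "\<forall>q\<in>aff 1. h q = poly p (q 0)" ..
  have "poly p t = 0" if "t \<noteq> 0" for t
  proof -
    let ?z = "\<lambda>i::nat. if i = 0 then t else 0"
    have z: "?z \<in> aff 1" by (simp add: aff_def)
    then have "?z \<in> ?S" using S_iff[OF z] that by simp
    then show ?thesis using h(2) p z by auto
  qed
  then have "{t. poly p t \<noteq> 0} \<subseteq> {0}" by auto
  then have "p = 0" using poly_zero_cofinite finite_subset by blast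
  then show False using h(3) p zero by simp
qed

lemma jacobian_conjecture_fails:
  "n > 0 \<Longrightarrow> \<not> generalized_jacobian_conjecture (danielewski n)"
  unfolding generalized_jacobian_conjecture_def using etale_endo not_proper_endo by blast

section \<open>Differentials of rational functions\<close>

definition frac_diff :: "(pt \<Rightarrow> complex) \<Rightarrow> (pt \<Rightarrow> complex) \<Rightarrow> pt \<Rightarrow> pt \<Rightarrow> complex" where
  "frac_diff f b y v = (dir_deriv f y v * b y - f y * dir_deriv b y v) / (b y)\<^sup>2"

text \<open>
  Two representations of \<open>\<phi>\<close> as a quotient agree after cross multiplication, where both
  denominators are nonzero. So the cross product, multiplied by the denominators, vanishes on \<open>X\<close>, and hence so does its derivative along a tangent
  vector.
\<close>

lemma differential_eq:
  assumes x: "x \<in> X" and v: "v \<in> tangent_space X x"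
    and ab: "a \<in> polyfun" "b \<in> polyfun" "b x \<noteq> 0" "\<forall>y\<in>X. b y \<noteq> 0 \<longrightarrow> \<phi> y = a y / b y"
  shows "differential X \<phi> x v = frac_diff a b x v"
  unfolding differential_def
proof (rule the_equality)
  show "\<exists>f\<in>polyfun. \<exists>g\<in>polyfun. g x \<noteq> 0 \<and> (\<forall>y\<in>X. g y \<noteq> 0 \<longrightarrow> \<phi> y = f y / g y) \<and>
      frac_diff a b x v = (dir_deriv f x v * g x - f x * dir_deriv g x v) / (g x)\<^sup>2"
    by (rule bexI[of _ a], rule bexI[of _ b]) (use ab in \<open>simp_all add: frac_diff_def\<close>)
next
  fix w assume "\<exists>a\<in>polyfun. \<exists>b\<in>polyfun. b x \<noteq> 0 \<and> (\<forall>y\<in>X. b y \<noteq> 0 \<longrightarrow> \<phi> y = a y / b y) \<and>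
      w = (dir_deriv a x v * b x - a x * dir_deriv b x v) / (b x)\<^sup>2"
  then obtain a' b' where ab': "a' \<in> polyfun" "b' \<in> polyfun" "b' x \<noteq> 0"
    "\<forall>y\<in>X. b' y \<noteq> 0 \<longrightarrow> \<phi> y = a' y / b' y"
    and w: "w = (dir_deriv a' x v * b' x - a' x * dir_deriv b' x v) / (b' x)\<^sup>2" by blast
  let ?h = "\<lambda>y. a y * b' y - a' y * b y" and ?g = "\<lambda>y. b y * b' y"
  have hp: "?h \<in> polyfun" by (rule polyfun_diff[OF polyfun.mult[OF ab(1) ab'(2)] polyfun.mult[OF ab'(1) ab(2)]])
  have gp: "?g \<in> polyfun" by (rule polyfun.mult[OF ab(2) ab'(2)])
  have h0: "?h y = 0" if "y \<in> X" "?g y \<noteq> 0" for y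
  proof -
    have nz: "b y \<noteq> 0" "b' y \<noteq> 0" using that(2) by auto
    then have "a y / b y = a' y / b' y" using ab(4) ab'(4) that(1) by metis
    then show ?thesis using nz by (simp add: frac_eq_eq)
  qed
  have "\<forall>y\<in>X. ?h y * ?g y = 0" using h0 by fastforce
  then have "dir_deriv (\<lambda>y. ?h y * ?g y) x v = 0"
    using v polyfun.mult[OF hp gp] unfolding tangent_space_def by simp
  moreover have hx: "?h x = 0" by (rule h0[OF x]) (use ab ab' in simp)
  ultimately have "dir_deriv ?h x v * ?g x = 0"
    unfolding dir_deriv_mult[OF hp gp] by simp
  then have "dir_deriv ?h x v = 0" using ab(3) ab'(3) by simp
  moreover have "dir_deriv ?h x v = dir_deriv a x v * b' x + a x * dir_deriv b' x v -
      (dir_deriv a' x v * b x + a' x * dir_deriv b x v)"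
    unfolding dir_deriv_diff[OF polyfun.mult[OF ab(1) ab'(2)] polyfun.mult[OF ab'(1) ab(2)]]
      dir_deriv_mult[OF ab(1) ab'(2)] dir_deriv_mult[OF ab'(1) ab(2)] ..
  ultimately have D: "dir_deriv a x v * b' x + a x * dir_deriv b' x v =
      dir_deriv a' x v * b x + a' x * dir_deriv b x v" by simp
  define A A' B B' Da Da' Db Db' where "A = a x" "A' = a' x" "B = b x" "B' = b' x"
    "Da = dir_deriv a x v" "Da' = dir_deriv a' x v" "Db = dir_deriv b x v" "Db' = dir_deriv b' x v"
  note defs = this
  have e1: "A * B' = A' * B" using hx by (simp add: defs)
  have e2: "Da * B' + A * Db' = Da' * B + A' * Db" using D by (simp only: defs)
  have "(Da * B - A * Db) * B'\<^sup>2 - (Da' * B' - A' * Db') * B\<^sup>2 =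
      B * B' * ((Da * B' + A * Db') - (Da' * B + A' * Db)) + (A' * B - A * B') * (B' * Db + B * Db')"
    by (simp add: power2_eq_square algebra_simps)
  also have "\<dots> = 0" unfolding e1 e2 by simp
  finally have "(Da * B - A * Db) / B\<^sup>2 = (Da' * B' - A' * Db') / B'\<^sup>2"
    using ab(3) ab'(3) by (simp add: frac_eq_eq defs)
  then show "w = frac_diff a b x v" unfolding w frac_diff_def by (simp only: defs)
qed

lemma frac_diff_cancel:
  assumes abc: "a \<in> polyfun" "b \<in> polyfun" "c \<in> polyfun" and c: "c y \<noteq> 0"
  shows "frac_diff (\<lambda>y. a y * c y) (\<lambda>y. b y * c y) y v = frac_diff a b y v"
proof -
  have "(dir_deriv a y v * c y + a y * dir_deriv c y v) * (b y * c y) -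
      (a y * c y) * (dir_deriv b y v * c y + b y * dir_deriv c y v) =
      (dir_deriv a y v * b y - a y * dir_deriv b y v) * (c y)\<^sup>2"
    by (simp add: power2_eq_square algebra_simps)
  then show ?thesis
    unfolding frac_diff_def dir_deriv_mult[OF abc(1,3)] dir_deriv_mult[OF abc(2,3)]
    using c by (simp add: power_mult_distrib)
qed

lemma homogeneous_polyfun: "homogeneous e h \<Longrightarrow> h \<in> polyfun"
  by (simp add: homogeneous_def)

lemma homogeneous_scl: "homogeneous e h \<Longrightarrow> h (scl c x) = c ^ e * h x"
  by (simp add: homogeneous_def)

lemma det_mat_cong:
  assumes "\<And>i l. i < d \<Longrightarrow> l < d \<Longrightarrow> F i l = G i l"
  shows "Determinant.det (Matrix.mat d d (\<lambda>(i, l). F i l)) = Determinant.det (Matrix.mat d d (\<lambda>(i, l). G i l))"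
proof -
  have "Matrix.mat d d (\<lambda>(i, l). F i l) = Matrix.mat d d (\<lambda>(i, l). G i l)"
    by (rule eq_matI) (use assms in auto)
  then show ?thesis by (simp only:)
qed

section \<open>Logarithmic forms in homogeneous coordinates\<close>

text \<open>
  The form \<open>g/h (dlog (f\<^sub>0/b\<^sub>0) \<and> \<dots> \<and> dlog (f\<^bsub>k-1\<^esub>/b\<^bsub>k-1\<^esub>) \<and> d(f\<^sub>k/b\<^sub>k) \<and> \<dots> \<and> d(f\<^bsub>d-1\<^esub>/b\<^bsub>d-1\<^esub>))\<^sup>\<otimes>\<^sup>m\<close> with polynomial
  functions in place of the local parameters.
\<close>

definition log_form_expression ::
  "nat \<Rightarrow> nat \<Rightarrow> nat \<Rightarrow> (nat \<Rightarrow> pt \<Rightarrow> complex) \<Rightarrow> (nat \<Rightarrow> pt \<Rightarrow> complex) \<Rightarrow> (pt \<Rightarrow> complex) \<Rightarrow>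
   (pt \<Rightarrow> complex) \<Rightarrow> pt \<Rightarrow> (nat \<Rightarrow> pt) \<Rightarrow> complex" where
  "log_form_expression d k m f b g h y v = g y / h y *
     (Determinant.det (Matrix.mat d d (\<lambda>(i, l). frac_diff (f l) (b l) y (v i))) / (\<Prod>l<k. f l y / b l y)) ^ m"

text \<open>
  The local parameters and the coefficient at \<open>p\<close> are quotients of homogeneous functions of equal degree, so
  they may be evaluated at any homogeneous coordinates, in particular at the polynomial ones. The formula holds on an open set
  that contains \<open>p\<close>, which may be a point of the boundary.
\<close>

lemma log_form_near:
  assumes snc: "snc_completion X P j" and lp: "log_pluricanonical X P j m \<omega>"
    and d: "zariski_dim X = d"
    and a: "\<And>i. (\<lambda>y. a y i) \<in> polyfun"
    and aj: "\<And>y. y \<in> X \<Longrightarrow> a y \<noteq> (\<lambda>_. 0) \<Longrightarrow> \<exists>c. c \<noteq> 0 \<and> a y = scl c (j y)"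
    and p: "p \<in> P" "p \<noteq> (\<lambda>_. 0)"
  shows "\<exists>k s \<alpha> \<beta> \<gamma> \<eta>. k \<le> d \<and> (\<exists>e. homogeneous e s) \<and> s p \<noteq> 0 \<and>
     (\<forall>l<d. \<exists>e. homogeneous e (\<alpha> l) \<and> homogeneous e (\<beta> l) \<and> \<beta> l p \<noteq> 0) \<and>
     (\<exists>e. homogeneous e \<gamma> \<and> homogeneous e \<eta> \<and> \<eta> p \<noteq> 0) \<and>
     (\<forall>y\<in>X. a y \<noteq> (\<lambda>_. 0) \<longrightarrow> s (a y) \<noteq> 0 \<longrightarrow> \<eta> (a y) \<noteq> 0 \<longrightarrow> (\<forall>l<d. \<beta> l (a y) \<noteq> 0) \<longrightarrow>
        (\<forall>l<k. \<alpha> l (a y) \<noteq> 0) \<and>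
        (\<forall>v. (\<forall>i<d. v i \<in> tangent_space X y) \<longrightarrow>
           \<omega> y v = log_form_expression d k m (\<lambda>l y. \<alpha> l (a y)) (\<lambda>l y. \<beta> l (a y))
             (\<lambda>y. \<gamma> (a y)) (\<lambda>y. \<eta> (a y)) y v))"
proof -
  obtain k z g where kz: "snc_coordinates P (boundary X P j) p d k z" and g: "g \<in> regular_at p"
    and form: "near P p (\<lambda>q. \<forall>x\<in>X. j x = q \<longrightarrow> (\<forall>v. (\<forall>i<d. v i \<in> tangent_space X x) \<longrightarrow>
                \<omega> x v = g q * (Determinant.det (Matrix.mat d d (\<lambda>(i, l). differential X (\<lambda>y. z l (j y)) x (v i)))
                   / (\<Prod>l<k. z l q)) ^ m))"
    using lp p unfolding log_pluricanonical_def d by blast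
  have emb: "open_embedding X P j" using snc unfolding snc_completion_def by blast
  have jP: "j y \<in> P" "j y \<noteq> (\<lambda>_. 0)" if "y \<in> X" for y
    using emb that unfolding open_embedding_def by blast+
  have kd: "k \<le> d" using kz unfolding snc_coordinates_def by blast
  have zreg: "\<forall>l\<in>{..<d}. z l \<in> regular_at p"
    using kz unfolding snc_coordinates_def local_parameters_def by blast
  have "\<forall>l\<in>{..<d}. \<exists>\<alpha>\<beta>. z l = (\<lambda>q. fst \<alpha>\<beta> q / snd \<alpha>\<beta> q) \<and>
      (\<exists>e. homogeneous e (fst \<alpha>\<beta>) \<and> homogeneous e (snd \<alpha>\<beta>) \<and> snd \<alpha>\<beta> p \<noteq> 0)"
  proof
    fix l assume "l \<in> {..<d}"
    then have "z l \<in> regular_at p" using zreg by blast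
    then obtain a b e where "z l = (\<lambda>q. a q / b q)" "homogeneous e a" "homogeneous e b" "b p \<noteq> 0"
      unfolding regular_at_def by auto
    then show "\<exists>\<alpha>\<beta>. z l = (\<lambda>q. fst \<alpha>\<beta> q / snd \<alpha>\<beta> q) \<and>
        (\<exists>e. homogeneous e (fst \<alpha>\<beta>) \<and> homogeneous e (snd \<alpha>\<beta>) \<and> snd \<alpha>\<beta> p \<noteq> 0)"
      by (intro exI[of _ "(a, b)"]) auto
  qed
  from bchoice[OF this] obtain ab where ab: "\<forall>l\<in>{..<d}. z l = (\<lambda>q. fst (ab l) q / snd (ab l) q) \<and>
      (\<exists>e. homogeneous e (fst (ab l)) \<and> homogeneous e (snd (ab l)) \<and> snd (ab l) p \<noteq> 0)" ..
  define \<alpha> \<beta> where "\<alpha> = (\<lambda>l. fst (ab l))" and "\<beta> = (\<lambda>l. snd (ab l))"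
  have z: "z l = (\<lambda>q. \<alpha> l q / \<beta> l q)" and hom: "\<exists>e. homogeneous e (\<alpha> l) \<and> homogeneous e (\<beta> l) \<and> \<beta> l p \<noteq> 0"
    if "l < d" for l
    using ab that by (auto simp: \<alpha>_def \<beta>_def)
  obtain \<gamma> \<eta> e0 where g_eq: "g = (\<lambda>q. \<gamma> q / \<eta> q)" and g_hom: "homogeneous e0 \<gamma>" "homogeneous e0 \<eta>" "\<eta> p \<noteq> 0"
    using g unfolding regular_at_def by auto
  obtain e1 s1 where s1: "homogeneous e1 s1" "s1 p \<noteq> 0"
    and form': "\<And>q. q \<in> P \<Longrightarrow> q \<noteq> (\<lambda>_. 0) \<Longrightarrow> s1 q \<noteq> 0 \<Longrightarrow> (\<forall>x\<in>X. j x = q \<longrightarrow> (\<forall>v. (\<forall>i<d. v i \<in> tangent_space X x) \<longrightarrow>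
                \<omega> x v = g q * (Determinant.det (Matrix.mat d d (\<lambda>(i, l). differential X (\<lambda>y. z l (j y)) x (v i)))
                   / (\<Prod>l<k. z l q)) ^ m))"
    using form unfolding near_def by auto
  obtain e2 s2 where s2: "homogeneous e2 s2" "s2 p \<noteq> 0"
    and bd: "\<And>q. q \<in> P \<Longrightarrow> q \<noteq> (\<lambda>_. 0) \<Longrightarrow> s2 q \<noteq> 0 \<Longrightarrow> q \<in> boundary X P j \<longleftrightarrow> (\<exists>l<k. z l q = 0)"
    using kz unfolding snc_coordinates_def near_def by auto
  define s where "s = (\<lambda>q. s1 q * s2 q)"
  have s_hom: "homogeneous (e1 + e2) s"
    using s1(1) s2(1) unfolding homogeneous_def s_def
    by (auto intro: polyfun.mult simp: power_add)
  have main: "(\<forall>l<k. \<alpha> l (a y) \<noteq> 0) \<and> (\<forall>v. (\<forall>i<d. v i \<in> tangent_space X y) \<longrightarrow>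
           \<omega> y v = log_form_expression d k m (\<lambda>l y. \<alpha> l (a y)) (\<lambda>l y. \<beta> l (a y))
             (\<lambda>y. \<gamma> (a y)) (\<lambda>y. \<eta> (a y)) y v)"
    if y: "y \<in> X" "a y \<noteq> (\<lambda>_. 0)" "s (a y) \<noteq> 0" "\<eta> (a y) \<noteq> 0" "\<forall>l<d. \<beta> l (a y) \<noteq> 0" for y
  proof -
    obtain c where c: "c \<noteq> 0" "a y = scl c (j y)" using aj[OF y(1,2)] by blast
    have "s1 (a y) = c ^ e1 * s1 (j y)" "s2 (a y) = c ^ e2 * s2 (j y)"
      unfolding c(2) using homogeneous_scl s1(1) s2(1) by blast+
    then have s12: "s1 (j y) \<noteq> 0" "s2 (j y) \<noteq> 0" using y(3) by (auto simp: s_def)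
    have quot: "\<alpha> l (j x) / \<beta> l (j x) = \<alpha> l (a x) / \<beta> l (a x)" if l: "l < d" and x: "x \<in> X" "a x \<noteq> (\<lambda>_. 0)" for l x
    proof -
      obtain e where e: "homogeneous e (\<alpha> l)" "homogeneous e (\<beta> l)" using hom[OF l] by blast
      obtain c where c: "c \<noteq> 0" "a x = scl c (j x)" using aj[OF x] by blast
      show ?thesis
        unfolding c(2) homogeneous_scl[OF e(1)] homogeneous_scl[OF e(2)] using c(1) by simp
    qed
    have "j y \<notin> boundary X P j"
    proof -
      have "j y = scl 1 (j y) \<and> (1 :: complex) \<noteq> 0 \<and> y \<in> X" using y(1) by (simp add: scl_def)
      then have "j y \<in> {scl c (j x) | c x. c \<noteq> 0 \<and> x \<in> X}" by blast
      then show ?thesis unfolding boundary_def by blast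
    qed
    then have znz: "z l (j y) \<noteq> 0" if "l < k" for l
      using bd[OF jP[OF y(1)] s12(2)] that by blast
    have \<alpha>nz: "\<alpha> l (a y) \<noteq> 0" if "l < k" for l
    proof -
      have l: "l < d" using that kd by simp
      have "\<alpha> l (a y) / \<beta> l (a y) \<noteq> 0" using znz[OF that] z[OF l] quot[OF l y(1,2)] by simp
      then show ?thesis by auto
    qed
    have ap: "(\<lambda>y. h (a y)) \<in> polyfun" if "h \<in> polyfun" for h
      by (rule polyfun_compose[OF that a])
    obtain i0 where i0: "a y i0 \<noteq> 0" using y(2) by auto
    \<comment> \<open>The factor \<open>a y i0\<close> in numerator and denominator restricts the quotient to points where the coordinates \<open>a\<close> do not all vanish.\<close>
    have diff: "differential X (\<lambda>y. z l (j y)) y v = frac_diff (\<lambda>y. \<alpha> l (a y)) (\<lambda>y. \<beta> l (a y)) y v"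
      if l: "l < d" and v: "v \<in> tangent_space X y" for l v
    proof -
      obtain e where e: "homogeneous e (\<alpha> l)" "homogeneous e (\<beta> l)" using hom[OF l] by blast
      note pp = ap[OF homogeneous_polyfun[OF e(1)]] ap[OF homogeneous_polyfun[OF e(2)]]
      have "differential X (\<lambda>y. z l (j y)) y v =
          frac_diff (\<lambda>y. \<alpha> l (a y) * a y i0) (\<lambda>y. \<beta> l (a y) * a y i0) y v"
      proof (rule differential_eq[OF y(1) v])
        show "(\<lambda>y. \<alpha> l (a y) * a y i0) \<in> polyfun" "(\<lambda>y. \<beta> l (a y) * a y i0) \<in> polyfun"
          by (rule polyfun.mult[OF pp(1) a], rule polyfun.mult[OF pp(2) a])
        show "\<beta> l (a y) * a y i0 \<noteq> 0" using y(5) l i0 by simp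
        show "\<forall>x\<in>X. \<beta> l (a x) * a x i0 \<noteq> 0 \<longrightarrow> z l (j x) = \<alpha> l (a x) * a x i0 / (\<beta> l (a x) * a x i0)"
        proof (intro ballI impI)
          fix x assume x: "x \<in> X" "\<beta> l (a x) * a x i0 \<noteq> 0"
          then have "a x \<noteq> (\<lambda>_. 0)" by auto
          from quot[OF l x(1) this] show "z l (j x) = \<alpha> l (a x) * a x i0 / (\<beta> l (a x) * a x i0)"
            using x(2) unfolding z[OF l] by simp
        qed
      qed
      also have "\<dots> = frac_diff (\<lambda>y. \<alpha> l (a y)) (\<lambda>y. \<beta> l (a y)) y v"
        by (rule frac_diff_cancel[OF pp a i0])
      finally show ?thesis .
    qed
    have "\<omega> y v = log_form_expression d k m (\<lambda>l y. \<alpha> l (a y)) (\<lambda>l y. \<beta> l (a y))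
             (\<lambda>y. \<gamma> (a y)) (\<lambda>y. \<eta> (a y)) y v" if v: "\<forall>i<d. v i \<in> tangent_space X y" for v
    proof -
      have "\<omega> y v = g (j y) * (Determinant.det (Matrix.mat d d (\<lambda>(i, l). differential X (\<lambda>y. z l (j y)) y (v i)))
                   / (\<Prod>l<k. z l (j y))) ^ m"
        using form'[OF jP[OF y(1)] s12(1)] y(1) v by blast
      also have "Determinant.det (Matrix.mat d d (\<lambda>(i, l). differential X (\<lambda>y. z l (j y)) y (v i))) =
          Determinant.det (Matrix.mat d d (\<lambda>(i, l). frac_diff (\<lambda>y. \<alpha> l (a y)) (\<lambda>y. \<beta> l (a y)) y (v i)))"
        by (rule det_mat_cong) (rule diff, use v in auto)
      also have "(\<Prod>l<k. z l (j y)) = (\<Prod>l<k. \<alpha> l (a y) / \<beta> l (a y))"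
      proof (rule prod.cong[OF refl])
        fix l assume "l \<in> {..<k}"
        then have l: "l < d" using kd by simp
        show "z l (j y) = \<alpha> l (a y) / \<beta> l (a y)" unfolding z[OF l] by (rule quot[OF l y(1,2)])
      qed
      also have "g (j y) = \<gamma> (a y) / \<eta> (a y)"
        unfolding g_eq c(2) homogeneous_scl[OF g_hom(1)] homogeneous_scl[OF g_hom(2)] using c(1) by simp
      finally show ?thesis unfolding log_form_expression_def .
    qed
    then show ?thesis using \<alpha>nz by blast
  qed
  have sp: "s p \<noteq> 0" using s1 s2 by (simp add: s_def)
  show ?thesis
    apply (rule exI[of _ k], rule exI[of _ s], rule exI[of _ \<alpha>], rule exI[of _ \<beta>],
      rule exI[of _ \<gamma>], rule exI[of _ \<eta>])
    apply (intro conjI)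
    subgoal by (rule kd)
    subgoal by (rule exI) (rule s_hom)
    subgoal by (rule sp)
    subgoal using hom by blast
    subgoal using g_hom by blast
    subgoal using main by blast
    done
qed

section \<open>The additive group action\<close>

text \<open>
  The polynomials \<open>x\<close>, \<open>y + t x\<^sup>2\<close>, \<open>z + 2 t y + t\<^sup>2 x\<^sup>2\<close> again solve the equation. In the charts this is the
  translation \<open>u \<mapsto> u + t\<close>.
\<close>

definition flow :: "complex \<Rightarrow> pt \<Rightarrow> pt" where
  "flow t P = P(1 := P 1 + 2 * t * P 2 + t ^ 2 * P 0 ^ 2, 2 := P 2 + t * P 0 ^ 2)"

definition flow_field :: "pt \<Rightarrow> pt" where
  "flow_field P = (\<lambda>i. if i = 1 then 2 * P 2 else if i = 2 then P 0 ^ 2 else 0)"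

text \<open>
  The differential of the flow, which transports tangent vectors along orbits.
\<close>

definition push :: "complex \<Rightarrow> pt \<Rightarrow> pt \<Rightarrow> pt" where
  "push t P v = (\<lambda>i. dir_deriv (\<lambda>P. flow t P i) P v)"

lemma polyfun_flow: "(\<lambda>P. flow t P i) \<in> polyfun"
proof -
  have "(\<lambda>P. P 1 + 2 * t * P 2 + t ^ 2 * P 0 ^ 2) \<in> polyfun" "(\<lambda>P. P 2 + t * P 0 ^ 2) \<in> polyfun"
    by (intro polyfun.add polyfun.mult polyfun_power polyfun.coord polyfun.const)+
  then show ?thesis by (cases "i = 1"; cases "i = 2") (simp_all add: flow_def polyfun.coord)
qed

lemma flow_0: "flow 0 P = P"
  by (auto simp: flow_def fun_eq_iff)

lemma flow_danielewski:
  assumes "n > 0" "P \<in> danielewski n"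
  shows "flow t P \<in> danielewski n"
proof -
  have X: "P \<in> aff (n + 2)" "P 0 ^ 2 * P 1 = P 2 ^ 2 - 1" using assms by (auto simp: danielewski_def)
  have "P 0 ^ 2 * (P 1 + 2 * t * P 2 + t ^ 2 * P 0 ^ 2) = P 0 ^ 2 * P 1 + (P 2 + t * P 0 ^ 2) ^ 2 - P 2 ^ 2"
    by (simp add: power2_eq_square algebra_simps)
  then show ?thesis using X assms(1) by (auto simp: danielewski_def aff_def flow_def)
qed

section \<open>Determinants\<close>

abbreviation det_of :: "nat \<Rightarrow> (nat \<Rightarrow> nat \<Rightarrow> complex) \<Rightarrow> complex" where
  "det_of d F \<equiv> Determinant.det (Matrix.mat d d (\<lambda>(i, l). F i l))"

lemma det_of_eq:
  "det_of d F = (\<Sum>p\<in>{p. p permutes {0..<d}}. signof p * (\<Prod>i = 0..<d. F i (p i)))"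
proof -
  have "det_of d F = (\<Sum>p\<in>{p. p permutes {0..<d}}. signof p *
      (\<Prod>i = 0..<d. Matrix.mat d d (\<lambda>(i, l). F i l) $$ (i, p i)))"
    by (rule det_def') simp
  also have "\<dots> = (\<Sum>p\<in>{p. p permutes {0..<d}}. signof p * (\<Prod>i = 0..<d. F i (p i)))"
  proof (rule sum.cong[OF refl])
    fix p assume "p \<in> {p. p permutes {0..<d}}"
    then have p: "p permutes {0..<d}" by simp
    have "(\<Prod>i = 0..<d. Matrix.mat d d (\<lambda>(i, l). F i l) $$ (i, p i)) = (\<Prod>i = 0..<d. F i (p i))"
    proof (rule prod.cong[OF refl])
      fix i assume i: "i \<in> {0..<d}"
      then have "p i \<in> {0..<d}" using permutes_in_image[OF p] by blast
      then show "Matrix.mat d d (\<lambda>(i, l). F i l) $$ (i, p i) = F i (p i)" using i by simp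
    qed
    then show "signof p * (\<Prod>i = 0..<d. Matrix.mat d d (\<lambda>(i, l). F i l) $$ (i, p i)) =
        signof p * (\<Prod>i = 0..<d. F i (p i))" by (simp only:)
  qed
  finally show ?thesis .
qed

lemma det_scale_columns: "det_of d (\<lambda>i l. r l * F i l) = (\<Prod>l<d. r l) * det_of d F"
  unfolding det_of_eq sum_distrib_left
proof (rule sum.cong[OF refl])
  fix p assume "p \<in> {p. p permutes {0..<d}}"
  then have p: "p permutes {0..<d}" by simp
  have "(\<Prod>i = 0..<d. r (p i)) = (\<Prod>l<d. r l)"
    using prod.permute[OF p, of r] by (simp add: comp_def lessThan_atLeast0)
  then show "signof p * (\<Prod>i = 0..<d. r (p i) * F i (p i)) = (\<Prod>l<d. r l) * (signof p * (\<Prod>i = 0..<d. F i (p i)))"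
    by (simp add: prod.distrib mult_ac)
qed

lemma tendsto_det:
  assumes "\<And>i l. i < d \<Longrightarrow> l < d \<Longrightarrow> ((\<lambda>t. F t i l) \<longlongrightarrow> L i l) A"
  shows "((\<lambda>t. det_of d (F t)) \<longlongrightarrow> det_of d L) A"
  unfolding det_of_eq
proof (intro tendsto_sum tendsto_mult tendsto_prod tendsto_const)
  fix p i assume p: "p \<in> {p. p permutes {0..<d}}" and i: "i \<in> {0..<d}"
  have "p i \<in> {0..<d}" using permutes_in_image[of p "{0..<d}" i] p i by blast
  then show "((\<lambda>t. F t i (p i)) \<longlongrightarrow> L i (p i)) A" using assms i by simp
qed

lemma det_zero_iff_dependent:
  "det_of d F = 0 \<longleftrightarrow> (\<exists>c. (\<exists>i<d. c i \<noteq> 0) \<and> (\<forall>l<d. (\<Sum>i<d. c i * F i l) = 0))"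
proof -
  let ?A = "Matrix.mat d d (\<lambda>(i, l). F i l)"
  have "det_of d F = 0 \<longleftrightarrow> Determinant.det (transpose_mat ?A) = 0"
    by (subst det_transpose[where n = d]) simp_all
  also have "\<dots> \<longleftrightarrow> (\<exists>v. v \<in> carrier_vec d \<and> v \<noteq> 0\<^sub>v d \<and> transpose_mat ?A *\<^sub>v v = 0\<^sub>v d)"
    by (rule det_0_iff_vec_prod_zero) simp
  also have "\<dots> \<longleftrightarrow> (\<exists>c. (\<exists>i<d. c i \<noteq> 0) \<and> (\<forall>l<d. (\<Sum>i<d. c i * F i l) = 0))" (is "?L \<longleftrightarrow> ?R")
  proof -
    have eq: "(transpose_mat ?A *\<^sub>v v) $ l = (\<Sum>i<d. v $ i * F i l)" if "l < d" "v \<in> carrier_vec d" for v l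
      using that by (auto simp: scalar_prod_def lessThan_atLeast0 intro!: sum.cong)
    show ?thesis
    proof
      assume ?L
      then obtain v where v: "v \<in> carrier_vec d" "v \<noteq> 0\<^sub>v d" "transpose_mat ?A *\<^sub>v v = 0\<^sub>v d" by blast
      have "\<exists>i<d. v $ i \<noteq> 0"
      proof (rule ccontr)
        assume "\<not> (\<exists>i<d. v $ i \<noteq> 0)"
        then have "v = 0\<^sub>v d" using v(1) by (intro eq_vecI) auto
        then show False using v(2) by simp
      qed
      moreover have "(\<Sum>i<d. v $ i * F i l) = 0" if "l < d" for l
        using eq[OF that v(1)] that v(3) by simp
      ultimately show ?R by (intro exI[of _ "\<lambda>i. v $ i"]) simp
    next
      assume ?R
      then obtain c where c: "\<exists>i<d. c i \<noteq> 0" "\<forall>l<d. (\<Sum>i<d. c i * F i l) = 0" by blast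
      let ?v = "Matrix.vec d c"
      have v: "?v \<in> carrier_vec d" by simp
      have "?v \<noteq> 0\<^sub>v d"
      proof
        assume e: "?v = 0\<^sub>v d"
        have "c i = 0" if "i < d" for i using arg_cong[OF e, of "\<lambda>w. Matrix.vec_index w i"] that by simp
        then show False using c(1) by blast
      qed
      moreover have "transpose_mat ?A *\<^sub>v ?v = 0\<^sub>v d"
      proof (rule eq_vecI)
        fix l assume "l < dim_vec (0\<^sub>v d :: complex Matrix.vec)"
        then have l: "l < d" by simp
        have "(\<Sum>i<d. ?v $ i * F i l) = (\<Sum>i<d. c i * F i l)" by (rule sum.cong) auto
        then show "(transpose_mat ?A *\<^sub>v ?v) $ l = 0\<^sub>v d $ l"
          unfolding eq[OF l v] using c(2) l by simp
      qed simp
      ultimately show ?L using v by blast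
    qed
  qed
  finally show ?thesis .
qed

lemma more_vectors_than_coordinates:
  fixes d :: nat and F :: "nat \<Rightarrow> nat \<Rightarrow> complex"
  shows "\<exists>c. (\<exists>i\<le>d. c i \<noteq> 0) \<and> (\<forall>l<d. (\<Sum>i\<le>d. c i * F i l) = (0 :: complex))"
proof -
  \<comment> \<open>A zero column makes the matrix square.\<close>
  define G where "G = (\<lambda>i l. (if l = d then 0 else 1) * F i l)"
  have "det_of (Suc d) G = 0"
    unfolding G_def det_scale_columns by simp
  then obtain c where c: "\<exists>i<Suc d. c i \<noteq> 0" "\<forall>l<Suc d. (\<Sum>i<Suc d. c i * G i l) = 0"
    unfolding det_zero_iff_dependent by blast
  have "(\<Sum>i\<le>d. c i * F i l) = 0" if "l < d" for l
    using c(2)[rule_format, of l] that by (simp add: G_def lessThan_Suc_atMost)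
  then show ?thesis using c(1) less_Suc_eq_le by blast
qed

section \<open>Locally rational functions\<close>

text \<open>
  Quotients with polynomial numerator and denominator, the latter not vanishing at \<open>x\<close>. This class is closed under the
  operations in the formula for a logarithmic form.
\<close>

definition rational_at :: "pt \<Rightarrow> (pt \<Rightarrow> complex) \<Rightarrow> bool" where
  "rational_at x \<phi> \<longleftrightarrow> (\<exists>A\<in>polyfun. \<exists>B\<in>polyfun. B x \<noteq> 0 \<and> (\<forall>y. B y \<noteq> 0 \<longrightarrow> \<phi> y = A y / B y))"

lemma rational_atI:
  "A \<in> polyfun \<Longrightarrow> B \<in> polyfun \<Longrightarrow> B x \<noteq> 0 \<Longrightarrow> (\<And>y. B y \<noteq> 0 \<Longrightarrow> \<phi> y = A y / B y) \<Longrightarrow> rational_at x \<phi>"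
  unfolding rational_at_def by blast

lemma rational_atE:
  assumes "rational_at x \<phi>"
  obtains A B where "A \<in> polyfun" "B \<in> polyfun" "B x \<noteq> 0" "\<And>y. B y \<noteq> 0 \<Longrightarrow> \<phi> y = A y / B y"
  using assms unfolding rational_at_def by blast

lemma rational_at_const: "rational_at x (\<lambda>_. c)"
  by (rule rational_atI[OF polyfun.const[of c] polyfun.const[of 1]]) simp_all

lemma rational_at_add:
  assumes "rational_at x \<phi>" "rational_at x \<psi>"
  shows "rational_at x (\<lambda>y. \<phi> y + \<psi> y)"
proof -
  obtain A B where 1: "A \<in> polyfun" "B \<in> polyfun" "B x \<noteq> 0" "\<And>y. B y \<noteq> 0 \<Longrightarrow> \<phi> y = A y / B y"
    using assms(1) by (rule rational_atE) blast
  obtain C D where 2: "C \<in> polyfun" "D \<in> polyfun" "D x \<noteq> 0" "\<And>y. D y \<noteq> 0 \<Longrightarrow> \<psi> y = C y / D y"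
    using assms(2) by (rule rational_atE) blast
  show ?thesis
    by (rule rational_atI[OF polyfun.add[OF polyfun.mult[OF 1(1) 2(2)] polyfun.mult[OF 2(1) 1(2)]]
          polyfun.mult[OF 1(2) 2(2)]])
       (use 1(3,4) 2(3,4) in \<open>simp_all add: add_frac_eq\<close>)
qed

lemma rational_at_mult:
  assumes "rational_at x \<phi>" "rational_at x \<psi>"
  shows "rational_at x (\<lambda>y. \<phi> y * \<psi> y)"
proof -
  obtain A B where 1: "A \<in> polyfun" "B \<in> polyfun" "B x \<noteq> 0" "\<And>y. B y \<noteq> 0 \<Longrightarrow> \<phi> y = A y / B y"
    using assms(1) by (rule rational_atE) blast
  obtain C D where 2: "C \<in> polyfun" "D \<in> polyfun" "D x \<noteq> 0" "\<And>y. D y \<noteq> 0 \<Longrightarrow> \<psi> y = C y / D y"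
    using assms(2) by (rule rational_atE) blast
  show ?thesis
    by (rule rational_atI[OF polyfun.mult[OF 1(1) 2(1)] polyfun.mult[OF 1(2) 2(2)]])
       (use 1(3,4) 2(3,4) in simp_all)
qed

lemma rational_at_sum: "(\<And>i. i \<in> I \<Longrightarrow> rational_at x (\<phi> i)) \<Longrightarrow> rational_at x (\<lambda>y. \<Sum>i\<in>I. \<phi> i y)"
  by (induction I rule: infinite_finite_induct) (simp_all add: rational_at_const rational_at_add)

lemma rational_at_prod: "(\<And>i. i \<in> I \<Longrightarrow> rational_at x (\<phi> i)) \<Longrightarrow> rational_at x (\<lambda>y. \<Prod>i\<in>I. \<phi> i y)"
  by (induction I rule: infinite_finite_induct) (simp_all add: rational_at_const rational_at_mult)

lemma rational_at_power: "rational_at x \<phi> \<Longrightarrow> rational_at x (\<lambda>y. \<phi> y ^ k)"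
  by (induction k) (simp_all add: rational_at_const rational_at_mult)

lemma rational_at_quotient:
  assumes "a \<in> polyfun" "b \<in> polyfun" "b x \<noteq> 0"
  shows "rational_at x (\<lambda>y. a y / b y)"
  by (rule rational_atI[OF assms]) simp

lemma rational_at_det:
  assumes "\<And>i l. i < d \<Longrightarrow> l < d \<Longrightarrow> rational_at x (\<lambda>y. F y i l)"
  shows "rational_at x (\<lambda>y. det_of d (F y))"
  unfolding det_of_eq
proof (intro rational_at_sum rational_at_mult rational_at_prod rational_at_const)
  fix p i assume p: "p \<in> {p. p permutes {0..<d}}" and i: "i \<in> {0..<d}"
  have "p i \<in> {0..<d}" using permutes_in_image[of p "{0..<d}" i] p i by blast
  then show "rational_at x (\<lambda>y. F y i (p i))" using assms i by simp
qed

lemma polyfun_dir_deriv_compose: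
  assumes "h \<in> polyfun" "\<And>i. (\<lambda>q. Y q i) \<in> polyfun" "\<And>i. (\<lambda>q. W q i) \<in> polyfun"
  shows "(\<lambda>q. dir_deriv h (Y q) (W q)) \<in> polyfun"
  using assms(1)
proof (induction h rule: polyfun.induct)
  case (mult a b)
  show ?case
    unfolding dir_deriv_mult[OF mult.hyps]
    by (rule polyfun.add[OF polyfun.mult[OF mult.IH(1) polyfun_compose[OF mult.hyps(2) assms(2)]]
          polyfun.mult[OF polyfun_compose[OF mult.hyps(1) assms(2)] mult.IH(2)]])
qed (simp_all add: dir_deriv_add polyfun.const polyfun.add assms)

lemma rational_at_log_form:
  assumes fb: "\<And>l. l < d \<Longrightarrow> f l \<in> polyfun \<and> b l \<in> polyfun \<and> b l (Y q) \<noteq> 0"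
    and gh: "g \<in> polyfun" "h \<in> polyfun" "h (Y q) \<noteq> 0"
    and k: "k \<le> d" "\<And>l. l < k \<Longrightarrow> f l (Y q) \<noteq> 0"
    and YW: "\<And>i. (\<lambda>q. Y q i) \<in> polyfun" "\<And>j i. (\<lambda>q. W j q i) \<in> polyfun"
  shows "rational_at q (\<lambda>q. log_form_expression d k m f b g h (Y q) (\<lambda>j. W j q))"
proof -
  have c: "(\<lambda>q. u (Y q)) \<in> polyfun" if "u \<in> polyfun" for u
    by (rule polyfun_compose[OF that YW(1)])
  have D: "(\<lambda>q. dir_deriv u (Y q) (W j q)) \<in> polyfun" if "u \<in> polyfun" for u j
    by (rule polyfun_dir_deriv_compose[OF that YW(1) YW(2)])
  have fd: "rational_at q (\<lambda>q. frac_diff (f l) (b l) (Y q) (W i q))" if l: "l < d" for i l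
  proof -
    have fp: "f l \<in> polyfun" and bp: "b l \<in> polyfun" and bq: "b l (Y q) \<noteq> 0" using fb[OF l] by auto
    show ?thesis
      unfolding frac_diff_def
    proof (rule rational_at_quotient)
      show "(\<lambda>q. dir_deriv (f l) (Y q) (W i q) * b l (Y q) - f l (Y q) * dir_deriv (b l) (Y q) (W i q)) \<in> polyfun"
        by (rule polyfun_diff[OF polyfun.mult[OF D[OF fp] c[OF bp]] polyfun.mult[OF c[OF fp] D[OF bp]]])
      show "(\<lambda>q. (b l (Y q))\<^sup>2) \<in> polyfun" by (rule polyfun_power[OF c[OF bp]])
      show "(b l (Y q))\<^sup>2 \<noteq> 0" using bq by simp
    qed
  qed
  have "rational_at q (\<lambda>q. g (Y q) / h (Y q))"
    by (rule rational_at_quotient[OF c[OF gh(1)] c[OF gh(2)] gh(3)])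
  moreover have "rational_at q (\<lambda>q. det_of d (\<lambda>i l. frac_diff (f l) (b l) (Y q) (W i q)))"
    by (rule rational_at_det[OF fd])
  moreover have "rational_at q (\<lambda>q. \<Prod>l<k. b l (Y q) / f l (Y q))"
  proof (rule rational_at_prod)
    fix l assume "l \<in> {..<k}"
    then have l: "l < d" "l < k" using k(1) by auto
    then show "rational_at q (\<lambda>q. b l (Y q) / f l (Y q))"
      using fb[OF l(1)] k(2)[OF l(2)] by (intro rational_at_quotient c) auto
  qed
  ultimately have "rational_at q (\<lambda>q. g (Y q) / h (Y q) *
      (det_of d (\<lambda>i l. frac_diff (f l) (b l) (Y q) (W i q)) * (\<Prod>l<k. b l (Y q) / f l (Y q))) ^ m)"
    by (intro rational_at_mult rational_at_power)
  moreover have "(\<Prod>l<k. b l (Y q) / f l (Y q)) = 1 / (\<Prod>l<k. f l (Y q) / b l (Y q))" for q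
    by (simp add: prod_dividef)
  ultimately show ?thesis unfolding log_form_expression_def by simp
qed

section \<open>Orbits of the action\<close>

lemma flow_add: "flow s (flow t P) = flow (s + t) P"
  by (auto simp: flow_def fun_eq_iff power2_eq_square algebra_simps)

lemma push_eq:
  "push t P v = v(1 := v 1 + 2 * t * v 2 + t ^ 2 * (2 * P 0 * v 0), 2 := v 2 + t * (2 * P 0 * v 0))"
proof -
  have 1: "dir_deriv (\<lambda>P. P 1 + 2 * t * P 2 + t ^ 2 * P 0 ^ 2) P v =
      v 1 + 2 * t * v 2 + t ^ 2 * (2 * P 0 * v 0)"
    by (rule dir_deriv_unique) (auto intro!: derivative_eq_intros)
  have 2: "dir_deriv (\<lambda>P. P 2 + t * P 0 ^ 2) P v = v 2 + t * (2 * P 0 * v 0)"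
    by (rule dir_deriv_unique) (auto intro!: derivative_eq_intros)
  have "push t P v i = (v(1 := v 1 + 2 * t * v 2 + t ^ 2 * (2 * P 0 * v 0), 2 := v 2 + t * (2 * P 0 * v 0))) i" for i
  proof -
    consider "i = 1" | "i = 2" | "i \<noteq> 1" "i \<noteq> 2" by blast
    then show ?thesis
    proof cases
      case 1
      then show ?thesis unfolding push_def flow_def using \<open>dir_deriv (\<lambda>P. P 1 + 2 * t * P 2 + t ^ 2 * P 0 ^ 2) P v = _\<close> by simp
    next
      case 2
      then show ?thesis unfolding push_def flow_def using \<open>dir_deriv (\<lambda>P. P 2 + t * P 0 ^ 2) P v = _\<close> by simp
    next
      case 3
      then show ?thesis unfolding push_def flow_def by simp
    qed
  qed
  then show ?thesis by blast
qed

lemma push_0: "push 0 P v = v"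
  unfolding push_eq by (simp add: fun_eq_iff)

lemma polyfun_flow_time: "(\<lambda>q. flow (q 0) P i) \<in> polyfun"
proof -
  have "(\<lambda>q. P 1 + 2 * q 0 * P 2 + q 0 ^ 2 * P 0 ^ 2) \<in> polyfun" "(\<lambda>q. P 2 + q 0 * P 0 ^ 2) \<in> polyfun"
    by (intro polyfun.add polyfun.mult polyfun_power polyfun.coord polyfun.const)+
  then show ?thesis by (cases "i = 1"; cases "i = 2") (simp_all add: flow_def polyfun.const)
qed

lemma polyfun_push_time: "(\<lambda>q. push (q 0) P v i) \<in> polyfun"
proof -
  have "(\<lambda>q. v 1 + 2 * q 0 * v 2 + q 0 ^ 2 * (2 * P 0 * v 0)) \<in> polyfun"
    "(\<lambda>q. v 2 + q 0 * (2 * P 0 * v 0)) \<in> polyfun"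
    by (intro polyfun.add polyfun.mult polyfun_power polyfun.coord polyfun.const)+
  then show ?thesis unfolding push_eq by (cases "i = 1"; cases "i = 2") (simp_all add: polyfun.const)
qed

lemma dir_deriv_push: "h \<in> polyfun \<Longrightarrow> dir_deriv h (flow t P) (push t P v) = dir_deriv (\<lambda>Q. h (flow t Q)) P v"
  unfolding push_def by (rule dir_deriv_compose[symmetric, OF _ polyfun_flow])

lemma push_tangent:
  assumes n: "n > 0" and v: "v \<in> tangent_space (danielewski n) P"
  shows "push t P v \<in> tangent_space (danielewski n) (flow t P)"
  unfolding tangent_space_def
proof (intro CollectI ballI impI)
  fix h assume h: "h \<in> polyfun" "\<forall>y\<in>danielewski n. h y = 0"
  have z: "\<forall>y\<in>danielewski n. h (flow t y) = 0" using h(2) flow_danielewski[OF n] by blast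
  have "dir_deriv g P v = 0" if "g \<in> polyfun" "\<forall>y\<in>danielewski n. g y = 0" for g
    using v that by (simp add: tangent_space_def)
  from this[OF polyfun_compose[OF h(1) polyfun_flow] z]
  show "dir_deriv h (flow t P) (push t P v) = 0" unfolding dir_deriv_push[OF h(1)] .
qed

lemma flow_derivative:
  assumes "h \<in> polyfun"
  shows "((\<lambda>t. h (flow t P)) has_field_derivative dir_deriv h P (flow_field P)) (at 0)"
proof -
  have "((\<lambda>t. h (flow t P)) has_field_derivative dir_deriv h (flow 0 P) (flow_field P)) (at 0)"
  proof (rule polyfun_curve_derivative[OF assms])
    fix i :: nat
    consider "i = 1" | "i = 2" | "i \<noteq> 1" "i \<noteq> 2" by blast
    then show "((\<lambda>t. flow t P i) has_field_derivative flow_field P i) (at 0)"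
    proof cases
      case 1
      then show ?thesis unfolding flow_def flow_field_def by (auto intro!: derivative_eq_intros)
    next
      case 2
      then show ?thesis unfolding flow_def flow_field_def by (auto intro!: derivative_eq_intros)
    next
      case 3
      then show ?thesis unfolding flow_def flow_field_def by simp
    qed
  qed
  then show ?thesis unfolding flow_0 .
qed

lemma flow_field_tangent:
  assumes n: "n > 0" and P: "P \<in> danielewski n"
  shows "flow_field P \<in> tangent_space (danielewski n) P"
  unfolding tangent_space_def
proof (intro CollectI ballI impI)
  fix h assume h: "h \<in> polyfun" "\<forall>y\<in>danielewski n. h y = 0"
  have "(\<lambda>t. h (flow t P)) = (\<lambda>t. 0)" using h(2) flow_danielewski[OF n P] by auto
  then have "((\<lambda>t. 0) has_field_derivative dir_deriv h P (flow_field P)) (at 0)"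
    using flow_derivative[OF h(1), of P] by (simp only:)
  then show "dir_deriv h P (flow_field P) = 0" using DERIV_unique DERIV_const by blast
qed

text \<open>
  The flow is polynomial in the time.
\<close>

lemma flow_expansion:
  assumes "h \<in> polyfun"
  shows "\<exists>p :: pt \<Rightarrow> complex poly. \<exists>K. (\<forall>i. (\<lambda>P. coeff (p P) i) \<in> polyfun) \<and> (\<forall>P. degree (p P) \<le> K) \<and>
    (\<forall>P t. h (flow t P) = poly (p P) t)"
  using assms
proof (induction h rule: polyfun.induct)
  case (const c)
  show ?case
    by (rule exI[of _ "\<lambda>_. [:c:]"], rule exI[of _ 0]) (simp add: polyfun.const)
next
  case (coord i)
  define p :: "pt \<Rightarrow> complex poly" where
    "p = (\<lambda>P. if i = 1 then [:P 1, 2 * P 2, P 0 ^ 2:] else if i = 2 then [:P 2, P 0 ^ 2:] else [:P i:])"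
  have c: "(\<lambda>P. coeff (p P) j) \<in> polyfun" for j
  proof -
    have "(\<lambda>P. 2 * P 2) \<in> polyfun" "(\<lambda>P. P 0 ^ 2) \<in> polyfun" by (intro polyfun.intros polyfun_power)+
    note q = this
    consider "j = 0" | "j = 1" | "j = 2" | k where "j = Suc (Suc (Suc k))"
      by (metis One_nat_def Suc_1 not0_implies_Suc)
    then show ?thesis
      unfolding p_def
      by cases (cases "i = 1"; cases "i = 2";
        use q in \<open>simp add: polyfun.coord polyfun.const numeral_2_eq_2\<close>)+
  qed
  show ?case
    by (rule exI[of _ p], rule exI[of _ 2])
       (use c in \<open>auto simp: p_def flow_def power2_eq_square algebra_simps\<close>)
next
  case (add a b)
  obtain p K q L where p: "\<forall>i. (\<lambda>P. coeff (p P) i) \<in> polyfun" "\<forall>P. degree (p P) \<le> K" "\<forall>P t. a (flow t P) = poly (p P) t"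
    and q: "\<forall>i. (\<lambda>P. coeff (q P) i) \<in> polyfun" "\<forall>P. degree (q P) \<le> L" "\<forall>P t. b (flow t P) = poly (q P) t"
    using add.IH by blast
  show ?case
  proof (rule exI[of _ "\<lambda>P. p P + q P"], rule exI[of _ "max K L"], intro conjI allI)
    fix P :: pt and i :: nat and t
    show "(\<lambda>P. coeff (p P + q P) i) \<in> polyfun"
      unfolding coeff_add by (rule polyfun.add[OF p(1)[rule_format] q(1)[rule_format]])
    show "degree (p P + q P) \<le> max K L" using p(2) q(2) by (intro degree_add_le) (auto simp: le_max_iff_disj)
    show "a (flow t P) + b (flow t P) = poly (p P + q P) t" using p(3) q(3) by simp
  qed
next
  case (mult a b)
  obtain p K q L where p: "\<forall>i. (\<lambda>P. coeff (p P) i) \<in> polyfun" "\<forall>P. degree (p P) \<le> K" "\<forall>P t. a (flow t P) = poly (p P) t"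
    and q: "\<forall>i. (\<lambda>P. coeff (q P) i) \<in> polyfun" "\<forall>P. degree (q P) \<le> L" "\<forall>P t. b (flow t P) = poly (q P) t"
    using mult.IH by blast
  show ?case
  proof (rule exI[of _ "\<lambda>P. p P * q P"], rule exI[of _ "K + L"], intro conjI allI)
    fix P :: pt and i :: nat and t
    show "(\<lambda>P. coeff (p P * q P) i) \<in> polyfun"
      unfolding coeff_mult
      by (rule polyfun_sum, rule polyfun.mult[OF p(1)[rule_format] q(1)[rule_format]])
    have "degree (p P * q P) \<le> degree (p P) + degree (q P)" by (rule degree_mult_le)
    then show "degree (p P * q P) \<le> K + L" using p(2)[rule_format, of P] q(2)[rule_format, of P] by linarith
    show "a (flow t P) * b (flow t P) = poly (p P * q P) t" using p(3) q(3) by simp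
  qed
qed

lemma sum_powers_limit:
  fixes c :: "nat \<Rightarrow> complex"
  shows "((\<lambda>t. (\<Sum>i\<le>K. c i * t ^ i) / t ^ K) \<longlongrightarrow> c K) at_infinity"
proof -
  have "((\<lambda>t. c i * t ^ i / t ^ K) \<longlongrightarrow> (if i = K then c K else 0)) at_infinity" if i: "i \<le> K" for i
  proof -
    have nz: "eventually (\<lambda>t :: complex. t \<noteq> 0) at_infinity" by (rule eventually_not_equal_at_infinity)
    have "((\<lambda>t. c i * inverse t ^ (K - i)) \<longlongrightarrow> c i * 0 ^ (K - i)) at_infinity"
      by (intro tendsto_intros tendsto_inverse_0)
    then have "((\<lambda>t. c i * t ^ i / t ^ K) \<longlongrightarrow> c i * 0 ^ (K - i)) at_infinity"
    proof (rule Lim_transform_eventually)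
      show "eventually (\<lambda>t. c i * inverse t ^ (K - i) = c i * t ^ i / t ^ K) at_infinity"
        using nz
      proof eventually_elim
        case (elim t)
        have "t ^ K = t ^ i * t ^ (K - i)" using i by (simp flip: power_add)
        then show ?case using elim by (simp add: power_inverse field_simps)
      qed
    qed
    moreover have "c i * 0 ^ (K - i) = (if i = K then c K else 0)" using i by (auto simp: power_0_left)
    ultimately show ?thesis by simp
  qed
  then have "((\<lambda>t. \<Sum>i\<le>K. c i * t ^ i / t ^ K) \<longlongrightarrow> (\<Sum>i\<le>K. if i = K then c K else 0)) at_infinity"
    by (intro tendsto_sum) simp
  then show ?thesis by (simp add: sum_divide_distrib)
qed

lemma poly_as_sum: "degree (p :: complex poly) \<le> K \<Longrightarrow> poly p t = (\<Sum>i\<le>K. coeff p i * t ^ i)"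
proof -
  assume "degree p \<le> K"
  then have "poly p t = poly (\<Sum>i\<le>K. monom (coeff p i) i) t" by (simp only: poly_as_sum_of_monoms')
  then show ?thesis by (simp add: poly_sum poly_monom)
qed

lemma flow_leading:
  assumes h: "h \<in> polyfun" and nz: "\<exists>Q\<in>X. h Q \<noteq> 0"
  shows "\<exists>c K. (\<forall>i. c i \<in> polyfun) \<and> (\<exists>Q\<in>X. c K Q \<noteq> 0) \<and> (\<forall>P\<in>X. \<forall>t. h (flow t P) = (\<Sum>i\<le>K. c i P * t ^ i))"
proof -
  obtain p K0 where p: "\<forall>i. (\<lambda>P. coeff (p P) i) \<in> polyfun" "\<forall>P. degree (p P) \<le> K0" "\<forall>P t. h (flow t P) = poly (p P) t"
    using flow_expansion[OF h] by blast
  define S where "S = {i. \<exists>Q\<in>X. coeff (p Q) i \<noteq> 0}"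
  have "S \<subseteq> {..K0}"
  proof
    fix i assume "i \<in> S"
    then obtain Q where "coeff (p Q) i \<noteq> 0" unfolding S_def by blast
    then have "i \<le> degree (p Q)" by (rule le_degree)
    then show "i \<in> {..K0}" using p(2) order_trans by auto
  qed
  then have fin: "finite S" using finite_subset by blast
  have ne: "S \<noteq> {}"
  proof
    assume "S = {}"
    then have "p Q = 0" if "Q \<in> X" for Q using that unfolding S_def by (auto simp: poly_eq_iff)
    then have "h (flow 0 Q) = 0" if "Q \<in> X" for Q using that p(3) by simp
    then show False using nz unfolding flow_0 by blast
  qed
  have deg: "degree (p P) \<le> Max S" if "P \<in> X" for P
  proof (rule degree_le, intro allI impI)
    fix i assume "Max S < i"
    then have "i \<notin> S" using Max_ge[OF fin] by (metis not_le)
    then show "coeff (p P) i = 0" using that unfolding S_def by blast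
  qed
  show ?thesis
  proof (rule exI[of _ "\<lambda>i P. coeff (p P) i"], rule exI[of _ "Max S"], intro conjI)
    show "\<exists>Q\<in>X. coeff (p Q) (Max S) \<noteq> 0" using Max_in[OF fin ne] unfolding S_def by blast
    show "\<forall>P\<in>X. \<forall>t. h (flow t P) = (\<Sum>i\<le>Max S. coeff (p P) i * t ^ i)"
      using p(3) poly_as_sum[OF deg] by simp
  qed (use p(1) in simp)
qed

text \<open>
  Along an orbit \<open>h\<close> is a polynomial in the time; \<open>N\<close> is the leading coefficient for the general orbit. Coefficients of
  higher order vanish identically, so that their derivatives along tangent vectors vanish, too. The leading coefficient is
  unchanged by a translation of the time, that is, it is invariant under the flow.
\<close>

lemma log_derivative_limit:
  assumes n: "n > 0" and h: "h \<in> polyfun" and nz: "\<exists>Q\<in>danielewski n. h Q \<noteq> 0"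
  shows "\<exists>N. N \<in> polyfun \<and> (\<exists>Q\<in>danielewski n. N Q \<noteq> 0) \<and>
    (\<forall>P\<in>danielewski n. dir_deriv N P (flow_field P) = 0 \<and>
      (N P \<noteq> 0 \<longrightarrow> eventually (\<lambda>t. h (flow t P) \<noteq> 0) at_infinity \<and>
        (\<forall>v\<in>tangent_space (danielewski n) P.
          ((\<lambda>t. dir_deriv h (flow t P) (push t P v) / h (flow t P)) \<longlongrightarrow> dir_deriv N P v / N P) at_infinity)))"
proof -
  let ?X = "danielewski n"
  obtain c K where c: "\<forall>i. c i \<in> polyfun" "\<exists>Q\<in>?X. c K Q \<noteq> 0"
    and exp: "\<forall>P\<in>?X. \<forall>t. h (flow t P) = (\<Sum>i\<le>K. c i P * t ^ i)"
    using flow_leading[OF h nz] by blast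
  have lim: "((\<lambda>t. h (flow t P) / t ^ K) \<longlongrightarrow> c K P) at_infinity" if "P \<in> ?X" for P
    using sum_powers_limit[of "\<lambda>i. c i P" K] exp that by simp
  have t0: "eventually (\<lambda>t :: complex. t \<noteq> 0) at_infinity" by (rule eventually_not_equal_at_infinity)
  have inv: "c K (flow s P) = c K P" if P: "P \<in> ?X" for s P
  proof -
    have "filterlim (\<lambda>t. t + s) at_infinity at_infinity"
      by (rule tendsto_add_filterlim_at_infinity'[OF filterlim_ident tendsto_const])
    from filterlim_compose[OF lim[OF P] this]
    have 1: "((\<lambda>t. h (flow (t + s) P) / (t + s) ^ K) \<longlongrightarrow> c K P) at_infinity" .
    have "((\<lambda>t. ((t + s) / t) ^ K) \<longlongrightarrow> (1 + s * 0) ^ K) at_infinity"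
    proof (rule Lim_transform_eventually)
      show "((\<lambda>t. (1 + s * inverse t) ^ K) \<longlongrightarrow> (1 + s * 0) ^ K) at_infinity"
        by (intro tendsto_intros tendsto_inverse_0)
      show "eventually (\<lambda>t. (1 + s * inverse t) ^ K = ((t + s) / t) ^ K) at_infinity"
        using t0 by eventually_elim (simp add: field_simps)
    qed
    from tendsto_mult[OF 1 this]
    have 2: "((\<lambda>t. h (flow (t + s) P) / (t + s) ^ K * ((t + s) / t) ^ K) \<longlongrightarrow> c K P) at_infinity" by simp
    have "eventually (\<lambda>t. h (flow (t + s) P) / (t + s) ^ K * ((t + s) / t) ^ K = h (flow t (flow s P)) / t ^ K) at_infinity"
      using eventually_not_equal_at_infinity[of "- s"]
    proof eventually_elim
      case (elim t)
      then have "t + s \<noteq> 0" by (simp add: eq_neg_iff_add_eq_0)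
      then show ?case by (simp add: flow_add power_divide)
    qed
    from Lim_transform_eventually[OF 2 this]
    have "((\<lambda>t. h (flow t (flow s P)) / t ^ K) \<longlongrightarrow> c K P) at_infinity" .
    moreover have "((\<lambda>t. h (flow t (flow s P)) / t ^ K) \<longlongrightarrow> c K (flow s P)) at_infinity"
      by (rule lim[OF flow_danielewski[OF n P]])
    ultimately show ?thesis by (rule tendsto_unique[OF trivial_limit_at_infinity, symmetric])
  qed
  have D0: "dir_deriv (c K) P (flow_field P) = 0" if P: "P \<in> ?X" for P
  proof -
    have "((\<lambda>t. c K P) has_field_derivative dir_deriv (c K) P (flow_field P)) (at 0)"
      using flow_derivative[OF c(1)[rule_format], of K P] unfolding inv[OF P] .
    then show ?thesis using DERIV_unique DERIV_const by blast
  qed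
  have main: "eventually (\<lambda>t. h (flow t P) \<noteq> 0) at_infinity"
    "((\<lambda>t. dir_deriv h (flow t P) (push t P v) / h (flow t P)) \<longlongrightarrow> dir_deriv (c K) P v / c K P) at_infinity"
    if P: "P \<in> ?X" "c K P \<noteq> 0" and v: "v \<in> tangent_space ?X P" for P v
  proof -
    have D: "dir_deriv h (flow t P) (push t P v) = (\<Sum>i\<le>K. dir_deriv (c i) P v * t ^ i)" for t
    proof -
      have p1: "(\<lambda>Q. h (flow t Q)) \<in> polyfun" by (rule polyfun_compose[OF h polyfun_flow])
      have p3: "(\<lambda>Q. c i Q * t ^ i) \<in> polyfun" for i by (rule polyfun.mult[OF c(1)[rule_format] polyfun.const])
      have p2: "(\<lambda>Q. \<Sum>i\<le>K. c i Q * t ^ i) \<in> polyfun" by (rule polyfun_sum[OF p3])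
      have "dir_deriv (\<lambda>Q. h (flow t Q) - (\<Sum>i\<le>K. c i Q * t ^ i)) P v = 0"
        using v polyfun_diff[OF p1 p2] exp unfolding tangent_space_def by simp
      then have "dir_deriv (\<lambda>Q. h (flow t Q)) P v = dir_deriv (\<lambda>Q. \<Sum>i\<le>K. c i Q * t ^ i) P v"
        unfolding dir_deriv_diff[OF p1 p2] by simp
      also have "\<dots> = (\<Sum>i\<le>K. dir_deriv (\<lambda>Q. c i Q * t ^ i) P v)" by (rule dir_deriv_sum[OF p3])
      also have "\<dots> = (\<Sum>i\<le>K. dir_deriv (c i) P v * t ^ i)"
        by (rule sum.cong[OF refl]) (simp add: dir_deriv_mult[OF c(1)[rule_format] polyfun.const])
      finally show ?thesis unfolding dir_deriv_push[OF h] .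
    qed
    have L: "((\<lambda>t. dir_deriv h (flow t P) (push t P v) / t ^ K) \<longlongrightarrow> dir_deriv (c K) P v) at_infinity"
      unfolding D by (rule sum_powers_limit)
    have ev: "eventually (\<lambda>t. h (flow t P) / t ^ K \<noteq> 0) at_infinity"
      by (rule tendsto_imp_eventually_ne[OF lim[OF P(1)] P(2)])
    then show "eventually (\<lambda>t. h (flow t P) \<noteq> 0) at_infinity" by eventually_elim auto
    show "((\<lambda>t. dir_deriv h (flow t P) (push t P v) / h (flow t P)) \<longlongrightarrow> dir_deriv (c K) P v / c K P) at_infinity"
    proof (rule Lim_transform_eventually[OF tendsto_divide[OF L lim[OF P(1)] P(2)]])
      show "eventually (\<lambda>t. dir_deriv h (flow t P) (push t P v) / t ^ K / (h (flow t P) / t ^ K) =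
          dir_deriv h (flow t P) (push t P v) / h (flow t P)) at_infinity"
        using t0 by eventually_elim simp
    qed
  qed
  show ?thesis
    by (rule exI[of _ "c K"]) (use c D0 main flow_field_tangent[OF n] in blast)
qed

section \<open>Logarithmic forms on the surface\<close>

text \<open>
  The map \<open>Y\<close> and the vectors \<open>W\<close> depend polynomially on parameters \<open>q\<close>. This is applied to an orbit, with the
  time as parameter, and to tangent vector fields, with the point itself as parameter.
\<close>

lemma log_form_rational:
  assumes snc: "snc_completion X P j" and lp: "log_pluricanonical X P j m \<omega>"
    and d: "zariski_dim X = d" and x: "Y q0 \<in> X"
    and Y: "\<And>i. (\<lambda>q. Y q i) \<in> polyfun" and W: "\<And>l i. (\<lambda>q. W l q i) \<in> polyfun"
  shows "\<exists>A B. A \<in> polyfun \<and> B \<in> polyfun \<and> B q0 \<noteq> 0 \<and>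
    (\<forall>q. B q \<noteq> 0 \<and> Y q \<in> X \<and> (\<forall>i<d. W i q \<in> tangent_space X (Y q)) \<longrightarrow> \<omega> (Y q) (\<lambda>i. W i q) = A q / B q)"
proof -
  let ?x = "Y q0"
  have emb: "open_embedding X P j" using snc unfolding snc_completion_def by blast
  have jP: "j ?x \<in> P" "j ?x \<noteq> (\<lambda>_. 0)" using emb x unfolding open_embedding_def by blast+
  obtain a where a: "\<forall>i. (\<lambda>y. a y i) \<in> polyfun" "a ?x \<noteq> (\<lambda>_. 0)"
    and aj: "\<forall>y\<in>X. a y \<noteq> (\<lambda>_. 0) \<longrightarrow> (\<exists>c. c \<noteq> 0 \<and> a y = scl c (j y))"
    using emb x unfolding open_embedding_def by blast
  have near: "\<exists>k s \<alpha> \<beta> \<gamma> \<eta>. k \<le> d \<and> (\<exists>e. homogeneous e s) \<and> s (j ?x) \<noteq> 0 \<and>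
     (\<forall>l<d. \<exists>e. homogeneous e (\<alpha> l) \<and> homogeneous e (\<beta> l) \<and> \<beta> l (j ?x) \<noteq> 0) \<and>
     (\<exists>e. homogeneous e \<gamma> \<and> homogeneous e \<eta> \<and> \<eta> (j ?x) \<noteq> 0) \<and>
     (\<forall>y\<in>X. a y \<noteq> (\<lambda>_. 0) \<longrightarrow> s (a y) \<noteq> 0 \<longrightarrow> \<eta> (a y) \<noteq> 0 \<longrightarrow> (\<forall>l<d. \<beta> l (a y) \<noteq> 0) \<longrightarrow>
        (\<forall>l<k. \<alpha> l (a y) \<noteq> 0) \<and>
        (\<forall>v. (\<forall>i<d. v i \<in> tangent_space X y) \<longrightarrow>
           \<omega> y v = log_form_expression d k m (\<lambda>l y. \<alpha> l (a y)) (\<lambda>l y. \<beta> l (a y))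
             (\<lambda>y. \<gamma> (a y)) (\<lambda>y. \<eta> (a y)) y v))"
    by (rule log_form_near[OF snc lp d]) (use a(1) aj jP in blast)+
  then obtain k s \<alpha> \<beta> \<gamma> \<eta> where k: "k \<le> d" and s: "\<exists>e. homogeneous e s" "s (j ?x) \<noteq> 0"
    and \<alpha>\<beta>: "\<forall>l<d. \<exists>e. homogeneous e (\<alpha> l) \<and> homogeneous e (\<beta> l) \<and> \<beta> l (j ?x) \<noteq> 0"
    and \<gamma>\<eta>: "\<exists>e. homogeneous e \<gamma> \<and> homogeneous e \<eta> \<and> \<eta> (j ?x) \<noteq> 0"
    and form: "\<forall>y\<in>X. a y \<noteq> (\<lambda>_. 0) \<longrightarrow> s (a y) \<noteq> 0 \<longrightarrow> \<eta> (a y) \<noteq> 0 \<longrightarrow> (\<forall>l<d. \<beta> l (a y) \<noteq> 0) \<longrightarrow>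
        (\<forall>l<k. \<alpha> l (a y) \<noteq> 0) \<and>
        (\<forall>v. (\<forall>i<d. v i \<in> tangent_space X y) \<longrightarrow>
           \<omega> y v = log_form_expression d k m (\<lambda>l y. \<alpha> l (a y)) (\<lambda>l y. \<beta> l (a y))
             (\<lambda>y. \<gamma> (a y)) (\<lambda>y. \<eta> (a y)) y v)" by blast
  obtain c where c: "c \<noteq> 0" "a ?x = scl c (j ?x)" using aj x a(2) by blast
  have nz: "h (a ?x) \<noteq> 0" if "homogeneous e h" "h (j ?x) \<noteq> 0" for e h
    unfolding c(2) homogeneous_scl[OF that(1)] using that(2) c(1) by simp
  have ap: "(\<lambda>y. h (a y)) \<in> polyfun" if "homogeneous e h" for e h
    by (rule polyfun_compose[OF homogeneous_polyfun[OF that]]) (use a(1) in simp)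
  have sp: "(\<lambda>y. s (a y)) \<in> polyfun" "s (a ?x) \<noteq> 0" using s ap nz by blast+
  have gp: "(\<lambda>y. \<gamma> (a y)) \<in> polyfun" "(\<lambda>y. \<eta> (a y)) \<in> polyfun" "\<eta> (a ?x) \<noteq> 0" using \<gamma>\<eta> ap nz by blast+
  have bp: "(\<lambda>y. \<alpha> l (a y)) \<in> polyfun \<and> (\<lambda>y. \<beta> l (a y)) \<in> polyfun \<and> \<beta> l (a ?x) \<noteq> 0" if l: "l < d" for l
  proof -
    obtain e where e: "homogeneous e (\<alpha> l)" "homogeneous e (\<beta> l)" "\<beta> l (j ?x) \<noteq> 0" using \<alpha>\<beta> l by blast
    show ?thesis by (intro conjI ap[OF e(1)] ap[OF e(2)] nz[OF e(2,3)])
  qed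
  have bnz: "\<forall>l<d. \<beta> l (a ?x) \<noteq> 0" using bp by blast
  have kx: "\<alpha> l (a ?x) \<noteq> 0" if "l < k" for l
    using form x a(2) sp(2) gp(3) bnz that by blast
  have "rational_at q0 (\<lambda>q. log_form_expression d k m (\<lambda>l y. \<alpha> l (a y)) (\<lambda>l y. \<beta> l (a y))
             (\<lambda>y. \<gamma> (a y)) (\<lambda>y. \<eta> (a y)) (Y q) (\<lambda>i. W i q))"
    by (rule rational_at_log_form[OF bp gp k kx Y W])
  then obtain A B where AB: "A \<in> polyfun" "B \<in> polyfun" "B q0 \<noteq> 0"
    and eq: "\<And>q. B q \<noteq> 0 \<Longrightarrow> log_form_expression d k m (\<lambda>l y. \<alpha> l (a y)) (\<lambda>l y. \<beta> l (a y))
             (\<lambda>y. \<gamma> (a y)) (\<lambda>y. \<eta> (a y)) (Y q) (\<lambda>i. W i q) = A q / B q"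
    by (rule rational_atE) blast
  obtain i0 where i0: "a ?x i0 \<noteq> 0" using a(2) by auto
  \<comment> \<open>The formula for the form is valid where this does not vanish.\<close>
  define C where "C = (\<lambda>y. a y i0 * s (a y) * \<eta> (a y) * (\<Prod>l<d. \<beta> l (a y)))"
  have Cp: "C \<in> polyfun"
    unfolding C_def
    by (intro polyfun.mult sp(1) gp(2) a(1)[rule_format] polyfun_prod) (use bp in blast)
  have Cq: "(\<lambda>q. C (Y q)) \<in> polyfun" by (rule polyfun_compose[OF Cp Y])
  show ?thesis
  proof (rule exI[of _ "\<lambda>q. A q * C (Y q)"], rule exI[of _ "\<lambda>q. B q * C (Y q)"], intro conjI allI impI)
    show "(\<lambda>q. A q * C (Y q)) \<in> polyfun" by (rule polyfun.mult[OF AB(1) Cq])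
    show "(\<lambda>q. B q * C (Y q)) \<in> polyfun" by (rule polyfun.mult[OF AB(2) Cq])
    show "B q0 * C ?x \<noteq> 0" using AB(3) i0 sp(2) gp(3) bnz by (simp add: C_def)
    fix q assume q: "B q * C (Y q) \<noteq> 0 \<and> Y q \<in> X \<and> (\<forall>i<d. W i q \<in> tangent_space X (Y q))"
    then have "C (Y q) \<noteq> 0" by simp
    then have nzq: "a (Y q) \<noteq> (\<lambda>_. 0)" "s (a (Y q)) \<noteq> 0" "\<eta> (a (Y q)) \<noteq> 0" "\<forall>l<d. \<beta> l (a (Y q)) \<noteq> 0"
      unfolding C_def by auto
    have yX: "Y q \<in> X" and WT: "\<forall>i<d. W i q \<in> tangent_space X (Y q)" using q by auto
    note form[THEN bspec, OF yX, THEN mp, OF nzq(1), THEN mp, OF nzq(2), THEN mp, OF nzq(3), THEN mp, OF nzq(4)]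
    from this[THEN conjunct2, THEN spec[of _ "\<lambda>i. W i q"], THEN mp, OF WT]
    have "\<omega> (Y q) (\<lambda>i. W i q) = log_form_expression d k m (\<lambda>l y. \<alpha> l (a y)) (\<lambda>l y. \<beta> l (a y))
             (\<lambda>y. \<gamma> (a y)) (\<lambda>y. \<eta> (a y)) (Y q) (\<lambda>i. W i q)" .
    also have "\<dots> = A q / B q" by (rule eq) (use q in simp)
    finally show "\<omega> (Y q) (\<lambda>i. W i q) = A q * C (Y q) / (B q * C (Y q))" using \<open>C (Y q) \<noteq> 0\<close> by simp
  qed
qed

lemma log_form_along_flow_entire:
  assumes n: "n > 0" and snc: "snc_completion (danielewski n) P j"
    and lp: "log_pluricanonical (danielewski n) P j m \<omega>"
    and d: "zariski_dim (danielewski n) = d" and x: "x \<in> danielewski n"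
    and v: "\<And>i. i < d \<Longrightarrow> v i \<in> tangent_space (danielewski n) x"
  shows "(\<lambda>t. \<omega> (flow t x) (\<lambda>i. push t x (v i))) holomorphic_on UNIV"
proof -
  let ?X = "danielewski n" and ?H = "\<lambda>t. \<omega> (flow t x) (\<lambda>i. push t x (v i))"
  define \<tau> :: "complex \<Rightarrow> pt" where "\<tau> = (\<lambda>t i. if i = 0 then t else 0)"
  have diff: "(\<lambda>t. h (\<tau> t)) field_differentiable at t" if "h \<in> polyfun" for h t
  proof -
    have "((\<lambda>t. h (\<tau> t)) has_field_derivative dir_deriv h (\<tau> t) (\<lambda>i. if i = 0 then 1 else 0)) (at t)"
    proof (rule polyfun_curve_derivative[OF that])
      fix i :: nat
      show "((\<lambda>t. \<tau> t i) has_field_derivative (if i = 0 then 1 else 0)) (at t)"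
        by (cases "i = 0") (simp_all add: \<tau>_def)
    qed
    then show ?thesis unfolding field_differentiable_def by blast
  qed
  have "?H field_differentiable at t0" for t0
  proof -
    have f0: "flow (\<tau> t0 0) x \<in> ?X" by (rule flow_danielewski[OF n x])
    obtain A B where AB: "A \<in> polyfun" "B \<in> polyfun" "B (\<tau> t0) \<noteq> 0"
      and eq: "\<forall>q. B q \<noteq> 0 \<and> flow (q 0) x \<in> ?X \<and> (\<forall>i<d. push (q 0) x (v i) \<in> tangent_space ?X (flow (q 0) x)) \<longrightarrow>
        \<omega> (flow (q 0) x) (\<lambda>i. push (q 0) x (v i)) = A q / B q"
      using log_form_rational[where Y = "\<lambda>q. flow (q 0) x" and W = "\<lambda>i q. push (q 0) x (v i)" and ?q0.0 = "\<tau> t0", OF snc lp d f0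
          polyfun_flow_time polyfun_push_time] by blast
    have H: "?H t = A (\<tau> t) / B (\<tau> t)" if "B (\<tau> t) \<noteq> 0" for t
    proof -
      have "\<tau> t 0 = t" by (simp add: \<tau>_def)
      then show ?thesis
        using eq[rule_format, of "\<tau> t"] that flow_danielewski[OF n x] push_tangent[OF n v] by simp
    qed
    have "isCont (\<lambda>t. B (\<tau> t)) t0"
      using diff[OF AB(2)] field_differentiable_imp_continuous_at by blast
    then have "eventually (\<lambda>t. B (\<tau> t) \<noteq> 0) (nhds t0)"
      using AB(3) by (auto simp: isCont_def dest: tendsto_imp_eventually_ne intro: eventually_nhds_conv_at[THEN iffD2])
    then have ev: "eventually (\<lambda>t. ?H t = A (\<tau> t) / B (\<tau> t)) (nhds t0)"
      by eventually_elim (rule H)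
    have "(\<lambda>t. A (\<tau> t) / B (\<tau> t)) field_differentiable at t0"
      by (rule field_differentiable_divide[OF diff[OF AB(1)] diff[OF AB(2)] AB(3)])
    then show ?thesis
      unfolding field_differentiable_def using DERIV_cong_ev[OF refl ev refl] by blast
  qed
  then show ?thesis
    by (simp add: holomorphic_on_def)
qed

lemma polyfun_tendsto:
  assumes "h \<in> polyfun" "\<And>i. ((\<lambda>t. x t i) \<longlongrightarrow> l i) F"
  shows "((\<lambda>t. h (x t)) \<longlongrightarrow> h l) F"
  using assms(1)
  by (induction h rule: polyfun.induct) (simp_all add: assms(2) tendsto_add tendsto_mult)

text \<open>
  The homogeneous coordinates of the limit point of an orbit are the coefficients at the highest power of \<open>t\<close> that
  occurs on a general orbit.
\<close>

lemma flow_limit: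
  assumes a: "\<And>i. (\<lambda>y. a y i) \<in> polyfun" and M: "\<And>y i. y \<in> X \<Longrightarrow> i \<ge> M \<Longrightarrow> a y i = 0"
    and fX: "\<And>t y. y \<in> X \<Longrightarrow> flow t y \<in> X"
    and nz: "\<exists>y\<in>X. a y \<noteq> (\<lambda>_. 0)"
  shows "\<exists>e A. (\<forall>i. (\<lambda>y. A y i) \<in> polyfun) \<and> (\<exists>y\<in>X. A y \<noteq> (\<lambda>_. 0)) \<and>
    (\<forall>y\<in>X. \<forall>i. ((\<lambda>t. scl (1 / t ^ e) (a (flow t y)) i) \<longlongrightarrow> A y i) at_infinity)"
proof -
  have "\<forall>i. \<exists>pK. (\<forall>k. (\<lambda>P. coeff (fst pK P) k) \<in> polyfun) \<and> (\<forall>P. degree (fst pK P :: complex poly) \<le> snd pK) \<and>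
    (\<forall>P t. a (flow t P) i = poly (fst pK P) t)"
  proof
    fix i
    from flow_expansion[OF a[of i]] obtain p K where "\<forall>k. (\<lambda>P. coeff (p P) k) \<in> polyfun"
      "\<forall>P. degree (p P :: complex poly) \<le> K" "\<forall>P t. a (flow t P) i = poly (p P) t" by blast
    then show "\<exists>pK. (\<forall>k. (\<lambda>P. coeff (fst pK P) k) \<in> polyfun) \<and> (\<forall>P. degree (fst pK P :: complex poly) \<le> snd pK) \<and>
      (\<forall>P t. a (flow t P) i = poly (fst pK P) t)" by (intro exI[of _ "(p, K)"]) simp
  qed
  from choice[OF this] obtain pK where pK: "\<forall>i. (\<forall>k. (\<lambda>P. coeff (fst (pK i) P) k) \<in> polyfun) \<and>
    (\<forall>P. degree (fst (pK i) P :: complex poly) \<le> snd (pK i)) \<and>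
    (\<forall>P t. a (flow t P) i = poly (fst (pK i) P) t)" ..
  define p where "p = (\<lambda>i. fst (pK i))"
  have pp: "(\<lambda>P. coeff (p i P) k) \<in> polyfun" and pd: "degree (p i P) \<le> snd (pK i)"
    and pe: "a (flow t P) i = poly (p i P) t" for i k P t
    using pK unfolding p_def by auto
  define S where "S = {k. \<exists>y\<in>X. \<exists>i<M. coeff (p i y) k \<noteq> 0}"
  have "S \<subseteq> (\<Union>i<M. {..snd (pK i)})"
  proof
    fix k assume "k \<in> S"
    then obtain y i where "i < M" "coeff (p i y) k \<noteq> 0" unfolding S_def by blast
    then show "k \<in> (\<Union>i<M. {..snd (pK i)})" using le_degree pd order_trans by blast
  qed
  then have fin: "finite S" using finite_subset by blast
  have ne: "S \<noteq> {}"
  proof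
    assume S: "S = {}"
    obtain y where y: "y \<in> X" "a y \<noteq> (\<lambda>_. 0)" using nz by blast
    then obtain i where i: "a y i \<noteq> 0" by auto
    then have "i < M" using M[OF y(1)] not_le by blast
    then have "p i y = 0" using S y(1) unfolding S_def by (auto simp: poly_eq_iff)
    then show False using pe[of 0 y i] i unfolding flow_0 by simp
  qed
  let ?e = "Max S"
  define A where "A = (\<lambda>y i. if i < M then coeff (p i y) ?e else 0)"
  have deg: "degree (p i y) \<le> ?e" if "y \<in> X" "i < M" for y i
  proof (rule degree_le, intro allI impI)
    fix k assume "?e < k"
    then have "k \<notin> S" using Max_ge[OF fin] by (metis not_le)
    then show "coeff (p i y) k = 0" using that unfolding S_def by blast
  qed
  show ?thesis
  proof (rule exI[of _ ?e], rule exI[of _ A], intro conjI allI ballI)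
    fix i :: nat
    show "(\<lambda>y. A y i) \<in> polyfun" unfolding A_def by (cases "i < M") (simp_all add: pp polyfun.const)
  next
    obtain y i where "y \<in> X" "i < M" "coeff (p i y) ?e \<noteq> 0"
      using Max_in[OF fin ne] unfolding S_def by blast
    then show "\<exists>y\<in>X. A y \<noteq> (\<lambda>_. 0)"
      by (intro bexI[of _ y]) (auto simp: A_def fun_eq_iff intro!: exI[of _ i])
  next
    fix y and i :: nat assume y: "y \<in> X"
    show "((\<lambda>t. scl (1 / t ^ ?e) (a (flow t y)) i) \<longlongrightarrow> A y i) at_infinity"
    proof (cases "i < M")
      case True
      have "(\<lambda>t. scl (1 / t ^ ?e) (a (flow t y)) i) = (\<lambda>t. (\<Sum>k\<le>?e. coeff (p i y) k * t ^ k) / t ^ ?e)"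
        unfolding scl_def pe poly_as_sum[OF deg[OF y True]] by (simp add: fun_eq_iff)
      then show ?thesis using sum_powers_limit[of "\<lambda>k. coeff (p i y) k" ?e] True by (simp add: A_def)
    next
      case False
      then have "a (flow t y) i = 0" for t using M[OF fX[OF y]] by simp
      then show ?thesis using False by (simp add: A_def scl_def)
    qed
  qed
qed

text \<open>Tangent vectors at a point with \<open>x 0 \<noteq> 0\<close> are determined by their coordinates other than \<open>1\<close>.\<close>

lemma tangent_vectors_dependent:
  assumes n: "n > 0" and x: "x \<in> danielewski n" "x 0 \<noteq> 0"
    and v: "\<And>i. i < n + 1 \<Longrightarrow> v i \<in> tangent_space (danielewski n) x"
  shows "\<exists>c \<kappa>. (\<exists>i<n+1. c i \<noteq> 0) \<and> (\<forall>l. (\<Sum>i<n+1. c i * v i l) = \<kappa> * flow_field x l)"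
proof -
  have T: "w \<in> aff (n + 2) \<and> tangent_form x w = 0" if "w \<in> tangent_space (danielewski n) x" for w
    using that unfolding tangent_space_danielewski[OF n x(1)] by simp
  define \<sigma> :: "nat \<Rightarrow> nat" where "\<sigma> = (\<lambda>l. if l = 0 then 0 else l + 1)"
  define u where "u = (\<lambda>i. if i < n + 1 then v i else flow_field x)"
  have uT: "u i \<in> tangent_space (danielewski n) x" for i
    unfolding u_def using v flow_field_tangent[OF n x(1)] by simp
  obtain c where c: "\<exists>i\<le>n+1. c i \<noteq> 0" "\<forall>l<n+1. (\<Sum>i\<le>n+1. c i * u i (\<sigma> l)) = 0"
    using more_vectors_than_coordinates[of "n + 1" "\<lambda>i l. u i (\<sigma> l)"] by blast
  define w where "w = (\<lambda>l. \<Sum>i\<le>n+1. c i * u i l)"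
  have w0: "w l = 0" if "l \<noteq> 1" for l
  proof -
    have "l = 0 \<or> l \<ge> n + 2 \<or> (l \<ge> 2 \<and> l < n + 2)" using that by arith
    then consider "l = 0" | "l \<ge> n + 2" | "l \<ge> 2" "l < n + 2" by blast
    then show ?thesis
    proof cases
      case 1
      then show ?thesis using c(2)[rule_format, of 0] by (simp add: w_def \<sigma>_def)
    next
      case 2
      have "u i l = 0" for i using T[OF uT] 2 by (simp add: aff_def)
      then show ?thesis by (simp add: w_def)
    next
      case 3
      then show ?thesis using c(2)[rule_format, of "l - 1"] by (simp add: w_def \<sigma>_def)
    qed
  qed
  have "tangent_form x w = (\<Sum>i\<le>n+1. c i * tangent_form x (u i))"
    unfolding tangent_form_def w_def
    by (simp add: sum_distrib_left sum.distrib sum_subtractf algebra_simps)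
  also have "\<dots> = 0" using T[OF uT] by simp
  finally have "w 1 = 0" using w0 x(2) by (simp add: tangent_form_def)
  then have w: "w l = 0" for l using w0 by (cases "l = 1") auto
  have sum: "(\<Sum>i<n+1. c i * v i l) = - c (n + 1) * flow_field x l" for l
  proof -
    have "w l = (\<Sum>i<n+1. c i * u i l) + c (n + 1) * u (n + 1) l"
      unfolding w_def by (simp add: atMost_Suc lessThan_Suc_atMost)
    moreover have "(\<Sum>i<n+1. c i * u i l) = (\<Sum>i<n+1. c i * v i l)"
      by (rule sum.cong[OF refl]) (simp add: u_def)
    moreover have "u (n + 1) l = flow_field x l" by (simp add: u_def)
    ultimately show ?thesis using w[of l] by (simp add: eq_neg_iff_add_eq_0)
  qed
  have "\<exists>i<n+1. c i \<noteq> 0"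
  proof (rule ccontr)
    assume z: "\<not> (\<exists>i<n+1. c i \<noteq> 0)"
    then have "c (n + 1) \<noteq> 0" using c(1) by (metis le_neq_implies_less)
    moreover have "(\<Sum>i<n+1. c i * v i 2) = 0" using z by (intro sum.neutral) simp
    ultimately have "flow_field x 2 = 0" using sum[of 2] by simp
    then show False using x(2) by (simp add: flow_field_def)
  qed
  then show ?thesis using sum by blast
qed

text \<open>
  Where \<open>x \<noteq> 0\<close> the linearized equation can be solved for the coordinate \<open>1\<close> of the vector after
  multiplication by \<open>x\<^sup>2\<close>. Where \<open>x = 0\<close>, and hence \<open>y \<noteq> 0\<close>, it can be solved for the coordinate
  \<open>2\<close> after multiplication by \<open>2 y\<close>.
\<close>

lemma tangent_field:
  assumes n: "n > 0" and x: "x \<in> danielewski n" and v: "v \<in> tangent_space (danielewski n) x"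
  shows "\<exists>V. (\<forall>i. (\<lambda>y. V y i) \<in> polyfun) \<and> V x = v \<and> (\<forall>y\<in>danielewski n. V y \<in> tangent_space (danielewski n) y)"
proof -
  have v': "v \<in> aff (n + 2)" "2 * x 0 * x 1 * v 0 + x 0 ^ 2 * v 1 - 2 * x 2 * v 2 = 0"
    using v unfolding tangent_space_danielewski[OF n x] by (simp_all add: tangent_form_def)
  show ?thesis
  proof (cases "x 0 = 0")
    case False
    define V :: "pt \<Rightarrow> pt" where
      "V = (\<lambda>y i. if i = 1 then (2 * y 2 * v 2 - 2 * y 0 * y 1 * v 0) * (1 / x 0 ^ 2) else v i * y 0 ^ 2 * (1 / x 0 ^ 2))"
    have "(\<lambda>y. V y i) \<in> polyfun" for i
    proof -
      have "(\<lambda>y. (2 * y 2 * v 2 - 2 * y 0 * y 1 * v 0) * (1 / x 0 ^ 2)) \<in> polyfun" "(\<lambda>y. v i * y 0 ^ 2 * (1 / x 0 ^ 2)) \<in> polyfun"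
        by (intro polyfun.mult polyfun_diff polyfun_power polyfun.coord polyfun.const)+
      then show ?thesis unfolding V_def by (cases "i = 1") simp_all
    qed
    moreover have "V x = v"
    proof
      fix i
      have "2 * x 2 * v 2 - 2 * x 0 * x 1 * v 0 = x 0 ^ 2 * v 1" using v'(2) by (simp add: algebra_simps)
      then show "V x i = v i" unfolding V_def using False by simp
    qed
    moreover have "V y \<in> tangent_space (danielewski n) y" if y: "y \<in> danielewski n" for y
    proof -
      have "2 * y 0 * y 1 * (v 0 * y 0 ^ 2 * K) + y 0 ^ 2 * ((2 * y 2 * v 2 - 2 * y 0 * y 1 * v 0) * K) -
          2 * y 2 * (v 2 * y 0 ^ 2 * K) = 0" for K by (simp add: power2_eq_square algebra_simps)
      moreover have "V y 0 = v 0 * y 0 ^ 2 * (1 / x 0 ^ 2)"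
        "V y 1 = (2 * y 2 * v 2 - 2 * y 0 * y 1 * v 0) * (1 / x 0 ^ 2)" "V y 2 = v 2 * y 0 ^ 2 * (1 / x 0 ^ 2)"
        by (simp_all only: V_def) simp_all
      ultimately have "tangent_form y (V y) = 0" by (simp only: tangent_form_def)
      moreover have "V y \<in> aff (n + 2)" using v'(1) n by (simp add: V_def aff_def)
      ultimately show ?thesis unfolding tangent_space_danielewski[OF n y] by simp
    qed
    ultimately show ?thesis by blast
  next
    case True
    then have x2: "x 2 ^ 2 = 1" using x by (simp add: danielewski_def)
    then have x20: "x 2 \<noteq> 0" by auto
    define V :: "pt \<Rightarrow> pt" where
      "V = (\<lambda>y i. if i = 2 then (y 0 * y 1 * v 0 + y 0 ^ 2 * (v 1 / 2)) * (1 / x 2) else v i * y 2 * (1 / x 2))"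
    have "(\<lambda>y. V y i) \<in> polyfun" for i
    proof -
      have "(\<lambda>y. (y 0 * y 1 * v 0 + y 0 ^ 2 * (v 1 / 2)) * (1 / x 2)) \<in> polyfun" "(\<lambda>y. v i * y 2 * (1 / x 2)) \<in> polyfun"
        by (intro polyfun.mult polyfun.add polyfun_power polyfun.coord polyfun.const)+
      then show ?thesis unfolding V_def by (cases "i = 2") simp_all
    qed
    moreover have "V x = v"
    proof
      fix i
      have "v 2 = 0" using v'(2) True x20 by simp
      then show "V x i = v i" unfolding V_def using True x20 by simp
    qed
    moreover have "V y \<in> tangent_space (danielewski n) y" if y: "y \<in> danielewski n" for y
    proof -
      have "2 * y 0 * y 1 * (v 0 * y 2 * K) + y 0 ^ 2 * (2 * h * y 2 * K) -
          2 * y 2 * ((y 0 * y 1 * v 0 + y 0 ^ 2 * h) * K) = 0" for K h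
        by (simp add: power2_eq_square algebra_simps)
      note this[of "1 / x 2" "v 1 / 2"]
      moreover have "V y 0 = v 0 * y 2 * (1 / x 2)" "V y 1 = 2 * (v 1 / 2) * y 2 * (1 / x 2)"
        "V y 2 = (y 0 * y 1 * v 0 + y 0 ^ 2 * (v 1 / 2)) * (1 / x 2)"
        by (simp_all only: V_def) simp_all
      ultimately have "tangent_form y (V y) = 0" by (simp only: tangent_form_def)
      moreover have "V y \<in> aff (n + 2)" using v'(1) n by (simp add: V_def aff_def)
      ultimately show ?thesis unfolding tangent_space_danielewski[OF n y] by simp
    qed
    ultimately show ?thesis by blast
  qed
qed

text \<open>
  The form, evaluated along an orbit, is \<open>\<gamma>/\<eta>\<close> times the \<open>m\<close>-th power of \<open>\<Prod>\<^sub>l f\<^sub>l/b\<^sub>l \<cdot> det R\<close>, where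
  the product is over the local parameters that do not belong to the boundary, and \<open>R\<close> is the
  matrix of logarithmic derivatives of all local parameters \<open>f\<^sub>l/b\<^sub>l\<close> in the directions of the given vectors. At infinity the factors
  have limits. A combination of the given vectors is proportional to the direction of the orbit, where the logarithmic derivatives
  tend to zero. So the limit of \<open>det R\<close> is zero.
  
  The local parameters are taken at the limit point \<open>p\<close> of one orbit. They serve all
  orbits whose limit points are near \<open>p\<close>; these are general orbits.
\<close>

lemma log_form_vanishes_generically:
  assumes n: "n > 0" and snc: "snc_completion (danielewski n) P j"
    and lp: "log_pluricanonical (danielewski n) P j m \<omega>" and m: "m \<ge> 1"
  shows "\<exists>G. G \<in> polyfun \<and> (\<exists>x\<in>danielewski n. G x \<noteq> 0) \<and>
    (\<forall>x\<in>danielewski n. G x \<noteq> 0 \<longrightarrow>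
      (\<forall>v. (\<forall>i<n+1. v i \<in> tangent_space (danielewski n) x) \<longrightarrow> \<omega> x v = 0))"
proof -
  let ?X = "danielewski n" and ?d = "n + 1"
  have d: "zariski_dim ?X = ?d" by (rule zariski_dim_danielewski[OF n])
  have emb: "open_embedding ?X P j" and cone: "projective_cone P" using snc unfolding snc_completion_def by blast+
  have fX: "flow t y \<in> ?X" if "y \<in> ?X" for t y by (rule flow_danielewski[OF n that])
  have var: "affine_variety P" using cone unfolding projective_cone_def by blast
  obtain M where M: "P \<subseteq> aff M" and Pcl: "zariski_closed P" and Pne: "P \<noteq> {}"
    using var unfolding affine_variety_def zariski_irreducible_def by blast
  have Pscl: "scl c y \<in> P" if "y \<in> P" for c y using cone that unfolding projective_cone_def by blast
  have jP: "j y \<in> P" "j y \<noteq> (\<lambda>_. 0)" if "y \<in> ?X" for y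
    using emb that unfolding open_embedding_def by blast+
  obtain x0 where x0: "x0 \<in> ?X" using danielewski_point[OF n] by blast
  obtain a where a: "\<forall>i. (\<lambda>y. a y i) \<in> polyfun" "a x0 \<noteq> (\<lambda>_. 0)"
    and aj: "\<forall>y\<in>?X. a y \<noteq> (\<lambda>_. 0) \<longrightarrow> (\<exists>c. c \<noteq> 0 \<and> a y = scl c (j y))"
    using emb x0 unfolding open_embedding_def by blast
  have aP: "a y \<in> P" if y: "y \<in> ?X" for y
  proof (cases "a y = (\<lambda>_. 0)")
    case True
    have "scl 0 (j y) \<in> P" by (rule Pscl[OF jP(1)[OF y]])
    then show ?thesis unfolding True scl_def by simp
  next
    case False
    then obtain c where "a y = scl c (j y)" using aj y by blast
    then show ?thesis using Pscl[OF jP(1)[OF y]] by simp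
  qed
  have aM: "a y i = 0" if "y \<in> ?X" "i \<ge> M" for y i
    using aP[OF that(1)] M that(2) by (auto simp: aff_def)
  have "\<exists>y\<in>?X. a y \<noteq> (\<lambda>_. 0)" using x0 a(2) by blast
  from flow_limit[OF a(1)[rule_format] aM fX this]
  obtain e A where Ap: "\<forall>i. (\<lambda>y. A y i) \<in> polyfun" and Anz: "\<exists>y\<in>?X. A y \<noteq> (\<lambda>_. 0)"
    and Alim: "\<forall>y\<in>?X. \<forall>i. ((\<lambda>t. scl (1 / t ^ e) (a (flow t y)) i) \<longlongrightarrow> A y i) at_infinity" by blast
  define b where "b = (\<lambda>t y. scl (1 / t ^ e) (a (flow t y)))"
  have blim: "((\<lambda>t. h (b t y)) \<longlongrightarrow> h (A y)) at_infinity" if "h \<in> polyfun" "y \<in> ?X" for h y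
    unfolding b_def by (rule polyfun_tendsto[OF that(1)]) (use Alim that(2) in blast)
  have AP: "A y \<in> P" if y: "y \<in> ?X" for y
  proof (rule ccontr)
    assume "A y \<notin> P"
    from zariski_closed_separate[OF Pcl this] obtain h
      where h: "h \<in> polyfun" "\<forall>z\<in>P. h z = 0" "h (A y) \<noteq> 0" by blast
    have "b t y \<in> P" for t unfolding b_def by (rule Pscl[OF aP[OF fX[OF y]]])
    then have "((\<lambda>t :: complex. 0 :: complex) \<longlongrightarrow> h (A y)) at_infinity" using blim[OF h(1) y] h(2) by simp
    from tendsto_unique[OF trivial_limit_at_infinity this tendsto_const] show False using h(3) by simp
  qed
  obtain y0 where y0: "y0 \<in> ?X" "A y0 \<noteq> (\<lambda>_. 0)" using Anz by blast
  let ?p = "A y0"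
  have near: "\<exists>k s \<alpha> \<beta> \<gamma> \<eta>. k \<le> ?d \<and> (\<exists>e. homogeneous e s) \<and> s ?p \<noteq> 0 \<and>
     (\<forall>l<?d. \<exists>e. homogeneous e (\<alpha> l) \<and> homogeneous e (\<beta> l) \<and> \<beta> l ?p \<noteq> 0) \<and>
     (\<exists>e. homogeneous e \<gamma> \<and> homogeneous e \<eta> \<and> \<eta> ?p \<noteq> 0) \<and>
     (\<forall>y\<in>?X. a y \<noteq> (\<lambda>_. 0) \<longrightarrow> s (a y) \<noteq> 0 \<longrightarrow> \<eta> (a y) \<noteq> 0 \<longrightarrow> (\<forall>l<?d. \<beta> l (a y) \<noteq> 0) \<longrightarrow>
        (\<forall>l<k. \<alpha> l (a y) \<noteq> 0) \<and>
        (\<forall>v. (\<forall>i<?d. v i \<in> tangent_space ?X y) \<longrightarrow>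
           \<omega> y v = log_form_expression ?d k m (\<lambda>l y. \<alpha> l (a y)) (\<lambda>l y. \<beta> l (a y))
             (\<lambda>y. \<gamma> (a y)) (\<lambda>y. \<eta> (a y)) y v))"
    by (rule log_form_near[OF snc lp d]) (use a(1) aj AP[OF y0(1)] y0(2) in blast)+
  then obtain k s \<alpha> \<beta> \<gamma> \<eta> where k: "k \<le> ?d" and s: "\<exists>e. homogeneous e s" "s ?p \<noteq> 0"
    and \<alpha>\<beta>: "\<forall>l<?d. \<exists>e. homogeneous e (\<alpha> l) \<and> homogeneous e (\<beta> l) \<and> \<beta> l ?p \<noteq> 0"
    and \<gamma>\<eta>: "\<exists>e. homogeneous e \<gamma> \<and> homogeneous e \<eta> \<and> \<eta> ?p \<noteq> 0"
    and form: "\<forall>y\<in>?X. a y \<noteq> (\<lambda>_. 0) \<longrightarrow> s (a y) \<noteq> 0 \<longrightarrow> \<eta> (a y) \<noteq> 0 \<longrightarrow> (\<forall>l<?d. \<beta> l (a y) \<noteq> 0) \<longrightarrow>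
        (\<forall>l<k. \<alpha> l (a y) \<noteq> 0) \<and>
        (\<forall>v. (\<forall>i<?d. v i \<in> tangent_space ?X y) \<longrightarrow>
           \<omega> y v = log_form_expression ?d k m (\<lambda>l y. \<alpha> l (a y)) (\<lambda>l y. \<beta> l (a y))
             (\<lambda>y. \<gamma> (a y)) (\<lambda>y. \<eta> (a y)) y v)" by blast
  obtain es where es: "homogeneous es s" using s(1) by blast
  obtain eg where eg: "homogeneous eg \<gamma>" "homogeneous eg \<eta>" "\<eta> ?p \<noteq> 0" using \<gamma>\<eta> by blast
  have hab: "\<alpha> l \<in> polyfun \<and> \<beta> l \<in> polyfun \<and> \<beta> l ?p \<noteq> 0 \<and>
      (\<exists>e. homogeneous e (\<alpha> l) \<and> homogeneous e (\<beta> l))" if "l < ?d" for l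
    using \<alpha>\<beta> that homogeneous_polyfun by blast
  have ca: "(\<lambda>y. h (a y)) \<in> polyfun" "(\<lambda>y. h (A y)) \<in> polyfun" if "h \<in> polyfun" for h
    by (rule polyfun_compose[OF that a(1)[rule_format]], rule polyfun_compose[OF that Ap[rule_format]])
  have t0: "eventually (\<lambda>t :: complex. t \<noteq> 0) at_infinity" by (rule eventually_not_equal_at_infinity)
  have ev_nz: "eventually (\<lambda>t. h (a (flow t y)) \<noteq> 0) at_infinity"
    if h: "homogeneous e' h" "h (A y) \<noteq> 0" and y: "y \<in> ?X" for h e' y
  proof -
    have "eventually (\<lambda>t. h (b t y) \<noteq> 0) at_infinity"
      by (rule tendsto_imp_eventually_ne[OF blim[OF homogeneous_polyfun[OF h(1)] y] h(2)])
    then show ?thesis by eventually_elim (simp add: b_def homogeneous_scl[OF h(1)])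
  qed
  have ratio: "((\<lambda>t. f (a (flow t y)) / h (a (flow t y))) \<longlongrightarrow> f (A y) / h (A y)) at_infinity"
    if fh: "homogeneous e' f" "homogeneous e' h" "h (A y) \<noteq> 0" and y: "y \<in> ?X" for f h e' y
  proof (rule Lim_transform_eventually)
    show "((\<lambda>t. f (b t y) / h (b t y)) \<longlongrightarrow> f (A y) / h (A y)) at_infinity"
      by (rule tendsto_divide[OF blim[OF homogeneous_polyfun[OF fh(1)] y] blim[OF homogeneous_polyfun[OF fh(2)] y] fh(3)])
    show "eventually (\<lambda>t. f (b t y) / h (b t y) = f (a (flow t y)) / h (a (flow t y))) at_infinity"
      using t0 by eventually_elim (simp add: b_def homogeneous_scl[OF fh(1)] homogeneous_scl[OF fh(2)])
  qed
  \<comment> \<open>If \<open>h\<close> vanishes identically, the last condition is void and \<open>N = 1\<close> is admissible.\<close>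
  define leads where "leads h N \<longleftrightarrow> N \<in> polyfun \<and> (\<exists>Q\<in>?X. N Q \<noteq> 0) \<and>
    ((\<exists>Q\<in>?X. h Q \<noteq> 0) \<longrightarrow> (\<forall>y\<in>?X. dir_deriv N y (flow_field y) = 0 \<and>
      (N y \<noteq> 0 \<longrightarrow> eventually (\<lambda>t. h (flow t y) \<noteq> 0) at_infinity \<and>
        (\<forall>v\<in>tangent_space ?X y.
          ((\<lambda>t. dir_deriv h (flow t y) (push t y v) / h (flow t y)) \<longlongrightarrow> dir_deriv N y v / N y) at_infinity))))"
    for h N :: "pt \<Rightarrow> complex"
  have leads: "\<exists>N. leads h N" if h: "h \<in> polyfun" for h
  proof (cases "\<exists>Q\<in>?X. h Q \<noteq> 0")
    case True
    then show ?thesis using log_derivative_limit[OF n h True] unfolding leads_def by blast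
  next
    case False
    have "leads h (\<lambda>_. 1)" unfolding leads_def using False x0 by (auto simp: polyfun.const)
    then show ?thesis by blast
  qed
  have "\<forall>l\<in>{..<?d}. \<exists>N. leads (\<lambda>y. \<alpha> l (a y)) N" "\<forall>l\<in>{..<?d}. \<exists>N. leads (\<lambda>y. \<beta> l (a y)) N"
    using leads hab ca by simp_all
  from bchoice[OF this(1)] bchoice[OF this(2)] obtain N L
    where NL: "\<forall>l\<in>{..<?d}. leads (\<lambda>y. \<alpha> l (a y)) (N l)" "\<forall>l\<in>{..<?d}. leads (\<lambda>y. \<beta> l (a y)) (L l)" by blast
  obtain i0 where i0: "?p i0 \<noteq> 0" using y0(2) by auto
  \<comment> \<open>The conditions on a general orbit.\<close>
  define G :: "nat \<Rightarrow> pt \<Rightarrow> complex" where "G = (\<lambda>r y. (if r = 0 then y 0 else if r = 1 then A y i0 else if r = 2 then s (A y)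
     else if r = 3 then \<eta> (A y) else if r = 4 then (\<Prod>l<?d. N l y)
     else if r = 5 then (\<Prod>l<?d. L l y) else (\<Prod>l<?d. \<beta> l (A y))))"
  have dom: "function_domain ?X" by (rule function_domain_danielewski[OF n])
  have Gp: "G r \<in> polyfun" and Gnz: "\<exists>y\<in>?X. G r y \<noteq> 0" for r :: nat
  proof -
    have NLp: "N l \<in> polyfun" "\<exists>Q\<in>?X. N l Q \<noteq> 0" "L l \<in> polyfun" "\<exists>Q\<in>?X. L l Q \<noteq> 0" if "l < ?d" for l
      using NL that unfolding leads_def by auto
    have ex0: "\<exists>y\<in>?X. y 0 \<noteq> 0"
      by (rule bexI[of _ "\<lambda>i. if i = 0 then 1 else if i = 1 then - 1 else 0"])
         (use n in \<open>auto simp: danielewski_def aff_def\<close>)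
    have "r = 0 \<or> r = 1 \<or> r = 2 \<or> r = 3 \<or> r = 4 \<or> r = 5 \<or> r \<ge> 6" by arith
    then consider "r = 0" | "r = 1" | "r = 2" | "r = 3" | "r = 4" | "r = 5" | "r \<ge> 6" by blast
    then have "G r \<in> polyfun \<and> (\<exists>y\<in>?X. G r y \<noteq> 0)"
    proof cases
      case 1
      then show ?thesis using ex0 by (simp add: G_def polyfun.coord)
    next
      case 2
      then show ?thesis using Ap i0 y0(1) by (auto simp: G_def)
    next
      case 3
      then show ?thesis using ca(2)[OF homogeneous_polyfun[OF es]] s(2) y0(1) by (auto simp: G_def)
    next
      case 4
      then show ?thesis using ca(2)[OF homogeneous_polyfun[OF eg(2)]] eg(3) y0(1) by (auto simp: G_def)
    next
      case 5
      have "(\<lambda>y. \<Prod>l<?d. N l y) \<in> polyfun" by (rule polyfun_prod) (use NLp in simp)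
      moreover have "\<exists>y\<in>?X. (\<Prod>l<?d. N l y) \<noteq> 0"
        by (rule function_domain_prod_nonzero[OF dom]) (use NLp in simp_all)
      ultimately show ?thesis unfolding G_def 5 by simp
    next
      case 6
      have "(\<lambda>y. \<Prod>l<?d. L l y) \<in> polyfun" by (rule polyfun_prod) (use NLp in simp)
      moreover have "\<exists>y\<in>?X. (\<Prod>l<?d. L l y) \<noteq> 0"
        by (rule function_domain_prod_nonzero[OF dom]) (use NLp in simp_all)
      ultimately show ?thesis unfolding G_def 6 by simp
    next
      case 7
      have "(\<lambda>y. \<Prod>l<?d. \<beta> l (A y)) \<in> polyfun" by (rule polyfun_prod) (use hab ca in simp)
      moreover have "(\<Prod>l<?d. \<beta> l (A y0)) \<noteq> 0" using hab by simp
      ultimately show ?thesis unfolding G_def using 7 y0(1) by auto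
    qed
    then show "G r \<in> polyfun" "\<exists>y\<in>?X. G r y \<noteq> 0" by auto
  qed
  have main: "\<omega> x v = 0" if x: "x \<in> ?X" and Gx: "\<And>r. r < 7 \<Longrightarrow> G r x \<noteq> 0"
    and v: "\<forall>i<?d. v i \<in> tangent_space ?X x" for x v
  proof -
    have gen: "x 0 \<noteq> 0" "A x i0 \<noteq> 0" "s (A x) \<noteq> 0" "\<eta> (A x) \<noteq> 0"
      using Gx[of 0] Gx[of 1] Gx[of 2] Gx[of 3] by (simp_all add: G_def)
    have genl: "N l x \<noteq> 0" "L l x \<noteq> 0" "\<beta> l (A x) \<noteq> 0" if "l < ?d" for l
      using Gx[of 4] Gx[of 5] Gx[of 6] that by (auto simp: G_def less_Suc_eq)
    have vT: "v i \<in> tangent_space ?X x" if "i < ?d" for i using v that by blast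
    define H where "H = (\<lambda>t. \<omega> (flow t x) (\<lambda>i. push t x (v i)))"
    let ?f = "\<lambda>l y. \<alpha> l (a y)" and ?b = "\<lambda>l y. \<beta> l (a y)"
    let ?F = "\<lambda>t i l. frac_diff (?f l) (?b l) (flow t x) (push t x (v i))"
    have ev_b: "eventually (\<lambda>t. \<forall>l\<in>{..<?d}. ?b l (flow t x) \<noteq> 0) at_infinity"
    proof (rule eventually_ball_finite)
      show "\<forall>l\<in>{..<?d}. eventually (\<lambda>t. ?b l (flow t x) \<noteq> 0) at_infinity"
        using hab genl(3) ev_nz x by fastforce
    qed simp
    have ev_a: "eventually (\<lambda>t. a (flow t x) \<noteq> (\<lambda>_. 0)) at_infinity"
    proof -
      have "eventually (\<lambda>t. b t x i0 \<noteq> 0) at_infinity"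
        by (rule tendsto_imp_eventually_ne[OF blim[OF polyfun.coord x] gen(2)])
      then show ?thesis by eventually_elim (auto simp: b_def scl_def)
    qed
    have ev_form: "eventually (\<lambda>t. (\<forall>l<k. ?f l (flow t x) \<noteq> 0) \<and>
        H t = log_form_expression ?d k m ?f ?b (\<lambda>y. \<gamma> (a y)) (\<lambda>y. \<eta> (a y)) (flow t x) (\<lambda>i. push t x (v i))) at_infinity"
      using ev_a ev_nz[OF es gen(3) x] ev_nz[OF eg(2) gen(4) x] ev_b
    proof eventually_elim
      case (elim t)
      have b': "\<forall>l<?d. \<beta> l (a (flow t x)) \<noteq> 0" using elim(4) by simp
      have T: "\<forall>i<?d. push t x (v i) \<in> tangent_space ?X (flow t x)" using push_tangent[OF n vT] by simp
      note F = form[THEN bspec, OF fX[OF x], THEN mp, OF elim(1), THEN mp, OF elim(2), THEN mp, OF elim(3), THEN mp, OF b']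
      from F[THEN conjunct2, THEN spec[of _ "\<lambda>i. push t x (v i)"], THEN mp, OF T] F[THEN conjunct1]
      show ?case unfolding H_def by (intro conjI)
    qed
    have "(H \<longlongrightarrow> 0) at_infinity"
    \<comment> \<open>A local parameter that vanishes identically on \<open>X\<close> has no logarithmic derivative, but contributes a zero column.\<close>
    proof (cases "\<exists>l<?d. \<forall>y\<in>?X. ?f l y = 0")
      case True
      then obtain l where l: "l < ?d" "\<forall>y\<in>?X. \<alpha> l (a y) = 0" by blast
      have lp: "?f l \<in> polyfun" using hab[OF l(1)] ca(1) by blast
      have detz: "det_of ?d (?F t) = 0" for t
      proof -
        have "?F t i l = 0" if i: "i < ?d" for i
        proof -
          have "dir_deriv (?f l) (flow t x) (push t x (v i)) = 0"
            using push_tangent[OF n vT[OF i], of t] lp l(2) unfolding tangent_space_def by simp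
          then show ?thesis unfolding frac_diff_def using l(2) fX[OF x] by simp
        qed
        then have "det_of ?d (?F t) = det_of ?d (\<lambda>i l'. (if l' = l then 0 else 1) * ?F t i l')"
          by (intro det_mat_cong) auto
        also have "\<dots> = 0" unfolding det_scale_columns using l(1) by simp
        finally show ?thesis .
      qed
      have "eventually (\<lambda>t. 0 = H t) at_infinity"
        using ev_form
      proof eventually_elim
        case (elim t)
        then show ?case
          using detz[of t] m unfolding log_form_expression_def by (simp only:) (simp add: power_0_left)
      qed
      then show ?thesis by (rule Lim_transform_eventually[OF tendsto_const])
    next
      case False
      then have fnz: "\<exists>y\<in>?X. ?f l y \<noteq> 0" if "l < ?d" for l using that by blast
      have bnz: "\<exists>y\<in>?X. ?b l y \<noteq> 0" if l: "l < ?d" for l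
      proof (rule ccontr)
        assume "\<not> (\<exists>y\<in>?X. ?b l y \<noteq> 0)"
        then have z: "?b l (flow t x) = 0" for t using fX[OF x] by blast
        have "eventually (\<lambda>t :: complex. False) at_infinity"
          using ev_b
        proof eventually_elim
          case (elim t)
          then show False using z[of t] l by blast
        qed
        then show False using trivial_limit_at_infinity[where 'a = complex] by (simp add: eventually_False)
      qed
      have lN: "dir_deriv (N l) x (flow_field x) = 0" "eventually (\<lambda>t. ?f l (flow t x) \<noteq> 0) at_infinity"
        "\<And>w. w \<in> tangent_space ?X x \<Longrightarrow>
          ((\<lambda>t. dir_deriv (?f l) (flow t x) (push t x w) / ?f l (flow t x)) \<longlongrightarrow> dir_deriv (N l) x w / N l x) at_infinity"
        if l: "l < ?d" for l
        using NL(1) l fnz[OF l] x genl(1)[OF l] unfolding leads_def by simp_all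
      have lL: "dir_deriv (L l) x (flow_field x) = 0"
        "\<And>w. w \<in> tangent_space ?X x \<Longrightarrow>
          ((\<lambda>t. dir_deriv (?b l) (flow t x) (push t x w) / ?b l (flow t x)) \<longlongrightarrow> dir_deriv (L l) x w / L l x) at_infinity"
        if l: "l < ?d" for l
        using NL(2) l bnz[OF l] x genl(2)[OF l] unfolding leads_def by simp_all
      have NLp: "N l \<in> polyfun" "L l \<in> polyfun" if "l < ?d" for l
        using NL that unfolding leads_def by auto
      define R where "R = (\<lambda>t i l. dir_deriv (?f l) (flow t x) (push t x (v i)) / ?f l (flow t x) -
         dir_deriv (?b l) (flow t x) (push t x (v i)) / ?b l (flow t x))"
      define R0 where "R0 = (\<lambda>i l. dir_deriv (N l) x (v i) / N l x - dir_deriv (L l) x (v i) / L l x)"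
      have "((\<lambda>t. det_of ?d (R t)) \<longlongrightarrow> det_of ?d R0) at_infinity"
        unfolding R_def R0_def by (rule tendsto_det) (rule tendsto_diff[OF lN(3) lL(2)], use vT in simp_all)
      moreover have "det_of ?d R0 = 0"
      proof -
        obtain c \<kappa> where c: "\<exists>i<?d. c i \<noteq> 0" "\<forall>l. (\<Sum>i<?d. c i * v i l) = \<kappa> * flow_field x l"
          using tangent_vectors_dependent[where v = v, OF n x gen(1) vT] by blast
        have comb: "(\<Sum>i<?d. c i * dir_deriv h x (v i)) = \<kappa> * dir_deriv h x (flow_field x)" if "h \<in> polyfun" for h
        proof -
          have "(\<Sum>i<?d. c i * dir_deriv h x (v i)) = dir_deriv h x (\<lambda>l. \<Sum>i<?d. c i * v i l)"
            by (rule dir_deriv_lincomb[OF that, symmetric])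
          also have "\<dots> = dir_deriv h x (\<lambda>l. \<kappa> * flow_field x l)" using c(2) by (simp only:)
          also have "\<dots> = \<kappa> * dir_deriv h x (flow_field x)" by (rule dir_deriv_scale[OF that])
          finally show ?thesis .
        qed
        have "(\<Sum>i<?d. c i * R0 i l) = 0" if l: "l < ?d" for l
        proof -
          have "(\<Sum>i<?d. c i * R0 i l) = (\<Sum>i<?d. c i * dir_deriv (N l) x (v i)) / N l x -
              (\<Sum>i<?d. c i * dir_deriv (L l) x (v i)) / L l x"
            unfolding R0_def by (simp only: right_diff_distrib sum_subtractf sum_divide_distrib times_divide_eq_right)
          also have "\<dots> = 0" unfolding comb[OF NLp(1)[OF l]] comb[OF NLp(2)[OF l]] lN(1)[OF l] lL(1)[OF l] by simp
          finally show ?thesis .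
        qed
        then show ?thesis unfolding det_zero_iff_dependent using c(1) by blast
      qed
      ultimately have R: "((\<lambda>t. det_of ?d (R t)) \<longlongrightarrow> 0) at_infinity" by simp
      have lim: "((\<lambda>t. \<gamma> (a (flow t x)) / \<eta> (a (flow t x)) *
          ((\<Prod>l\<in>{k..<?d}. ?f l (flow t x) / ?b l (flow t x)) * det_of ?d (R t)) ^ m) \<longlongrightarrow>
          \<gamma> (A x) / \<eta> (A x) * ((\<Prod>l\<in>{k..<?d}. \<alpha> l (A x) / \<beta> l (A x)) * 0) ^ m) at_infinity"
      proof (intro tendsto_mult tendsto_power tendsto_prod R ratio[OF eg(1,2) gen(4) x])
        fix l assume "l \<in> {k..<?d}"
        then have l: "l < ?d" by simp
        obtain e' where e': "homogeneous e' (\<alpha> l)" "homogeneous e' (\<beta> l)" using hab[OF l] by blast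
        show "((\<lambda>t. ?f l (flow t x) / ?b l (flow t x)) \<longlongrightarrow> \<alpha> l (A x) / \<beta> l (A x)) at_infinity"
          by (rule ratio[OF e' genl(3)[OF l] x])
      qed
      have ev_f: "eventually (\<lambda>t. \<forall>l\<in>{..<?d}. ?f l (flow t x) \<noteq> 0) at_infinity"
        by (rule eventually_ball_finite) (use lN(2) in auto)
      have "eventually (\<lambda>t. \<gamma> (a (flow t x)) / \<eta> (a (flow t x)) *
          ((\<Prod>l\<in>{k..<?d}. ?f l (flow t x) / ?b l (flow t x)) * det_of ?d (R t)) ^ m = H t) at_infinity"
        using ev_form ev_f ev_b
      proof eventually_elim
        case (elim t)
        let ?r = "\<lambda>l. ?f l (flow t x) / ?b l (flow t x)"
        have "det_of ?d (?F t) = det_of ?d (\<lambda>i l. ?r l * R t i l)"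
        proof (rule det_mat_cong)
          fix i l assume "i < ?d" "l < ?d"
          then have "?f l (flow t x) \<noteq> 0" "?b l (flow t x) \<noteq> 0" using elim by auto
          then show "?F t i l = ?r l * R t i l"
            unfolding frac_diff_def R_def by (simp add: power2_eq_square diff_divide_distrib right_diff_distrib)
        qed
        also have "\<dots> = (\<Prod>l<?d. ?r l) * det_of ?d (R t)" by (rule det_scale_columns)
        also have "(\<Prod>l<?d. ?r l) = (\<Prod>l<k. ?r l) * (\<Prod>l\<in>{k..<?d}. ?r l)"
          using prod.atLeastLessThan_concat[of 0 k ?d ?r] k by (simp add: lessThan_atLeast0)
        finally have D: "det_of ?d (?F t) = (\<Prod>l<k. ?r l) * (\<Prod>l\<in>{k..<?d}. ?r l) * det_of ?d (R t)" .
        have nz: "(\<Prod>l<k. ?r l) \<noteq> 0" using elim k by auto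
        have "H t = \<gamma> (a (flow t x)) / \<eta> (a (flow t x)) * (det_of ?d (?F t) / (\<Prod>l<k. ?r l)) ^ m"
          using elim(1) unfolding log_form_expression_def by blast
        then show ?case unfolding D using nz by (simp add: mult.assoc)
      qed
      from Lim_transform_eventually[OF lim this] show ?thesis using m by (simp add: power_0_left)
    qed
    moreover have "H holomorphic_on UNIV"
      unfolding H_def by (rule log_form_along_flow_entire[OF n snc lp d x vT])
    ultimately have "H 0 = 0" using Liouville_weak_0 by blast
    then show ?thesis by (simp add: H_def flow_0 push_0)
  qed
  show ?thesis
  proof (rule exI[of _ "\<lambda>y. \<Prod>r<7. G r y"], intro conjI ballI impI allI)
    show "(\<lambda>y. \<Prod>r<7. G r y) \<in> polyfun" by (rule polyfun_prod) (rule Gp)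
    show "\<exists>y\<in>?X. (\<Prod>r<7. G r y) \<noteq> 0"
      by (rule function_domain_prod_nonzero[OF dom _ Gp Gnz]) simp
    fix x v assume x: "x \<in> ?X" "(\<Prod>r<7. G r x) \<noteq> 0" "\<forall>i<?d. v i \<in> tangent_space ?X x"
    then show "\<omega> x v = 0" by (intro main) simp_all
  qed
qed

text \<open>
  On polynomial tangent fields the form is locally a quotient of polynomials, which vanishes on a
  Zariski dense set, hence everywhere.
\<close>

lemma negative_log_kodaira_dimension_danielewski:
  assumes n: "n > 0"
  shows "negative_log_kodaira_dimension (danielewski n)"
  unfolding negative_log_kodaira_dimension_def zariski_dim_danielewski[OF n]
proof (intro allI impI ballI)
  fix P j m \<omega> x v
  let ?X = "danielewski n" and ?d = "n + 1"
  assume snc: "snc_completion ?X P j" and m: "1 \<le> m" and lp: "log_pluricanonical ?X P j m \<omega>"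
    and x: "x \<in> ?X" and v: "\<forall>i<?d. v i \<in> tangent_space ?X x"
  have dom: "function_domain ?X" by (rule function_domain_danielewski[OF n])
  obtain G where G: "G \<in> polyfun" "\<exists>y\<in>?X. G y \<noteq> 0"
    and van: "\<forall>y\<in>?X. G y \<noteq> 0 \<longrightarrow> (\<forall>v. (\<forall>i<?d. v i \<in> tangent_space ?X y) \<longrightarrow> \<omega> y v = 0)"
    using log_form_vanishes_generically[OF n snc lp m] by blast
  have "\<forall>i\<in>{..<?d}. \<exists>V. (\<forall>l. (\<lambda>y. V y l) \<in> polyfun) \<and> V x = v i \<and> (\<forall>y\<in>?X. V y \<in> tangent_space ?X y)"
    using tangent_field[OF n x] v by blast
  from bchoice[OF this] obtain V where V: "\<forall>i\<in>{..<?d}. (\<forall>l. (\<lambda>y. V i y l) \<in> polyfun) \<and> V i x = v i \<and>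
    (\<forall>y\<in>?X. V i y \<in> tangent_space ?X y)" ..
  define W where "W = (\<lambda>i y. if i < ?d then V i y else v i)"
  have Wp: "(\<lambda>y. W i y l) \<in> polyfun" for i l
    using V by (cases "i < ?d") (simp_all add: W_def polyfun.const)
  have WT: "\<forall>i<?d. W i y \<in> tangent_space ?X y" if "y \<in> ?X" for y using V that by (simp add: W_def)
  have Wx: "(\<lambda>i. W i x) = v" using V by (auto simp: W_def fun_eq_iff)
  have "\<exists>A B. A \<in> polyfun \<and> B \<in> polyfun \<and> B x \<noteq> 0 \<and>
    (\<forall>q. B q \<noteq> 0 \<and> q \<in> ?X \<and> (\<forall>i<?d. W i q \<in> tangent_space ?X q) \<longrightarrow> \<omega> q (\<lambda>i. W i q) = A q / B q)"
    by (rule log_form_rational[where Y = "\<lambda>y. y" and ?q0.0 = x and W = W,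
          OF snc lp zariski_dim_danielewski[OF n] x polyfun.coord Wp])
  then obtain A B where AB: "A \<in> polyfun" "B \<in> polyfun" "B x \<noteq> 0"
    and eq: "\<And>q. B q \<noteq> 0 \<Longrightarrow> q \<in> ?X \<Longrightarrow> \<omega> q (\<lambda>i. W i q) = A q / B q" using WT by blast
  have "\<forall>y\<in>?X. A y * (B y * G y) = 0"
  proof
    fix y assume y: "y \<in> ?X"
    show "A y * (B y * G y) = 0"
    proof (cases "B y = 0 \<or> G y = 0")
      case False
      then have "\<omega> y (\<lambda>i. W i y) = 0" using van[THEN bspec, OF y] WT[OF y] by simp
      then show ?thesis using eq[OF _ y] False by simp
    qed auto
  qed
  then have "(\<forall>y\<in>?X. A y = 0) \<or> (\<forall>y\<in>?X. B y * G y = 0)"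
    by (rule function_domain_cases[OF dom AB(1) polyfun.mult[OF AB(2) G(1)]])
  moreover have "\<not> (\<forall>y\<in>?X. B y * G y = 0)"
  proof
    assume "\<forall>y\<in>?X. B y * G y = 0"
    then have "(\<forall>y\<in>?X. B y = 0) \<or> (\<forall>y\<in>?X. G y = 0)"
      by (rule function_domain_cases[OF dom AB(2) G(1)])
    then show False using AB(3) x G(2) by blast
  qed
  ultimately have "A x = 0" using x by blast
  then show "\<omega> x v = 0" using eq[OF AB(3) x] unfolding Wx by simp
qed

theorem corollary1p2:
  fixes n :: nat
  assumes "n > 0"
  shows "\<exists>X. affine_variety X \<and> smooth_variety X \<and>
           affine_space_fibered n X (aff 1) \<and>
           rational_variety X \<and> negative_log_kodaira_dimension X \<and>
           simply_connected X \<and>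
           \<not> generalized_jacobian_conjecture X"
  using assms affine_variety_danielewski smooth_danielewski affine_space_fibered_danielewski
    rational_danielewski negative_log_kodaira_dimension_danielewski simply_connected_danielewski
    jacobian_conjecture_fails
  by (intro exI[of _ "danielewski n"]) simp

end
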